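(* Let $0<\beta<\tfrac12$, let $a,\lambda,A,\alpha$ be positive constants, let $\nu$ be a constant, and let $h(t)$ be a given function of $t>0$ with Laplace transform $\bar h(p)$. Consider the following boundary value problem (radial case of the fractional incomplete lumped formulation of the temperature field problem) for $u=u(r,z,t)=u(r,z,t;\beta)$: $$D_*^{2\beta}u=a^2\frac{\partial^2u}{\partial z^2}-\lambda\frac{\partial u}{\partial z},\qquad 0<r,z,t<\infty,$$ subject to the boundary condition $$z=0:\quad D_*^{2\beta}u=\frac{\partial^2u}{\partial r^2}+\frac{1-2\nu}{r}\frac{\partial u}{\partial r}+\alpha\frac{\partial u}{\partial z},\qquad 0<r,t<\infty,$$ and the additional conditions (a) $u=A\,h(t)$ at $z=r=0$; (b) $u\to0$ as $r^2+z^2\to\infty$; (c) $u=0$ at $t=0$. Then the solution of this problem is given by $$u(r,z,t;\beta)=\frac{A}{\Gamma(\nu)}\int_0^\infty\frac{1}{\tau^{\nu+1}}\left(\frac r2\right)^{2\nu}e^{-\frac{r^2}{4\tau}}\,e^{\frac{\lambda}{2a^2}(z+\alpha\tau)}\,g_1(t,\tau,z;\beta)\,d\tau,$$ where $g_1(t,\tau,z;\beta)$ is the Laplace convolution (in the variable $t$) of three functions, $$g_1(t,\tau,z;\beta)=L^{-1}\!\left(e^{-\tau p^{2\beta}}\right)*L^{-1}\!\left(\bar h(p)\right)*L^{-1}\!\left(e^{-\frac{z+\alpha\tau}{a}\sqrt{p^{2\beta}+\frac{\lambda^2}{4a^2}}}\right).$$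
   Context: The Caputo fractional derivative $D_*^{2\beta}$ acts in the variable $t$. For $m\in\mathbb N$, $D_*^{\delta}f(t)=\frac{1}{\Gamma(m-\delta)}\int_0^t\frac{f^{(m)}(s)}{(t-s)^{\delta+1-m}}\,ds$ if $m-1<\delta<m$, and $D_*^{m}f(t)=\frac{d^mf}{dt^m}(t)$; in particular, for $0<2\beta<1$, $D_*^{2\beta}f(t)=\frac{1}{\Gamma(1-2\beta)}\int_0^t (t-s)^{-2\beta}f'(s)\,ds$. The Laplace transform is $\bar f(p)=L[f(t)]=\int_0^\infty e^{-pt}f(t)\,dt$, $\operatorname{Re}(p)>0$, and $L^{-1}$ is its inverse, from functions of $p$ to functions of $t$ (here $\tau,z$ are parameters). Powers and square roots are principal branches. Convolution is $(f*g)(t)=\int_0^t f(t-s)g(s)\,ds$. $\Gamma$ is the Gamma function.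
   Formalization: That the formula solves the problem is claimed only for ν>0 (for ν≤0 condition (a) fails unless h=0 a.e.); uniqueness, for all real ν, is among solutions with Laplace-transformable majorants, with (a) also in weighted L¹, since pointwise (a) alone allows a nonzero solution for h=0. *)

theory Defs
  imports "HOL-Analysis.Analysis"
begin

definition caputo :: "real \<Rightarrow> (real \<Rightarrow> real) \<Rightarrow> real \<Rightarrow> real" where
  "caputo \<delta> f t =
     (let m = nat \<lceil>\<delta>\<rceil> in
      if \<delta> = real m then (deriv ^^ m) f t
      else 1 / Gamma (real m - \<delta>) *
           (LBINT s:{0<..<t}. (deriv ^^ m) f s / (t - s) powr (\<delta> + 1 - real m)))"

definition caputo_differentiable :: "real \<Rightarrow> (real \<Rightarrow> real) \<Rightarrow> real \<Rightarrow> bool" where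
  "caputo_differentiable \<delta> f t \<longleftrightarrow>
     (let m = nat \<lceil>\<delta>\<rceil> in
      (\<forall>k<m. \<forall>s\<in>{0<..t}. (deriv ^^ k) f differentiable (at s)) \<and>
      (\<delta> \<noteq> real m \<longrightarrow>
        set_integrable lborel {0<..<t} (\<lambda>s. (deriv ^^ m) f s / (t - s) powr (\<delta> + 1 - real m))))"

definition laplace_transformable :: "(real \<Rightarrow> real) \<Rightarrow> bool" where
  "laplace_transformable f \<longleftrightarrow>
     (\<forall>p::complex. 0 < Re p \<longrightarrow>
        set_integrable lborel {0<..} (\<lambda>t. exp (- p * of_real t) * of_real (f t)))"

definition laplace :: "(real \<Rightarrow> real) \<Rightarrow> complex \<Rightarrow> complex" where
  "laplace f p = (LBINT t:{0<..}. exp (- p * of_real t) * of_real (f t))"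

text \<open>A real-valued inverse transform is determined only up to null sets; one is chosen. The
  value of a convolution at a given point does not depend on the choice.\<close>

definition inverse_laplace :: "(complex \<Rightarrow> complex) \<Rightarrow> real \<Rightarrow> real" where
  "inverse_laplace F =
     (SOME f. laplace_transformable f \<and> (\<forall>p. 0 < Re p \<longrightarrow> laplace f p = F p))"

definition laplace_convolution :: "(real \<Rightarrow> real) \<Rightarrow> (real \<Rightarrow> real) \<Rightarrow> real \<Rightarrow> real" where
  "laplace_convolution f g t = (LBINT s:{0..t}. f (t - s) * g s)"

definition laplace_dominated :: "'i set \<Rightarrow> ('i \<Rightarrow> real \<Rightarrow> real) \<Rightarrow> bool" where
  "laplace_dominated I F \<longleftrightarrow>
     (\<exists>M. laplace_transformable M \<and> (\<forall>i\<in>I. \<forall>t>0. \<bar>F i t\<bar> \<le> M t))"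

text \<open>
  Solutions are functions of $r > 0$, $z \ge 0$, $t > 0$: the derivative in $z$ is one-sided at
  $z = 0$, and the conditions at $r = z = 0$, at infinity and at $t = 0$ are limits from this domain.
  Here \<open>uz\<close>, \<open>uzz\<close> are the derivatives in $z$, and \<open>ur\<close>, \<open>urr\<close> the derivatives in $r$ along $z = 0$.

  Since \<open>h\<close> is only assumed to have a Laplace transform, the condition $u = A h(t)$ at $r = z = 0$
  means pointwise convergence at the continuity points of \<open>h\<close> together with convergence in the
  weighted $L^1$ spaces of the Laplace transform. Pointwise convergence for all $t > 0$ would not
  determine \<open>u\<close>, even for continuous \<open>h\<close>: the response to a Dirac impulse at $t = 0$ in place of
  \<open>h\<close> satisfies all other conditions and tends pointwise to $0$ at $r = z = 0$.

  The last four conditions make the Laplace transform in $t$ applicable: \<open>u\<close> away from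
  $r = z = 0$, and locally its derivatives, have Laplace transformable majorants in $t$.
\<close>

definition temperature_field_solution ::
  "real \<Rightarrow> real \<Rightarrow> real \<Rightarrow> real \<Rightarrow> real \<Rightarrow> real \<Rightarrow> (real \<Rightarrow> real) \<Rightarrow>
   (real \<Rightarrow> real \<Rightarrow> real \<Rightarrow> real) \<Rightarrow> bool" where
  "temperature_field_solution \<beta> a lam A \<alpha> \<nu> h u \<longleftrightarrow>
    (\<exists>uz uzz :: real \<Rightarrow> real \<Rightarrow> real \<Rightarrow> real. \<exists>ur urr :: real \<Rightarrow> real \<Rightarrow> real.
      (\<forall>r>0. \<forall>z\<ge>0. \<forall>t>0. caputo_differentiable (2 * \<beta>) (u r z) t) \<and>
      (\<forall>r>0. \<forall>z\<ge>0. \<forall>t>0. ((\<lambda>y. u r y t) has_real_derivative uz r z t) (at z within {0..})) \<and>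
      (\<forall>r>0. \<forall>z>0. \<forall>t>0. ((\<lambda>y. uz r y t) has_real_derivative uzz r z t) (at z)) \<and>
      (\<forall>r>0. \<forall>t>0. ((\<lambda>x. u x 0 t) has_real_derivative ur r t) (at r)) \<and>
      (\<forall>r>0. \<forall>t>0. ((\<lambda>x. ur x t) has_real_derivative urr r t) (at r)) \<and>
      (\<forall>r>0. \<forall>z>0. \<forall>t>0.
         caputo (2 * \<beta>) (u r z) t = a\<^sup>2 * uzz r z t - lam * uz r z t) \<and>
      (\<forall>r>0. \<forall>t>0.
         caputo (2 * \<beta>) (u r 0) t = urr r t + (1 - 2 * \<nu>) / r * ur r t + \<alpha> * uz r 0 t) \<and>
      (\<forall>t>0. isCont h t \<longrightarrow>
         ((\<lambda>(r, z). u r z t) \<longlongrightarrow> A * h t) (at (0, 0) within {0<..} \<times> {0..})) \<and>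
      (\<forall>p>0. ((\<lambda>(r, z). LBINT t:{0<..}. exp (- p * t) * \<bar>u r z t - A * h t\<bar>) \<longlongrightarrow> 0)
         (at (0, 0) within {0<..} \<times> {0..})) \<and>
      (\<forall>t>0. ((\<lambda>(r, z). u r z t) \<longlongrightarrow> 0) (inf at_infinity (principal ({0<..} \<times> {0..})))) \<and>
      (\<forall>r>0. \<forall>z\<ge>0. (u r z \<longlongrightarrow> 0) (at_right 0)) \<and>
      (\<forall>\<rho>>0. laplace_dominated {(r, z). 0 < r \<and> 0 \<le> z \<and> \<rho> \<le> r\<^sup>2 + z\<^sup>2} (\<lambda>(r, z). u r z)) \<and>
      (\<forall>K. compact K \<and> K \<subseteq> {0<..} \<times> {0..} \<longrightarrow> laplace_dominated K (\<lambda>(r, z). uz r z)) \<and>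
      (\<forall>K. compact K \<and> K \<subseteq> {0<..} \<times> {0<..} \<longrightarrow> laplace_dominated K (\<lambda>(r, z). uzz r z)) \<and>
      (\<forall>K. compact K \<and> K \<subseteq> {0<..} \<longrightarrow> laplace_dominated K ur \<and> laplace_dominated K urr))"

definition g1 ::
  "real \<Rightarrow> real \<Rightarrow> real \<Rightarrow> real \<Rightarrow> (real \<Rightarrow> real) \<Rightarrow> real \<Rightarrow> real \<Rightarrow> real \<Rightarrow> real" where
  "g1 \<beta> a lam \<alpha> h t \<tau> z =
     laplace_convolution
       (laplace_convolution
         (inverse_laplace (\<lambda>p. exp (- of_real \<tau> * p powr of_real (2 * \<beta>))))
         (inverse_laplace (laplace h)))
       (inverse_laplace (\<lambda>p. exp (- of_real ((z + \<alpha> * \<tau>) / a) *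
          csqrt (p powr of_real (2 * \<beta>) + of_real (lam\<^sup>2 / (4 * a\<^sup>2)))))) t"

definition temperature_field ::
  "real \<Rightarrow> real \<Rightarrow> real \<Rightarrow> real \<Rightarrow> real \<Rightarrow> real \<Rightarrow> (real \<Rightarrow> real) \<Rightarrow>
   real \<Rightarrow> real \<Rightarrow> real \<Rightarrow> real" where
  "temperature_field \<beta> a lam A \<alpha> \<nu> h r z t =
     A / Gamma \<nu> *
     (LBINT \<tau>:{0<..}. 1 / \<tau> powr (\<nu> + 1) * (r / 2) powr (2 * \<nu>) * exp (- (r\<^sup>2 / (4 * \<tau>))) *
        exp (lam / (2 * a\<^sup>2) * (z + \<alpha> * \<tau>)) * g1 \<beta> a lam \<alpha> h t \<tau> z)"

end

theory Submission
  imports Defs "HOL-Complex_Analysis.Complex_Analysis" "HOL-Probability.Sinc_Integral" "HOL-Real_Asymp.Real_Asymp"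
begin

text \<open>
  Transforming in \<open>t\<close> turns the equation into $a^2 U'' - \lambda U' = s U$ in \<open>z\<close> with $s = p^{2\beta}$; its
  solutions vanishing at infinity are $C(r) e^{-kz}$, where \<open>k\<close> is the positive root of $a^2 k^2 + \lambda k = s$,
  and the boundary condition becomes $C'' + \frac{1-2\nu}{r} C' = m C$ with $m = s + \alpha k$. An energy
  argument (a weight times $(C^2)'$ is nondecreasing) shows that at most one \<open>C\<close> has the prescribed limits at 0 and at
  infinity, and none for $\nu \le 0$ unless \<open>h\<close> vanishes.

  For existence the transform $e^{-kz}$ times an integral of $e^{-\tau m}$ over \<open>\<tau>\<close> is inverted along a vertical line.
  Near $r = z = 0$ the field is the convolution of $A h$ with a kernel that is nonnegative, because $e^{-\sigma s - \zeta k}$ is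
  completely monotone in \<open>p\<close>, so that the kernels form an approximate identity.
\<close>

text \<open>The datum h is merely integrable against exponentials, so its transform is bounded on
  each half plane Re p >= c > 0 and offers no decay. All decay along the line must come from the
  kernel: for Re p > 0 the power s stays in a sector of half-angle \<delta> pi / 2 < pi / 2, where
  \<delta> = 2 \<beta>, and k stays in a sector as well, so exp (- \<tau> s) decays faster than
  every power of |p|. The \<tau>-integral keeps this gain for r > 0, even at z = 0, because exp (-
  r^2 / (4 \<tau>)) absorbs every negative power of \<tau>. Pointwise identities in t come from
  comparing transforms on the positive real axis; there uniqueness and positivity both rest on a
  Hausdorff moment argument in x = exp (- t). An arbitrary solution offers little regularity in t:
  its time derivative need not have a transform, so the rule for the Caputo derivative is derived by
  Abel inversion on bounded time intervals. The inverse transforms in \<open>g1\<close> are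
  arbitrary representatives, and convolution removes the arbitrariness.\<close>

abbreviation "ind \<equiv> indicator {0::real<..}"
abbreviation "int_pos \<equiv> set_integrable lborel {0::real<..}"
abbreviation "conv \<equiv> laplace_convolution"

section \<open>Differentiation under the integral sign\<close>

text \<open>Difference quotients along a sequence are passed to the limit by dominated convergence.
  On the convex set S the mean value inequality gives |f y w - f x w| <= g w |y - x|, so the
  remainder quotient is at most 2 g. Working within S rather than at an interior point covers
  one-sided derivatives, such as the one in z at z = 0.\<close>

lemma has_derivative_integral:
  fixes f :: "'a::real_normed_vector \<Rightarrow> 'm \<Rightarrow> 'b::{banach,second_countable_topology}"
  assumes S: "convex S" "x \<in> S"
    and int: "\<And>y. y \<in> S \<Longrightarrow> integrable M (f y)"
    and der: "\<And>y w. y \<in> S \<Longrightarrow> w \<in> space M \<Longrightarrow> ((\<lambda>y. f y w) has_derivative f' y w) (at y within S)"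
    and meas: "\<And>h. (\<lambda>w. f' x w h) \<in> borel_measurable M"
    and bd: "\<And>y w. y \<in> S \<Longrightarrow> w \<in> space M \<Longrightarrow> onorm (f' y w) \<le> g w"
    and g: "integrable M g"
  shows "((\<lambda>y. \<integral>w. f y w \<partial>M) has_derivative (\<lambda>h. \<integral>w. f' x w h \<partial>M)) (at x within S)"
proof -
  have bl: "bounded_linear (f' y w)" if "y \<in> S" "w \<in> space M" for y w
    using der[OF that] has_derivative_bounded_linear by blast
  have nb: "norm (f' y w h) \<le> g w * norm h" if "y \<in> S" "w \<in> space M" for y w h
    using onorm[OF bl[OF that], of h] bd[OF that] mult_right_mono[OF bd[OF that], of "norm h"]
    by (meson norm_ge_zero order_trans)
  have g0: "0 \<le> g w" if "w \<in> space M" for w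
    using onorm_pos_le[OF bl[OF S(2) that]] bd[OF S(2) that] by linarith
  have int': "integrable M (\<lambda>w. f' x w h)" for h
    by (rule Bochner_Integration.integrable_bound[OF integrable_mult_left[OF g, of "norm h"] meas])
       (use nb[OF S(2)] g0 in \<open>auto intro!: AE_I2\<close>)
  have diff: "norm (f y w - f x w) \<le> g w * norm (y - x)" if "y \<in> S" "w \<in> space M" for y w
    using differentiable_bound[of S "\<lambda>y. f y w" "\<lambda>y. f' y w" "g w" y x] S der bd that by blast
  have lin: "bounded_linear (\<lambda>h. \<integral>w. f' x w h \<partial>M)"
  proof (rule bounded_linear_intro[where K="\<integral>w. g w \<partial>M"])
    fix h k :: 'a and r :: real
    have "(\<integral>w. f' x w (h + k) \<partial>M) = (\<integral>w. f' x w h + f' x w k \<partial>M)"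
      by (rule Bochner_Integration.integral_cong)
         (use bl[OF S(2)] in \<open>auto simp: linear_add bounded_linear.linear\<close>)
    also have "\<dots> = (\<integral>w. f' x w h \<partial>M) + (\<integral>w. f' x w k \<partial>M)"
      by (rule Bochner_Integration.integral_add[OF int' int'])
    finally show "(\<integral>w. f' x w (h + k) \<partial>M) = (\<integral>w. f' x w h \<partial>M) + (\<integral>w. f' x w k \<partial>M)" .
    have "(\<integral>w. f' x w (r *\<^sub>R h) \<partial>M) = (\<integral>w. r *\<^sub>R f' x w h \<partial>M)"
      by (rule Bochner_Integration.integral_cong)
         (use bl[OF S(2)] in \<open>auto simp: linear_scale bounded_linear.linear\<close>)
    then show "(\<integral>w. f' x w (r *\<^sub>R h) \<partial>M) = r *\<^sub>R (\<integral>w. f' x w h \<partial>M)" by simp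
    have "norm (\<integral>w. f' x w h \<partial>M) \<le> (\<integral>w. norm (f' x w h) \<partial>M)" by simp
    also have "\<dots> \<le> (\<integral>w. g w * norm h \<partial>M)"
      by (rule integral_mono) (use int' g nb[OF S(2)] in auto)
    finally show "norm (\<integral>w. f' x w h \<partial>M) \<le> norm h * (\<integral>w. g w \<partial>M)"
      by (simp add: mult.commute)
  qed
  let ?q = "\<lambda>y w. (1 / norm (y - x)) *\<^sub>R (f y w - (f x w + f' x w (y - x)))"
  have "((\<lambda>y. (1 / norm (y - x)) *\<^sub>R ((\<integral>w. f y w \<partial>M) - ((\<integral>w. f x w \<partial>M) + (\<integral>w. f' x w (y - x) \<partial>M)))) \<longlongrightarrow> 0) (at x within S)"
    unfolding tendsto_at_iff_sequentially comp_def
  proof safe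
    fix X assume X: "\<forall>i. X i \<in> S - {x}" and lim: "X \<longlonglongrightarrow> x"
    have "(\<lambda>i. \<integral>w. ?q (X i) w \<partial>M) \<longlonglongrightarrow> (\<integral>w. 0 \<partial>M)"
    proof (rule integral_dominated_convergence[where w="\<lambda>w. 2 * g w"])
      show "(\<lambda>w. ?q (X i) w) \<in> borel_measurable M" for i
        using X int S meas by (intro borel_measurable_scaleR borel_measurable_diff borel_measurable_add) auto
      show "AE w in M. (\<lambda>i. ?q (X i) w) \<longlonglongrightarrow> 0"
      proof (rule AE_I2)
        fix w assume w: "w \<in> space M"
        have "((\<lambda>y. ?q y w) \<longlongrightarrow> 0) (at x within S)"
          using der[OF S(2) w] unfolding has_derivative_within by blast
        then show "(\<lambda>i. ?q (X i) w) \<longlonglongrightarrow> 0"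
          using X lim unfolding tendsto_at_iff_sequentially comp_def by blast
      qed
      show "AE w in M. norm (?q (X i) w) \<le> 2 * g w" for i
      proof (rule AE_I2)
        fix w assume w: "w \<in> space M"
        have Xi: "X i \<in> S" "norm (X i - x) > 0" using X by auto
        have "norm (f (X i) w - (f x w + f' x w (X i - x))) \<le> norm (f (X i) w - f x w) + norm (f' x w (X i - x))"
          by (metis diff_diff_eq norm_triangle_ineq4)
        also have "\<dots> \<le> 2 * g w * norm (X i - x)"
          using diff[OF Xi(1) w] nb[OF S(2) w, of "X i - x"] by linarith
        finally show "norm (?q (X i) w) \<le> 2 * g w"
          unfolding norm_scaleR using Xi by (simp add: field_simps del: scaleR_right_diff_distrib)
      qed
    qed (use g in auto)
    moreover have "(\<integral>w. ?q (X i) w \<partial>M) = (1 / norm (X i - x)) *\<^sub>R ((\<integral>w. f (X i) w \<partial>M) - ((\<integral>w. f x w \<partial>M) + (\<integral>w. f' x w (X i - x) \<partial>M)))" for i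
      unfolding integral_scaleR_right
      using X int S int' by (subst Bochner_Integration.integral_diff) (auto simp: Bochner_Integration.integral_add)
    ultimately show "(\<lambda>i. (1 / norm (X i - x)) *\<^sub>R ((\<integral>w. f (X i) w \<partial>M) - ((\<integral>w. f x w \<partial>M) + (\<integral>w. f' x w (X i - x) \<partial>M)))) \<longlonglongrightarrow> 0"
      by (simp only: integral_zero)
  qed
  then show ?thesis unfolding has_derivative_within using lin by blast
qed

lemma has_vector_derivative_integral:
  fixes f :: "real \<Rightarrow> 'm \<Rightarrow> 'b::{banach,second_countable_topology}"
  assumes "convex S" "x \<in> S"
    and "\<And>y. y \<in> S \<Longrightarrow> integrable M (f y)"
    and der: "\<And>y w. y \<in> S \<Longrightarrow> w \<in> space M \<Longrightarrow> ((\<lambda>y. f y w) has_vector_derivative f' y w) (at y within S)"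
    and meas: "f' x \<in> borel_measurable M"
    and bd: "\<And>y w. y \<in> S \<Longrightarrow> w \<in> space M \<Longrightarrow> norm (f' y w) \<le> g w"
    and g: "integrable M g"
  shows "((\<lambda>y. \<integral>w. f y w \<partial>M) has_vector_derivative (\<integral>w. f' x w \<partial>M)) (at x within S)"
proof -
  have "((\<lambda>y. \<integral>w. f y w \<partial>M) has_derivative (\<lambda>h. \<integral>w. h *\<^sub>R f' x w \<partial>M)) (at x within S)"
  proof (rule has_derivative_integral[where f'="\<lambda>y w h. h *\<^sub>R f' y w", OF assms(1-3) _ _ _ g])
    fix y w assume "y \<in> S" "w \<in> space M"
    then show "onorm (\<lambda>h. h *\<^sub>R f' y w) \<le> g w"
      using bd[of y w] by (intro onorm_le) (auto simp: mult.commute[of _ "g w"] mult.commute[of _ "norm (f' y w)"] intro!: mult_right_mono)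
  qed (use der meas in \<open>auto simp: has_vector_derivative_def\<close>)
  then show ?thesis by (simp add: has_vector_derivative_def)
qed

lemma has_field_derivative_integral:
  fixes f :: "complex \<Rightarrow> 'm \<Rightarrow> complex"
  assumes "convex S" "x \<in> S"
    and "\<And>y. y \<in> S \<Longrightarrow> integrable M (f y)"
    and der: "\<And>y w. y \<in> S \<Longrightarrow> w \<in> space M \<Longrightarrow> ((\<lambda>y. f y w) has_field_derivative f' y w) (at y within S)"
    and meas: "f' x \<in> borel_measurable M"
    and bd: "\<And>y w. y \<in> S \<Longrightarrow> w \<in> space M \<Longrightarrow> norm (f' y w) \<le> g w"
    and g: "integrable M g"
  shows "((\<lambda>y. \<integral>w. f y w \<partial>M) has_field_derivative (\<integral>w. f' x w \<partial>M)) (at x within S)"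
proof -
  have "((\<lambda>y. \<integral>w. f y w \<partial>M) has_derivative (\<lambda>h. \<integral>w. f' x w * h \<partial>M)) (at x within S)"
  proof (rule has_derivative_integral[where f'="\<lambda>y w h. f' y w * h", OF assms(1-3) _ _ _ g])
    fix y w assume "y \<in> S" "w \<in> space M"
    then show "onorm (\<lambda>h. f' y w * h) \<le> g w"
      using bd[of y w] by (intro onorm_le) (auto simp: norm_mult intro!: mult_right_mono)
  qed (use der meas in \<open>auto simp: has_field_derivative_def\<close>)
  then show ?thesis by (simp add: has_field_derivative_def)
qed

section \<open>Real Laplace integrals\<close>

definition exp_integrable :: "(real \<Rightarrow> real) \<Rightarrow> bool" where
  "exp_integrable f \<longleftrightarrow> (\<forall>p>0. int_pos (\<lambda>t. exp (- p * t) * f t))"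

definition rlap :: "(real \<Rightarrow> real) \<Rightarrow> real \<Rightarrow> real" where
  "rlap f p = (LBINT t:{0<..}. exp (- p * t) * f t)"

lemma exp_minus_mult_of_real: "exp (- complex_of_real p * of_real t) = of_real (exp (- p * t))"
  by (metis exp_of_real of_real_minus of_real_mult)

lemma exp_integrableD: "exp_integrable f \<Longrightarrow> 0 < p \<Longrightarrow> int_pos (\<lambda>t. exp (- p * t) * f t)"
  by (simp add: exp_integrable_def)

lemma borel_measurable_exp_times:
  fixes f :: "real \<Rightarrow> real"
  assumes [measurable]: "f \<in> borel_measurable borel"
  shows "(\<lambda>t. exp (c * t) * f t) \<in> borel_measurable borel"
  by measurable

text \<open>Nothing is known about f for t <= 0, so measurability is stated for the cut-off
  function; it is recovered from the integrable weighted function at p = 1 by multiplying by exp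
  t.\<close>

lemma exp_integrable_measurable:
  assumes "exp_integrable f"
  shows "(\<lambda>t. ind t * f t) \<in> borel_measurable borel"
proof -
  have "(\<lambda>t. ind t * (exp (- 1 * t) * f t)) \<in> borel_measurable borel"
    using exp_integrableD[OF assms, of 1] unfolding set_integrable_def by (auto dest: borel_measurable_integrable)
  then have "(\<lambda>t. exp (1 * t) * (ind t * (exp (- 1 * t) * f t))) \<in> borel_measurable borel"
    by (rule borel_measurable_exp_times)
  moreover have "exp (1 * t) * (ind t * (exp (- 1 * t) * f t)) = ind t * f t" for t :: real
    by (simp add: exp_minus field_simps)
  ultimately show ?thesis by (simp only:)
qed

text \<open>The modulus of exp (- p t) depends on Re p alone, so integrability for real p is the
  whole condition. This allows most of the proof to work with \<open>rlap\<close> on the positive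
  real axis.\<close>

lemma laplace_transformable_iff: "laplace_transformable f \<longleftrightarrow> exp_integrable f"
proof
  assume lt: "laplace_transformable f"
  show "exp_integrable f" unfolding exp_integrable_def
  proof (intro allI impI)
    fix p :: real assume "0 < p"
    then have "int_pos (\<lambda>t. exp (- of_real p * of_real t) * complex_of_real (f t))"
      using lt unfolding laplace_transformable_def by (metis Re_complex_of_real)
    then have "integrable lborel (\<lambda>t. Re (ind t *\<^sub>R (exp (- of_real p * of_real t) * complex_of_real (f t))))"
      unfolding set_integrable_def by (rule integrable_Re)
    moreover have "Re (ind t *\<^sub>R (exp (- of_real p * of_real t) * complex_of_real (f t))) = ind t *\<^sub>R (exp (- p * t) * f t)" for t
      unfolding exp_minus_mult_of_real by (simp flip: of_real_mult add: scaleR_conv_of_real)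
    ultimately show "int_pos (\<lambda>t. exp (- p * t) * f t)"
      unfolding set_integrable_def by (simp only:)
  qed
next
  assume e: "exp_integrable f"
  show "laplace_transformable f" unfolding laplace_transformable_def
  proof (intro allI impI)
    fix p :: complex assume p: "0 < Re p"
    have eq: "ind t *\<^sub>R (exp (- p * of_real t) * complex_of_real (f t)) = exp (- p * of_real t) * of_real (ind t * f t)" for t
      by (simp add: indicator_def)
    have m: "(\<lambda>t. exp (- p * of_real t) * complex_of_real (g t)) \<in> borel_measurable lborel"
      if [measurable]: "g \<in> borel_measurable borel" for g by measurable
    have "integrable lborel (\<lambda>t. exp (- p * of_real t) * complex_of_real (ind t * f t))"
      by (rule Bochner_Integration.integrable_bound[OF exp_integrableD[OF e p, unfolded set_integrable_def]
            m[OF exp_integrable_measurable[OF e]]])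
         (auto simp: norm_mult indicator_def abs_mult)
    then show "int_pos (\<lambda>t. exp (- p * of_real t) * complex_of_real (f t))"
      unfolding set_integrable_def eq .
  qed
qed

lemma laplace_of_real: "laplace f (of_real p) = of_real (rlap f p)"
  unfolding laplace_def rlap_def set_integral_complex_of_real[symmetric]
  by (rule set_lebesgue_integral_cong) (auto simp only: exp_minus_mult_of_real of_real_mult, simp)

lemma exp_integrable_bound:
  assumes "exp_integrable g" and m: "(\<lambda>t. ind t * f t) \<in> borel_measurable borel"
    and le: "\<And>t. 0 < t \<Longrightarrow> \<bar>f t\<bar> \<le> g t"
  shows "exp_integrable f"
  unfolding exp_integrable_def set_integrable_def
proof (intro allI impI)
  fix p :: real assume "0 < p"
  have m': "(\<lambda>t. exp (-p*t) * (ind t * f t)) \<in> borel_measurable lborel"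
    using borel_measurable_exp_times[OF m, of "-p"] by simp
  have "integrable lborel (\<lambda>t. exp (-p*t) * (ind t * f t))"
    by (rule Bochner_Integration.integrable_bound[OF exp_integrableD[OF assms(1) \<open>0 < p\<close>, unfolded set_integrable_def] m'])
       (auto simp: indicator_def abs_mult intro!: AE_I2 mult_left_mono order_trans[OF le abs_ge_self])
  then show "integrable lborel (\<lambda>t. ind t *\<^sub>R (exp (- p * t) * f t))"
    by (simp add: mult.left_commute)
qed

lemma exp_integrable_cong:
  assumes "\<And>t. 0 < t \<Longrightarrow> f t = g t"
  shows "exp_integrable f \<longleftrightarrow> exp_integrable g" "rlap f p = rlap g p"
  unfolding exp_integrable_def rlap_def set_integrable_def set_lebesgue_integral_def using assms
  by (auto intro!: all_cong imp_cong Bochner_Integration.integrable_cong Bochner_Integration.integral_cong simp: indicator_def)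

lemma exp_integrable_add: "exp_integrable f \<Longrightarrow> exp_integrable g \<Longrightarrow> exp_integrable (\<lambda>t. f t + g t)"
  unfolding exp_integrable_def by (auto simp: distrib_left intro!: set_integral_add)

lemma rlap_add: "exp_integrable f \<Longrightarrow> exp_integrable g \<Longrightarrow> 0 < p \<Longrightarrow> rlap (\<lambda>t. f t + g t) p = rlap f p + rlap g p"
  unfolding exp_integrable_def rlap_def by (auto simp: distrib_left intro!: set_integral_add)

lemma exp_integrable_mult: "exp_integrable f \<Longrightarrow> exp_integrable (\<lambda>t. c * f t)"
  unfolding exp_integrable_def by (auto simp: mult.left_commute[of _ c] intro!: set_integrable_mult_right)

lemma rlap_mult: "rlap (\<lambda>t. c * f t) p = c * rlap f p"
  unfolding rlap_def by (simp add: mult.left_commute[of _ c])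

lemma exp_integrable_diff: "exp_integrable f \<Longrightarrow> exp_integrable g \<Longrightarrow> exp_integrable (\<lambda>t. f t - g t)"
  using exp_integrable_add[of f "\<lambda>t. (-1) * g t"] exp_integrable_mult[of g "-1"] by simp

lemma rlap_diff: "exp_integrable f \<Longrightarrow> exp_integrable g \<Longrightarrow> 0 < p \<Longrightarrow> rlap (\<lambda>t. f t - g t) p = rlap f p - rlap g p"
  using rlap_add[of f "\<lambda>t. (-1) * g t"] exp_integrable_mult[of g "-1"] rlap_mult[of "-1" g] by simp

lemma exp_integrable_abs: "exp_integrable f \<Longrightarrow> exp_integrable (\<lambda>t. \<bar>f t\<bar>)"
  unfolding exp_integrable_def
proof (intro allI impI)
  fix p :: real assume "\<forall>p>0. int_pos (\<lambda>t. exp (- p * t) * f t)" "0 < p"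
  then have "int_pos (\<lambda>t. \<bar>exp (- p * t) * f t\<bar>)" by (intro set_integrable_abs) auto
  then show "int_pos (\<lambda>t. exp (- p * t) * \<bar>f t\<bar>)" by (simp add: abs_mult)
qed

text \<open>The growth bound with c = p / 2 leaves the integrable factor exp (- p t / 2).\<close>

lemma exp_integrable_exp:
  assumes m: "(\<lambda>t. ind t * f t) \<in> borel_measurable borel"
    and le: "\<And>c. 0 < c \<Longrightarrow> \<exists>C. \<forall>t>0. \<bar>f t\<bar> \<le> C * exp (c * t)"
  shows "exp_integrable f"
  unfolding exp_integrable_def set_integrable_def
proof (intro allI impI)
  fix p :: real assume "0 < p"
  then obtain C where C: "\<And>t. 0 < t \<Longrightarrow> \<bar>f t\<bar> \<le> C * exp (p / 2 * t)" using le[of "p/2"] by auto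
  have m': "(\<lambda>t. exp (-p*t) * (ind t * f t)) \<in> borel_measurable lborel"
    using borel_measurable_exp_times[OF m, of "-p"] by simp
  have i: "integrable lborel (\<lambda>t. C * (ind t *\<^sub>R exp (- (t * (p/2)))))"
    using integrable_I0i_exp_mscale[of "p/2"] \<open>0 < p\<close> unfolding set_integrable_def by (intro integrable_mult_right) simp
  have "integrable lborel (\<lambda>t. exp (-p*t) * (ind t * f t))"
  proof (rule Bochner_Integration.integrable_bound[OF i m'], rule AE_I2)
    fix t :: real
    show "norm (exp (-p*t) * (ind t * f t)) \<le> norm (C * (ind t *\<^sub>R exp (- (t * (p/2)))))"
    proof (cases "0 < t")
      case True
      have "exp (-p*t) * \<bar>f t\<bar> \<le> exp (-p*t) * (C * exp (p / 2 * t))"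
        using C[OF True] by simp
      also have "\<dots> = C * exp (- (t * (p/2)))"
        by (simp add: exp_add[symmetric] field_simps)
      also have "\<dots> \<le> \<bar>C\<bar> * exp (- (t * (p/2)))" by (intro mult_right_mono) auto
      finally show ?thesis using True by (simp add: abs_mult)
    qed simp
  qed
  then show "integrable lborel (\<lambda>t. ind t *\<^sub>R (exp (- p * t) * f t))"
    by (simp add: mult.left_commute)
qed

text \<open>The definition asks for one majorant serving all p, while the constants C depend on c.
  The pointwise infimum of the bounds for c = 1 / (n + 1) lies below each of them and is therefore
  at most a multiple of exp (c t) for every c > 0.\<close>

lemma laplace_dominated_exp:
  assumes "\<And>c. 0 < c \<Longrightarrow> \<exists>C. \<forall>i\<in>I. \<forall>t>0. \<bar>F i t\<bar> \<le> C * exp (c * t)"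
  shows "laplace_dominated I F"
proof -
  have "\<exists>C::nat \<Rightarrow> real. \<forall>n. 0 \<le> C n \<and> (\<forall>i\<in>I. \<forall>t>0. \<bar>F i t\<bar> \<le> C n * exp (t / (real n + 1)))"
  proof (rule choice, rule allI)
    fix n :: nat
    obtain C where C: "\<forall>i\<in>I. \<forall>t>0. \<bar>F i t\<bar> \<le> C * exp (1 / (real n + 1) * t)"
      using assms[of "1/(real n + 1)"] by auto
    have "\<bar>F i t\<bar> \<le> \<bar>C\<bar> * exp (t / (real n + 1))" if "i \<in> I" "0 < t" for i t
    proof -
      have "C * exp (t / (real n + 1)) \<le> \<bar>C\<bar> * exp (t / (real n + 1))" by (intro mult_right_mono) auto
      moreover have "\<bar>F i t\<bar> \<le> C * exp (t / (real n + 1))" using C that by simp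
      ultimately show ?thesis by linarith
    qed
    then show "\<exists>C\<ge>0. \<forall>i\<in>I. \<forall>t>0. \<bar>F i t\<bar> \<le> C * exp (t / (real n + 1))"
      by (intro exI[of _ "\<bar>C\<bar>"]) auto
  qed
  then obtain C where C0: "\<And>n::nat. 0 \<le> C n" and C: "\<And>n i t. i \<in> I \<Longrightarrow> 0 < t \<Longrightarrow> \<bar>F i t\<bar> \<le> C n * exp (t / (real n + 1))"
    by blast
  define M where "M t = (INF n::nat. C n * exp (t / (real n + 1)))" for t
  have bdd: "bdd_below (range (\<lambda>n::nat. C n * exp (t / (real n + 1))))" for t
    using C0 by (intro bdd_belowI[of _ 0]) auto
  have [measurable]: "M \<in> borel_measurable borel"
    unfolding M_def by (intro borel_measurable_cINF_real bdd) auto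
  have M0: "0 \<le> M t" for t unfolding M_def by (intro cINF_greatest) (use C0 in auto)
  have "exp_integrable M"
  proof (rule exp_integrable_exp)
    fix c :: real assume "0 < c"
    obtain n where n: "1 / (real n + 1) < c" using \<open>0 < c\<close> nat_approx_posE[of c] by (metis of_nat_Suc add.commute)
    have "\<bar>M t\<bar> \<le> C n * exp (c * t)" if "0 < t" for t
    proof -
      have "M t \<le> C n * exp (t / (real n + 1))" unfolding M_def by (rule cINF_lower[OF bdd]) simp
      also have "\<dots> \<le> C n * exp (c * t)"
        using n that C0 mult_right_mono[of "1/(real n + 1)" c t] by (intro mult_left_mono) auto
      finally show ?thesis using M0 by simp
    qed
    then show "\<exists>C. \<forall>t>0. \<bar>M t\<bar> \<le> C * exp (c * t)" by blast
  qed simp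
  moreover have "\<bar>F i t\<bar> \<le> M t" if "i \<in> I" "0 < t" for i t
    unfolding M_def by (intro cINF_greatest) (use C that in auto)
  ultimately show ?thesis unfolding laplace_dominated_def laplace_transformable_iff by blast
qed

section \<open>Positivity and uniqueness for Laplace integrals\<close>

text \<open>Complete monotonicity up to a given order, in terms of the differences with step 1.\<close>

primrec alternating :: "nat \<Rightarrow> (real \<Rightarrow> real) \<Rightarrow> bool" where
  "alternating 0 F \<longleftrightarrow> (\<forall>p>0. 0 \<le> F p)"
| "alternating (Suc n) F \<longleftrightarrow> (\<forall>p>0. 0 \<le> F p) \<and> alternating n (\<lambda>p. F p - F (p + 1))"

lemma alternating_nonneg: "alternating n F \<Longrightarrow> 0 < p \<Longrightarrow> 0 \<le> F p"
  by (cases n) auto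

lemma alternating_cong: "(\<And>p. 0 < p \<Longrightarrow> F p = G p) \<Longrightarrow> alternating n F \<longleftrightarrow> alternating n G"
proof (induction n arbitrary: F G)
  case (Suc n)
  from Suc.IH[of "\<lambda>p. F p - F (p + 1)" "\<lambda>p. G p - G (p + 1)"] Suc.prems show ?case by simp
qed simp

lemma exp_integrable_mult_bounded:
  assumes f: "exp_integrable f" and [measurable]: "g \<in> borel_measurable borel"
    and b: "\<And>t. 0 < t \<Longrightarrow> \<bar>g t\<bar> \<le> 1"
  shows "exp_integrable (\<lambda>t. g t * f t)"
proof (rule exp_integrable_bound[OF exp_integrable_abs[OF f]])
  have "(\<lambda>t. g t * (ind t * f t)) \<in> borel_measurable borel"
    by (rule borel_measurable_times[OF assms(2) exp_integrable_measurable[OF f]])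
  then show "(\<lambda>t. ind t * (g t * f t)) \<in> borel_measurable borel"
    by (simp only: mult.left_commute)
  fix t :: real assume "0 < t"
  then show "\<bar>g t * f t\<bar> \<le> \<bar>f t\<bar>"
    using mult_right_mono[OF b, of t "\<bar>f t\<bar>"] by (simp add: abs_mult)
qed

text \<open>This is why the differences have step 1: each of them multiplies f by 1 - x with x = exp
  (- t), so that iterated differences reach polynomials in x.\<close>

lemma rlap_difference:
  assumes "exp_integrable f" "0 < p"
  shows "rlap f p - rlap f (p + 1) = rlap (\<lambda>t. (1 - exp (- t)) * f t) p"
proof -
  have "rlap f p - rlap f (p + 1) = (LBINT t:{0<..}. exp (- p * t) * f t - exp (- (p + 1) * t) * f t)"
    unfolding rlap_def by (rule set_integral_diff(2)[symmetric]; intro exp_integrableD assms) (use assms in simp)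
  also have "\<dots> = rlap (\<lambda>t. (1 - exp (- t)) * f t) p"
    unfolding rlap_def by (rule arg_cong[where f="set_lebesgue_integral _ _"])
      (auto simp: algebra_simps simp flip: exp_add)
  finally show ?thesis .
qed

lemma alternating_rlap_integral:
  assumes "exp_integrable f" "alternating n (rlap f)" "0 < p"
  shows "0 \<le> rlap (\<lambda>t. (1 - exp (- t)) ^ n * f t) p"
  using assms
proof (induction n arbitrary: f)
  case 0
  then show ?case by simp
next
  case (Suc n)
  have i: "exp_integrable (\<lambda>t. (1 - exp (- t)) * f t)"
    by (rule exp_integrable_mult_bounded[OF Suc.prems(1)]) (auto simp: abs_if)
  have "alternating n (rlap (\<lambda>t. (1 - exp (- t)) * f t))"
    using Suc.prems(2) alternating_cong[OF rlap_difference[OF Suc.prems(1)], where n=n] by simp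
  from Suc.IH[OF i this Suc.prems(3)] show ?case by (simp add: mult.assoc power_Suc2 del: power_Suc)
qed

text \<open>Hausdorff's moment argument in the variable x = exp (- t). The Bernstein polynomials of
  a nonnegative \<phi> are nonnegative combinations of x^k (1 - x)^(N - k), and the alternating
  differences make the integral of f against each of these nonnegative. Uniform approximation within
  e costs at most e times the weighted L^1 norm of f.\<close>

lemma alternating_test_function:
  assumes f: "exp_integrable f" and alt: "\<And>n. alternating n (rlap f)"
    and \<phi>: "continuous_on {0..1} \<phi>" "\<And>x. x \<in> {0..1} \<Longrightarrow> 0 \<le> \<phi> x"
    and [measurable]: "\<phi> \<in> borel_measurable borel"
  shows "0 \<le> rlap (\<lambda>t. \<phi> (exp (- t)) * f t) 1"
proof -
  have "compact (\<phi> ` {0..1})" by (rule compact_continuous_image[OF \<phi>(1)]) simp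
  then obtain B where "0 < B" "\<forall>x\<in>{0..1}. \<bar>\<phi> x\<bar> \<le> B"
    using compact_imp_bounded[of "\<phi> ` {0..1}"] unfolding bounded_pos by auto
  then have B: "\<And>x. x \<in> {0..1} \<Longrightarrow> \<bar>\<phi> x\<bar> \<le> B" "0 < B" by auto
  have if1: "exp_integrable (\<lambda>t. g (exp (- t)) * f t)"
    if g: "g \<in> borel_measurable borel" "\<And>x. x \<in> {0..1} \<Longrightarrow> \<bar>g x\<bar> \<le> C" "0 < C" for g :: "real \<Rightarrow> real" and C
  proof -
    have "(\<lambda>t. g (exp (-t))) \<in> borel_measurable borel" using g(1) by measurable
    then have "exp_integrable (\<lambda>t. (g (exp (-t)) / C) * f t)"
      by (intro exp_integrable_mult_bounded[OF f] borel_measurable_divide borel_measurable_const)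
         (use g in \<open>auto\<close>)
    from exp_integrable_mult[OF this, of C] show ?thesis using g(3) by simp
  qed
  have i0: "exp_integrable (\<lambda>t. \<phi> (exp (- t)) * f t)" by (rule if1[OF _ B]) auto
  let ?I = "rlap (\<lambda>t. \<bar>f t\<bar>) 1"
  have *: "0 \<le> rlap (\<lambda>t. \<phi> (exp (- t)) * f t) 1 + e * ?I" if e: "0 < e" for e
  proof -
    obtain N where N: "\<And>n x. N \<le> n \<Longrightarrow> x \<in> {0..1} \<Longrightarrow> \<bar>\<phi> x - (\<Sum>k\<le>n. \<phi> (k/n) * Bernstein n k x)\<bar> < e"
      using Bernstein_Weierstrass[OF \<phi>(1) e] by blast
    define Q where "Q x = (\<Sum>k\<le>N. \<phi> (k/N) * Bernstein N k x)" for x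
    have mQ: "Q \<in> borel_measurable borel"
      unfolding Q_def Bernstein_def by measurable
    have dQ: "\<bar>\<phi> x - Q x\<bar> < e" if "x \<in> {0..1}" for x
      using N[of N x] that unfolding Q_def by simp
    have iQ: "exp_integrable (\<lambda>t. Q (exp (- t)) * f t)"
      by (rule if1[OF mQ, of "B + e"]) (use B e in \<open>auto intro!: order_trans[OF _ add_mono[OF B(1) less_imp_le[OF dQ]]]\<close>)
    have ik: "exp_integrable (\<lambda>t. (exp (-t)) ^ k * ((1 - exp (- t)) ^ (N - k) * f t))" for k
    proof -
      have "exp_integrable (\<lambda>t. ((exp (-t)) ^ k * (1 - exp (- t)) ^ (N - k)) * f t)"
        by (rule if1[of "\<lambda>x. x ^ k * (1 - x) ^ (N - k)" 1])
           (auto simp: abs_mult power_abs intro!: mult_le_one power_le_one)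
      then show ?thesis by (simp add: mult.assoc)
    qed
    have pk: "0 \<le> rlap (\<lambda>t. (exp (-t)) ^ k * ((1 - exp (- t)) ^ (N - k) * f t)) 1" for k
    proof -
      \<comment> \<open>The factor x^k is absorbed by the exponential weight: it moves the transform
        from p = 1 to p = 1 + k.\<close>
      have "rlap (\<lambda>t. (exp (-t)) ^ k * ((1 - exp (- t)) ^ (N - k) * f t)) 1 = rlap (\<lambda>t. (1 - exp (- t)) ^ (N - k) * f t) (1 + real k)"
        unfolding rlap_def
      proof (rule arg_cong[where f="set_lebesgue_integral _ _"], rule ext)
        fix t :: real
        have "exp (- 1 * t) * exp (- t) ^ k = exp (- (1 + real k) * t)"
          unfolding exp_of_nat_mult[symmetric] exp_add[symmetric] by (simp add: algebra_simps)
        then show "exp (- 1 * t) * (exp (- t) ^ k * ((1 - exp (- t)) ^ (N - k) * f t)) = exp (- (1 + real k) * t) * ((1 - exp (- t)) ^ (N - k) * f t)"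
          by (simp only: mult.assoc[symmetric])
      qed
      also have "0 \<le> \<dots>" by (rule alternating_rlap_integral[OF f alt]) simp
      finally show ?thesis .
    qed
    have "rlap (\<lambda>t. Q (exp (- t)) * f t) 1 = rlap (\<lambda>t. \<Sum>k\<le>N. (\<phi> (k/N) * (N choose k)) * ((exp (-t)) ^ k * ((1 - exp (- t)) ^ (N - k) * f t))) 1"
      unfolding Q_def Bernstein_def by (rule exp_integrable_cong) (simp add: sum_distrib_right mult.assoc)
    also have "\<dots> = (\<Sum>k\<le>N. (\<phi> (k/N) * (N choose k)) * rlap (\<lambda>t. (exp (-t)) ^ k * ((1 - exp (- t)) ^ (N - k) * f t)) 1)"
    proof -
      have "exp_integrable (\<lambda>t. \<Sum>k\<in>K. c k * F k t) \<and> rlap (\<lambda>t. \<Sum>k\<in>K. c k * F k t) 1 = (\<Sum>k\<in>K. c k * rlap (F k) 1)"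
        if "finite K" "\<And>k. exp_integrable (F k)" for K c and F :: "nat \<Rightarrow> real \<Rightarrow> real"
        using that(1)
      proof (induction K rule: finite_induct)
        case empty
        show ?case by (auto simp: exp_integrable_def set_integrable_def rlap_def set_lebesgue_integral_def)
      next
        case (insert x F)
        then show ?case using that(2) by (simp add: rlap_add rlap_mult exp_integrable_add exp_integrable_mult)
      qed
      from this[of "{..N}" "\<lambda>k t. (exp (-t)) ^ k * ((1 - exp (- t)) ^ (N - k) * f t)" "\<lambda>k. \<phi> (k/N) * (N choose k)", OF _ ik]
      show ?thesis by (simp only: finite_atMost simp_thms)
    qed
    also have "0 \<le> \<dots>"
      by (intro sum_nonneg mult_nonneg_nonneg pk \<phi>(2)) (auto simp: divide_le_eq_1)
    finally have "0 \<le> rlap (\<lambda>t. Q (exp (- t)) * f t) 1" .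
    moreover have "rlap (\<lambda>t. Q (exp (- t)) * f t) 1 \<le> rlap (\<lambda>t. \<phi> (exp (- t)) * f t + e * \<bar>f t\<bar>) 1"
      unfolding rlap_def
    proof (rule set_integral_mono)
      fix t :: real assume "t \<in> {0<..}"
      have "Q (exp (-t)) * f t - \<phi> (exp (- t)) * f t \<le> \<bar>Q (exp (-t)) - \<phi> (exp (- t))\<bar> * \<bar>f t\<bar>"
        unfolding left_diff_distrib[symmetric] abs_mult[symmetric] by simp
      also have "\<dots> \<le> e * \<bar>f t\<bar>"
        using dQ[of "exp (-t)"] \<open>t \<in> {0<..}\<close> by (intro mult_right_mono) (auto simp: abs_minus_commute less_imp_le)
      finally show "exp (- 1 * t) * (Q (exp (- t)) * f t) \<le> exp (- 1 * t) * (\<phi> (exp (- t)) * f t + e * \<bar>f t\<bar>)"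
        by (intro mult_left_mono) auto
    qed (intro exp_integrableD iQ exp_integrable_add exp_integrable_mult exp_integrable_abs f i0 zero_less_one)+
    moreover have "\<dots> = rlap (\<lambda>t. \<phi> (exp (- t)) * f t) 1 + e * ?I"
      using i0 f by (simp add: rlap_add rlap_mult exp_integrable_mult exp_integrable_abs)
    ultimately show ?thesis by linarith
  qed
  moreover have "0 \<le> ?I" unfolding rlap_def set_lebesgue_integral_def by (intro integral_nonneg_AE) auto
  ultimately have "0 \<le> rlap (\<lambda>t. \<phi> (exp (- t)) * f t) 1 + e" if "0 < e" for e
  proof -
    have "0 \<le> rlap (\<lambda>t. \<phi> (exp (- t)) * f t) 1 + e / (1 + ?I) * ?I"
      using \<open>0 \<le> ?I\<close> that by (intro *) simp
    moreover have "e / (1 + ?I) * ?I \<le> e"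
      using \<open>0 \<le> ?I\<close> that by (simp add: field_simps)
    ultimately show ?thesis by linarith
  qed
  then show ?thesis by (meson field_le_epsilon)
qed

text \<open>If f were negative at t0, continuity would make it negative on an interval (a, b). A
  test function of x = exp (- t) that is positive exactly there would have an integral against f
  that is both nonnegative and strictly negative.\<close>

lemma alternating_imp_nonneg:
  assumes f: "exp_integrable f" and alt: "\<And>n. alternating n (rlap f)"
    and c: "continuous_on {0<..} f" and t0: "0 < t0"
  shows "0 \<le> f t0"
proof (rule ccontr)
  assume "\<not> 0 \<le> f t0"
  then have neg: "f t0 < 0" by simp
  have "isCont f t0" using c t0 by (simp add: continuous_on_eq_continuous_at)
  then have "eventually (\<lambda>t. f t < 0) (nhds t0)"
    using neg by (simp add: isCont_def eventually_nhds_conv_at order_tendstoD)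
  then obtain e where e: "0 < e" "\<And>t. dist t t0 < e \<Longrightarrow> f t < 0"
    unfolding eventually_nhds_metric by blast
  define a b where "a = t0 - min e t0 / 2" and "b = t0 + min e t0 / 2"
  have ab: "0 < a" "a < b" and fab: "\<And>t. a < t \<Longrightarrow> t < b \<Longrightarrow> f t < 0"
    using e t0 unfolding a_def b_def by (auto simp: dist_real_def abs_if min_def split: if_splits)
  \<comment> \<open>A parabola in x with zeros at exp (- b) and exp (- a), truncated at 0. Since exp
    (- t) decreases in t, it is positive exactly for a < t < b.\<close>
  define \<phi> where "\<phi> x = max 0 ((x - exp (- b)) * (exp (- a) - x))" for x :: real
  have \<phi>pos: "0 < \<phi> (exp (-t))" if "a < t" "t < b" for t
    using that unfolding \<phi>_def by simp
  have \<phi>0: "\<phi> (exp (-t)) = 0" if "\<not> (a < t \<and> t < b)" for t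
  proof -
    have "(exp (-t) - exp (- b)) * (exp (- a) - exp (-t)) \<le> 0"
      using that ab by (auto simp: mult_le_0_iff not_less)
    then show ?thesis unfolding \<phi>_def by simp
  qed
  have m: "\<phi> \<in> borel_measurable borel" and cphi: "continuous_on {0..1} \<phi>"
    unfolding \<phi>_def by (auto intro!: borel_measurable_continuous_onI continuous_intros)
  have "0 \<le> rlap (\<lambda>t. \<phi> (exp (- t)) * f t) 1"
    by (rule alternating_test_function[OF f alt cphi _ m]) (simp add: \<phi>_def)
  define G where "G t = - (ind t *\<^sub>R (exp (- 1 * t) * (\<phi> (exp (- t)) * f t)))" for t
  have Gpos: "0 < G t" if "a < t" "t < b" for t
    unfolding G_def using fab[OF that] \<phi>pos[OF that] that ab by (simp add: mult_pos_neg mult_neg_pos mult_less_0_iff)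
  have G0: "0 \<le> G t" for t
    by (cases "a < t \<and> t < b") (use Gpos \<phi>0[of t] in \<open>auto simp: G_def less_imp_le\<close>)
  have "exp_integrable (\<lambda>t. \<phi> (exp (- t)) * f t)"
  proof (rule exp_integrable_mult_bounded[OF f])
    show "(\<lambda>t. \<phi> (exp (-t))) \<in> borel_measurable borel" using m by measurable
    fix t :: real assume "0 < t"
    show "\<bar>\<phi> (exp (- t))\<bar> \<le> 1"
    proof (cases "a < t \<and> t < b")
      case True
      then have "\<phi> (exp (-t)) = (exp (-t) - exp (- b)) * (exp (- a) - exp (-t))"
        using \<phi>pos[of t] unfolding \<phi>_def by (simp add: max_def split: if_splits)
      also have "\<dots> \<le> 1"
      proof (rule mult_le_one)
        show "exp (-t) - exp (- b) \<le> 1" "exp (- a) - exp (-t) \<le> 1" "0 \<le> exp (- a) - exp (-t)"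
          using ab True exp_gt_zero[of "-b"] exp_gt_zero[of "-t"] exp_le_one_iff[of "-t"] exp_le_one_iff[of "-a"]
          by (auto simp del: exp_gt_zero exp_le_one_iff)
      qed
      finally show ?thesis using \<phi>pos[of t] True by simp
    qed (simp add: \<phi>0)
  qed
  then have iG: "integrable lborel G"
    unfolding G_def by (intro Bochner_Integration.integrable_minus exp_integrableD[unfolded set_integrable_def]) simp_all
  have "integral\<^sup>L lborel G \<le> 0"
    using \<open>0 \<le> rlap _ 1\<close> unfolding rlap_def set_lebesgue_integral_def G_def by simp
  moreover have "0 \<le> integral\<^sup>L lborel G" using G0 by (intro Bochner_Integration.integral_nonneg)
  ultimately have "integral\<^sup>L lborel G = 0" by linarith
  then have "AE t in lborel. G t = 0"
    using integral_nonneg_eq_0_iff_AE[OF iG] G0 by auto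
  then have "AE t in lborel. t \<notin> {a<..<b}"
    by eventually_elim (use Gpos in force)
  then have "emeasure lborel {a<..<b} = 0" by (subst (asm) AE_iff_measurable[of "{a<..<b}"]) auto
  then show False using ab by simp
qed

text \<open>A vanishing transform is alternating to every order for f and for - f, so all
  nonnegative continuous test functions of exp (- t) integrate to 0 against f. Ramps approximate the
  indicators of {..x}, and these sets generate the Borel sets.\<close>

lemma rlap_zero_imp_AE_zero:
  assumes f: "exp_integrable f" and z: "\<And>p. 0 < p \<Longrightarrow> rlap f p = 0"
  shows "AE t in lborel. 0 < t \<longrightarrow> f t = 0"
proof -
  have alt0: "alternating n (\<lambda>p. 0)" for n by (induction n) auto
  have altp: "alternating n (rlap f)" for n
    using alternating_cong[of "rlap f" "\<lambda>p. 0" n] z alt0 by simp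
  have altm: "alternating n (rlap (\<lambda>t. (- 1) * f t))" for n
    using alternating_cong[of "rlap (\<lambda>t. (- 1) * f t)" "\<lambda>p. 0" n] z alt0 unfolding rlap_mult by simp
  have fm: "exp_integrable (\<lambda>t. (- 1) * f t)" by (rule exp_integrable_mult[OF f])
  define g where "g t = ind t *\<^sub>R (exp (- 1 * t) * f t)" for t
  have g: "integrable lborel g"
    using exp_integrableD[OF f, of 1] unfolding g_def set_integrable_def by simp
  have test: "(LBINT t. \<phi> (exp (-t)) * g t) = 0"
    if "continuous_on UNIV \<phi>" "\<And>x. 0 \<le> \<phi> x" for \<phi> :: "real \<Rightarrow> real"
  proof -
    have m: "\<phi> \<in> borel_measurable borel" by (rule borel_measurable_continuous_onI[OF that(1)])
    have c: "continuous_on {0..1} \<phi>" using that(1) continuous_on_subset by blast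
    have "0 \<le> rlap (\<lambda>t. \<phi> (exp (- t)) * f t) 1" "0 \<le> rlap (\<lambda>t. \<phi> (exp (- t)) * ((-1) * f t)) 1"
      by (rule alternating_test_function[OF f altp c that(2) m] alternating_test_function[OF fm altm c that(2) m])+
    moreover have "rlap (\<lambda>t. \<phi> (exp (- t)) * ((-1) * f t)) 1 = - rlap (\<lambda>t. \<phi> (exp (- t)) * f t) 1"
      using rlap_mult[of "-1" "\<lambda>t. \<phi> (exp (- t)) * f t" 1] by simp
    ultimately have "rlap (\<lambda>t. \<phi> (exp (- t)) * f t) 1 = 0" by simp
    moreover have "rlap (\<lambda>t. \<phi> (exp (- t)) * f t) 1 = (LBINT t. \<phi> (exp (-t)) * g t)"
      unfolding rlap_def set_lebesgue_integral_def g_def by (rule Bochner_Integration.integral_cong) auto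
    ultimately show ?thesis by simp
  qed
  have atM: "(LBINT t. indicator {..x} t * g t) = 0" for x
  proof -
    \<comment> \<open>A ramp of slope n that rises from 0 to 1 just above u = exp (- x). In t it
      converges to the indicator of t < x; the point t = x is a null set.\<close>
    define \<phi> where "\<phi> n u = min 1 (max 0 (real n * (u - exp (- x))))" for n :: nat and u :: real
    have "(\<lambda>n. \<integral>t. \<phi> n (exp (-t)) * g t \<partial>lborel) \<longlonglongrightarrow> (LBINT t. indicator {..x} t * g t)"
    proof (rule integral_dominated_convergence[where w="\<lambda>t. \<bar>g t\<bar>"])
      have [measurable]: "g \<in> borel_measurable borel" using g by auto
      show "(\<lambda>t. indicator {..x} t * g t) \<in> borel_measurable lborel"
        "(\<lambda>t. \<phi> n (exp (- t)) * g t) \<in> borel_measurable lborel" for n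
        unfolding \<phi>_def by measurable
      show "integrable lborel (\<lambda>t. \<bar>g t\<bar>)" using g by simp
      show "AE t in lborel. norm (\<phi> n (exp (- t)) * g t) \<le> \<bar>g t\<bar>" for n
        by (intro AE_I2) (auto simp: abs_mult \<phi>_def intro!: mult_left_le_one_le)
      have "(\<lambda>n. \<phi> n (exp (-t)) * g t) \<longlonglongrightarrow> indicator {..x} t * g t" if "t \<noteq> x" for t
      proof (intro tendsto_mult tendsto_const, cases "t < x")
        case True
        then have d: "exp (-t) - exp (-x) > 0" by simp
        obtain N :: nat where N: "1 / (exp (-t) - exp (-x)) < N" using reals_Archimedean2 by blast
        have "\<phi> n (exp (-t)) = 1" if "N \<le> n" for n
        proof -
          have "1 / (exp (-t) - exp (-x)) < real n" using N that by (meson of_nat_mono order_less_le_trans)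
          then have "1 < real n * (exp (-t) - exp (-x))" using d by (simp add: field_simps)
          then show ?thesis by (simp add: \<phi>_def)
        qed
        then have "\<forall>\<^sub>F n in sequentially. \<phi> n (exp (-t)) = 1" unfolding eventually_sequentially by blast
        then show "(\<lambda>n. \<phi> n (exp (-t))) \<longlonglongrightarrow> indicator {..x} t"
          using True by (simp add: tendsto_eventually)
      next
        case False
        then have "exp (-t) - exp (-x) \<le> 0" using that by simp
        then have "\<phi> n (exp (-t)) = 0" for n unfolding \<phi>_def by (simp add: mult_nonneg_nonpos)
        then show "(\<lambda>n. \<phi> n (exp (-t))) \<longlonglongrightarrow> indicator {..x} t"
          using False that by simp
      qed
      then show "AE t in lborel. (\<lambda>n. \<phi> n (exp (- t)) * g t) \<longlonglongrightarrow> indicator {..x} t * g t"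
        using AE_lborel_singleton[of x] by (auto elim: eventually_mono)
    qed
    moreover have "(LBINT t. \<phi> n (exp (-t)) * g t) = 0" for n
      by (rule test) (auto simp: \<phi>_def intro!: continuous_intros)
    ultimately show ?thesis by (simp add: LIMSEQ_const_iff)
  qed
  have all: "(LBINT t. g t) = 0" using test[of "\<lambda>x. 1"] by simp
  have si: "set_integrable lborel X g" if "X \<in> sets lborel" for X
    using that g unfolding set_integrable_def by (rule integrable_mult_indicator)
  have sets: "(LBINT t:X. g t) = 0" if "X \<in> sets lborel" for X
  proof -
    have "Int_stable (range (\<lambda>a::real. {..a}))" by (auto simp: Int_stable_def)
    moreover have "range (\<lambda>a::real. {..a}) \<subseteq> Pow UNIV" by simp
    moreover have "X \<in> sigma_sets UNIV (range (\<lambda>a::real. {..a}))"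
      using that unfolding sets_lborel by (subst (asm) borel_eq_atMost) simp
    ultimately show ?thesis
    proof (induction X rule: sigma_sets_induct_disjoint)
      case (basic X)
      then show ?case using atM unfolding set_lebesgue_integral_def by auto
    next
      case empty
      show ?case by (simp add: set_lebesgue_integral_def)
    next
      case (compl X)
      have X: "X \<in> sets lborel" using compl(1) unfolding sets_lborel by (subst borel_eq_atMost) simp
      have "(LBINT t:UNIV. g t) = (LBINT t:X. g t) + (LBINT t:UNIV - X. g t)"
        using X by (subst set_integral_Un[symmetric]) (auto intro!: si)
      then show ?case using compl(2) all by (simp add: set_lebesgue_integral_def)
    next
      case (union A)
      have A: "A i \<in> sets lborel" for i using union(2) unfolding sets_lborel by (subst borel_eq_atMost) auto
      have "(LBINT t:(\<Union>i. A i). g t) = (\<Sum>i. LBINT t:A i. g t)"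
        using A union(1)
        by (intro lebesgue_integral_countable_add si) (auto simp: disjoint_family_on_def)
      then show ?case using union(3) by simp
    qed
  qed
  have "AE t in lborel. g t = 0"
    by (rule density_unique_real[OF g]) (use sets in auto)
  then show ?thesis by eventually_elim (auto simp: g_def)
qed

lemma rlap_eq_imp_AE_eq:
  assumes "exp_integrable f" "exp_integrable g" "\<And>p. 0 < p \<Longrightarrow> rlap f p = rlap g p"
  shows "AE t in lborel. 0 < t \<longrightarrow> f t = g t"
  using rlap_zero_imp_AE_zero[OF exp_integrable_diff[OF assms(1,2)]] rlap_diff[OF assms(1,2)] assms(3) by simp

lemma AE_eq_imp_eq_continuous:
  fixes f g :: "real \<Rightarrow> real"
  assumes "AE t in lborel. 0 < t \<longrightarrow> f t = g t" "continuous_on {0<..} f" "continuous_on {0<..} g" "0 < t"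
  shows "f t = g t"
proof (rule ccontr)
  assume ne: "f t \<noteq> g t"
  let ?S = "{0<..} \<inter> (\<lambda>t. f t - g t) -` (- {0})"
  have "open ?S" by (rule continuous_open_preimage[OF continuous_on_diff[OF assms(2,3)]]) auto
  moreover have "?S \<noteq> {}" using ne assms(4) by auto
  ultimately have "\<not> negligible ?S" by (rule open_not_negligible)
  moreover have "?S \<in> null_sets lborel"
  proof -
    have "?S \<in> sets lborel" using \<open>open ?S\<close> by simp
    moreover have "AE t in lborel. t \<notin> ?S" using assms(1) by eventually_elim auto
    ultimately show ?thesis by (simp add: AE_iff_null_sets)
  qed
  ultimately show False using null_sets_completionI negligible_iff_null_sets by blast
qed

text \<open>The device behind most pointwise identities below: equality of transforms on the
  positive axis gives equality almost everywhere, and continuity gives it for every t > 0.\<close>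

lemma rlap_eq_imp_eq:
  assumes "exp_integrable f" "exp_integrable g" "\<And>p. 0 < p \<Longrightarrow> rlap f p = rlap g p"
    "continuous_on {0<..} f" "continuous_on {0<..} g" "0 < t"
  shows "f t = g t"
  by (rule AE_eq_imp_eq_continuous[OF rlap_eq_imp_AE_eq[OF assms(1-3)] assms(4-6)])

section \<open>Convolution\<close>

text \<open>Since exp (- p t) = exp (- p (t - s)) exp (- p s), the weighted convolution is a
  convolution over the whole line of weighted cut-off functions, to which Fubini's theorem applies.
  The case p = 0 expresses \<open>conv\<close> itself by cut-off functions.\<close>

lemma conv_eq_integral:
  "ind t * (exp (- p * t) * conv f g t) =
    (LBINT s. (ind (t - s) * (exp (- p * (t - s)) * f (t - s))) * (ind s * (exp (- p * s) * g s)))"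
proof (cases "0 < t")
  case True
  have e: "exp (- p * (t - s)) * exp (- p * s) = exp (- p * t)" for s
    by (simp add: exp_add[symmetric] algebra_simps)
  have "exp (- p * t) * conv f g t = (LBINT s. exp (- p * t) * (indicator {0..t} s *\<^sub>R (f (t - s) * g s)))"
    unfolding laplace_convolution_def set_lebesgue_integral_def by simp
  also have "\<dots> = (LBINT s. (ind (t - s) * (exp (- p * (t - s)) * f (t - s))) * (ind s * (exp (- p * s) * g s)))"
  \<comment> \<open>\<open>conv\<close> integrates over the closed interval, the cut-offs over the
    open one; only the two endpoints differ.\<close>
  proof (rule integral_discrete_difference[of "{0, t}"])
    fix s :: real assume "s \<notin> {0, t}"
    then show "exp (- p * t) * (indicator {0..t} s *\<^sub>R (f (t - s) * g s)) =
       (ind (t - s) * (exp (- p * (t - s)) * f (t - s))) * (ind s * (exp (- p * s) * g s))"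
      unfolding e[of s, symmetric] by (auto simp: indicator_def)
  qed auto
  finally show ?thesis using True by simp
next
  case False
  have "(LBINT s. (ind (t - s) * (exp (- p * (t - s)) * f (t - s))) * (ind s * (exp (- p * s) * g s))) = (LBINT (s::real). 0)"
    by (rule Bochner_Integration.integral_cong) (use False in \<open>auto simp: indicator_def\<close>)
  with False show ?thesis by simp
qed

lemma conv_nonpos: "t \<le> 0 \<Longrightarrow> conv f g t = 0"
proof -
  assume "t \<le> 0"
  have "(LBINT s. indicator {0..t} s *\<^sub>R (f (t - s) * g s)) = (LBINT (s::real). 0)"
    by (rule integral_discrete_difference[of "{0}"]) (use \<open>t \<le> 0\<close> in \<open>auto simp: indicator_def\<close>)
  then show ?thesis unfolding laplace_convolution_def set_lebesgue_integral_def by simp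
qed

lemma conv_transform:
  assumes f: "exp_integrable f" and g: "exp_integrable g"
  shows "exp_integrable (conv f g)"
    and "0 < q \<Longrightarrow> rlap (conv f g) q = rlap f q * rlap g q"
proof -
  have "int_pos (\<lambda>t. exp (- p * t) * conv f g t) \<and>
    rlap (conv f g) p = rlap f p * rlap g p" if p: "0 < p" for p
  proof -
    define F where "F t = ind t * (exp (- p * t) * f t)" for t
    define G where "G t = ind t * (exp (- p * t) * g t)" for t
    have F: "integrable lborel F" and G: "integrable lborel G"
      using exp_integrableD[OF f p] exp_integrableD[OF g p] unfolding F_def G_def set_integrable_def by simp_all
    have [measurable]: "F \<in> borel_measurable borel" "G \<in> borel_measurable borel" using F G by auto
    have tr: "integrable lborel (\<lambda>t. F (t - s))" for s
      using lborel_integrable_real_affine[OF F, of 1 "-s"] by simp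
    have trn: "(LBINT t. \<bar>F (t - s)\<bar>) = (LBINT t. \<bar>F t\<bar>)" and tri: "(LBINT t. F (t - s)) = (LBINT t. F t)" for s
      using lborel_integral_real_affine[of 1 "\<lambda>t. \<bar>F t\<bar>" "-s"] lborel_integral_real_affine[of 1 F "-s"] by simp_all
    have int: "integrable (lborel \<Otimes>\<^sub>M lborel) (\<lambda>(s, t). F (t - s) * G s)"
    proof (rule lborel_pair.Fubini_integrable)
      show "(\<lambda>(s, t). F (t - s) * G s) \<in> borel_measurable (lborel \<Otimes>\<^sub>M lborel)" by measurable
      have "(\<lambda>s. \<integral>t. norm (case (s, t) of (s, t) \<Rightarrow> F (t - s) * G s) \<partial>lborel) = (\<lambda>s. (LBINT t. \<bar>F t\<bar>) * \<bar>G s\<bar>)"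
        by (simp add: abs_mult trn)
      then show "integrable lborel (\<lambda>s. \<integral>t. norm (case (s, t) of (s, t) \<Rightarrow> F (t - s) * G s) \<partial>lborel)"
        using G by simp
      show "AE s in lborel. integrable lborel (\<lambda>t. case (s, t) of (s, t) \<Rightarrow> F (t - s) * G s)"
        using tr by simp
    qed
    have eq: "ind t *\<^sub>R (exp (- p * t) * conv f g t) = (LBINT s. F (t - s) * G s)" for t
      using conv_eq_integral[of t p f g] unfolding F_def G_def by simp
    have "integrable lborel (\<lambda>t. \<integral>s. F (t - s) * G s \<partial>lborel)"
      using lborel_pair.integrable_snd[of "\<lambda>s t. F (t - s) * G s"] int by simp
    moreover have "(LBINT t. (LBINT s. F (t - s) * G s)) = (LBINT s. (LBINT t. F (t - s) * G s))"
      using lborel_pair.Fubini_integral[OF int] by simp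
    moreover have "(LBINT s. (LBINT t. F (t - s) * G s)) = (LBINT t. F t) * (LBINT t. G t)"
      by (simp add: tri)
    ultimately show ?thesis
      unfolding rlap_def set_integrable_def set_lebesgue_integral_def eq
      by (simp add: F_def G_def)
  qed
  then show "exp_integrable (conv f g)"
    and "0 < q \<Longrightarrow> rlap (conv f g) q = rlap f q * rlap g q"
    unfolding exp_integrable_def by auto
qed

lemma conv_commute: "conv f g t = conv g f t"
proof -
  have "conv f g t = (LBINT s. indicator {0..t} (t + (-1) * s) *\<^sub>R (f (t - (t + (-1) * s)) * g (t + (-1) * s)))"
    unfolding laplace_convolution_def set_lebesgue_integral_def by (subst lborel_integral_real_affine[of "-1" _ t]) auto
  also have "\<dots> = conv g f t"
    unfolding laplace_convolution_def set_lebesgue_integral_def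
    by (rule Bochner_Integration.integral_cong) (auto simp: indicator_def)
  finally show ?thesis .
qed

text \<open>\<open>inverse_laplace\<close> determines a function up to null sets. Reflecting the
  null set by s -> t - s shows that a convolution with it does not depend on the choice, at every
  single t.\<close>

lemma conv_cong_AE:
  assumes f: "exp_integrable f" and f': "exp_integrable f'" and g: "exp_integrable g"
    and eq: "AE t in lborel. 0 < t \<longrightarrow> f t = f' t"
  shows "conv f g t = conv f' g t"
proof (cases "0 < t")
  case True
  let ?F = "\<lambda>t. ind t * f t" and ?F' = "\<lambda>t. ind t * f' t" and ?G = "\<lambda>t. ind t * g t"
  have m: "?F \<in> borel_measurable borel" "?F' \<in> borel_measurable borel" "?G \<in> borel_measurable borel"
    using exp_integrable_measurable f f' g by auto
  have "AE s in lborel. ?F s = ?F' s" using eq by eventually_elim auto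
  moreover have "Measurable.pred borel (\<lambda>s. ?F s = ?F' s)" using m by measurable
  ultimately have "AE s in lborel. ?F (t + (-1) * s) = ?F' (t + (-1) * s)"
    by (intro AE_borel_affine) auto
  then have ae: "AE s in lborel. ?F (t - s) * ?G s = ?F' (t - s) * ?G s" by eventually_elim simp
  have mm: "(\<lambda>s. F (t - s) * G s) \<in> borel_measurable lborel"
    if [measurable]: "F \<in> borel_measurable borel" "G \<in> borel_measurable borel" for F G :: "real \<Rightarrow> real"
    by measurable
  have "conv f g t = (LBINT s. ?F (t - s) * ?G s)"
    using conv_eq_integral[of t 0 f g] True by simp
  also have "\<dots> = (LBINT s. ?F' (t - s) * ?G s)"
    by (rule integral_cong_AE[OF mm[OF m(1,3)] mm[OF m(2,3)] ae])
  also have "\<dots> = conv f' g t"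
    using conv_eq_integral[of t 0 f' g] True by simp
  finally show ?thesis .
qed (simp add: conv_nonpos)

lemma exp_integrable_integrable_Ioo:
  assumes g: "exp_integrable g"
  shows "integrable lborel (\<lambda>s. indicator {0<..<T} s * g s)"
proof -
  have "integrable lborel (\<lambda>s. exp \<bar>T\<bar> * (ind s *\<^sub>R (exp (- 1 * s) * g s)))"
    using exp_integrableD[OF g, of 1] unfolding set_integrable_def by (intro integrable_mult_right) simp
  then show ?thesis
  proof (rule Bochner_Integration.integrable_bound)
    have "(\<lambda>s. indicator {0<..<T} s * (ind s * g s)) \<in> borel_measurable borel"
      by (intro borel_measurable_times exp_integrable_measurable[OF g]) simp
    moreover have "indicator {0<..<T} s * (ind s * g s) = indicator {0<..<T} s * g s" for s :: real
      by (auto simp: indicator_def)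
    ultimately show "(\<lambda>s. indicator {0<..<T} s * g s) \<in> borel_measurable lborel" by simp
    show "AE s in lborel. norm (indicator {0<..<T} s * g s) \<le> norm (exp \<bar>T\<bar> * (ind s *\<^sub>R (exp (- 1 * s) * g s)))"
    proof (rule AE_I2)
      fix s :: real
      have "1 * \<bar>g s\<bar> \<le> exp (\<bar>T\<bar> - s) * \<bar>g s\<bar>" if "s < T" "0 < s" using that by (intro mult_right_mono) auto
      then show "norm (indicator {0<..<T} s * g s) \<le> norm (exp \<bar>T\<bar> * (ind s *\<^sub>R (exp (- 1 * s) * g s)))"
        by (auto simp: indicator_def abs_mult exp_diff exp_minus field_simps)
    qed
  qed
qed

text \<open>Because f vanishes for t <= 0, the upper limit t can be replaced by a fixed T > t. The
  integration domain then no longer moves with t and dominated convergence applies, with g entering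
  as an integrable function on (0, T).\<close>

lemma conv_continuous:
  assumes f: "continuous_on UNIV f" "\<And>t. t \<le> 0 \<Longrightarrow> f t = 0" and g: "exp_integrable g"
  shows "continuous_on UNIV (conv f g)"
proof -
  have rep: "conv f g t = (LBINT s. f (t - s) * (indicator {0<..<T} s * g s))" if "t < T" for t T
    unfolding laplace_convolution_def set_lebesgue_integral_def
    by (rule integral_discrete_difference[of "{0}"]) (use that f(2) in \<open>auto simp: indicator_def\<close>)
  have "isCont (conv f g) t" for t
    unfolding continuous_at_sequentially comp_def
  proof safe
    fix x :: "nat \<Rightarrow> real" assume x: "x \<longlonglongrightarrow> t"
    then obtain K where K: "0 < K" "\<And>n. \<bar>x n\<bar> \<le> K"
      using convergent_imp_Bseq[of x] unfolding convergent_def Bseq_def by auto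
    have tK: "\<bar>t\<bar> \<le> K" using LIMSEQ_le_const2[OF tendsto_rabs[OF x]] K by blast
    define T where "T = K + 1"
    have "compact (f ` {-K-T..K})" by (rule compact_continuous_image[OF continuous_on_subset[OF f(1)]]) auto
    then obtain B where B: "\<forall>s\<in>{-K-T..K}. \<bar>f s\<bar> \<le> B"
      using compact_imp_bounded[of "f ` {-K-T..K}"] unfolding bounded_iff by auto
    have gi: "integrable lborel (\<lambda>s. indicator {0<..<T} s * g s)" by (rule exp_integrable_integrable_Ioo[OF g])
    have m: "(\<lambda>s. f (y - s) * G s) \<in> borel_measurable lborel" if [measurable]: "G \<in> borel_measurable borel" for y G
    proof -
      have [measurable]: "f \<in> borel_measurable borel" by (rule borel_measurable_continuous_onI[OF f(1)])
      show ?thesis by measurable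
    qed
    have gm: "(\<lambda>s. indicator {0<..<T} s * g s) \<in> borel_measurable borel" using gi by auto
    have "(\<lambda>n. \<integral>s. f (x n - s) * (indicator {0<..<T} s * g s) \<partial>lborel) \<longlonglongrightarrow> (LBINT s. f (t - s) * (indicator {0<..<T} s * g s))"
    proof (rule integral_dominated_convergence[where w="\<lambda>s. B * \<bar>indicator {0<..<T} s * g s\<bar>"])
      show "AE s in lborel. (\<lambda>n. f (x n - s) * (indicator {0<..<T} s * g s)) \<longlonglongrightarrow> f (t - s) * (indicator {0<..<T} s * g s)"
      proof (intro AE_I2 tendsto_mult tendsto_const)
        fix s :: real
        have "isCont f (t - s)" using f(1) by (simp add: continuous_on_eq_continuous_at)
        then show "(\<lambda>n. f (x n - s)) \<longlonglongrightarrow> f (t - s)"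
          by (rule isCont_tendsto_compose) (intro tendsto_intros x)
      qed
      show "AE s in lborel. norm (f (x n - s) * (indicator {0<..<T} s * g s)) \<le> B * \<bar>indicator {0<..<T} s * g s\<bar>" for n
      proof (rule AE_I2)
        fix s :: real
        show "norm (f (x n - s) * (indicator {0<..<T} s * g s)) \<le> B * \<bar>indicator {0<..<T} s * g s\<bar>"
        proof (cases "s \<in> {0<..<T}")
          case True
          then have "x n - s \<in> {-K-T..K}" using K(2)[of n] by (auto simp: abs_le_iff)
          then have "\<bar>f (x n - s)\<bar> * \<bar>g s\<bar> \<le> B * \<bar>g s\<bar>" using B by (intro mult_right_mono) auto
          then show ?thesis using True by (simp add: abs_mult)
        qed simp
      qed
    qed (use gi m[OF gm] in auto)
    moreover have "x n < T" "t < T" for n using K(2)[of n] tK by (auto simp: T_def)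
    ultimately show "(\<lambda>n. conv f g (x n)) \<longlonglongrightarrow> conv f g t"
      by (simp only: rep[of _ T])
  qed
  then show ?thesis by (simp add: continuous_on_eq_continuous_at)
qed

lemma Gamma_integral_lborel:
  assumes "0 < (a::real)"
  shows "int_pos (\<lambda>t. t powr (a - 1) * exp (- t))"
    and "(LBINT t:{0<..}. t powr (a - 1) * exp (- t)) = Gamma a"
proof -
  have hi: "((\<lambda>t. t powr (a - 1) * exp (- t)) has_integral Gamma a) {0<..}"
  proof -
    have "((\<lambda>t. t powr (a - 1) * exp (- t)) has_integral Gamma a) {0..}"
      using Gamma_integral_real[OF assms] by (simp add: exp_minus divide_inverse)
    then have "((\<lambda>t. if t \<in> {0..} then t powr (a - 1) * exp (- t) else 0) has_integral Gamma a) UNIV"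
      by (simp only: has_integral_restrict_UNIV)
    also have "(\<lambda>t. if t \<in> {0..} then t powr (a - 1) * exp (- t) else 0) = (\<lambda>t. if t \<in> {0<..} then t powr (a - 1) * exp (- t) else 0)"
      by (auto simp: fun_eq_iff)
    finally show ?thesis by (simp only: has_integral_restrict_UNIV)
  qed
  have ai: "(\<lambda>t. t powr (a - 1) * exp (- t)) absolutely_integrable_on {0<..}"
    by (rule nonnegative_absolutely_integrable_1) (use hi in auto)
  have m: "(\<lambda>t. ind t *\<^sub>R (t powr (a - 1) * exp (- t))) \<in> borel_measurable borel" by measurable
  show si: "int_pos (\<lambda>t. t powr (a - 1) * exp (- t))"
    using ai integrable_completion[of "\<lambda>t. ind t *\<^sub>R (t powr (a - 1) * exp (- t))" lborel] m
    unfolding set_integrable_def by simp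
  show "(LBINT t:{0<..}. t powr (a - 1) * exp (- t)) = Gamma a"
    using set_borel_integral_eq_integral(2)[OF si] hi by (simp add: integral_unique)
qed

lemma powr_transform:
  assumes "0 < (a::real)"
  shows "exp_integrable (\<lambda>t. t powr (a - 1))"
    and "0 < q \<Longrightarrow> rlap (\<lambda>t. t powr (a - 1)) q = Gamma a * q powr (- a)"
proof -
  let ?F = "\<lambda>t. ind t *\<^sub>R (t powr (a - 1) * exp (- t))"
  have scale: "?F (0 + p * t) = p powr (a - 1) * (ind t *\<^sub>R (exp (- p * t) * t powr (a - 1)))" if "0 < p" for p t :: real
    using that by (auto simp: indicator_def powr_mult zero_less_mult_iff)
  have i: "integrable lborel ?F" and v: "integral\<^sup>L lborel ?F = Gamma a"
    using Gamma_integral_lborel[OF assms] unfolding set_integrable_def set_lebesgue_integral_def by auto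
  have "integrable lborel (\<lambda>t. p powr (a - 1) * (ind t *\<^sub>R (exp (- p * t) * t powr (a - 1))))" if "0 < p" for p
    using lborel_integrable_real_affine[OF i, of p 0] that unfolding scale[OF that] by simp
  then have *: "integrable lborel (\<lambda>t. ind t *\<^sub>R (exp (- p * t) * t powr (a - 1)))" if "0 < p" for p
    using that integrable_mult_right[of "1 / p powr (a - 1)" lborel "\<lambda>t. p powr (a - 1) * (ind t *\<^sub>R (exp (- p * t) * t powr (a - 1)))"]
    by (simp del: integrable_mult_right)
  then show "exp_integrable (\<lambda>t. t powr (a - 1))" unfolding exp_integrable_def set_integrable_def by (intro allI impI) (rule *)
  assume q: "0 < q"
  have "Gamma a = q * (q powr (a - 1) * rlap (\<lambda>t. t powr (a - 1)) q)"
    using lborel_integral_real_affine[of q ?F 0] q v unfolding scale[OF q] rlap_def set_lebesgue_integral_def by simp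
  also have "\<dots> = q powr a * rlap (\<lambda>t. t powr (a - 1)) q"
    using q by (simp add: powr_diff)
  finally show "rlap (\<lambda>t. t powr (a - 1)) q = Gamma a * q powr (- a)"
    using q by (simp add: powr_minus field_simps)
qed

section \<open>The Bromwich integral\<close>

lemma norm_Complex_sq: "norm (Complex c y) ^ 2 = c\<^sup>2 + y\<^sup>2"
  by (simp add: cmod_def)

lemma integral_inverse_square:
  fixes d y0 :: real
  assumes "0 < d"
  shows "integrable lborel (\<lambda>y. 1 / (d\<^sup>2 + (y - y0)\<^sup>2))" "(LBINT y. 1 / (d\<^sup>2 + (y - y0)\<^sup>2)) = pi / d"
proof -
  have U: "einterval (-\<infinity>) \<infinity> = UNIV" by auto
  have i: "integrable lborel (\<lambda>x::real. inverse (1 + x\<^sup>2))"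
    using integrable_inverse_1_plus_square unfolding set_integrable_def U by simp
  have v: "(LBINT x. inverse (1 + x\<^sup>2)) = pi"
    using LBINT_inverse_1_plus_square unfolding interval_lebesgue_integral_def set_lebesgue_integral_def U by simp
  have eq: "1 / (d\<^sup>2 + (y - y0)\<^sup>2) = (1 / d\<^sup>2) * inverse (1 + (- y0 / d + (1 / d) * y)\<^sup>2)" for y
  proof -
    have "d\<^sup>2 + (y - y0)\<^sup>2 = d\<^sup>2 * (1 + (- y0 / d + (1 / d) * y)\<^sup>2)"
      using assms by (simp add: power2_eq_square field_simps)
    then show ?thesis by (simp add: divide_inverse)
  qed
  have "integrable lborel (\<lambda>x. inverse (1 + (- y0 / d + (1 / d) * x)\<^sup>2))"
    using lborel_integrable_real_affine[OF i, of "1/d" "-y0/d"] assms by simp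
  then show "integrable lborel (\<lambda>y. 1 / (d\<^sup>2 + (y - y0)\<^sup>2))" unfolding eq by (rule integrable_mult_right)
  have "pi = (1 / d) * (LBINT x. inverse (1 + (- y0 / d + (1 / d) * x)\<^sup>2))"
    using lborel_integral_real_affine[of "1/d" "\<lambda>x. inverse (1 + x\<^sup>2)" "-y0/d"] assms v by simp
  then have "pi / d = (1 / d\<^sup>2) * (LBINT x. inverse (1 + (- y0 / d + (1 / d) * x)\<^sup>2))"
    by (metis (no_types) divide_divide_eq_left times_divide_eq_left mult_1 power2_eq_square)
  then show "(LBINT y. 1 / (d\<^sup>2 + (y - y0)\<^sup>2)) = pi / d"
    by (simp only: eq integral_mult_right_zero)
qed

lemma integrable_inverse_square_norm:
  assumes "0 < c"
  shows "integrable lborel (\<lambda>y. C / (c\<^sup>2 + y\<^sup>2))" "(LBINT y. C / (c\<^sup>2 + y\<^sup>2)) = C * pi / c"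
  using integral_inverse_square[OF assms, of 0] integrable_mult_right[of C lborel "\<lambda>y. 1 / (c\<^sup>2 + y\<^sup>2)"]
    integral_mult_right_zero[of lborel C "\<lambda>y. 1 / (c\<^sup>2 + y\<^sup>2)"] by simp_all

lemma vertical_line_continuous:
  assumes "H holomorphic_on {p. b < Re p}" "b < c"
  shows "continuous_on UNIV (\<lambda>y. H (Complex c y))"
proof -
  have "continuous_on UNIV (\<lambda>y. H (of_real c + \<i> * of_real y))"
    by (rule continuous_on_compose2[OF holomorphic_on_imp_continuous_on[OF assms(1)]])
       (use assms(2) in \<open>auto intro!: continuous_intros\<close>)
  then show ?thesis by (simp add: Complex_eq)
qed

lemma vertical_line_integrable:
  fixes H :: "complex \<Rightarrow> complex"
  assumes "continuous_on UNIV (\<lambda>y. H (Complex c y))" "0 < c" "\<And>y. norm (H (Complex c y)) \<le> C / (c\<^sup>2 + y\<^sup>2)"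
  shows "integrable lborel (\<lambda>y. H (Complex c y))"
    "norm (LBINT y. H (Complex c y)) \<le> C * pi / c"
proof -
  show i: "integrable lborel (\<lambda>y. H (Complex c y))"
  proof (rule Bochner_Integration.integrable_bound[OF integrable_inverse_square_norm(1)[OF assms(2), of C]])
    show "(\<lambda>y. H (Complex c y)) \<in> borel_measurable lborel"
      using borel_measurable_continuous_onI[OF assms(1)] by simp
    show "AE y in lborel. norm (H (Complex c y)) \<le> norm (C / (c\<^sup>2 + y\<^sup>2))"
      using assms(3) by (auto intro!: AE_I2 order_trans[OF _ abs_ge_self] simp del: abs_divide)
  qed
  have "norm (LBINT y. H (Complex c y)) \<le> (LBINT y. norm (H (Complex c y)))" by simp
  also have "\<dots> \<le> (LBINT y. C / (c\<^sup>2 + y\<^sup>2))"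
    by (rule integral_mono) (use i assms(3) integrable_inverse_square_norm(1)[OF assms(2)] in auto)
  finally show "norm (LBINT y. H (Complex c y)) \<le> C * pi / c"
    using integrable_inverse_square_norm(2)[OF assms(2)] by simp
qed

lemma half_plane_convex: "convex {p. b < Re p}" "open {p. b < Re p}"
  using convex_halfspace_Re_gt[of b] open_halfspace_Re_gt[of b] by simp_all

text \<open>A primitive on the half plane replaces the rectangular contour.\<close>

lemma vertical_line_shift:
  assumes hol: "H holomorphic_on {p. b < Re p}" and c: "b < c1" "0 < c1" "c1 \<le> c2"
    and bd: "\<And>p. c1 \<le> Re p \<Longrightarrow> Re p \<le> c2 \<Longrightarrow> norm (H p) \<le> C / (norm p)\<^sup>2"
  shows "(LBINT y. H (Complex c1 y)) = (LBINT y. H (Complex c2 y))"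
proof -
  have "\<exists>P. \<forall>x. b < Re x \<longrightarrow> (P has_field_derivative H x) (at x)"
  proof (rule holomorphic_convex_primitive'[OF half_plane_convex(1) half_plane_convex(2) hol])
    fix P assume P: "\<And>x. x \<in> {p. b < Re p} \<Longrightarrow> (P has_field_derivative H x) (at x within {p. b < Re p})"
    have "(P has_field_derivative H x) (at x)" if "b < Re x" for x
      using P[of x] that at_within_open[of x "{p. b < Re p}"] half_plane_convex(2)[of b] by simp
    then show ?thesis by blast
  qed
  then obtain P where P': "\<And>x. b < Re x \<Longrightarrow> (P has_field_derivative H x) (at x)" by blast
  have lim: "(\<lambda>n. - \<i> * (P (Complex c (real n)) - P (Complex c (- real n)))) \<longlonglongrightarrow> (LBINT y. H (Complex c y))"
    if c': "c1 \<le> c" "c \<le> c2" for c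
  proof -
    have bc: "b < c" "0 < c" using c c' by auto
    have i: "integrable lborel (\<lambda>y. H (Complex c y))"
      by (rule vertical_line_integrable(1)[OF vertical_line_continuous[OF hol bc(1)] bc(2)])
         (use bd[of "Complex c _"] c' norm_Complex_sq[of c] in auto)
    have "(\<lambda>n. \<integral>y. indicator {- real n..real n} y *\<^sub>R H (Complex c y) \<partial>lborel) \<longlonglongrightarrow> (LBINT y. H (Complex c y))"
    proof (rule integral_dominated_convergence[where w="\<lambda>y. norm (H (Complex c y))"])
      have [measurable]: "(\<lambda>y. H (Complex c y)) \<in> borel_measurable borel" using i by auto
      show "(\<lambda>y. indicator {- real n..real n} y *\<^sub>R H (Complex c y)) \<in> borel_measurable lborel" for n by measurable
      show "AE y in lborel. (\<lambda>n. indicator {- real n..real n} y *\<^sub>R H (Complex c y)) \<longlonglongrightarrow> H (Complex c y)"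
      proof (rule AE_I2)
        fix y :: real
        obtain N :: nat where "\<bar>y\<bar> < N" using reals_Archimedean2 by blast
        then have "indicator {- real n..real n} y *\<^sub>R H (Complex c y) = H (Complex c y)" if "N \<le> n" for n
          using that of_nat_mono[OF that, where 'a=real] by (simp add: indicator_def abs_if split: if_splits)
        then have "\<forall>\<^sub>F n in sequentially. indicator {- real n..real n} y *\<^sub>R H (Complex c y) = H (Complex c y)"
          unfolding eventually_sequentially by blast
        then show "(\<lambda>n. indicator {- real n..real n} y *\<^sub>R H (Complex c y)) \<longlonglongrightarrow> H (Complex c y)"
          by (rule tendsto_eventually)
      qed
    qed (use i in \<open>auto simp: indicator_def\<close>)
    moreover have "(LBINT y. indicator {- real n..real n} y *\<^sub>R H (Complex c y)) = - \<i> * (P (Complex c (real n)) - P (Complex c (- real n)))" for n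
    proof -
      have "(LBINT y. indicator {- real n..real n} y *\<^sub>R H (Complex c y)) = - \<i> * P (Complex c (real n)) - (- \<i> * P (Complex c (- real n)))"
      proof (rule integral_FTC_atLeastAtMost)
        fix y :: real
        have "((\<lambda>y. P (of_real c + \<i> * of_real y)) has_vector_derivative (\<i> * H (of_real c + \<i> * of_real y))) (at y within {- real n..real n})"
        proof (rule field_vector_diff_chain_at[where f="\<lambda>y. of_real c + \<i> * of_real y" and g=P, unfolded comp_def, THEN has_vector_derivative_at_within])
          show "((\<lambda>y. of_real c + \<i> * of_real y) has_vector_derivative \<i>) (at y)"
            by (auto intro!: derivative_eq_intros simp: has_vector_derivative_def scaleR_conv_of_real mult.commute)
          show "(P has_field_derivative H (of_real c + \<i> * of_real y)) (at (of_real c + \<i> * of_real y))"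
            by (rule P') (use bc in simp)
        qed
        then have "((\<lambda>y. - \<i> * P (of_real c + \<i> * of_real y)) has_vector_derivative (- \<i> * (\<i> * H (of_real c + \<i> * of_real y)))) (at y within {- real n..real n})"
          by (intro has_vector_derivative_mult_right)
        then show "((\<lambda>y. - \<i> * P (Complex c y)) has_vector_derivative H (Complex c y)) (at y within {- real n..real n})"
          by (simp add: Complex_eq mult.assoc[symmetric])
      qed (use vertical_line_continuous[OF hol bc(1)] in \<open>auto intro: continuous_on_subset\<close>)
      then show ?thesis by (simp add: algebra_simps)
    qed
    ultimately show ?thesis by simp
  qed
  \<comment> \<open>The horizontal sides of the contour, at height n for s = 1 and - n for s = - 1.
    Their length is c2 - c1 and the integrand is at most |C| / n there, so they contribute nothing
    in the limit.\<close>
  have diff0: "(\<lambda>n. P (Complex c2 (s * real n)) - P (Complex c1 (s * real n))) \<longlonglongrightarrow> 0" if s: "\<bar>s\<bar> = 1" for s :: real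
  proof (rule Lim_null_comparison)
    show "\<forall>\<^sub>F n in sequentially. norm (P (Complex c2 (s * real n)) - P (Complex c1 (s * real n))) \<le> \<bar>C\<bar> * inverse (real n)  * (c2 - c1)"
    proof (rule eventually_sequentiallyI[of 1])
      fix n :: nat assume n: "1 \<le> n"
      let ?S = "{p. c1 \<le> Re p} \<inter> {p. Re p \<le> c2} \<inter> {p. Im p = s * real n}"
      have cv: "convex ?S"
        using convex_halfspace_Re_ge[of c1] convex_halfspace_Re_le[of c2] convex_hyperplane[of \<i> "s * real n"]
        by (intro convex_Int) (auto simp: inner_complex_def)
      have "norm (P (Complex c2 (s * real n)) - P (Complex c1 (s * real n))) \<le> \<bar>C\<bar> * inverse (real n) * norm (Complex c2 (s * real n) - Complex c1 (s * real n))"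
      proof (rule field_differentiable_bound[OF cv])
        fix z assume z: "z \<in> ?S"
        then show "(P has_field_derivative H z) (at z within ?S)"
          using c by (rule_tac has_field_derivative_at_within[OF P']) auto
        have nz: "real n \<le> norm z"
          using abs_Im_le_cmod[of z] z s by (auto simp: abs_mult)
        have "real n * 1 \<le> norm z * norm z"
          using nz n of_nat_mono[OF n, where 'a=real] by (intro mult_mono) auto
        then have "real n \<le> (norm z)\<^sup>2" by (simp add: power2_eq_square)
        have "norm (H z) \<le> C / (norm z)\<^sup>2" using bd z by auto
        also have "\<dots> \<le> \<bar>C\<bar> / (norm z)\<^sup>2" by (intro divide_right_mono) auto
        also have "\<dots> \<le> \<bar>C\<bar> / real n" using \<open>real n \<le> (norm z)\<^sup>2\<close> n by (intro divide_left_mono mult_pos_pos) (auto intro: order_less_le_trans[of 0 "real n"])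
        finally show "norm (H z) \<le> \<bar>C\<bar> * inverse (real n)" by (simp add: divide_inverse)
      qed (use c in auto)
      also have "norm (Complex c2 (s * real n) - Complex c1 (s * real n)) = c2 - c1"
        using c by (simp add: cmod_def)
      finally show "norm (P (Complex c2 (s * real n)) - P (Complex c1 (s * real n))) \<le> \<bar>C\<bar> * inverse (real n) * (c2 - c1)" .
    qed
    have "(\<lambda>n. \<bar>C\<bar> * inverse (real n) * (c2 - c1)) \<longlonglongrightarrow> \<bar>C\<bar> * 0 * (c2 - c1)"
      by (intro tendsto_intros lim_inverse_n)
    then show "(\<lambda>n. \<bar>C\<bar> * inverse (real n) * (c2 - c1)) \<longlonglongrightarrow> 0" by simp
  qed
  have "(\<lambda>n. - \<i> * (P (Complex c2 (real n)) - P (Complex c2 (- real n))) - (- \<i> * (P (Complex c1 (real n)) - P (Complex c1 (- real n)))))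
     \<longlonglongrightarrow> (LBINT y. H (Complex c2 y)) - (LBINT y. H (Complex c1 y))"
    by (intro tendsto_diff lim) (use c in auto)
  moreover have "(\<lambda>n. - \<i> * (P (Complex c2 (1 * real n)) - P (Complex c1 (1 * real n))) + \<i> * (P (Complex c2 ((-1) * real n)) - P (Complex c1 ((-1) * real n)))) \<longlonglongrightarrow> - \<i> * 0 + \<i> * 0"
    by (intro tendsto_add tendsto_mult tendsto_const diff0) auto
  ultimately show ?thesis
    by (auto simp: algebra_simps dest: LIMSEQ_unique)
qed

text \<open>Shifting the line to c + n leaves the integral unchanged, while its bound C pi / (c + n)
  tends to 0.\<close>

lemma vertical_line_zero:
  assumes hol: "H holomorphic_on {p. b < Re p}" and c: "b < c" "0 < c"
    and bd: "\<And>p. c \<le> Re p \<Longrightarrow> norm (H p) \<le> C / (norm p)\<^sup>2"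
  shows "(LBINT y. H (Complex c y)) = 0"
proof -
  have eq: "(LBINT y. H (Complex c y)) = (LBINT y. H (Complex (c + real n) y))" for n
    by (rule vertical_line_shift[OF hol c]) (use bd in auto)
  have "norm (LBINT y. H (Complex c y)) \<le> C * pi * inverse (c + real n)" for n
    unfolding eq[of n] divide_inverse[symmetric]
    by (rule vertical_line_integrable(2)[OF vertical_line_continuous[OF hol]])
       (use bd[of "Complex (c + real n) _"] c norm_Complex_sq[of "c + real n"] in auto)
  moreover have "(\<lambda>n. C * pi * inverse (c + real n)) \<longlonglongrightarrow> C * pi * 0"
    by (intro tendsto_intros tendsto_inverse_0_at_top filterlim_tendsto_add_at_top[OF tendsto_const filterlim_real_sequentially])
  ultimately have "norm (LBINT y. H (Complex c y)) \<le> C * pi * 0"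
    by (intro LIMSEQ_le_const) auto
  then show ?thesis by simp
qed

text \<open>Decay of order |p|^(-2) makes the inversion integral absolutely convergent and the
  inverse transform continuous on the whole line and 0 for t <= 0. The constant may depend on c, so
  F may be unbounded near the imaginary axis.\<close>

definition bromwich_symbol :: "(complex \<Rightarrow> complex) \<Rightarrow> bool" where
  "bromwich_symbol F \<longleftrightarrow> F holomorphic_on {p. 0 < Re p} \<and>
     (\<forall>c>0. \<exists>C. \<forall>p. c \<le> Re p \<longrightarrow> norm (F p) \<le> C / (norm p)\<^sup>2)"

text \<open>The real part makes the values real; for symbols that are real on the positive axis the
  integral is already real, by \<open>bromwich_complex\<close>. Any other line Re p = c > 0 gives
  the same value, by \<open>exp_symbol_line\<close>.\<close>

definition bromwich :: "(complex \<Rightarrow> complex) \<Rightarrow> real \<Rightarrow> real" where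
  "bromwich F t = Re (LBINT y. exp (Complex 1 y * of_real t) * F (Complex 1 y)) / (2 * pi)"

lemma bromwich_symbol_bound:
  assumes "bromwich_symbol F" "0 < c"
  obtains C where "0 < C" "\<And>p. c \<le> Re p \<Longrightarrow> norm (F p) \<le> C / (norm p)\<^sup>2"
proof -
  obtain C where C: "\<And>p. c \<le> Re p \<Longrightarrow> norm (F p) \<le> C / (norm p)\<^sup>2"
    using assms unfolding bromwich_symbol_def by blast
  have "norm (F p) \<le> (\<bar>C\<bar> + 1) / (norm p)\<^sup>2" if "c \<le> Re p" for p
    by (rule order_trans[OF C[OF that]], rule divide_right_mono) auto
  then show ?thesis using that[of "\<bar>C\<bar> + 1"] by auto
qed

context
  fixes F :: "complex \<Rightarrow> complex"
  assumes F: "bromwich_symbol F"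
begin

lemma symbol_holomorphic: "F holomorphic_on {p. 0 < Re p}"
  using F by (simp add: bromwich_symbol_def)

lemma exp_symbol_holomorphic: "(\<lambda>p. exp (p * of_real t) * F p) holomorphic_on {p. 0 < Re p}"
  by (intro holomorphic_intros symbol_holomorphic)

lemma exp_symbol_continuous: "0 < c \<Longrightarrow> continuous_on UNIV (\<lambda>y. exp (Complex c y * of_real t) * F (Complex c y))"
  using vertical_line_continuous[OF exp_symbol_holomorphic] by simp

lemma exp_symbol_integrable:
  assumes "0 < c"
  shows "integrable lborel (\<lambda>y. exp (Complex c y * of_real t) * F (Complex c y))"
proof -
  obtain C where C: "\<And>p. c \<le> Re p \<Longrightarrow> norm (F p) \<le> C / (norm p)\<^sup>2"
    using bromwich_symbol_bound[OF F assms] by blast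
  have "norm (exp (Complex c y * of_real t) * F (Complex c y)) \<le> (exp (c * t) * C) / (c\<^sup>2 + y\<^sup>2)" for y
    using mult_left_mono[OF C[of "Complex c y"], of "exp (c * t)"] by (simp add: norm_mult norm_Complex_sq)
  then show ?thesis
    using vertical_line_integrable(1)[where H="\<lambda>p. exp (p * of_real t) * F p", OF exp_symbol_continuous[OF assms] assms] by blast
qed

lemma exp_symbol_shift:
  assumes "0 < c" "c \<le> c'"
  shows "(LBINT y. exp (Complex c y * of_real t) * F (Complex c y)) = (LBINT y. exp (Complex c' y * of_real t) * F (Complex c' y))"
proof -
  obtain C where C: "0 < C" "\<And>p. c \<le> Re p \<Longrightarrow> norm (F p) \<le> C / (norm p)\<^sup>2"
    using bromwich_symbol_bound[OF F assms(1)] by blast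
  show ?thesis
  proof (rule vertical_line_shift[where H="\<lambda>p. exp (p * of_real t) * F p" and C="exp (c' * \<bar>t\<bar>) * C", OF exp_symbol_holomorphic assms(1,1,2)])
    fix p assume p: "c \<le> Re p" "Re p \<le> c'"
    have "Re p * t \<le> c' * \<bar>t\<bar>" using p assms by (intro order_trans[OF _ mult_mono[of "Re p" c' "\<bar>t\<bar>"]] mult_left_mono) auto
    then have "norm (exp (p * of_real t)) * norm (F p) \<le> exp (c' * \<bar>t\<bar>) * (C / (norm p)\<^sup>2)"
      using C(2)[OF p(1)] by (intro mult_mono) auto
    then show "norm (exp (p * of_real t) * F p) \<le> exp (c' * \<bar>t\<bar>) * C / (norm p)\<^sup>2" by (simp add: norm_mult)
  qed
qed

lemma exp_symbol_line:
  "0 < c \<Longrightarrow> (LBINT y. exp (Complex c y * of_real t) * F (Complex c y)) = (LBINT y. exp (Complex 1 y * of_real t) * F (Complex 1 y))"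
  using exp_symbol_shift[of c 1 t] exp_symbol_shift[of 1 c t] by (cases "c \<le> 1") auto

text \<open>For t <= 0 the factor exp (p t) has modulus at most 1 on Re p >= 1, so the line can be
  moved to the right to infinity. This is the source of the initial condition for the field.\<close>

lemma exp_symbol_nonpos:
  assumes "t \<le> 0"
  shows "(LBINT y. exp (Complex 1 y * of_real t) * F (Complex 1 y)) = 0"
proof -
  obtain C where C: "0 < C" "\<And>p. 1 \<le> Re p \<Longrightarrow> norm (F p) \<le> C / (norm p)\<^sup>2"
    using bromwich_symbol_bound[OF F, of 1] by auto
  show ?thesis
  proof (rule vertical_line_zero[where H="\<lambda>p. exp (p * of_real t) * F p" and C=C, OF exp_symbol_holomorphic])
    fix p assume p: "1 \<le> Re p"
    have "norm (exp (p * of_real t)) * norm (F p) \<le> 1 * (C / (norm p)\<^sup>2)"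
      using C(2)[OF p] p assms by (intro mult_mono) (auto simp: mult_nonneg_nonpos)
    then show "norm (exp (p * of_real t) * F p) \<le> C / (norm p)\<^sup>2" by (simp add: norm_mult)
  qed auto
qed

lemma exp_symbol_tendsto:
  assumes "0 < c" "x \<longlonglongrightarrow> t"
  shows "(\<lambda>n. \<integral>y. exp (Complex c y * of_real (x n)) * F (Complex c y) \<partial>lborel) \<longlonglongrightarrow> (LBINT y. exp (Complex c y * of_real t) * F (Complex c y))"
proof -
  obtain K where K: "\<And>n. \<bar>x n\<bar> \<le> K"
    using convergent_imp_Bseq[of x] assms(2) unfolding convergent_def Bseq_def by auto
  have i: "integrable lborel (\<lambda>y. exp (Complex c y * of_real K) * F (Complex c y))"
    by (rule exp_symbol_integrable[OF assms(1)])
  show ?thesis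
  proof (rule integral_dominated_convergence[where w="\<lambda>y. norm (exp (Complex c y * of_real K) * F (Complex c y))"])
    show "AE y in lborel. norm (exp (Complex c y * of_real (x n)) * F (Complex c y)) \<le> norm (exp (Complex c y * of_real K) * F (Complex c y))" for n
      using K[of n] assms(1) by (intro AE_I2) (auto simp: norm_mult intro!: mult_right_mono)
    show "AE y in lborel. (\<lambda>n. exp (Complex c y * of_real (x n)) * F (Complex c y)) \<longlonglongrightarrow> exp (Complex c y * of_real t) * F (Complex c y)"
      by (intro AE_I2 tendsto_intros assms(2))
    show "(\<lambda>y. exp (Complex c y * of_real t) * F (Complex c y)) \<in> borel_measurable lborel" for t
      using exp_symbol_integrable[OF assms(1), of t] by auto
    then show "(\<lambda>y. exp (Complex c y * of_real (x n)) * F (Complex c y)) \<in> borel_measurable lborel" for n .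
  qed (use i in auto)
qed

text \<open>Let p' be the reflection of p in the line Re q = c. The function K removes the pole at p
  by subtracting F p / (q - p), and adds F p / (q - p') so that the constant F p does not spoil the
  decay of order |q|^(-2). It is holomorphic to the right of p', so its integral over the line
  vanishes. On the line the two added fractions combine to a Poisson kernel, whose integral is pi /
  d.\<close>

lemma Cauchy_integral_line:
  assumes c: "0 < c" "c < Re p"
  shows "(LBINT y. F (Complex c y) / (p - Complex c y)) = 2 * pi * F p"
proof -
  define d where "d = Re p - c"
  have d: "0 < d" using c by (simp add: d_def)
  define p' where "p' = Complex (2 * c - Re p) (Im p)"
  define K where "K q = (if q = p then deriv F p else (F q - F p) / (q - p)) + F p / (q - p')" for q
  obtain C where C: "0 < C" "\<And>q. c \<le> Re q \<Longrightarrow> norm (F q) \<le> C / (norm q)\<^sup>2"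
    using bromwich_symbol_bound[OF F c(1)] by blast
  \<comment> \<open>The half plane Re q > b contains the line Re q = c and avoids the reflected
    point p'.\<close>
  define b where "b = max 0 (2 * c - Re p)"
  have b: "0 \<le> b" "b < c" "Re p' \<le> b" using c by (auto simp: b_def p'_def)
  have holK: "K holomorphic_on {q. b < Re q}"
    unfolding K_def
  proof (intro holomorphic_on_add holomorphic_on_divide holomorphic_on_diff holomorphic_on_const holomorphic_on_ident)
    show "(\<lambda>q. if q = p then deriv F p else (F q - F p) / (q - p)) holomorphic_on {q. b < Re q}"
      by (rule pole_lemma_open[OF holomorphic_on_subset[OF symbol_holomorphic] half_plane_convex(2)]) (use b in auto)
    show "q - p' \<noteq> 0" if "q \<in> {q. b < Re q}" for q using that b by auto
  qed
  have Keq: "K q = F q / (q - p) - F p * (p - p') / ((q - p) * (q - p'))" if "q \<noteq> p" "q \<noteq> p'" for q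
  proof -
    have "F p / (q - p) - F p / (q - p') = (F p * (q - p') - F p * (q - p)) / ((q - p) * (q - p'))"
      by (rule diff_frac_eq) (use that in auto)
    also have "F p * (q - p') - F p * (q - p) = F p * (p - p')" by (simp add: algebra_simps)
    finally have e: "F p * (p - p') / ((q - p) * (q - p')) = F p / (q - p) - F p / (q - p')" by (rule sym)
    show ?thesis unfolding e using that by (simp add: K_def diff_divide_distrib)
  qed
  \<comment> \<open>Beyond radius R, q keeps distance at least |q| / 2 from both p and p', and at
    least 1 from p.\<close>
  define R where "R = 2 * (norm p + norm p' + 1)"
  have R: "2 \<le> R" by (simp add: R_def)
  have Kout: "norm (K q) \<le> (C + 4 * norm (F p) * norm (p - p')) / (norm q)\<^sup>2" if q: "c \<le> Re q" "R \<le> norm q" for q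
  proof -
    have *: "norm q / 2 \<le> norm (q - p)" "1 \<le> norm (q - p)" "norm q / 2 \<le> norm (q - p')"
      using q(2) norm_triangle_ineq2[of q p] norm_triangle_ineq2[of q p'] norm_ge_zero[of p] norm_ge_zero[of p']
      unfolding R_def by - argo+
    have q0: "0 < norm q" using q R by linarith
    have ne: "q \<noteq> p" "q \<noteq> p'" using * q0 by auto
    have "norm (F q / (q - p)) \<le> C / (norm q)\<^sup>2"
    proof -
      have "norm (F q) / norm (q - p) \<le> norm (F q) / 1" using *(2) by (intro divide_left_mono) auto
      then show ?thesis using C(2)[OF q(1)] by (simp add: norm_divide)
    qed
    moreover have "norm (F p * (p - p') / ((q - p) * (q - p'))) \<le> (4 * norm (F p) * norm (p - p')) / (norm q)\<^sup>2"
    proof -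
      have "(norm q / 2) * (norm q / 2) \<le> norm (q - p) * norm (q - p')" using * by (intro mult_mono) auto
      then have "norm (F p) * norm (p - p') / (norm (q - p) * norm (q - p')) \<le> norm (F p) * norm (p - p') / ((norm q / 2) * (norm q / 2))"
        using q0 ne by (intro divide_left_mono) auto
      then show ?thesis by (simp add: norm_mult norm_divide power2_eq_square mult.commute mult.left_commute)
    qed
    ultimately show ?thesis
      unfolding Keq[OF ne] add_divide_distrib using norm_triangle_ineq4[of "F q / (q - p)" "F p * (p - p') / ((q - p) * (q - p'))"] by linarith
  qed
  have "compact ({q. c \<le> Re q} \<inter> cball 0 R)"
    by (intro closed_Int_compact closed_halfspace_Re_ge compact_cball)
  moreover have "continuous_on ({q. c \<le> Re q} \<inter> cball 0 R) K"
    by (rule continuous_on_subset[OF holomorphic_on_imp_continuous_on[OF holK]]) (use b in auto)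
  ultimately have "bounded (K ` ({q. c \<le> Re q} \<inter> cball 0 R))"
    by (intro compact_imp_bounded compact_continuous_image)
  then obtain B where B: "0 < B" "\<And>q. c \<le> Re q \<Longrightarrow> norm q \<le> R \<Longrightarrow> norm (K q) \<le> B"
    unfolding bounded_pos by auto
  define C' where "C' = B * R\<^sup>2 + (C + 4 * norm (F p) * norm (p - p'))"
  have Kb: "norm (K q) \<le> C' / (norm q)\<^sup>2" if q: "c \<le> Re q" for q
  proof (cases "norm q \<le> R")
    case True
    have q0: "0 < norm q" using q c complex_Re_le_cmod[of q] by linarith
    have "norm (K q) * (norm q)\<^sup>2 \<le> B * R\<^sup>2"
      using B True q by (intro mult_mono power_mono) auto
    also have "\<dots> \<le> C'" using C(1) by (simp add: C'_def)
    finally show ?thesis using q0 by (simp add: field_simps)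
  next
    case False
    have "(C + 4 * norm (F p) * norm (p - p')) / (norm q)\<^sup>2 \<le> C' / (norm q)\<^sup>2"
      using B(1) by (intro divide_right_mono) (auto simp: C'_def)
    then show ?thesis using Kout[OF q] False by auto
  qed
  have zero: "(LBINT y. K (Complex c y)) = 0"
    by (rule vertical_line_zero[OF holK b(2) c(1) Kb])
  have Kline: "K (Complex c y) = of_real (2 * d) * F p * of_real (1 / (d\<^sup>2 + (y - Im p)\<^sup>2)) - F (Complex c y) / (p - Complex c y)" for y
  proof -
    let ?q = "Complex c y"
    have ne: "?q \<noteq> p" "?q \<noteq> p'" using c by (auto simp: complex_eq_iff p'_def)
    have "(?q - p) * (?q - p') = - of_real (d\<^sup>2 + (y - Im p)\<^sup>2)"
      by (simp add: complex_eq_iff p'_def d_def power2_eq_square algebra_simps)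
    moreover have "p - p' = of_real (2 * d)" by (simp add: complex_eq_iff p'_def d_def)
    moreover have "u * v / (- of_real D) = - (v * u * of_real (1 / D))" for u v :: complex and D :: real
      by (simp add: mult.commute)
    ultimately have "F p * (p - p') / ((?q - p) * (?q - p')) = - (of_real (2 * d) * F p * of_real (1 / (d\<^sup>2 + (y - Im p)\<^sup>2)))"
      by (simp only:)
    moreover have "F ?q / (?q - p) = - (F ?q / (p - ?q))"
      by (metis minus_diff_eq minus_divide_right)
    ultimately show ?thesis unfolding Keq[OF ne] by simp
  qed
  have i1: "integrable lborel (\<lambda>y. of_real (2 * d) * F p * of_real (1 / (d\<^sup>2 + (y - Im p)\<^sup>2)))"
    using integral_inverse_square(1)[OF d, of "Im p"] by (intro integrable_mult_right integrable_of_real)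
  have iK: "integrable lborel (\<lambda>y. K (Complex c y))"
    by (rule vertical_line_integrable(1)[OF vertical_line_continuous[OF holK b(2)] c(1)])
       (use Kb[of "Complex c _"] norm_Complex_sq[of c] in auto)
  have i2: "integrable lborel (\<lambda>y. F (Complex c y) / (p - Complex c y))"
    using Bochner_Integration.integrable_diff[OF i1 iK] unfolding Kline by simp
  have "0 = (LBINT y. of_real (2 * d) * F p * of_real (1 / (d\<^sup>2 + (y - Im p)\<^sup>2))) - (LBINT y. F (Complex c y) / (p - Complex c y))"
    unfolding zero[symmetric] Kline by (rule Bochner_Integration.integral_diff[OF i1 i2])
  moreover have "(LBINT y. of_real (2 * d) * F p * of_real (1 / (d\<^sup>2 + (y - Im p)\<^sup>2))) = of_real (2 * d) * F p * of_real (pi / d)"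
    using integral_inverse_square(2)[OF d, of "Im p"] by (simp only: integral_mult_right_zero integral_complex_of_real)
  ultimately show ?thesis using d by simp
qed

lemma exp_Laplace_integral:
  assumes "0 < Re q"
  shows "integrable lborel (\<lambda>t. ind t *\<^sub>R exp (- q * of_real t))"
    "(LBINT t. ind t *\<^sub>R exp (- q * of_real t)) = 1 / q"
proof -
  have q0: "q \<noteq> 0" using assms by auto
  have E: "einterval 0 \<infinity> = {0<..}" by (auto simp: einterval_def zero_ereal_def)
  show i: "integrable lborel (\<lambda>t. ind t *\<^sub>R exp (- q * of_real t))"
  proof (rule Bochner_Integration.integrable_bound[OF integrable_I0i_exp_mscale[OF assms, unfolded set_integrable_def]])
    show "AE t in lborel. norm (ind t *\<^sub>R exp (- q * of_real t)) \<le> norm (indicat_real {0<..} t *\<^sub>R exp (- (t * Re q)))"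
      by (intro AE_I2) (auto simp: indicator_def mult.commute)
  qed measurable
  have lim: "((\<lambda>t. - exp (- q * of_real t) / q) \<longlongrightarrow> 0) at_top"
  proof (rule tendsto_norm_zero_cancel)
    have "((\<lambda>t. exp (- (Re q * t))) \<longlongrightarrow> 0) at_top"
      using assms by (intro exp_at_bot[THEN filterlim_compose])
        (auto simp: filterlim_uminus_at_bot intro!: filterlim_tendsto_pos_mult_at_top[OF tendsto_const] filterlim_ident)
    then have "((\<lambda>t. exp (- (Re q * t)) / norm q) \<longlongrightarrow> 0 / norm q) at_top" using q0 by (intro tendsto_divide tendsto_const) auto
    then show "((\<lambda>t. norm (- exp (- q * of_real t) / q)) \<longlongrightarrow> 0) at_top" by (simp add: norm_divide)
  qed
  have "(LBINT t=0..\<infinity>. exp (- q * of_real t)) = 0 - (- 1 / q)"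
  proof (rule interval_integral_FTC_integrable[where F="\<lambda>t. - exp (- q * of_real t) / q"])
    fix t :: real
    show "((\<lambda>t. - exp (- q * of_real t) / q) has_vector_derivative exp (- q * of_real t)) (at t)"
      using q0 by (auto intro!: derivative_eq_intros has_vector_derivative_real_field simp: field_simps)
    show "isCont (\<lambda>t. exp (- q * of_real t)) t" by (intro continuous_intros)
  next
    show "set_integrable lborel (einterval 0 \<infinity>) (\<lambda>t. exp (- q * of_real t))" using i unfolding E set_integrable_def .
    show "(((\<lambda>t. - exp (- q * of_real t) / q) \<circ> real_of_ereal) \<longlongrightarrow> - 1 / q) (at_right 0)"
      unfolding zero_ereal_def ereal_tendsto_simps by (auto intro!: tendsto_eq_intros simp: q0)
    show "(((\<lambda>t. - exp (- q * of_real t) / q) \<circ> real_of_ereal) \<longlongrightarrow> 0) (at_left \<infinity>)"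
      unfolding ereal_tendsto_simps by (rule lim)
  qed auto
  then show "(LBINT t. ind t *\<^sub>R exp (- q * of_real t)) = 1 / q"
    by (simp add: interval_lebesgue_integral_0_infty set_lebesgue_integral_def)
qed

text \<open>The line is moved to Re q = Re p / 2, where exp (- (p - q) t) is integrable over t > 0.
  Fubini's theorem then reduces the transform to the integral of F q / (p - q), which Cauchy's
  formula evaluates.\<close>

lemma exp_symbol_laplace:
  assumes p: "0 < Re p"
  shows "(LBINT t. ind t *\<^sub>R (exp (- p * of_real t) * (LBINT y. exp (Complex 1 y * of_real t) * F (Complex 1 y)))) = 2 * pi * F p"
proof -
  define c where "c = Re p / 2"
  have c: "0 < c" "c < Re p" using p by (auto simp: c_def)
  have ee: "exp (- p * of_real t) * (exp (q * of_real t) * X) = exp (- (p - q) * of_real t) * X" for q X :: complex and t :: real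
  proof -
    have "exp (- p * of_real t) * exp (q * of_real t) = exp (- (p - q) * of_real t)"
      by (simp add: exp_add[symmetric] algebra_simps)
    then show ?thesis by (simp only: mult.assoc[symmetric])
  qed
  let ?g = "\<lambda>t y. ind t *\<^sub>R (exp (- (p - Complex c y) * of_real t) * F (Complex c y))"
  have iF: "integrable lborel (\<lambda>y. F (Complex c y))" using exp_symbol_integrable[OF c(1), of 0] by simp
  have gn: "norm (?g t y) = ind t * exp (- (t * (Re p - c))) * norm (F (Complex c y))" for t y
    by (simp add: norm_mult algebra_simps)
  have int: "integrable (lborel \<Otimes>\<^sub>M lborel) (\<lambda>(t, y). ?g t y)"
  proof (rule lborel_pair.Fubini_integrable)
    have "(\<lambda>y. F (Complex c y)) \<in> borel_measurable borel" using iF by auto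
    then have [measurable]: "(\<lambda>y. F (of_real c + \<i> * of_real y)) \<in> borel_measurable borel" by (simp only: Complex_eq)
    show "(\<lambda>(t, y). ?g t y) \<in> borel_measurable (lborel \<Otimes>\<^sub>M lborel)" unfolding Complex_eq[of c] by measurable
    have "integrable lborel (\<lambda>t. ind t *\<^sub>R exp (- (t * (Re p - c))))"
      using integrable_I0i_exp_mscale[of "Re p - c"] c unfolding set_integrable_def by simp
    then have "integrable lborel (\<lambda>t. ind t *\<^sub>R exp (- (t * (Re p - c))) * (LBINT y. norm (F (Complex c y))))"
      by (rule integrable_mult_left)
    then show "integrable lborel (\<lambda>t. \<integral>y. norm (case (t, y) of (t, y) \<Rightarrow> ?g t y) \<partial>lborel)"
      unfolding prod.case gn by simp
    show "AE t in lborel. integrable lborel (\<lambda>y. case (t, y) of (t, y) \<Rightarrow> ?g t y)"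
    proof (rule AE_I2)
      fix t :: real
      have "integrable lborel (\<lambda>y. exp (- p * of_real t) * (exp (Complex c y * of_real t) * F (Complex c y)))"
        by (intro integrable_mult_right exp_symbol_integrable c)
      also have "(\<lambda>y. exp (- p * of_real t) * (exp (Complex c y * of_real t) * F (Complex c y))) = (\<lambda>y. exp (- (p - Complex c y) * of_real t) * F (Complex c y))"
        unfolding ee ..
      finally show "integrable lborel (\<lambda>y. case (t, y) of (t, y) \<Rightarrow> ?g t y)" by (simp add: integrable_scaleR_right)
    qed
  qed
  have "(LBINT t. ind t *\<^sub>R (exp (- p * of_real t) * (LBINT y. exp (Complex 1 y * of_real t) * F (Complex 1 y))))
     = (LBINT t. (LBINT y. ?g t y))" (is "_ = ?I")
  proof (rule Bochner_Integration.integral_cong[OF refl])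
    fix t :: real
    have "exp (- p * of_real t) * (LBINT y. exp (Complex 1 y * of_real t) * F (Complex 1 y)) = (LBINT y. exp (- p * of_real t) * (exp (Complex c y * of_real t) * F (Complex c y)))"
      unfolding exp_symbol_line[OF c(1), symmetric] by simp
    also have "\<dots> = (LBINT y. exp (- (p - Complex c y) * of_real t) * F (Complex c y))"
      unfolding ee ..
    finally show "ind t *\<^sub>R (exp (- p * of_real t) * (LBINT y. exp (Complex 1 y * of_real t) * F (Complex 1 y))) = (LBINT y. ?g t y)"
      by simp
  qed
  also have "\<dots> = (LBINT y. (LBINT t. ?g t y))"
    using lborel_pair.Fubini_integral[OF int] by simp
  also have "\<dots> = (LBINT y. F (Complex c y) / (p - Complex c y))"
  proof (rule Bochner_Integration.integral_cong[OF refl])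
    fix y
    have "(LBINT t. ?g t y) = (LBINT t. ind t *\<^sub>R exp (- (p - Complex c y) * of_real t) * F (Complex c y))"
      by simp
    also have "\<dots> = 1 / (p - Complex c y) * F (Complex c y)"
      using exp_Laplace_integral(2)[of "p - Complex c y"] c by (simp only: integral_mult_left_zero) simp
    finally show "(LBINT t. ?g t y) = F (Complex c y) / (p - Complex c y)" by simp
  qed
  also have "\<dots> = 2 * pi * F p" by (rule Cauchy_integral_line[OF c])
  finally show ?thesis .
qed

end

definition symbol_real :: "(complex \<Rightarrow> complex) \<Rightarrow> bool" where
  "symbol_real F \<longleftrightarrow> (\<forall>x>0. F (of_real x) \<in> \<real>)"

lemma rlap_zero_imp_zero:
  assumes "exp_integrable f" "\<And>p. 0 < p \<Longrightarrow> rlap f p = 0" "continuous_on {0<..} f" "0 < t"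
  shows "f t = 0"
  using AE_eq_imp_eq_continuous[of f "\<lambda>_. 0"] rlap_zero_imp_AE_zero[OF assms(1,2)] assms(3,4) by auto

lemma exp_symbol_norm_le:
  assumes F: "bromwich_symbol F" and c: "0 < c"
  shows "norm (LBINT y. exp (Complex 1 y * of_real t) * F (Complex 1 y)) \<le> exp (c * t) * (LBINT y. norm (F (Complex c y)))"
proof -
  have "norm (LBINT y. exp (Complex 1 y * of_real t) * F (Complex 1 y)) \<le> (LBINT y. norm (exp (Complex c y * of_real t) * F (Complex c y)))"
    unfolding exp_symbol_line[OF F c, symmetric] by simp
  then show ?thesis by (simp add: norm_mult)
qed

text \<open>Symmetry under conjugation is not part of \<open>symbol_real\<close>. Instead, the
  imaginary part of the integral is a continuous function of t whose transform at q > 0 is Im (2 pi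
  F q) = 0, so it vanishes by uniqueness.\<close>

lemma bromwich_complex:
  assumes F: "bromwich_symbol F" and r: "symbol_real F"
  shows "(LBINT y. exp (Complex 1 y * of_real t) * F (Complex 1 y)) = of_real (2 * pi * bromwich F t)"
proof -
  define B where "B t = (LBINT y. exp (Complex 1 y * of_real t) * F (Complex 1 y))" for t :: real
  have contB: "continuous_on UNIV B"
  proof -
    have "isCont B t" for t
      unfolding continuous_at_sequentially comp_def B_def using exp_symbol_tendsto[OF F, of 1] by auto
    then show ?thesis by (simp add: continuous_on_eq_continuous_at)
  qed
  have Bb: "\<exists>C. \<forall>t>0. norm (B t) \<le> C * exp (c * t)" if "0 < c" for c
  proof (intro exI allI impI)
    show "norm (B t) \<le> (LBINT y. norm (F (Complex c y))) * exp (c * t)" for t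
      using exp_symbol_norm_le[OF F that, of t] unfolding B_def by (simp only: mult.commute)
  qed
  have contI: "continuous_on UNIV (\<lambda>t. Im (B t))" using contB by (intro continuous_intros)
  have [measurable]: "(\<lambda>t. Im (B t)) \<in> borel_measurable borel" by (rule borel_measurable_continuous_onI[OF contI])
  have ei: "exp_integrable (\<lambda>t. Im (B t))"
  proof (rule exp_integrable_exp)
    fix c :: real assume "0 < c"
    from Bb[OF this] show "\<exists>C. \<forall>t>0. \<bar>Im (B t)\<bar> \<le> C * exp (c * t)" by (meson abs_Im_le_cmod order_trans)
  qed measurable
  have "rlap (\<lambda>t. Im (B t)) q = 0" if q: "0 < q" for q
  proof -
    have "(LBINT t. ind t *\<^sub>R (exp (- of_real q * of_real t) * B t)) = 2 * pi * F q"
      unfolding B_def using exp_symbol_laplace[OF F, of "of_real q"] that by simp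
    moreover have "integrable lborel (\<lambda>t. ind t *\<^sub>R (exp (- of_real q * of_real t) * B t))"
    proof -
      obtain C where C: "\<And>t. 0 < t \<Longrightarrow> norm (B t) \<le> C * exp (q / 2 * t)" using Bb[of "q/2"] q by auto
      have i: "integrable lborel (\<lambda>t. C * (ind t *\<^sub>R exp (- (t * (q / 2)))))"
        using integrable_I0i_exp_mscale[of "q/2"] that unfolding set_integrable_def by (intro integrable_mult_right) simp
      show ?thesis
      proof (rule Bochner_Integration.integrable_bound[OF i])
        have [measurable]: "B \<in> borel_measurable borel" by (rule borel_measurable_continuous_onI[OF contB])
        show "(\<lambda>t. ind t *\<^sub>R (exp (- of_real q * of_real t) * B t)) \<in> borel_measurable lborel" by measurable
        show "AE t in lborel. norm (ind t *\<^sub>R (exp (- of_real q * of_real t) * B t)) \<le> norm (C * (ind t *\<^sub>R exp (- (t * (q / 2)))))"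
        proof (rule AE_I2)
          fix t :: real
          show "norm (ind t *\<^sub>R (exp (- of_real q * of_real t) * B t)) \<le> norm (C * (ind t *\<^sub>R exp (- (t * (q / 2)))))"
          proof (cases "0 < t")
            case True
            have "exp (- (q * t)) * norm (B t) \<le> exp (- (q * t)) * (C * exp (q / 2 * t))" using C[OF True] by simp
            also have "\<dots> = C * exp (- (t * (q / 2)))" by (simp add: exp_add[symmetric] field_simps)
            finally show ?thesis using True by (simp add: norm_mult)
          qed simp
        qed
      qed
    qed
    ultimately have "(LBINT t. Im (ind t *\<^sub>R (exp (- of_real q * of_real t) * B t))) = Im (2 * pi * F q)"
      by (subst integral_Im) auto
    moreover have "Im (ind t *\<^sub>R (exp (- of_real q * of_real t) * B t)) = ind t *\<^sub>R (exp (- q * t) * Im (B t))" for t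
      unfolding exp_minus_mult_of_real by simp
    moreover have "Im (2 * pi * F q) = 0" using r that by (simp add: symbol_real_def complex_is_Real_iff)
    ultimately show ?thesis unfolding rlap_def set_lebesgue_integral_def by (simp only:)
  qed
  then have "Im (B t) = 0" if "0 < t" for t
    by (rule rlap_zero_imp_zero[OF ei _ continuous_on_subset[OF contI] that]) auto
  moreover have "B t = 0" if "t \<le> 0" for t using exp_symbol_nonpos[OF F that] by (simp add: B_def)
  ultimately have "Im (B t) = 0" by (cases "0 < t") auto
  then show ?thesis unfolding bromwich_def B_def[symmetric] by (simp add: complex_eq_iff)
qed

lemma bromwich_nonpos: "bromwich_symbol F \<Longrightarrow> t \<le> 0 \<Longrightarrow> bromwich F t = 0"
  unfolding bromwich_def by (subst exp_symbol_nonpos) auto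

lemma bromwich_continuous: "bromwich_symbol F \<Longrightarrow> continuous_on A (bromwich F)"
proof -
  assume F: "bromwich_symbol F"
  have "isCont (bromwich F) t" for t
    unfolding continuous_at_sequentially comp_def bromwich_def
    by (intro allI impI tendsto_divide tendsto_Re exp_symbol_tendsto[OF F] tendsto_const) auto
  then show ?thesis by (simp add: continuous_at_imp_continuous_on)
qed

lemma bromwich_measurable: "bromwich_symbol F \<Longrightarrow> bromwich F \<in> borel_measurable borel"
  by (intro borel_measurable_continuous_onI bromwich_continuous)

lemma bromwich_abs_le_integral:
  assumes F: "bromwich_symbol F" and c: "0 < c"
  shows "\<bar>bromwich F t\<bar> \<le> exp (c * t) * (LBINT y. norm (F (Complex c y))) / (2 * pi)"
  unfolding bromwich_def using exp_symbol_norm_le[OF assms, of t] pi_gt_zero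
  by (auto simp: intro!: divide_right_mono order_trans[OF abs_Re_le_cmod])

text \<open>The decay bound enters on the single line Re p = c. Applied for every c > 0, the lemma
  bounds an inverse transform by multiples of exp (c t) with c arbitrarily small.\<close>

lemma bromwich_abs_le:
  assumes F: "bromwich_symbol F" and c: "0 < c" and b: "\<And>p. Re p = c \<Longrightarrow> norm (F p) \<le> C / (norm p)\<^sup>2"
  shows "\<bar>bromwich F t\<bar> \<le> C / (2 * c) * exp (c * t)"
proof -
  have i: "integrable lborel (\<lambda>y. norm (F (Complex c y)))"
    using exp_symbol_integrable[OF F c, of 0] by simp
  have "(LBINT y. norm (F (Complex c y))) \<le> (LBINT y. C / (c\<^sup>2 + y\<^sup>2))"
    by (rule integral_mono[OF i integrable_inverse_square_norm(1)[OF c]]) (use b[of "Complex c _"] norm_Complex_sq[of c] in auto)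
  also have "\<dots> = C * pi / c" by (rule integrable_inverse_square_norm(2)[OF c])
  finally have "exp (c * t) * (LBINT y. norm (F (Complex c y))) / (2 * pi) \<le> exp (c * t) * (C * pi / c) / (2 * pi)"
    by (intro divide_right_mono mult_left_mono) auto
  then have "\<bar>bromwich F t\<bar> \<le> exp (c * t) * (C * pi / c) / (2 * pi)"
    by (rule order_trans[OF bromwich_abs_le_integral[OF F c]])
  also have "\<dots> = C / (2 * c) * exp (c * t)" by (simp add: mult.commute)
  finally show ?thesis .
qed

lemma bromwich_exp_bound:
  assumes F: "bromwich_symbol F" and c: "0 < c"
  shows "\<exists>C. \<forall>t. \<bar>bromwich F t\<bar> \<le> C * exp (c * t)"
  using bromwich_abs_le_integral[OF assms]
  by (intro exI[of _ "(LBINT y. norm (F (Complex c y))) / (2 * pi)"]) (auto simp: field_simps)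

lemma bromwich_exp_integrable: "bromwich_symbol F \<Longrightarrow> exp_integrable (bromwich F)"
proof (rule exp_integrable_exp)
  assume F: "bromwich_symbol F"
  have [measurable]: "bromwich F \<in> borel_measurable borel" by (rule bromwich_measurable[OF F])
  show "(\<lambda>t. ind t * bromwich F t) \<in> borel_measurable borel" by measurable
  show "\<exists>C. \<forall>t>0. \<bar>bromwich F t\<bar> \<le> C * exp (c * t)" if "0 < c" for c
    using bromwich_exp_bound[OF F that] by blast
qed

lemma laplace_bromwich:
  assumes F: "bromwich_symbol F" and r: "symbol_real F" and p: "0 < Re p"
  shows "laplace (bromwich F) p = F p"
proof -
  have "2 * pi * F p = (LBINT t. (2 * pi) * (ind t *\<^sub>R (exp (- p * of_real t) * of_real (bromwich F t))))"
    unfolding exp_symbol_laplace[OF F p, symmetric] bromwich_complex[OF F r]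
    by (rule Bochner_Integration.integral_cong) (auto simp: indicator_def)
  also have "\<dots> = 2 * pi * laplace (bromwich F) p"
    unfolding laplace_def set_lebesgue_integral_def by (rule integral_mult_right_zero)
  finally show ?thesis by simp
qed

lemma rlap_bromwich:
  assumes "bromwich_symbol F" "symbol_real F" "0 < q"
  shows "of_real (rlap (bromwich F) q) = F (of_real q)"
  using laplace_bromwich[OF assms(1,2), of "of_real q"] assms(3) by (simp add: laplace_of_real)

lemma bromwich_cong: "(\<And>p. Re p = 1 \<Longrightarrow> F p = G p) \<Longrightarrow> bromwich F = bromwich G"
  unfolding bromwich_def by (intro ext) (simp cong: Bochner_Integration.integral_cong)

lemma bromwich_add:
  "bromwich_symbol F \<Longrightarrow> bromwich_symbol G \<Longrightarrow> bromwich (\<lambda>p. F p + G p) t = bromwich F t + bromwich G t"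
  unfolding bromwich_def distrib_left
  by (subst Bochner_Integration.integral_add) (auto intro!: exp_symbol_integrable simp: add_divide_distrib)

lemma bromwich_mult: "bromwich (\<lambda>p. of_real c * F p) t = c * bromwich F t"
  unfolding bromwich_def mult.left_commute[of _ "of_real c"] by simp

lemma bromwich_symbol_mult:
  assumes F: "bromwich_symbol F" and G: "G holomorphic_on {p. 0 < Re p}"
    and b: "\<And>c. 0 < c \<Longrightarrow> \<exists>C. \<forall>p. c \<le> Re p \<longrightarrow> norm (G p) \<le> C"
  shows "bromwich_symbol (\<lambda>p. F p * G p)"
  unfolding bromwich_symbol_def
proof (intro conjI allI impI)
  show "(\<lambda>p. F p * G p) holomorphic_on {p. 0 < Re p}"
    by (intro holomorphic_on_mult G symbol_holomorphic[OF F])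
  fix c :: real assume c: "0 < c"
  obtain C where C: "0 < C" "\<And>p. c \<le> Re p \<Longrightarrow> norm (F p) \<le> C / (norm p)\<^sup>2"
    using bromwich_symbol_bound[OF F c] by blast
  obtain D where D: "\<And>p. c \<le> Re p \<Longrightarrow> norm (G p) \<le> D" using b[OF c] by blast
  have "norm (F p * G p) \<le> C * D / (norm p)\<^sup>2" if "c \<le> Re p" for p
    using mult_mono[OF C(2)[OF that] D[OF that]] C(1) by (simp add: norm_mult)
  then show "\<exists>C. \<forall>p. c \<le> Re p \<longrightarrow> norm (F p * G p) \<le> C / (norm p)\<^sup>2" by blast
qed

lemma symbol_real_mult: "symbol_real F \<Longrightarrow> symbol_real G \<Longrightarrow> symbol_real (\<lambda>p. F p * G p)"
  by (simp add: symbol_real_def)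

lemma bromwich_parameter_derivative:
  fixes F F' :: "real \<Rightarrow> complex \<Rightarrow> complex"
  assumes S: "convex S" "x \<in> S" and sym: "\<And>y. y \<in> S \<Longrightarrow> bromwich_symbol (F y)" and sym': "bromwich_symbol (F' x)"
    and der: "\<And>y p. y \<in> S \<Longrightarrow> Re p = 1 \<Longrightarrow> ((\<lambda>y. F y p) has_vector_derivative F' y p) (at y within S)"
    and bd: "\<And>y p. y \<in> S \<Longrightarrow> Re p = 1 \<Longrightarrow> norm (F' y p) \<le> C / (norm p)\<^sup>2"
  shows "((\<lambda>y. bromwich (F y) t) has_real_derivative bromwich (F' x) t) (at x within S)"
proof -
  have "((\<lambda>y. \<integral>v. exp (Complex 1 v * of_real t) * F y (Complex 1 v) \<partial>lborel) has_vector_derivative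
      (LBINT v. exp (Complex 1 v * of_real t) * F' x (Complex 1 v))) (at x within S)"
  proof (rule has_vector_derivative_integral[OF S, where g="\<lambda>v. (exp t * C) / (1\<^sup>2 + v\<^sup>2)"])
    show "integrable lborel (\<lambda>v. (exp t * C) / (1\<^sup>2 + v\<^sup>2))" by (rule integrable_inverse_square_norm) simp
    show "(\<lambda>v. exp (Complex 1 v * of_real t) * F' x (Complex 1 v)) \<in> borel_measurable lborel"
      using exp_symbol_integrable[OF sym', of 1 t] by auto
    fix y v assume y: "y \<in> S"
    show "integrable lborel (\<lambda>v. exp (Complex 1 v * of_real t) * F y (Complex 1 v))"
      by (rule exp_symbol_integrable[OF sym[OF y]]) simp
    show "((\<lambda>y. exp (Complex 1 v * of_real t) * F y (Complex 1 v)) has_vector_derivative exp (Complex 1 v * of_real t) * F' y (Complex 1 v)) (at y within S)"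
      by (intro has_vector_derivative_mult_right der y) simp
    show "norm (exp (Complex 1 v * of_real t) * F' y (Complex 1 v)) \<le> (exp t * C) / (1\<^sup>2 + v\<^sup>2)"
      using mult_left_mono[OF bd[OF y, of "Complex 1 v"], of "exp t"] by (simp add: norm_mult norm_Complex_sq)
  qed
  then have "((\<lambda>y. Re (LBINT v. exp (Complex 1 v * of_real t) * F y (Complex 1 v))) has_vector_derivative
      Re (LBINT v. exp (Complex 1 v * of_real t) * F' x (Complex 1 v))) (at x within S)"
    by (rule bounded_linear.has_vector_derivative[OF bounded_linear_Re])
  then show ?thesis
    unfolding bromwich_def by (intro DERIV_cdivide) (simp only: has_real_derivative_iff_has_vector_derivative)
qed

text \<open>Differentiation in t multiplies the symbol by p, so p F must itself decay like a symbol.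
  On the unit ball around t the exponential stays below exp (t + 1).\<close>

lemma bromwich_derivative:
  assumes F: "bromwich_symbol F" and F': "bromwich_symbol (\<lambda>p. p * F p)"
  shows "(bromwich F has_real_derivative bromwich (\<lambda>p. p * F p) t) (at t)"
proof -
  obtain C where C: "0 < C" "\<And>p. 1 \<le> Re p \<Longrightarrow> norm (p * F p) \<le> C / (norm p)\<^sup>2"
    using bromwich_symbol_bound[OF F', of 1] by auto
  let ?S = "ball t 1"
  have "((\<lambda>s. \<integral>v. exp (Complex 1 v * of_real s) * F (Complex 1 v) \<partial>lborel) has_vector_derivative
      (LBINT v. exp (Complex 1 v * of_real t) * (Complex 1 v * F (Complex 1 v)))) (at t within ?S)"
  proof (rule has_vector_derivative_integral[where g="\<lambda>v. (exp (t + 1) * C) / (1\<^sup>2 + v\<^sup>2)"])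
    show "integrable lborel (\<lambda>v. (exp (t + 1) * C) / (1\<^sup>2 + v\<^sup>2))" by (rule integrable_inverse_square_norm) simp
    show "(\<lambda>v. exp (Complex 1 v * of_real t) * (Complex 1 v * F (Complex 1 v))) \<in> borel_measurable lborel"
      using exp_symbol_integrable[OF F', of 1 t] by auto
    fix s v assume s: "s \<in> ?S"
    show "integrable lborel (\<lambda>v. exp (Complex 1 v * of_real s) * F (Complex 1 v))"
      by (rule exp_symbol_integrable[OF F]) simp
    have "((\<lambda>s. exp (Complex 1 v * of_real s)) has_vector_derivative (exp (Complex 1 v * of_real s) * Complex 1 v)) (at s within ?S)"
      by (rule has_vector_derivative_real_field) (auto intro!: derivative_eq_intros)
    from has_vector_derivative_mult_left[OF this, of "F (Complex 1 v)"]
    show "((\<lambda>s. exp (Complex 1 v * of_real s) * F (Complex 1 v)) has_vector_derivative exp (Complex 1 v * of_real s) * (Complex 1 v * F (Complex 1 v))) (at s within ?S)"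
      by (simp add: mult.assoc)
    have "s \<le> t + 1" using s by (auto simp: dist_real_def)
    then have "exp s * norm (Complex 1 v * F (Complex 1 v)) \<le> exp (t + 1) * (C / (norm (Complex 1 v))\<^sup>2)"
      using C by (intro mult_mono) auto
    then show "norm (exp (Complex 1 v * of_real s) * (Complex 1 v * F (Complex 1 v))) \<le> (exp (t + 1) * C) / (1\<^sup>2 + v\<^sup>2)"
      by (simp add: norm_mult norm_Complex_sq)
  qed auto
  then have "((\<lambda>s. Re (LBINT v. exp (Complex 1 v * of_real s) * F (Complex 1 v))) has_vector_derivative
      Re (LBINT v. exp (Complex 1 v * of_real t) * (Complex 1 v * F (Complex 1 v)))) (at t within ?S)"
    by (rule bounded_linear.has_vector_derivative[OF bounded_linear_Re])
  then have "((\<lambda>s. Re (LBINT v. exp (Complex 1 v * of_real s) * F (Complex 1 v))) has_real_derivative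
      Re (LBINT v. exp (Complex 1 v * of_real t) * (Complex 1 v * F (Complex 1 v)))) (at t)"
    by (simp only: has_real_derivative_iff_has_vector_derivative at_within_open[OF centre_in_ball[THEN iffD2, OF zero_less_one] open_ball])
  then show ?thesis
    unfolding bromwich_def by (rule DERIV_cdivide)
qed

lemma norm_laplace_le:
  assumes h: "exp_integrable h" and c: "0 < c" "c \<le> Re p"
  shows "norm (laplace h p) \<le> rlap (\<lambda>t. \<bar>h t\<bar>) c"
proof -
  have i: "int_pos (\<lambda>t. exp (- p * of_real t) * of_real (h t))"
    using h c unfolding laplace_transformable_iff[symmetric] laplace_transformable_def by auto
  have "norm (laplace h p) \<le> (LBINT t. norm (ind t *\<^sub>R (exp (- p * of_real t) * complex_of_real (h t))))"
    unfolding laplace_def set_lebesgue_integral_def by (rule integral_norm_bound)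
  also have "\<dots> \<le> (LBINT t. ind t *\<^sub>R (exp (- c * t) * \<bar>h t\<bar>))"
  proof (rule integral_mono)
    show "integrable lborel (\<lambda>t. norm (ind t *\<^sub>R (exp (- p * of_real t) * complex_of_real (h t))))"
      using i unfolding set_integrable_def by (rule integrable_norm)
    show "integrable lborel (\<lambda>t. ind t *\<^sub>R (exp (- c * t) * \<bar>h t\<bar>))"
      using exp_integrableD[OF exp_integrable_abs[OF h] c(1)] unfolding set_integrable_def .
    show "norm (ind t *\<^sub>R (exp (- p * of_real t) * complex_of_real (h t))) \<le> ind t *\<^sub>R (exp (- c * t) * \<bar>h t\<bar>)" for t
      using c by (auto simp: indicator_def norm_mult intro!: mult_right_mono)
  qed
  finally show ?thesis unfolding rlap_def set_lebesgue_integral_def .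
qed

lemma laplace_holomorphic:
  assumes h: "exp_integrable h"
  shows "laplace h holomorphic_on {p. 0 < Re p}"
proof (rule holomorphic_onI)
  fix p assume p: "p \<in> {p. 0 < Re p}"
  define c where "c = Re p / 2"
  have c: "0 < c" "c < Re p" using p by (auto simp: c_def)
  let ?f = "\<lambda>p t. ind t *\<^sub>R (exp (- p * of_real t) * complex_of_real (h t))"
  let ?f' = "\<lambda>p t. ind t *\<^sub>R (- of_real t * exp (- p * of_real t) * complex_of_real (h t))"
  have ii: "integrable lborel (?f q)" if "0 < Re q" for q
    using h that unfolding laplace_transformable_iff[symmetric] laplace_transformable_def set_integrable_def by auto
  have "((\<lambda>p. \<integral>t. ?f p t \<partial>lborel) has_field_derivative (LBINT t. ?f' p t)) (at p within {p. c < Re p})"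
  proof (rule has_field_derivative_integral[OF half_plane_convex(1), where g="\<lambda>t. (2 / c) * (ind t *\<^sub>R (exp (- (c / 2) * t) * \<bar>h t\<bar>))"])
    show "integrable lborel (\<lambda>t. (2 / c) * (ind t *\<^sub>R (exp (- (c / 2) * t) * \<bar>h t\<bar>)))"
      using exp_integrableD[OF exp_integrable_abs[OF h], of "c/2"] c unfolding set_integrable_def by (intro integrable_mult_right) auto
    have "(\<lambda>t. - of_real t * ?f p t) \<in> borel_measurable lborel"
      using ii[of p] p by (intro borel_measurable_times) auto
    then show "?f' p \<in> borel_measurable lborel" by (simp add: mult.assoc)
    fix q t assume q: "q \<in> {p. c < Re p}"
    show "integrable lborel (?f q)" using ii q c by auto
    have "((\<lambda>q. exp (- q * of_real t) * complex_of_real (h t)) has_field_derivative (- of_real t * exp (- q * of_real t) * complex_of_real (h t))) (at q within {p. c < Re p})"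
      by (auto intro!: derivative_eq_intros)
    then show "((\<lambda>q. ?f q t) has_field_derivative ?f' q t) (at q within {p. c < Re p})"
      unfolding scaleR_conv_of_real by (rule DERIV_cmult)
    show "norm (?f' q t) \<le> (2 / c) * (ind t *\<^sub>R (exp (- (c / 2) * t) * \<bar>h t\<bar>))"
    proof (cases "0 < t")
      case True
      \<comment> \<open>The factor t produced by the differentiation is absorbed by half of the
        weight exp (- c t).\<close>
      have "c / 2 * t \<le> exp (c / 2 * t)" using exp_ge_add_one_self[of "c/2*t"] by linarith
      then have "t \<le> (2 / c) * exp (c / 2 * t)" using c by (simp add: field_simps)
      then have "t * exp (- (Re q * t)) \<le> ((2 / c) * exp (c / 2 * t)) * exp (- (c * t))"
        using True q c by (intro mult_mono) auto
      also have "\<dots> = (2 / c) * exp (- (c / 2) * t)" by (simp add: mult_exp_exp algebra_simps)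
      finally have "t * exp (- (Re q * t)) * \<bar>h t\<bar> \<le> (2 / c) * exp (- (c / 2) * t) * \<bar>h t\<bar>" by (intro mult_right_mono) auto
      then show ?thesis using True by (simp add: norm_mult)
    qed simp
  qed (use c in auto)
  then have "(laplace h has_field_derivative (LBINT t. ?f' p t)) (at p)"
    unfolding laplace_def set_lebesgue_integral_def
    using c at_within_open[OF _ half_plane_convex(2), of p c] by (simp only: mem_Collect_eq)
  then show "laplace h field_differentiable at p within {p. 0 < Re p}"
    using field_differentiable_def field_differentiable_at_within by blast
qed

lemma laplace_symbol_real: "symbol_real (laplace h)"
  by (simp add: symbol_real_def laplace_of_real)

lemma bromwich_symbol_mult_laplace:
  assumes "bromwich_symbol F" "exp_integrable h"
  shows "bromwich_symbol (\<lambda>p. F p * laplace h p)"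
  using norm_laplace_le[OF assms(2)]
  by (intro bromwich_symbol_mult assms laplace_holomorphic) blast

section \<open>The symbols\<close>

text \<open>Raise x / b <= exp (x / b) to the power b. With x a multiple of a power of |p| this
  converts the exponential decay of the kernels into power decay of any prescribed order; the
  constants of the form \<open>b powr b\<close> come from here.\<close>

lemma exp_minus_le_powr:
  fixes x b :: real
  assumes "0 < b" "0 < x"
  shows "exp (- x) \<le> b powr b * x powr (- b)"
proof -
  have "x / b \<le> exp (x / b)" using exp_ge_add_one_self[of "x / b"] by linarith
  then have "(x / b) powr b \<le> exp (x / b) powr b" using assms by (intro powr_mono2) auto
  also have "\<dots> = exp x" using assms by (simp add: powr_def)
  finally have "x powr b \<le> b powr b * exp x" using assms by (simp add: powr_divide field_simps)
  then show ?thesis using assms by (simp add: exp_minus powr_minus field_simps)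
qed

definition poly_growth :: "(complex \<Rightarrow> complex) \<Rightarrow> bool" where
  "poly_growth M \<longleftrightarrow> M holomorphic_on {p. 0 < Re p} \<and>
     (\<exists>N\<ge>0. \<forall>c>0. \<exists>C\<ge>0. \<forall>p. c \<le> Re p \<longrightarrow> norm (M p) \<le> C * norm p powr N)"

lemma poly_growthI:
  assumes "M holomorphic_on {p. 0 < Re p}" "0 \<le> N"
    "\<And>c p. 0 < c \<Longrightarrow> c \<le> Re p \<Longrightarrow> norm (M p) \<le> C c * norm p powr N"
  shows "poly_growth M"
  unfolding poly_growth_def
proof (intro conjI assms(1), rule exI[of _ N], intro conjI allI impI assms(2))
  fix c :: real assume c: "0 < c"
  have "norm (M p) \<le> \<bar>C c\<bar> * norm p powr N" if "c \<le> Re p" for p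
    by (rule order_trans[OF assms(3)[OF c that]], rule mult_right_mono) auto
  then show "\<exists>C\<ge>0. \<forall>p. c \<le> Re p \<longrightarrow> norm (M p) \<le> C * norm p powr N" by (intro exI[of _ "\<bar>C c\<bar>"]) auto
qed

lemma poly_growth_mult:
  assumes "poly_growth M" "poly_growth M'"
  shows "poly_growth (\<lambda>p. M p * M' p)"
proof -
  obtain N N' where N: "0 \<le> N" "\<And>c. 0 < c \<Longrightarrow> \<exists>C\<ge>0. \<forall>p. c \<le> Re p \<longrightarrow> norm (M p) \<le> C * norm p powr N"
    and N': "0 \<le> N'" "\<And>c. 0 < c \<Longrightarrow> \<exists>C\<ge>0. \<forall>p. c \<le> Re p \<longrightarrow> norm (M' p) \<le> C * norm p powr N'"
    and hol: "M holomorphic_on {p. 0 < Re p}" "M' holomorphic_on {p. 0 < Re p}"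
    using assms unfolding poly_growth_def by blast
  show ?thesis
    unfolding poly_growth_def
  proof (intro conjI holomorphic_on_mult hol, rule exI[of _ "N + N'"], intro conjI allI impI)
    show "0 \<le> N + N'" using N N' by simp
  next
    fix c :: real assume c: "0 < c"
    obtain C C' where C: "0 \<le> C" "\<And>p. c \<le> Re p \<Longrightarrow> norm (M p) \<le> C * norm p powr N"
      and C': "0 \<le> C'" "\<And>p. c \<le> Re p \<Longrightarrow> norm (M' p) \<le> C' * norm p powr N'"
      using N(2)[OF c] N'(2)[OF c] by blast
    have "norm (M p * M' p) \<le> (C * C') * norm p powr (N + N')" if "c \<le> Re p" for p
    proof -
      have "norm (M p * M' p) \<le> (C * norm p powr N) * (C' * norm p powr N')"
        unfolding norm_mult using C C' that by (intro mult_mono) auto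
      then show ?thesis by (simp add: powr_add mult.commute mult.left_commute)
    qed
    then show "\<exists>C\<ge>0. \<forall>p. c \<le> Re p \<longrightarrow> norm (M p * M' p) \<le> C * norm p powr (N + N')"
      using C(1) C'(1) by (intro exI[of _ "C * C'"]) auto
  qed
qed

lemma poly_growth_const: "poly_growth (\<lambda>p. b)"
  by (rule poly_growthI[where N=0 and C="\<lambda>c. norm b"]) auto

lemma poly_growth_id: "poly_growth (\<lambda>p. p)"
  by (rule poly_growthI[where N=1 and C="\<lambda>c. 1"]) auto

lemma poly_growth_inverse: "poly_growth (\<lambda>p. 1 / p)"
proof (rule poly_growthI[where N=0 and C="\<lambda>c. 1 / c"])
  show "(\<lambda>p. 1 / p) holomorphic_on {p. 0 < Re p}" by (intro holomorphic_intros) auto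
  fix c :: real and p assume c: "0 < c" "c \<le> Re p"
  then have "c \<le> norm p" using complex_Re_le_cmod[of p] by linarith
  then show "norm (1 / p) \<le> 1 / c * norm p powr 0" using c by (auto simp: norm_divide field_simps)
qed auto

lemma half_plane_nonzero: "0 < c \<Longrightarrow> c \<le> Re p \<Longrightarrow> p \<noteq> 0"
  by auto

locale fractional_symbols =
  fixes \<delta> a lam \<alpha> :: real
  assumes pos: "0 < \<delta>" "\<delta> < 1" "0 < a" "0 < lam" "0 < \<alpha>"
begin

definition ss :: "complex \<Rightarrow> complex" where "ss p = p powr of_real \<delta>"
definition root :: "complex \<Rightarrow> complex" where "root p = csqrt (ss p + of_real (lam\<^sup>2 / (4 * a\<^sup>2)))"
text \<open>Of the two roots k of a^2 k^2 + lam k = s this is the one with positive real part;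
  \<open>root\<close> is a k + lam / (2 a).\<close>

definition kk :: "complex \<Rightarrow> complex" where "kk p = (root p - of_real (lam / (2 * a))) / of_real a"
definition mm :: "complex \<Rightarrow> complex" where "mm p = ss p + of_real \<alpha> * kk p"
text \<open>For Re p > 0 the argument of s is less than \<delta> pi / 2 in modulus; \<kappa> is the
  cosine of this half-angle, so that Re s >= \<kappa> |s|. It is positive because \<delta> <
  1.\<close>

definition \<kappa> :: real where "\<kappa> = cos (\<delta> * (pi / 2))"

lemma kappa: "0 < \<kappa>" "\<kappa> \<le> 1"
proof -
  have "\<delta> * (pi / 2) < 1 * (pi / 2)" using pos pi_gt_zero by (intro mult_strict_right_mono) auto
  moreover have "0 < \<delta> * (pi / 2)" using pos by simp
  ultimately show "0 < \<kappa>" unfolding \<kappa>_def by (intro cos_gt_zero) auto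
qed (simp add: \<kappa>_def)

lemma ss_polar:
  assumes "p \<noteq> 0"
  shows "ss p = of_real (norm p powr \<delta>) * cis (\<delta> * Im (Ln p))"
proof -
  have "Ln p = of_real (ln (norm p)) + \<i> * of_real (Im (Ln p))"
    using assms by (simp add: complex_eq_iff)
  then have "of_real \<delta> * Ln p = of_real (\<delta> * ln (norm p)) + \<i> * of_real (\<delta> * Im (Ln p))"
    by (metis distrib_left mult.left_commute of_real_mult)
  then have "ss p = exp (of_real (\<delta> * ln (norm p))) * exp (\<i> * of_real (\<delta> * Im (Ln p)))"
    using assms by (simp add: ss_def powr_def exp_add)
  then show ?thesis using assms by (simp add: cis_conv_exp powr_def exp_of_real del: of_real_mult)
qed

lemma norm_ss: "p \<noteq> 0 \<Longrightarrow> norm (ss p) = norm p powr \<delta>"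
  by (simp add: ss_polar norm_mult)

lemma Re_ss:
  assumes "0 < Re p"
  shows "\<kappa> * norm p powr \<delta> \<le> Re (ss p)"
proof -
  have p0: "p \<noteq> 0" using assms by auto
  have "\<bar>Im (Ln p)\<bar> < pi / 2" using assms Re_Ln_pos_lt[OF p0] by simp
  then have "\<bar>\<delta> * Im (Ln p)\<bar> \<le> \<delta> * (pi / 2)" using pos by (simp add: abs_mult)
  moreover have "\<delta> * (pi / 2) \<le> pi" using pos pi_gt_zero by (simp add: mult_le_cancel_right2 field_simps)
  ultimately have "\<kappa> \<le> cos \<bar>\<delta> * Im (Ln p)\<bar>"
    unfolding \<kappa>_def by (intro cos_monotone_0_pi_le) auto
  then have "\<kappa> \<le> cos (\<delta> * Im (Ln p))" by simp
  then show ?thesis unfolding ss_polar[OF p0] using mult_right_mono[of \<kappa> "cos (\<delta> * Im (Ln p))" "norm p powr \<delta>"] by (simp add: mult.commute)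
qed

lemma Re_ss_pos: "0 < Re p \<Longrightarrow> 0 < Re (ss p)"
proof -
  assume p: "0 < Re p"
  then have "0 < norm p powr \<delta>" by auto
  then have "0 < \<kappa> * norm p powr \<delta>" using kappa by simp
  then show ?thesis using Re_ss[OF p] by linarith
qed

lemma root_square: "root p ^ 2 = ss p + of_real (lam\<^sup>2 / (4 * a\<^sup>2))"
  by (simp add: root_def)

lemma root_kk: "root p = of_real a * kk p + of_real (lam / (2 * a))"
  using pos by (simp add: kk_def)

lemma kk_quadratic: "kk p * (of_real (a\<^sup>2) * kk p + of_real lam) = ss p"
proof -
  have "(of_real a * kk p + of_real (lam / (2 * a)))\<^sup>2 = ss p + of_real (lam\<^sup>2 / (4 * a\<^sup>2))"
    using root_square unfolding root_kk .
  moreover have "(of_real a * kk p + of_real (lam / (2 * a)))\<^sup>2 = kk p * (of_real (a\<^sup>2) * kk p + of_real lam) + of_real (lam\<^sup>2 / (4 * a\<^sup>2))"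
    using pos by (simp add: power2_eq_square field_simps)
  ultimately show ?thesis by simp
qed

text \<open>Taking real parts in root^2 = s + (lam / (2 a))^2 gives (Re root)^2 = Re s + (lam / (2
  a))^2 + (Im root)^2, hence Re root > lam / (2 a).\<close>

lemma Re_kk:
  assumes "0 < Re p"
  shows "0 < Re (kk p)"
proof -
  have "Re (root p ^ 2) = Re (ss p) + lam\<^sup>2 / (4 * a\<^sup>2)" unfolding root_square by simp
  then have "(Re (root p))\<^sup>2 = Re (ss p) + (lam / (2 * a))\<^sup>2 + (Im (root p))\<^sup>2"
    by (simp add: power2_eq_square field_simps)
  then have "(lam / (2 * a))\<^sup>2 < (Re (root p))\<^sup>2" using Re_ss_pos[OF assms] by (simp add: add_pos_nonneg)
  moreover have "0 \<le> Re (root p)" unfolding root_def by (rule Re_csqrt)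
  ultimately have "lam / (2 * a) < Re (root p)" by (rule power2_less_imp_less)
  then have "0 < a * Re (kk p)" unfolding root_kk by simp
  then show ?thesis using pos by (simp add: zero_less_mult_iff)
qed

text \<open>With k = x + i y one has Im s = y (2 a^2 x + lam) and Re s = a^2 (x^2 - y^2) + lam x <=
  x (2 a^2 x + lam). The sector condition for s therefore passes to k after cancelling the positive
  factor 2 a^2 x + lam.\<close>

lemma kk_cone:
  assumes "0 < Re p"
  shows "\<kappa> * \<bar>Im (kk p)\<bar> \<le> Re (kk p)"
proof -
  define x y where "x = Re (kk p)" and "y = Im (kk p)"
  have x: "0 < x" using Re_kk[OF assms] by (simp add: x_def)
  have D: "0 < 2 * a\<^sup>2 * x + lam" using pos x by (intro add_pos_pos mult_pos_pos) auto
  have im: "Im (ss p) = y * (2 * a\<^sup>2 * x + lam)" and re: "Re (ss p) = a\<^sup>2 * (x\<^sup>2 - y\<^sup>2) + lam * x"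
    unfolding kk_quadratic[symmetric] x_def y_def by (simp_all add: power2_eq_square algebra_simps)
  have p0: "p \<noteq> 0" using assms by auto
  have "\<kappa> * \<bar>Im (ss p)\<bar> \<le> \<kappa> * norm (ss p)" using kappa by (intro mult_left_mono abs_Im_le_cmod) auto
  also have "\<dots> \<le> Re (ss p)" using Re_ss[OF assms] norm_ss[OF p0] by simp
  finally have "\<kappa> * (\<bar>y\<bar> * (2 * a\<^sup>2 * x + lam)) \<le> a\<^sup>2 * (x\<^sup>2 - y\<^sup>2) + lam * x"
    unfolding im re using D by (simp add: abs_mult)
  also have "\<dots> \<le> x * (2 * a\<^sup>2 * x + lam)"
  proof -
    have "0 \<le> a\<^sup>2 * y\<^sup>2 + a\<^sup>2 * x\<^sup>2" by simp
    then show ?thesis by (simp add: power2_eq_square algebra_simps)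
  qed
  finally have "(\<kappa> * \<bar>y\<bar>) * (2 * a\<^sup>2 * x + lam) \<le> x * (2 * a\<^sup>2 * x + lam)" by (simp add: mult.assoc)
  then show ?thesis using D unfolding x_def[symmetric] y_def[symmetric] by (rule mult_right_le_imp_le)
qed

text \<open>The sector for k in terms of the modulus: |k| <= |Re k| + |Im k| turns \<kappa> |Im k|
  <= Re k into Re k >= \<kappa>' |k|. Being at most \<kappa>, this constant serves for s as
  well.\<close>

definition \<kappa>' :: real where "\<kappa>' = \<kappa> / (1 + \<kappa>)"

lemma kappa': "0 < \<kappa>'" "\<kappa>' \<le> \<kappa>"
  using kappa by (auto simp: \<kappa>'_def field_simps)

lemma norm_kk_le:
  assumes "0 < Re p"
  shows "\<kappa>' * norm (kk p) \<le> Re (kk p)"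
proof -
  have "\<kappa> * norm (kk p) \<le> \<kappa> * (\<bar>Re (kk p)\<bar> + \<bar>Im (kk p)\<bar>)" using kappa by (intro mult_left_mono cmod_le) auto
  also have "\<dots> \<le> \<kappa> * Re (kk p) + Re (kk p)" using kk_cone[OF assms] Re_kk[OF assms] by (simp add: distrib_left)
  finally have "\<kappa> * norm (kk p) \<le> (1 + \<kappa>) * Re (kk p)" by (simp add: algebra_simps)
  then show ?thesis using kappa by (simp add: \<kappa>'_def field_simps)
qed

lemma norm_kk_prod: "0 < Re p \<Longrightarrow> norm (kk p) * norm (of_real (a\<^sup>2) * kk p + of_real lam) = norm p powr \<delta>"
  using norm_ss[of p] unfolding kk_quadratic[symmetric] norm_mult by (cases "p = 0") simp_all

lemma norm_kk_upper:
  assumes "0 < Re p"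
  shows "norm (kk p) \<le> norm p powr \<delta> / lam"
proof -
  have "lam \<le> Re (of_real (a\<^sup>2) * kk p + of_real lam)" using Re_kk[OF assms] by simp
  also have "\<dots> \<le> norm (of_real (a\<^sup>2) * kk p + of_real lam)" by (rule complex_Re_le_cmod)
  finally have "norm (kk p) * lam \<le> norm p powr \<delta>"
    unfolding norm_kk_prod[OF assms, symmetric] by (intro mult_left_mono) auto
  then show ?thesis using pos by (simp add: field_simps)
qed

text \<open>In |k| |a^2 k + lam| = |p|^\<delta> = q^2, a value |k| < q / B would make the second
  factor at most B q and the product less than q^2. The constant lam is absorbed because q >=
  c^(\<delta> / 2). The exponent is \<delta> / 2 since k behaves like a square root of s for large
  p.\<close>

lemma Re_kk_lower:
  assumes c: "0 < c"
  shows "\<exists>c'>0. \<forall>p. c \<le> Re p \<longrightarrow> c' * norm p powr (\<delta> / 2) \<le> Re (kk p)"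
proof -
  define B where "B = a\<^sup>2 + lam / c powr (\<delta> / 2) + 1"
  have B: "1 \<le> B" "a\<^sup>2 + lam / c powr (\<delta> / 2) \<le> B" using pos c by (auto simp: B_def)
  have "\<kappa>' / B * norm p powr (\<delta> / 2) \<le> Re (kk p)" if p: "c \<le> Re p" for p
  proof -
    have p0: "0 < Re p" "c \<le> norm p" using p c complex_Re_le_cmod[of p] by auto
    define q where "q = norm p powr (\<delta> / 2)"
    have qq: "norm p powr \<delta> = q * q" unfolding q_def by (simp add: powr_add[symmetric])
    have q: "c powr (\<delta> / 2) \<le> q" "0 < q" unfolding q_def using p0 c pos by (auto intro!: powr_mono2)
    have "q / B \<le> norm (kk p)"
    proof (rule ccontr)
      assume "\<not> q / B \<le> norm (kk p)"
      then have lt: "norm (kk p) < q / B" by simp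
      have "norm (of_real (a\<^sup>2) * kk p + of_real lam) \<le> a\<^sup>2 * norm (kk p) + lam"
        by (rule order_trans[OF norm_triangle_ineq]) (use pos in \<open>simp add: norm_mult norm_power\<close>)
      also have "\<dots> \<le> a\<^sup>2 * q + lam * (q / c powr (\<delta> / 2))"
      proof (intro add_mono mult_left_mono)
        have "q / B \<le> q / 1" using B q by (intro divide_left_mono) auto
        then show "norm (kk p) \<le> q" using lt by simp
        show "lam \<le> lam * (q / c powr (\<delta> / 2))" using q pos c by (simp add: field_simps)
      qed auto
      also have "\<dots> = (a\<^sup>2 + lam / c powr (\<delta> / 2)) * q" by (simp add: distrib_right)
      also have "\<dots> \<le> B * q" using B q by (intro mult_right_mono) auto
      finally have w: "norm (of_real (a\<^sup>2) * kk p + of_real lam) \<le> B * q" .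
      have "q * q \<le> norm (kk p) * (B * q)"
        unfolding qq[symmetric] norm_kk_prod[OF p0(1), symmetric] using w by (intro mult_left_mono) auto
      also have "\<dots> < (q / B) * (B * q)" using lt B q by (intro mult_strict_right_mono) auto
      also have "\<dots> = q * q" using B by simp
      finally show False by simp
    qed
    then have "\<kappa>' * (q / B) \<le> \<kappa>' * norm (kk p)" using kappa' by (intro mult_left_mono) auto
    then show ?thesis using norm_kk_le[OF p0(1)] unfolding q_def by simp
  qed
  then show ?thesis using kappa' B by (intro exI[of _ "\<kappa>' / B"]) auto
qed

lemma ss_derivative: "0 < Re p \<Longrightarrow> (ss has_field_derivative (of_real \<delta> * ss p / p)) (at p)"
proof -
  assume p: "0 < Re p"
  then have "p \<notin> \<real>\<^sub>\<le>\<^sub>0" by (auto simp: complex_nonpos_Reals_iff)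
  from has_field_derivative_powr[OF this, of "of_real \<delta>"] show ?thesis
    unfolding ss_def[abs_def] using p by (auto simp: powr_diff)
qed

text \<open>The denominator 2 a^2 k + lam equals 2 a times \<open>root\<close> and is the derivative
  of a^2 k^2 + lam k in k. In this form the derivative will be \<open>k1 p / p\<close>.\<close>

lemma kk_derivative:
  assumes p: "0 < Re p"
  shows "(kk has_field_derivative (of_real \<delta> * ss p / (of_real (2 * a\<^sup>2) * kk p + of_real lam) / p)) (at p)"
proof -
  have re: "0 < Re (ss p + of_real (lam\<^sup>2 / (4 * a\<^sup>2)))" using Re_ss_pos[OF p] by (simp add: add_pos_nonneg)
  then have n: "ss p + of_real (lam\<^sup>2 / (4 * a\<^sup>2)) \<notin> \<real>\<^sub>\<le>\<^sub>0" by (auto simp: complex_nonpos_Reals_iff)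
  have "((\<lambda>p. ss p + of_real (lam\<^sup>2 / (4 * a\<^sup>2))) has_field_derivative (of_real \<delta> * ss p / p)) (at p)"
    using DERIV_add[OF ss_derivative[OF p] DERIV_const] by simp
  from DERIV_chain2[OF has_field_derivative_csqrt[OF n] this]
  have "(root has_field_derivative (inverse (2 * root p) * (of_real \<delta> * ss p / p))) (at p)"
    unfolding root_def[abs_def] .
  then have "(kk has_field_derivative (inverse (2 * root p) * (of_real \<delta> * ss p / p) / of_real a)) (at p)"
    unfolding kk_def[abs_def] using pos by (auto intro!: derivative_eq_intros)
  moreover have "of_real (2 * a\<^sup>2) * kk p + of_real lam = of_real (2 * a) * root p"
    unfolding root_kk using pos by (simp add: power2_eq_square field_simps)
  moreover have "inverse (2 * r) * (x / p) / of_real a = x / (of_real (2 * a) * r) / p" for r x :: complex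
    unfolding inverse_eq_divide times_divide_times_eq divide_divide_eq_left mult_1_left of_real_mult of_real_numeral
    by (simp only: mult_ac)
  ultimately show ?thesis by (simp only:)
qed

lemma ss_holomorphic: "ss holomorphic_on {p. 0 < Re p}" and kk_holomorphic: "kk holomorphic_on {p. 0 < Re p}"
  using ss_derivative kk_derivative by (auto simp: holomorphic_on_def field_differentiable_def intro: has_field_derivative_at_within)

lemma mm_holomorphic: "mm holomorphic_on {p. 0 < Re p}"
  unfolding mm_def[abs_def] by (intro holomorphic_intros ss_holomorphic kk_holomorphic)

lemma poly_growth_ss: "poly_growth ss"
  by (rule poly_growthI[where N=\<delta> and C="\<lambda>c. 1"]) (use pos ss_holomorphic in \<open>auto simp: norm_ss[OF half_plane_nonzero]\<close>)

lemma poly_growth_kk: "poly_growth kk"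
  by (rule poly_growthI[where N=\<delta> and C="\<lambda>c. 1 / lam"]) (use pos norm_kk_upper kk_holomorphic in auto)

lemma ss_of_real: "0 < x \<Longrightarrow> ss (of_real x) = of_real (x powr \<delta>)"
  by (simp add: ss_def powr_of_real)

lemma kk_of_real: "0 < x \<Longrightarrow> kk (of_real x) = of_real ((sqrt (x powr \<delta> + lam\<^sup>2 / (4 * a\<^sup>2)) - lam / (2 * a)) / a)"
proof -
  assume x: "0 < x"
  have "csqrt (of_real (x powr \<delta> + lam\<^sup>2 / (4 * a\<^sup>2))) = of_real (sqrt (x powr \<delta> + lam\<^sup>2 / (4 * a\<^sup>2)))"
    by (rule of_real_sqrt[symmetric]) simp
  then show ?thesis unfolding kk_def root_def ss_of_real[OF x] by simp
qed

lemma symbol_real_ss: "symbol_real ss" and symbol_real_kk: "symbol_real kk"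
  by (simp_all add: symbol_real_def ss_of_real kk_of_real)

lemma symbol_real_mm: "symbol_real mm"
  using symbol_real_ss symbol_real_kk by (simp add: symbol_real_def mm_def)

lemma exp_ss_bound:
  assumes "0 < N" "0 < \<tau>" "0 < Re p"
  shows "exp (- \<tau> * Re (ss p)) \<le> ((N / \<delta>) powr (N / \<delta>) * \<kappa> powr (- N / \<delta>)) * \<tau> powr (- N / \<delta>) * norm p powr (- N)"
proof -
  have p0: "p \<noteq> 0" "0 < norm p" using assms by auto
  have "exp (- \<tau> * Re (ss p)) \<le> exp (- (\<tau> * (\<kappa> * norm p powr \<delta>)))"
    using Re_ss[OF assms(3)] assms(2) by simp
  also have "\<dots> \<le> (N / \<delta>) powr (N / \<delta>) * (\<tau> * (\<kappa> * norm p powr \<delta>)) powr (- (N / \<delta>))"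
    by (rule exp_minus_le_powr) (use assms pos kappa p0 in auto)
  also have "(\<tau> * (\<kappa> * norm p powr \<delta>)) powr (- (N / \<delta>)) = \<tau> powr (- N / \<delta>) * (\<kappa> powr (- N / \<delta>) * norm p powr (- N))"
    using assms kappa pos by (simp add: powr_mult powr_powr)
  finally show ?thesis by (simp add: mult_ac)
qed

text \<open>The exponent 2 N / \<delta> is twice the one for s, because the lower bound for Re k has
  the order |p|^(\<delta> / 2). The constant K is uniform in \<zeta>.\<close>

lemma exp_kk_bound:
  assumes "0 < N" "0 < c"
  shows "\<exists>K>0. \<forall>\<zeta>>0. \<forall>p. c \<le> Re p \<longrightarrow> exp (- \<zeta> * Re (kk p)) \<le> K * \<zeta> powr (- 2 * N / \<delta>) * norm p powr (- N)"
proof -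
  obtain c' where c': "0 < c'" "\<And>p. c \<le> Re p \<Longrightarrow> c' * norm p powr (\<delta> / 2) \<le> Re (kk p)"
    using Re_kk_lower[OF assms(2)] by blast
  define b where "b = 2 * N / \<delta>"
  have b: "0 < b" "b * (\<delta> / 2) = N" using assms pos by (auto simp: b_def)
  have "exp (- \<zeta> * Re (kk p)) \<le> (b powr b * c' powr (- b)) * \<zeta> powr (- 2 * N / \<delta>) * norm p powr (- N)"
    if z: "0 < \<zeta>" and p: "c \<le> Re p" for \<zeta> p
  proof -
    have p0: "0 < norm p" using p assms by auto
    have "exp (- \<zeta> * Re (kk p)) \<le> exp (- (\<zeta> * (c' * norm p powr (\<delta> / 2))))"
      using c'(2)[OF p] z by simp
    also have "\<dots> \<le> b powr b * (\<zeta> * (c' * norm p powr (\<delta> / 2))) powr (- b)"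
      by (rule exp_minus_le_powr) (use b z c' p0 in auto)
    also have "(\<zeta> * (c' * norm p powr (\<delta> / 2))) powr (- b) = \<zeta> powr (- b) * (c' powr (- b) * norm p powr (- N))"
      using z c' b by (simp add: powr_mult powr_powr mult.commute)
    finally show ?thesis by (simp add: b_def mult_ac)
  qed
  then show ?thesis using b c' by (intro exI[of _ "b powr b * c' powr (- b)"]) auto
qed

end

section \<open>Complete monotonicity\<close>

lemma alternating_Suc: "alternating (Suc n) F \<Longrightarrow> alternating n F"
proof (induction n arbitrary: F)
  case (Suc n)
  have p: "\<forall>p>0. 0 \<le> F p" "alternating (Suc n) (\<lambda>p. F p - F (p + 1))"
    using Suc.prems alternating.simps(2)[of "Suc n" F] by blast+
  show ?case unfolding alternating.simps(2) using p(1) Suc.IH[OF p(2)] by blast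
qed simp

lemma alternating_shift: "alternating n F \<Longrightarrow> alternating n (\<lambda>p. F (p + 1))"
proof (induction n arbitrary: F)
  case (Suc n)
  show ?case using Suc.prems Suc.IH[of "\<lambda>p. F p - F (p + 1)"] by simp
qed simp

lemma alternating_add: "alternating n F \<Longrightarrow> alternating n G \<Longrightarrow> alternating n (\<lambda>p. F p + G p)"
proof (induction n arbitrary: F G)
  case (Suc n)
  have "(\<lambda>p. F p + G p - (F (p + 1) + G (p + 1))) = (\<lambda>p. (F p - F (p + 1)) + (G p - G (p + 1)))" by auto
  with Suc.prems Suc.IH[of "\<lambda>p. F p - F (p + 1)" "\<lambda>p. G p - G (p + 1)"] show ?case by simp
qed simp

lemma alternating_const: "0 \<le> c \<Longrightarrow> alternating n (\<lambda>p. c)"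
proof -
  have "alternating n (\<lambda>p. 0)" for n by (induction n) auto
  then show "0 \<le> c \<Longrightarrow> alternating n (\<lambda>p. c)" by (cases n) auto
qed

text \<open>The product rule for differences; one factor appears shifted by 1, which
  \<open>alternating_shift\<close> permits.\<close>

lemma alternating_mult: "alternating n F \<Longrightarrow> alternating n G \<Longrightarrow> alternating n (\<lambda>p. F p * G p)"
proof (induction n arbitrary: F G)
  case (Suc n)
  have eq: "(\<lambda>p. F p * G p - F (p + 1) * G (p + 1)) = (\<lambda>p. (F p - F (p + 1)) * G p + F (p + 1) * (G p - G (p + 1)))"
    by (auto simp: algebra_simps)
  have "alternating n (\<lambda>p. (F p - F (p + 1)) * G p + F (p + 1) * (G p - G (p + 1)))"
    using Suc.prems by (intro alternating_add Suc.IH alternating_shift) (auto intro: alternating_Suc)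
  with eq Suc.prems show ?case by simp
qed simp

lemma alternating_tendsto:
  assumes "\<And>i. alternating n (F i)" "\<And>p. 0 < p \<Longrightarrow> (\<lambda>i. F i p) \<longlonglongrightarrow> G p"
  shows "alternating n G"
  using assms
proof (induction n arbitrary: F G)
  case 0
  have "0 \<le> G p" if "0 < p" for p
    by (rule LIMSEQ_le_const[OF 0(2)[OF that]]) (use 0(1) that in auto)
  then show ?case by simp
next
  case (Suc n)
  have "alternating n (\<lambda>p. G p - G (p + 1))"
    by (rule Suc.IH[of "\<lambda>i p. F i p - F i (p + 1)"]) (use Suc.prems in \<open>auto intro!: tendsto_diff\<close>)
  moreover have "0 \<le> G p" if "0 < p" for p
    using Suc.prems that by (intro LIMSEQ_le_const[OF Suc.prems(2)[OF that]]) auto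
  ultimately show ?case by simp
qed

lemma alternating_power: "alternating n F \<Longrightarrow> alternating n (\<lambda>p. F p ^ k)"
proof (induction k)
  case (Suc k)
  then show ?case using alternating_mult[of n F "\<lambda>p. F p ^ k"] by simp
qed (simp add: alternating_const)

text \<open>Bernstein functions, again only up to a given order of differences.\<close>

definition bernstein :: "nat \<Rightarrow> (real \<Rightarrow> real) \<Rightarrow> bool" where
  "bernstein n g \<longleftrightarrow> (\<forall>p>0. 0 < g p) \<and> alternating n (\<lambda>p. g (p + 1) - g p)"

lemma bernstein_Suc: "bernstein (Suc n) g \<Longrightarrow> bernstein n g"
  unfolding bernstein_def using alternating_Suc by blast

text \<open>1 / g p - 1 / g (p + 1) is the difference of g times 1 / g p times 1 / g (p + 1), so the
  statement for the reciprocal feeds its own next order. One order is gained because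
  \<open>bernstein n\<close> controls n differences beyond the first.\<close>

lemma alternating_inverse: "bernstein n g \<Longrightarrow> alternating (Suc n) (\<lambda>p. 1 / g p)"
proof (induction n)
  have eq: "1 / g p - 1 / g (p + 1) = (g (p + 1) - g p) * (1 / g p * (1 / g (p + 1)))" if "bernstein n g" "0 < p" for n p
    using that by (auto simp: bernstein_def field_simps less_imp_neq[symmetric] dest!: spec[of _ p] spec[of _ "p+1"])
  have step: "alternating (Suc n) (\<lambda>p. 1 / g p)" if b: "bernstein n g" and a: "alternating n (\<lambda>p. 1 / g p)" for n
  proof -
    have "alternating n (\<lambda>p. (g (p + 1) - g p) * (1 / g p * (1 / g (p + 1))))"
      using b a by (intro alternating_mult alternating_shift[of n "\<lambda>p. 1 / g p"]) (auto simp: bernstein_def)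
    then have "alternating n (\<lambda>p. 1 / g p - 1 / g (p + 1))"
      using alternating_cong[OF eq[OF b], where n=n] by simp
    then show ?thesis using alternating_nonneg[OF a] by simp
  qed
  {
    case 0
    then show ?case by (intro step) (auto simp: bernstein_def less_imp_le)
  next
    case (Suc n)
    show ?case by (rule step[OF Suc.prems Suc.IH[OF bernstein_Suc[OF Suc.prems]]])
  }
qed

lemma bernstein_add: "bernstein n f \<Longrightarrow> bernstein n g \<Longrightarrow> bernstein n (\<lambda>p. f p + g p)"
proof -
  assume b: "bernstein n f" "bernstein n g"
  have "(\<lambda>p. f (p + 1) + g (p + 1) - (f p + g p)) = (\<lambda>p. (f (p + 1) - f p) + (g (p + 1) - g p))" by auto
  with b show ?thesis by (auto simp: bernstein_def add_pos_pos intro: alternating_add)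
qed

lemma bernstein_mult_const: "bernstein n g \<Longrightarrow> 0 < c \<Longrightarrow> bernstein n (\<lambda>p. c * g p)"
proof -
  assume b: "bernstein n g" "0 < c"
  have "(\<lambda>p. c * g (p + 1) - c * g p) = (\<lambda>p. c * (g (p + 1) - g p))" by (auto simp: algebra_simps)
  with b show ?thesis using alternating_mult[OF alternating_const[of c n], of "\<lambda>p. g (p + 1) - g p"] by (simp add: bernstein_def)
qed

lemma bernstein_add_const: "bernstein n g \<Longrightarrow> 0 \<le> c \<Longrightarrow> bernstein n (\<lambda>p. g p + c)"
  by (auto simp: bernstein_def add_pos_nonneg)

lemma bernstein_shift: "bernstein n g \<Longrightarrow> bernstein n (\<lambda>p. g (p + 1))"
  using alternating_shift[of n "\<lambda>p. g (p + 1) - g p"] by (auto simp: bernstein_def)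

text \<open>The difference of square roots is rationalized: it is the difference of g divided by the
  sum of two square roots, and that sum is a Bernstein function of the order already
  reached.\<close>

lemma bernstein_sqrt: "(\<And>n. bernstein n g) \<Longrightarrow> bernstein n (\<lambda>p. sqrt (g p))"
proof (induction n)
  assume b: "\<And>n. bernstein n g"
  have g0: "0 < g p" if "0 < p" for p using b[of 0] that by (auto simp: bernstein_def)
  have inc: "g p \<le> g (p + 1)" if "0 < p" for p using b[of 0] that by (auto simp: bernstein_def)
  {
    case 0
    then show ?case using g0 inc by (auto simp: bernstein_def)
  next
    case (Suc n)
    have s: "bernstein n (\<lambda>p. sqrt (g p) + sqrt (g (p + 1)))"
      using Suc by (intro bernstein_add bernstein_shift[of n "\<lambda>p. sqrt (g p)"]) auto
    have A: "alternating (Suc n) (\<lambda>p. (g (p + 1) - g p) * (1 / (sqrt (g p) + sqrt (g (p + 1)))))"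
      using b[of "Suc n"] by (intro alternating_mult alternating_inverse s) (auto simp: bernstein_def)
    have "sqrt (g (p + 1)) - sqrt (g p) = (g (p + 1) - g p) * (1 / (sqrt (g p) + sqrt (g (p + 1))))" if "0 < p" for p
    proof -
      have pos: "0 < g p" "0 < g (p + 1)" using g0[of p] g0[of "p + 1"] that by auto
      then have "g (p + 1) - g p = (sqrt (g (p + 1)) - sqrt (g p)) * (sqrt (g p) + sqrt (g (p + 1)))"
        by (simp add: algebra_simps)
      moreover have "sqrt (g p) + sqrt (g (p + 1)) \<noteq> 0"
        using pos by (metis add_pos_pos less_irrefl real_sqrt_gt_zero)
      ultimately show ?thesis by simp
    qed
    then have "alternating (Suc n) (\<lambda>p. sqrt (g (p + 1)) - sqrt (g p))"
      by (rule alternating_cong[THEN iffD2, OF _ A])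
    then show ?case using g0 by (auto simp: bernstein_def)
  }
qed

text \<open>Differences commute with differentiation, so the induction applies the statement to F p
  - F (p + 1), whose derivative is - (F' p - F' (p + 1)). Nonnegativity at each stage is the
  monotonicity of a function with derivative - F' <= 0.\<close>

lemma alternating_difference_of_derivative:
  assumes "\<And>p. 0 < p \<Longrightarrow> (F has_real_derivative - F' p) (at p)" "alternating n F'"
  shows "alternating n (\<lambda>p. F p - F (p + 1))"
  using assms
proof (induction n arbitrary: F F')
  have dec: "0 \<le> F p - F (p + 1)"
    if d: "\<And>p. 0 < p \<Longrightarrow> (F has_real_derivative - F' p) (at p)" and a: "alternating n F'" and p: "0 < p" for F F' n p
  proof -
    have "F (p + 1) \<le> F p"
    proof (rule DERIV_nonpos_imp_nonincreasing[of p "p + 1" F])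
      fix x assume "p \<le> x"
      then show "\<exists>y. (F has_real_derivative y) (at x) \<and> y \<le> 0"
        using d[of x] alternating_nonneg[OF a, of x] p by (intro exI[of _ "- F' x"]) auto
    qed simp
    then show ?thesis by simp
  qed
  {
    case 0
    show ?case using dec[OF 0] by simp
  next
    case (Suc n)
    have d: "((\<lambda>p. F p - F (p + 1)) has_real_derivative - (F' p - F' (p + 1))) (at p)" if "0 < p" for p
    proof -
      have "((\<lambda>p. F (p + 1)) has_real_derivative - F' (p + 1)) (at p)"
        using Suc.prems(1)[of "p + 1"] that DERIV_shift[of F "- F' (p + 1)" p 1] by (simp add: add.commute)
      from DERIV_diff[OF Suc.prems(1)[OF that] this] show ?thesis by simp
    qed
    have "alternating n (\<lambda>p. (F p - F (p + 1)) - (F (p + 1) - F (p + 1 + 1)))"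
      by (rule Suc.IH[OF d]) (use Suc.prems(2) in auto)
    then show ?case using dec[OF Suc.prems] by simp
  }
qed

text \<open>The derivative - b p^(- (b + 1)) is of the same kind, so the order is raised by
  induction with b left general.\<close>

lemma alternating_powr: "0 \<le> b \<Longrightarrow> alternating n (\<lambda>p. p powr (- b))"
proof (induction n arbitrary: b)
  case (Suc n)
  have "alternating n (\<lambda>p. p powr (- b) - (p + 1) powr (- b))"
  proof (rule alternating_difference_of_derivative[of _ "\<lambda>p. b * p powr (- (b + 1))"])
    show "((\<lambda>p. p powr - b) has_real_derivative - (b * p powr - (b + 1))) (at p)" if "0 < p" for p
      using that by (auto intro!: derivative_eq_intros)
    show "alternating n (\<lambda>p. b * p powr - (b + 1))"
      using Suc.IH[of "b + 1"] Suc.prems by (intro alternating_mult alternating_const) auto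
  qed
  then show ?case by simp
qed simp

lemma bernstein_powr:
  assumes "0 < b" "b < 1"
  shows "bernstein n (\<lambda>p. p powr b)"
proof -
  have "alternating n (\<lambda>p. - (p powr b) - (- ((p + 1) powr b)))"
  proof (rule alternating_difference_of_derivative[of _ "\<lambda>p. b * p powr (- (1 - b))"])
    show "((\<lambda>p. - (p powr b)) has_real_derivative - (b * p powr - (1 - b))) (at p)" if "0 < p" for p
      using that by (auto intro!: derivative_eq_intros)
    show "alternating n (\<lambda>p. b * p powr - (1 - b))"
      using assms by (intro alternating_mult alternating_const alternating_powr) auto
  qed
  then show ?thesis by (auto simp: bernstein_def)
qed

text \<open>exp (- g) is the limit of (1 + g / n)^(- n), a power of the reciprocal of a Bernstein
  function; powers and pointwise limits preserve the alternating signs.\<close>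

lemma alternating_exp_bernstein:
  assumes "\<And>n. bernstein n g"
  shows "alternating n (\<lambda>p. exp (- g p))"
proof (rule alternating_tendsto[where F="\<lambda>i p. (1 / (1 + g p / real (Suc i))) ^ Suc i"])
  fix i
  have "bernstein n (\<lambda>p. (1 / real (Suc i)) * g p + 1)" for n
    using assms by (intro bernstein_add_const bernstein_mult_const) auto
  from alternating_Suc[OF alternating_inverse[OF this]]
  have "alternating n (\<lambda>p. 1 / (1 + g p / real (Suc i)))" by (simp add: add.commute)
  then show "alternating n (\<lambda>p. (1 / (1 + g p / real (Suc i))) ^ Suc i)" by (rule alternating_power)
next
  fix p :: real assume "0 < p"
  have "(\<lambda>n. (1 + g p / real n) ^ n) \<longlonglongrightarrow> exp (g p)" by (rule tendsto_exp_limit_sequentially)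
  then have "(\<lambda>i. (1 + g p / real (Suc i)) ^ Suc i) \<longlonglongrightarrow> exp (g p)" by (rule LIMSEQ_Suc)
  then have "(\<lambda>i. inverse ((1 + g p / real (Suc i)) ^ Suc i)) \<longlonglongrightarrow> inverse (exp (g p))"
    by (rule tendsto_inverse) simp
  then show "(\<lambda>i. (1 / (1 + g p / real (Suc i))) ^ Suc i) \<longlonglongrightarrow> exp (- g p)"
    by (simp add: exp_minus power_inverse divide_inverse del: power_Suc)
qed

context fractional_symbols
begin

text \<open>For \<sigma> = \<tau> and \<zeta> = z + \<alpha> \<tau> the exponent is - (\<tau> m + z
  k), which belongs to the parameter \<tau> in the solution formula. With \<sigma> and \<zeta>
  independent the bounds below can be made uniform as both tend to 0.\<close>

definition EE :: "real \<Rightarrow> real \<Rightarrow> complex \<Rightarrow> complex" where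
  "EE \<sigma> \<zeta> p = exp (- (of_real \<sigma> * ss p + of_real \<zeta> * kk p))"

lemma norm_EE: "norm (EE \<sigma> \<zeta> p) = exp (- \<sigma> * Re (ss p)) * exp (- \<zeta> * Re (kk p))"
  by (simp add: EE_def exp_add[symmetric])

lemma norm_EE_le_1: "0 \<le> \<sigma> \<Longrightarrow> 0 \<le> \<zeta> \<Longrightarrow> 0 < Re p \<Longrightarrow> norm (EE \<sigma> \<zeta> p) \<le> 1"
  unfolding norm_EE using Re_ss_pos[of p] Re_kk[of p] by (intro mult_le_one) auto

lemma EE_holomorphic: "EE \<sigma> \<zeta> holomorphic_on {p. 0 < Re p}"
  unfolding EE_def[abs_def] by (intro holomorphic_intros ss_holomorphic kk_holomorphic)

text \<open>At least one of s and k occurs in the exponent, and its exponential decays faster than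
  every power of |p|. Order N + 2 compensates the growth N of the multiplier and leaves
  |p|^(-2).\<close>

lemma EE_symbol:
  assumes "0 \<le> \<sigma>" "0 \<le> \<zeta>" "0 < \<sigma> + \<zeta>" "poly_growth M"
  shows "bromwich_symbol (\<lambda>p. M p * EE \<sigma> \<zeta> p)"
proof -
  obtain N where N: "0 \<le> N" "\<And>c. 0 < c \<Longrightarrow> \<exists>C\<ge>0. \<forall>p. c \<le> Re p \<longrightarrow> norm (M p) \<le> C * norm p powr N"
    and hol: "M holomorphic_on {p. 0 < Re p}"
    using assms(4) unfolding poly_growth_def by blast
  have "\<exists>C. \<forall>p. c \<le> Re p \<longrightarrow> norm (M p * EE \<sigma> \<zeta> p) \<le> C / (norm p)\<^sup>2" if c: "0 < c" for c
  proof -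
    obtain C where C: "0 \<le> C" "\<And>p. c \<le> Re p \<Longrightarrow> norm (M p) \<le> C * norm p powr N" using N(2)[OF c] by blast
    have "\<exists>K\<ge>0. \<forall>p. c \<le> Re p \<longrightarrow> norm (EE \<sigma> \<zeta> p) \<le> K * norm p powr (- (N + 2))"
    proof (cases "0 < \<sigma>")
      case True
      let ?K = "(((N + 2) / \<delta>) powr ((N + 2) / \<delta>) * \<kappa> powr (- (N + 2) / \<delta>)) * \<sigma> powr (- (N + 2) / \<delta>)"
      have "norm (EE \<sigma> \<zeta> p) \<le> ?K * norm p powr (- (N + 2))" if "c \<le> Re p" for p
      proof -
        have "norm (EE \<sigma> \<zeta> p) \<le> exp (- \<sigma> * Re (ss p)) * 1"
          unfolding norm_EE using Re_kk[of p] that c assms(2) by (intro mult_left_mono) auto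
        then show ?thesis using exp_ss_bound[of "N + 2" \<sigma> p] N(1) True that c by simp
      qed
      then show ?thesis by (intro exI[of _ ?K]) auto
    next
      case False
      then have z: "0 < \<zeta>" using assms by auto
      obtain K where K: "0 < K" "\<And>\<zeta> p. 0 < \<zeta> \<Longrightarrow> c \<le> Re p \<Longrightarrow> exp (- \<zeta> * Re (kk p)) \<le> K * \<zeta> powr (- 2 * (N + 2) / \<delta>) * norm p powr (- (N + 2))"
        using exp_kk_bound[of "N + 2" c] N(1) c by auto
      have "norm (EE \<sigma> \<zeta> p) \<le> (K * \<zeta> powr (- 2 * (N + 2) / \<delta>)) * norm p powr (- (N + 2))" if "c \<le> Re p" for p
      proof -
        have "norm (EE \<sigma> \<zeta> p) \<le> 1 * exp (- \<zeta> * Re (kk p))"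
          unfolding norm_EE using Re_ss_pos[of p] that c assms(1) by (intro mult_right_mono) auto
        then show ?thesis using K(2)[OF z that] by simp
      qed
      then show ?thesis using K(1) by (intro exI[of _ "K * \<zeta> powr (- 2 * (N + 2) / \<delta>)"]) auto
    qed
    then obtain K where K: "0 \<le> K" "\<And>p. c \<le> Re p \<Longrightarrow> norm (EE \<sigma> \<zeta> p) \<le> K * norm p powr (- (N + 2))" by blast
    have "norm (M p * EE \<sigma> \<zeta> p) \<le> C * K / (norm p)\<^sup>2" if p: "c \<le> Re p" for p
    proof -
      have p0: "0 < norm p" using half_plane_nonzero[OF c p] by simp
      have "norm (M p * EE \<sigma> \<zeta> p) \<le> (C * norm p powr N) * (K * norm p powr (- (N + 2)))"
        unfolding norm_mult using C K p by (intro mult_mono) auto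
      also have "\<dots> = C * K * (norm p powr N * norm p powr (- (N + 2)))" by simp
      also have "norm p powr N * norm p powr (- (N + 2)) = norm p powr (- 2)" by (simp add: powr_add[symmetric])
      also have "\<dots> = 1 / (norm p)\<^sup>2" using p0 by (simp add: powr_minus powr_numeral divide_inverse)
      finally show ?thesis by simp
    qed
    then show ?thesis by blast
  qed
  then show ?thesis unfolding bromwich_symbol_def
    by (intro conjI holomorphic_on_mult hol EE_holomorphic) blast
qed

lemma EE_symbol1: "0 \<le> \<sigma> \<Longrightarrow> 0 \<le> \<zeta> \<Longrightarrow> 0 < \<sigma> + \<zeta> \<Longrightarrow> bromwich_symbol (EE \<sigma> \<zeta>)"
  using EE_symbol[OF _ _ _ poly_growth_const[of 1]] by simp

lemma EE_real: "symbol_real (EE \<sigma> \<zeta>)"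
  unfolding symbol_real_def
proof (intro allI impI)
  fix x :: real assume "0 < x"
  then have "ss (of_real x) \<in> \<real>" "kk (of_real x) \<in> \<real>"
    using symbol_real_ss symbol_real_kk by (auto simp: symbol_real_def)
  then obtain u v where "ss (of_real x) = of_real u" "kk (of_real x) = of_real v"
    by (elim Reals_cases)
  then have "EE \<sigma> \<zeta> (of_real x) = of_real (exp (- (\<sigma> * u + \<zeta> * v)))" by (simp add: EE_def exp_of_real[symmetric])
  then show "EE \<sigma> \<zeta> (of_real x) \<in> \<real>" by simp
qed

definition kr :: "real \<Rightarrow> real" where "kr x = (sqrt (x powr \<delta> + lam\<^sup>2 / (4 * a\<^sup>2)) - lam / (2 * a)) / a"

lemma kk_kr: "0 < x \<Longrightarrow> kk (of_real x) = of_real (kr x)"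
  by (simp add: kk_of_real kr_def)

lemma kr_pos: "0 < x \<Longrightarrow> 0 < kr x"
  using Re_kk[of "of_real x"] by (simp add: kk_kr)

text \<open>Subtracting the constant lam / (2 a^2) does not affect the differences of the square
  root; positivity of what remains is Re k > 0.\<close>

lemma bernstein_kr: "bernstein n kr"
proof -
  have "bernstein n (\<lambda>x. (1 / a) * sqrt (x powr \<delta> + lam\<^sup>2 / (4 * a\<^sup>2)))" for n
    using pos by (intro bernstein_mult_const bernstein_sqrt bernstein_add_const bernstein_powr) auto
  then have "alternating n (\<lambda>x. (1 / a) * sqrt ((x + 1) powr \<delta> + lam\<^sup>2 / (4 * a\<^sup>2)) - (1 / a) * sqrt (x powr \<delta> + lam\<^sup>2 / (4 * a\<^sup>2)))" for n
    by (simp add: bernstein_def)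
  moreover have "(\<lambda>x. kr (x + 1) - kr x) = (\<lambda>x. (1 / a) * sqrt ((x + 1) powr \<delta> + lam\<^sup>2 / (4 * a\<^sup>2)) - (1 / a) * sqrt (x powr \<delta> + lam\<^sup>2 / (4 * a\<^sup>2)))"
    by (auto simp: kr_def diff_divide_distrib)
  ultimately show ?thesis using kr_pos by (simp add: bernstein_def)
qed

lemma EE_nonneg:
  assumes "0 \<le> \<sigma>" "0 \<le> \<zeta>" "0 < \<sigma> + \<zeta>"
  shows "0 \<le> bromwich (EE \<sigma> \<zeta>) t"
proof (cases "0 < t")
  case True
  have sym: "bromwich_symbol (EE \<sigma> \<zeta>)" by (rule EE_symbol1[OF assms])
  \<comment> \<open>A vanishing coefficient is treated separately, because Bernstein functions are
    strictly positive here.\<close>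
  have cm: "alternating n (\<lambda>x. exp (- (c * g x)))" if "0 \<le> c" "\<And>n. bernstein n g" for c g n
  proof (cases "c = 0")
    case False
    then show ?thesis using that by (intro alternating_exp_bernstein bernstein_mult_const) auto
  qed (simp add: alternating_const)
  have A: "alternating n (\<lambda>x. exp (- (\<sigma> * x powr \<delta>)) * exp (- (\<zeta> * kr x)))" for n
    using pos assms by (intro alternating_mult cm bernstein_powr bernstein_kr)
  have "rlap (bromwich (EE \<sigma> \<zeta>)) x = exp (- (\<sigma> * x powr \<delta>)) * exp (- (\<zeta> * kr x))" if "0 < x" for x
  proof -
    have "complex_of_real (rlap (bromwich (EE \<sigma> \<zeta>)) x) = EE \<sigma> \<zeta> (of_real x)" by (rule rlap_bromwich[OF sym EE_real that])
    also have "\<dots> = of_real (exp (- (\<sigma> * x powr \<delta>) + - (\<zeta> * kr x)))"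
      unfolding exp_of_real[symmetric] EE_def by (simp add: ss_of_real kk_kr that)
    finally show ?thesis by (simp only: of_real_eq_iff exp_add)
  qed
  then have "alternating n (rlap (bromwich (EE \<sigma> \<zeta>)))" for n
    by (rule alternating_cong[THEN iffD2, OF _ A])
  then show ?thesis
    by (rule alternating_imp_nonneg[OF bromwich_exp_integrable[OF sym] _ bromwich_continuous[OF sym] True])
qed (simp add: bromwich_nonpos[OF EE_symbol1[OF assms]])

end

section \<open>Decay of the kernels away from the origin\<close>

lemma bromwich_symbol_add:
  assumes "bromwich_symbol F" "bromwich_symbol G"
  shows "bromwich_symbol (\<lambda>p. F p + G p)"
  unfolding bromwich_symbol_def
proof (intro conjI allI impI)
  show "(\<lambda>p. F p + G p) holomorphic_on {p. 0 < Re p}"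
    by (intro holomorphic_on_add symbol_holomorphic assms)
  fix c :: real assume c: "0 < c"
  obtain C D where C: "\<And>p. c \<le> Re p \<Longrightarrow> norm (F p) \<le> C / (norm p)\<^sup>2" and D: "\<And>p. c \<le> Re p \<Longrightarrow> norm (G p) \<le> D / (norm p)\<^sup>2"
    using bromwich_symbol_bound[OF assms(1) c] bromwich_symbol_bound[OF assms(2) c] by metis
  have "norm (F p + G p) \<le> (C + D) / (norm p)\<^sup>2" if "c \<le> Re p" for p
    unfolding add_divide_distrib by (rule norm_triangle_le) (use C D that in \<open>simp add: add_mono\<close>)
  then show "\<exists>C. \<forall>p. c \<le> Re p \<longrightarrow> norm (F p + G p) \<le> C / (norm p)\<^sup>2" by blast
qed

text \<open>Integration by parts along the line.\<close>

lemma bromwich_times_t: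
  assumes F: "bromwich_symbol F" and F': "bromwich_symbol F'"
    and der: "\<And>p. 0 < Re p \<Longrightarrow> (F has_field_derivative F' p) (at p)"
  shows "t * bromwich F t = - bromwich F' t"
proof -
  let ?\<Phi> = "\<lambda>y. exp (Complex 1 y * of_real t) * F (Complex 1 y)"
  let ?\<Phi>' = "\<lambda>y. exp (Complex 1 y * of_real t) * F' (Complex 1 y)"
  have i: "integrable lborel ?\<Phi>" "integrable lborel ?\<Phi>'"
    by (rule exp_symbol_integrable[OF F zero_less_one] exp_symbol_integrable[OF F' zero_less_one])+
  obtain C where C: "0 < C" "\<And>p. 1 \<le> Re p \<Longrightarrow> norm (F p) \<le> C / (norm p)\<^sup>2"
    using bromwich_symbol_bound[OF F, of 1] by auto
  have b: "norm (?\<Phi> y) \<le> exp t * (C / (1 + y\<^sup>2))" for y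
    using mult_left_mono[OF C(2)[of "Complex 1 y"], of "exp t"] by (simp add: norm_mult norm_Complex_sq)
  have lim: "(?\<Phi> \<longlongrightarrow> 0) at_top" "(?\<Phi> \<longlongrightarrow> 0) at_bot"
    by (rule Lim_null_comparison[OF always_eventually[OF allI[OF b]]], real_asymp)+
  have U: "einterval (-\<infinity>) \<infinity> = UNIV" by auto
  have "(LBINT y=-\<infinity>..\<infinity>. \<i> * of_real t * ?\<Phi> y + \<i> * ?\<Phi>' y) = 0 - 0"
  proof (rule interval_integral_FTC_integrable[where F="?\<Phi>"])
    fix y :: real
    have Cd: "((\<lambda>y. Complex 1 y) has_vector_derivative \<i>) (at y)"
      unfolding Complex_eq by (auto intro!: derivative_eq_intros simp: has_vector_derivative_def scaleR_conv_of_real mult.commute)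
    have d1: "((\<lambda>y. F (Complex 1 y)) has_vector_derivative (\<i> * F' (Complex 1 y))) (at y)"
      using field_vector_diff_chain_at[OF Cd der[of "Complex 1 y"]] by (simp add: o_def)
    have d2: "((\<lambda>y. exp (Complex 1 y * of_real t)) has_vector_derivative (\<i> * (exp (Complex 1 y * of_real t) * of_real t))) (at y)"
    proof -
      have "((\<lambda>z. exp (z * of_real t)) has_field_derivative exp (Complex 1 y * of_real t) * of_real t) (at (Complex 1 y))"
        by (auto intro!: derivative_eq_intros)
      from field_vector_diff_chain_at[OF Cd this] show ?thesis by (simp add: o_def)
    qed
    show "(?\<Phi> has_vector_derivative (\<i> * of_real t * ?\<Phi> y + \<i> * ?\<Phi>' y)) (at y)"
      using has_vector_derivative_mult[OF d2 d1] by (simp add: algebra_simps)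
    have "continuous_on UNIV ?\<Phi>" "continuous_on UNIV ?\<Phi>'"
      by (rule exp_symbol_continuous[OF F zero_less_one] exp_symbol_continuous[OF F' zero_less_one])+
    then have "isCont ?\<Phi> y" "isCont ?\<Phi>' y"
      by (simp_all only: continuous_on_eq_continuous_at[OF open_UNIV] ball_UNIV)
    then show "isCont (\<lambda>y. \<i> * of_real t * ?\<Phi> y + \<i> * ?\<Phi>' y) y"
      by (rule continuous_add[OF continuous_mult[OF continuous_const] continuous_mult[OF continuous_const]])
  next
    show "set_integrable lborel (einterval (-\<infinity>) \<infinity>) (\<lambda>y. \<i> * of_real t * ?\<Phi> y + \<i> * ?\<Phi>' y)"
      unfolding U set_integrable_def using i by (simp del: times_complex.sel)
    show "((?\<Phi> \<circ> real_of_ereal) \<longlongrightarrow> 0) (at_right (-\<infinity>))" "((?\<Phi> \<circ> real_of_ereal) \<longlongrightarrow> 0) (at_left \<infinity>)"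
      unfolding ereal_tendsto_simps by (rule lim)+
  qed auto
  then have "(LBINT y. \<i> * of_real t * ?\<Phi> y + \<i> * ?\<Phi>' y) = 0"
    unfolding interval_lebesgue_integral_def set_lebesgue_integral_def U by simp
  also have "(LBINT y. \<i> * of_real t * ?\<Phi> y + \<i> * ?\<Phi>' y) = (LBINT y. \<i> * of_real t * ?\<Phi> y) + (LBINT y. \<i> * ?\<Phi>' y)"
    by (rule Bochner_Integration.integral_add) (intro integrable_mult_right i)+
  also have "\<dots> = \<i> * (of_real t * (LBINT y. ?\<Phi> y) + (LBINT y. ?\<Phi>' y))"
    unfolding integral_mult_right_zero by (simp only: distrib_left mult.assoc)
  finally have "of_real t * (LBINT y. ?\<Phi> y) = - (LBINT y. ?\<Phi>' y)"
    by (simp only: mult_eq_0_iff complex_i_not_zero add_eq_0_iff2 simp_thms)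
  then have "Re (of_real t * (LBINT y. ?\<Phi> y)) = Re (- (LBINT y. ?\<Phi>' y))" by (simp only:)
  then have "t * Re (LBINT y. ?\<Phi> y) = - Re (LBINT y. ?\<Phi>' y)" by (simp only: times_complex.sel Re_complex_of_real Im_complex_of_real mult_zero_left diff_zero uminus_complex.sel)
  then show ?thesis unfolding bromwich_def by (simp only: times_divide_eq_right minus_divide_left)
qed

context fractional_symbols
begin

definition RR :: "complex \<Rightarrow> complex" where "RR p = of_real (2 * a\<^sup>2) * kk p + of_real lam"
text \<open>\<open>RR\<close> is the derivative of a^2 k^2 + lam k in k. \<open>k1\<close> is p
  times the derivative of \<open>kk\<close>, and \<open>k2\<close> is p times the derivative of
  \<open>k1\<close>. Unlike d/dp, the operator p d/dp preserves the order of growth, so both stay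
  comparable to \<open>kk\<close>.\<close>

definition k1 :: "complex \<Rightarrow> complex" where "k1 p = of_real \<delta> * ss p / RR p"
definition k2 :: "complex \<Rightarrow> complex" where
  "k2 p = of_real \<delta> * (of_real \<delta> * ss p) / RR p - k1 p * (of_real (2 * a\<^sup>2) * k1 p) / RR p"

text \<open>Both left-hand sides have nonnegative real part, and \<open>RR\<close> dominates them in
  the real part and in the modulus of the imaginary part.\<close>

lemma RR_bounds:
  assumes "0 < Re p"
  shows "RR p \<noteq> 0" "norm (of_real (a\<^sup>2) * kk p + of_real lam) \<le> norm (RR p)" "norm (of_real (2 * a\<^sup>2) * kk p) \<le> norm (RR p)"
proof -
  have k: "0 < Re (kk p)" by (rule Re_kk[OF assms])
  have "0 < Re (RR p)" unfolding RR_def using k pos by (simp add: add_pos_pos)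
  then show "RR p \<noteq> 0" by auto
  have mono: "norm z \<le> norm w" if "0 \<le> Re z" "Re z \<le> Re w" "\<bar>Im z\<bar> \<le> \<bar>Im w\<bar>" for z w
    unfolding cmod_def using power_mono[OF that(2,1), of 2] that(3)
    by (intro real_sqrt_le_mono add_mono) (simp_all add: abs_le_square_iff)
  show "norm (of_real (a\<^sup>2) * kk p + of_real lam) \<le> norm (RR p)" "norm (of_real (2 * a\<^sup>2) * kk p) \<le> norm (RR p)"
    unfolding RR_def using k pos by (intro mono; simp add: abs_mult mult_right_mono)+
qed

text \<open>s / RR = k (a^2 k + lam) / RR has modulus at most |k|. The quadratic term of
  \<open>k2\<close> is controlled by |2 a^2 k1| <= |2 a^2 k| <= |RR|.\<close>

lemma k1_k2_bounds:
  assumes p: "0 < Re p"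
  shows "norm (k1 p) \<le> norm (kk p)" "norm (k2 p) \<le> 2 * norm (kk p)"
proof -
  have R: "0 < norm (RR p)" using RR_bounds(1)[OF p] by simp
  have sR: "norm (ss p / RR p) \<le> norm (kk p)"
    unfolding kk_quadratic[symmetric] norm_divide norm_mult
    using mult_left_mono[OF RR_bounds(2)[OF p], of "norm (kk p)"] R by (simp add: divide_le_eq)
  have "norm (k1 p) = \<delta> * norm (ss p / RR p)" unfolding k1_def using pos by (simp add: norm_mult norm_divide)
  also have "\<dots> \<le> \<delta> * norm (kk p)" using sR pos by (intro mult_left_mono) auto
  finally have k1d: "norm (k1 p) \<le> \<delta> * norm (kk p)" .
  have le: "\<delta> * norm (kk p) \<le> 1 * norm (kk p)" using pos by (intro mult_right_mono) auto
  then show k1: "norm (k1 p) \<le> norm (kk p)" using k1d by simp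
  have "norm (of_real \<delta> * (of_real \<delta> * ss p) / RR p) = \<delta> * (\<delta> * norm (ss p / RR p))"
    using pos by (simp add: norm_mult norm_divide)
  also have "\<dots> \<le> 1 * (1 * norm (kk p))" using sR pos by (intro mult_mono) auto
  finally have A: "norm (of_real \<delta> * (of_real \<delta> * ss p) / RR p) \<le> norm (kk p)" by simp
  have "norm (of_real (2 * a\<^sup>2) * k1 p) \<le> norm (of_real (2 * a\<^sup>2) * kk p)"
    unfolding norm_mult using k1 by (intro mult_left_mono) auto
  then have "norm (of_real (2 * a\<^sup>2) * k1 p) \<le> norm (RR p)" using RR_bounds(3)[OF p] by linarith
  then have "norm (k1 p) * norm (of_real (2 * a\<^sup>2) * k1 p) \<le> norm (kk p) * norm (RR p)"
    using k1 by (intro mult_mono) auto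
  then have B: "norm (k1 p * (of_real (2 * a\<^sup>2) * k1 p) / RR p) \<le> norm (kk p)"
    unfolding norm_divide norm_mult[of "k1 p"] using R by (simp add: divide_le_eq)
  show "norm (k2 p) \<le> 2 * norm (kk p)"
    unfolding k2_def using norm_triangle_ineq4[of "of_real \<delta> * (of_real \<delta> * ss p) / RR p" "k1 p * (of_real (2 * a\<^sup>2) * k1 p) / RR p"] A B by linarith
qed

lemma kk_derivative': "0 < Re p \<Longrightarrow> (kk has_field_derivative (k1 p / p)) (at p)"
  using kk_derivative[of p] by (simp add: k1_def RR_def)

lemma k1_derivative:
  assumes p: "0 < Re p"
  shows "(k1 has_field_derivative (k2 p / p)) (at p)"
proof -
  have p0: "p \<noteq> 0" using p by auto
  have dR: "(RR has_field_derivative (of_real (2 * a\<^sup>2) * (k1 p / p))) (at p)"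
    unfolding RR_def[abs_def] by (auto intro!: derivative_eq_intros kk_derivative'[OF p])
  have ds: "((\<lambda>p. of_real \<delta> * ss p) has_field_derivative (of_real \<delta> * (of_real \<delta> * ss p / p))) (at p)"
    by (rule DERIV_cmult[OF ss_derivative[OF p]])
  have "(k1 has_field_derivative ((of_real \<delta> * (of_real \<delta> * ss p / p)) * RR p - of_real \<delta> * ss p * (of_real (2 * a\<^sup>2) * (k1 p / p))) / (RR p * RR p)) (at p)"
    unfolding k1_def[abs_def] by (rule DERIV_divide[OF ds dR[unfolded k1_def] RR_bounds(1)[OF p]])
  moreover have "(of_real \<delta> * (of_real \<delta> * ss p / p) * RR p - of_real \<delta> * ss p * (of_real (2 * a\<^sup>2) * (k1 p / p))) / (RR p * RR p) = k2 p / p"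
  proof -
    have B: "of_real \<delta> * ss p = k1 p * RR p" using RR_bounds(1)[OF p] by (simp add: k1_def)
    have gen: "(d * (K * R / p) * R - K * R * (c * (K / p))) / (R * R) = (d * (K * R) / R - K * (c * K) / R) / p"
      if "R \<noteq> 0" for d K R c :: complex using that p0 by (simp add: field_simps)
    show ?thesis unfolding k2_def B by (rule gen[OF RR_bounds(1)[OF p]])
  qed
  ultimately show ?thesis by (simp only:)
qed

text \<open>The operator p d/dp applied once to the exponent \<sigma> s + \<zeta> k; for
  \<open>N2\<close> it is applied twice.\<close>

definition N1 :: "real \<Rightarrow> real \<Rightarrow> complex \<Rightarrow> complex" where
  "N1 \<sigma> \<zeta> p = of_real \<sigma> * (of_real \<delta> * ss p) + of_real \<zeta> * k1 p"
definition N2 :: "real \<Rightarrow> real \<Rightarrow> complex \<Rightarrow> complex" where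
  "N2 \<sigma> \<zeta> p = of_real \<sigma> * (of_real \<delta> * (of_real \<delta> * ss p)) + of_real \<zeta> * k2 p"

text \<open>The derivative of \<open>EE\<close> in p, as \<open>EE2\<close> is the second one. The
  powers of 1 / p are kept as separate factors, so that each summand is a multiplier of polynomial
  growth times \<open>EE\<close>.\<close>

definition EE1 :: "real \<Rightarrow> real \<Rightarrow> complex \<Rightarrow> complex" where
  "EE1 \<sigma> \<zeta> p = (- N1 \<sigma> \<zeta> p) * (1 / p) * EE \<sigma> \<zeta> p"
definition EE2 :: "real \<Rightarrow> real \<Rightarrow> complex \<Rightarrow> complex" where
  "EE2 \<sigma> \<zeta> p = (N1 \<sigma> \<zeta> p * N1 \<sigma> \<zeta> p) * (1 / p * (1 / p)) * EE \<sigma> \<zeta> p + (N1 \<sigma> \<zeta> p - N2 \<sigma> \<zeta> p) * (1 / p * (1 / p)) * EE \<sigma> \<zeta> p"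

lemma EE_derivative: "0 < Re p \<Longrightarrow> (EE \<sigma> \<zeta> has_field_derivative EE1 \<sigma> \<zeta> p) (at p)"
proof -
  assume p: "0 < Re p"
  have "((\<lambda>p. - (of_real \<sigma> * ss p + of_real \<zeta> * kk p)) has_field_derivative - (of_real \<sigma> * (of_real \<delta> * ss p / p) + of_real \<zeta> * (k1 p / p))) (at p)"
    by (intro DERIV_minus DERIV_add DERIV_cmult ss_derivative kk_derivative' p)
  from DERIV_chain2[OF DERIV_exp this]
  have "(EE \<sigma> \<zeta> has_field_derivative EE \<sigma> \<zeta> p * - (of_real \<sigma> * (of_real \<delta> * ss p / p) + of_real \<zeta> * (k1 p / p))) (at p)"
    unfolding EE_def[abs_def] .
  moreover have "EE \<sigma> \<zeta> p * - (of_real \<sigma> * (of_real \<delta> * ss p / p) + of_real \<zeta> * (k1 p / p)) = EE1 \<sigma> \<zeta> p"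
    unfolding EE1_def N1_def by (simp add: algebra_simps add_divide_distrib)
  ultimately show ?thesis by simp
qed

lemma EE1_derivative: "0 < Re p \<Longrightarrow> (EE1 \<sigma> \<zeta> has_field_derivative EE2 \<sigma> \<zeta> p) (at p)"
proof -
  assume p: "0 < Re p"
  have p0: "p \<noteq> 0" using p by auto
  have "((\<lambda>p. - N1 \<sigma> \<zeta> p) has_field_derivative - (of_real \<sigma> * (of_real \<delta> * (of_real \<delta> * ss p / p)) + of_real \<zeta> * (k2 p / p))) (at p)"
    unfolding N1_def by (intro DERIV_minus DERIV_add DERIV_cmult ss_derivative k1_derivative p)
  moreover have "((\<lambda>p. 1 / p) has_field_derivative (- 1 / p\<^sup>2)) (at p)"
    using p0 by (auto intro!: derivative_eq_intros simp: power2_eq_square)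
  ultimately have "((\<lambda>p. (- N1 \<sigma> \<zeta> p) * (1 / p)) has_field_derivative
      (- (of_real \<sigma> * (of_real \<delta> * (of_real \<delta> * ss p / p)) + of_real \<zeta> * (k2 p / p))) * (1 / p) + (- 1 / p\<^sup>2) * (- N1 \<sigma> \<zeta> p)) (at p)"
    by (rule DERIV_mult)
  from DERIV_mult[OF this EE_derivative[OF p]]
  have "(EE1 \<sigma> \<zeta> has_field_derivative
      ((- (of_real \<sigma> * (of_real \<delta> * (of_real \<delta> * ss p / p)) + of_real \<zeta> * (k2 p / p))) * (1 / p) + (- 1 / p\<^sup>2) * (- N1 \<sigma> \<zeta> p)) * EE \<sigma> \<zeta> p
      + EE1 \<sigma> \<zeta> p * ((- N1 \<sigma> \<zeta> p) * (1 / p))) (at p)"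
    unfolding EE1_def[abs_def] .
  moreover have "((- (of_real \<sigma> * (of_real \<delta> * (of_real \<delta> * ss p / p)) + of_real \<zeta> * (k2 p / p))) * (1 / p) + (- 1 / p\<^sup>2) * (- N1 \<sigma> \<zeta> p)) * EE \<sigma> \<zeta> p
      + EE1 \<sigma> \<zeta> p * ((- N1 \<sigma> \<zeta> p) * (1 / p)) = EE2 \<sigma> \<zeta> p"
  proof -
    have "of_real \<sigma> * (of_real \<delta> * (of_real \<delta> * ss p / p)) + of_real \<zeta> * (k2 p / p) = N2 \<sigma> \<zeta> p * (1 / p)"
      unfolding N2_def by (simp add: add_divide_distrib)
    then show ?thesis unfolding EE1_def EE2_def using p0 by (simp add: power2_eq_square field_simps)
  qed
  ultimately show ?thesis by simp
qed

definition LL :: "real \<Rightarrow> real \<Rightarrow> complex \<Rightarrow> real" where "LL \<sigma> \<zeta> p = \<sigma> * norm (ss p) + \<zeta> * norm (kk p)"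

text \<open>Everything is measured by the single quantity \<open>LL\<close>: the derivatives of the
  exponent are at most linear in it, while \<open>EE\<close> decays exponentially in it because s
  and k lie in sectors.\<close>

lemma N_bounds:
  assumes "0 \<le> \<sigma>" "0 \<le> \<zeta>" "0 < Re p"
  shows "norm (N1 \<sigma> \<zeta> p) \<le> LL \<sigma> \<zeta> p" "norm (N2 \<sigma> \<zeta> p) \<le> 2 * LL \<sigma> \<zeta> p"
    "norm (EE \<sigma> \<zeta> p) \<le> exp (- \<kappa>' * LL \<sigma> \<zeta> p)"
proof -
  have d: "\<delta> * norm (ss p) \<le> 1 * norm (ss p)" using pos by (intro mult_right_mono) auto
  have dd: "\<delta> * (\<delta> * norm (ss p)) \<le> 1 * (\<delta> * norm (ss p))" using pos by (intro mult_right_mono) auto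
  have dd2: "\<delta> * (\<delta> * norm (ss p)) \<le> 2 * norm (ss p)" using d dd norm_ge_zero[of "ss p"] by linarith
  have "norm (N1 \<sigma> \<zeta> p) \<le> \<sigma> * (\<delta> * norm (ss p)) + \<zeta> * norm (k1 p)"
    unfolding N1_def by (rule order_trans[OF norm_triangle_ineq]) (use assms pos in \<open>simp add: norm_mult\<close>)
  also have "\<dots> \<le> \<sigma> * norm (ss p) + \<zeta> * norm (kk p)"
    using d k1_k2_bounds(1)[OF assms(3)] assms by (intro add_mono mult_left_mono) auto
  finally show "norm (N1 \<sigma> \<zeta> p) \<le> LL \<sigma> \<zeta> p" unfolding LL_def .
  have "norm (N2 \<sigma> \<zeta> p) \<le> \<sigma> * (\<delta> * (\<delta> * norm (ss p))) + \<zeta> * norm (k2 p)"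
    unfolding N2_def by (rule order_trans[OF norm_triangle_ineq]) (use assms pos in \<open>simp add: norm_mult\<close>)
  also have "\<dots> \<le> \<sigma> * (2 * norm (ss p)) + \<zeta> * (2 * norm (kk p))"
    using dd2 k1_k2_bounds(2)[OF assms(3)] assms by (intro add_mono mult_left_mono) auto
  finally show "norm (N2 \<sigma> \<zeta> p) \<le> 2 * LL \<sigma> \<zeta> p" unfolding LL_def by simp
  have "\<kappa>' * norm (ss p) \<le> \<kappa> * norm (ss p)" using kappa' by (intro mult_right_mono) auto
  also have "\<dots> \<le> Re (ss p)" using Re_ss[OF assms(3)] norm_ss[of p] assms(3) by (cases "p = 0") auto
  finally have "\<sigma> * (\<kappa>' * norm (ss p)) + \<zeta> * (\<kappa>' * norm (kk p)) \<le> \<sigma> * Re (ss p) + \<zeta> * Re (kk p)"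
    using norm_kk_le[OF assms(3)] assms by (intro add_mono mult_left_mono) auto
  then have "- (\<sigma> * Re (ss p)) + - (\<zeta> * Re (kk p)) \<le> - \<kappa>' * LL \<sigma> \<zeta> p" by (simp add: LL_def algebra_simps)
  then show "norm (EE \<sigma> \<zeta> p) \<le> exp (- \<kappa>' * LL \<sigma> \<zeta> p)" unfolding norm_EE exp_add[symmetric] by simp
qed

lemma norm_EE2:
  assumes "0 \<le> \<sigma>" "0 \<le> \<zeta>" "0 < Re p"
  shows "norm (EE2 \<sigma> \<zeta> p) \<le> (3 * LL \<sigma> \<zeta> p + (LL \<sigma> \<zeta> p)\<^sup>2) * exp (- \<kappa>' * LL \<sigma> \<zeta> p) / (norm p)\<^sup>2"
proof -
  let ?N = "N1 \<sigma> \<zeta> p * N1 \<sigma> \<zeta> p + (N1 \<sigma> \<zeta> p - N2 \<sigma> \<zeta> p)"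
  have eq: "EE2 \<sigma> \<zeta> p = ?N * EE \<sigma> \<zeta> p * (1 / p * (1 / p))"
  proof -
    have "x * i * e + y * i * e = (x + y) * e * i" for x y i e :: complex by (simp add: algebra_simps)
    then show ?thesis unfolding EE2_def .
  qed
  have "norm ?N \<le> norm (N1 \<sigma> \<zeta> p) * norm (N1 \<sigma> \<zeta> p) + (norm (N1 \<sigma> \<zeta> p) + norm (N2 \<sigma> \<zeta> p))"
    using norm_triangle_ineq[of "N1 \<sigma> \<zeta> p * N1 \<sigma> \<zeta> p" "N1 \<sigma> \<zeta> p - N2 \<sigma> \<zeta> p"] norm_triangle_ineq4[of "N1 \<sigma> \<zeta> p" "N2 \<sigma> \<zeta> p"]
    unfolding norm_mult by linarith
  also have "\<dots> \<le> LL \<sigma> \<zeta> p * LL \<sigma> \<zeta> p + (LL \<sigma> \<zeta> p + 2 * LL \<sigma> \<zeta> p)"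
    using N_bounds(1,2)[OF assms] order_trans[OF norm_ge_zero N_bounds(1)[OF assms]] by (intro add_mono mult_mono) auto
  finally have "norm ?N * norm (EE \<sigma> \<zeta> p) \<le> (3 * LL \<sigma> \<zeta> p + (LL \<sigma> \<zeta> p)\<^sup>2) * exp (- \<kappa>' * LL \<sigma> \<zeta> p)"
    using N_bounds(3)[OF assms] by (intro mult_mono) (auto simp: power2_eq_square order_trans[OF norm_ge_zero N_bounds(1)[OF assms]])
  then show ?thesis unfolding eq norm_mult[of _ "1 / p * (1 / p)"] norm_mult[of ?N]
    by (simp add: norm_mult norm_divide power2_eq_square divide_right_mono)
qed

lemma LL_le: "0 \<le> \<sigma> \<Longrightarrow> 0 \<le> \<zeta> \<Longrightarrow> 0 < Re p \<Longrightarrow> LL \<sigma> \<zeta> p \<le> (\<sigma> + \<zeta> / lam) * norm p powr \<delta>"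
proof -
  assume *: "0 \<le> \<sigma>" "0 \<le> \<zeta>" "0 < Re p"
  have "\<sigma> * norm (ss p) + \<zeta> * norm (kk p) \<le> \<sigma> * norm p powr \<delta> + \<zeta> * (norm p powr \<delta> / lam)"
    using norm_ss[of p] norm_kk_upper[OF *(3)] * by (intro add_mono mult_left_mono) (cases "p = 0", auto)
  then show ?thesis by (simp add: LL_def algebra_simps)
qed

lemma N_poly_growth:
  assumes "0 \<le> \<sigma>" "0 \<le> \<zeta>"
  shows "poly_growth (N1 \<sigma> \<zeta>)" "poly_growth (\<lambda>p. N1 \<sigma> \<zeta> p - N2 \<sigma> \<zeta> p)"
proof -
  have hk: "RR holomorphic_on {p. 0 < Re p}" "ss holomorphic_on {p. 0 < Re p}"
    unfolding RR_def[abs_def] by (intro holomorphic_intros ss_holomorphic kk_holomorphic)+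
  have h1: "k1 holomorphic_on {p. 0 < Re p}" unfolding k1_def[abs_def] by (intro holomorphic_intros hk) (use RR_bounds in auto)
  have h2: "k2 holomorphic_on {p. 0 < Re p}" unfolding k2_def[abs_def] by (intro holomorphic_intros hk h1) (use RR_bounds in auto)
  have H1: "N1 \<sigma> \<zeta> holomorphic_on {p. 0 < Re p}" unfolding N1_def[abs_def] by (intro holomorphic_intros hk h1)
  have H2: "(\<lambda>p. N1 \<sigma> \<zeta> p - N2 \<sigma> \<zeta> p) holomorphic_on {p. 0 < Re p}" unfolding N2_def[abs_def] by (intro holomorphic_intros H1 hk h2)
  show "poly_growth (N1 \<sigma> \<zeta>)"
    by (rule poly_growthI[OF H1, where N=\<delta> and C="\<lambda>c. \<sigma> + \<zeta> / lam"])
      (use pos assms in \<open>auto intro!: order_trans[OF N_bounds(1) LL_le]\<close>)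
  show "poly_growth (\<lambda>p. N1 \<sigma> \<zeta> p - N2 \<sigma> \<zeta> p)"
  proof (rule poly_growthI[OF H2, where N=\<delta> and C="\<lambda>c. 3 * (\<sigma> + \<zeta> / lam)"])
    fix c :: real and p assume "0 < c" "c \<le> Re p"
    then have p: "0 < Re p" by simp
    have "norm (N1 \<sigma> \<zeta> p - N2 \<sigma> \<zeta> p) \<le> 3 * LL \<sigma> \<zeta> p"
      using norm_triangle_ineq4[of "N1 \<sigma> \<zeta> p" "N2 \<sigma> \<zeta> p"] N_bounds(1,2)[OF assms p] by linarith
    also have "\<dots> \<le> 3 * ((\<sigma> + \<zeta> / lam) * norm p powr \<delta>)" using LL_le[OF assms p] by simp
    finally show "norm (N1 \<sigma> \<zeta> p - N2 \<sigma> \<zeta> p) \<le> 3 * (\<sigma> + \<zeta> / lam) * norm p powr \<delta>" by (simp only: mult.assoc)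
  qed (use pos in auto)
qed

text \<open>Multiplication by t^2 becomes two derivatives of the symbol. The second derivative is
  bounded by a multiple of |p|^(-2) uniformly in \<sigma> and \<zeta>, a bound that
  \<open>EE\<close> itself cannot satisfy as both parameters tend to 0; hence the kernels are
  estimated away from t = 0 in this form.\<close>

lemma EE_times_t_square:
  assumes "0 \<le> \<sigma>" "0 \<le> \<zeta>" "0 < \<sigma> + \<zeta>"
  shows "bromwich_symbol (EE2 \<sigma> \<zeta>)" "t\<^sup>2 * bromwich (EE \<sigma> \<zeta>) t = bromwich (EE2 \<sigma> \<zeta>) t"
proof -
  have i: "poly_growth (\<lambda>p. 1 / p * (1 / p))" by (intro poly_growth_mult poly_growth_inverse)
  have m: "poly_growth (\<lambda>p. - N1 \<sigma> \<zeta> p)"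
    using poly_growth_mult[OF poly_growth_const[of "-1"] N_poly_growth(1)[OF assms(1,2)]] by simp
  have s1: "bromwich_symbol (EE1 \<sigma> \<zeta>)"
    unfolding EE1_def[abs_def] by (intro EE_symbol[OF assms] poly_growth_mult m poly_growth_inverse)
  show s2: "bromwich_symbol (EE2 \<sigma> \<zeta>)"
    unfolding EE2_def[abs_def]
    by (intro bromwich_symbol_add EE_symbol[OF assms] poly_growth_mult[OF _ i] poly_growth_mult[OF N_poly_growth(1) N_poly_growth(1)] N_poly_growth assms)
  have "t * bromwich (EE \<sigma> \<zeta>) t = - bromwich (EE1 \<sigma> \<zeta>) t" "t * bromwich (EE1 \<sigma> \<zeta>) t = - bromwich (EE2 \<sigma> \<zeta>) t"
    by (rule bromwich_times_t EE_symbol1 s1 s2 assms EE_derivative EE1_derivative | assumption)+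
  then show "t\<^sup>2 * bromwich (EE \<sigma> \<zeta>) t = bromwich (EE2 \<sigma> \<zeta>) t"
    by (simp add: power2_eq_square mult.assoc)
qed

text \<open>A bound for (3 L + L^2) exp (- \<kappa>' L) over all L >= 0. The two summands come from
  y <= exp y with y = \<kappa>' L and, squared, with y = \<kappa>' L / 2.\<close>

definition K0 :: real where "K0 = 3 / \<kappa>' + 4 / \<kappa>'\<^sup>2"

lemma LL_exp_bound:
  assumes "0 \<le> L"
  shows "(3 * L + L\<^sup>2) * exp (- \<kappa>' * L) \<le> K0"
proof -
  have "\<kappa>' * L \<le> exp (\<kappa>' * L)" using exp_ge_add_one_self[of "\<kappa>' * L"] by linarith
  then have 1: "3 * L \<le> 3 / \<kappa>' * exp (\<kappa>' * L)" using kappa' by (simp add: field_simps)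
  have "\<kappa>' * L / 2 \<le> exp (\<kappa>' * L / 2)" using exp_ge_add_one_self[of "\<kappa>' * L / 2"] by linarith
  then have "(\<kappa>' * L / 2)\<^sup>2 \<le> (exp (\<kappa>' * L / 2))\<^sup>2" using assms kappa' by (intro power_mono) auto
  also have "(exp (\<kappa>' * L / 2))\<^sup>2 = exp (\<kappa>' * L)" by (simp add: power2_eq_square exp_add[symmetric])
  finally have 2: "L\<^sup>2 \<le> 4 / \<kappa>'\<^sup>2 * exp (\<kappa>' * L)" using kappa' by (simp add: field_simps power2_eq_square)
  have "3 * L + L\<^sup>2 \<le> K0 * exp (\<kappa>' * L)" unfolding K0_def distrib_right using 1 2 by (rule add_mono)
  then show ?thesis by (simp add: exp_minus field_simps)
qed

lemma K0_pos: "0 < K0" using kappa' by (simp add: K0_def add_pos_pos)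

text \<open>The bound for the second derivative depends on \<sigma> and \<zeta> only through
  \<open>LL\<close>, and \<open>K0\<close> covers all values of \<open>LL\<close>; hence it is
  uniform in the parameters.\<close>

lemma EE_tail_bound:
  assumes "0 \<le> \<sigma>" "0 \<le> \<zeta>" "0 < \<sigma> + \<zeta>"
  shows "t\<^sup>2 * bromwich (EE \<sigma> \<zeta>) t \<le> K0 * exp t"
proof -
  have "\<bar>bromwich (EE2 \<sigma> \<zeta>) t\<bar> \<le> K0 / (2 * 1) * exp (1 * t)"
  proof (rule bromwich_abs_le[OF EE_times_t_square(1)[OF assms]])
    fix p assume "Re p = 1"
    then have p: "0 < Re p" by simp
    have L: "0 \<le> LL \<sigma> \<zeta> p" using assms by (simp add: LL_def)
    show "norm (EE2 \<sigma> \<zeta> p) \<le> K0 / (norm p)\<^sup>2"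
      by (rule order_trans[OF norm_EE2[OF assms(1,2) p]]) (intro divide_right_mono LL_exp_bound[OF L], simp)
  qed simp
  then show ?thesis unfolding EE_times_t_square(2)[OF assms] using mult_right_mono[of "K0 / 2" K0 "exp t"] K0_pos by auto
qed

text \<open>As \<sigma> and \<zeta> tend to 0, \<open>LL\<close> tends to 0 at each point of the
  line, and with it the second derivative of the symbol; the bound by \<open>K0\<close> dominates.
  Thus the kernels lose their mass away from t = 0.\<close>

lemma EE_tail_small:
  assumes e: "0 < e"
  shows "\<exists>d>0. \<forall>\<sigma> \<zeta> t. 0 \<le> \<sigma> \<longrightarrow> \<sigma> \<le> d \<longrightarrow> 0 \<le> \<zeta> \<longrightarrow> \<zeta> \<le> d \<longrightarrow> 0 < \<sigma> + \<zeta> \<longrightarrow> t\<^sup>2 * bromwich (EE \<sigma> \<zeta>) t \<le> e * exp t"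
proof -
  define \<Lambda> where "\<Lambda> y = norm (ss (Complex 1 y)) + norm (kk (Complex 1 y))" for y
  \<comment> \<open>A common majorant of the modulus of \<open>EE2\<close> on the line Re p = 1 for
    all \<sigma>, \<zeta> <= 1 / (n + 1): \<open>K0\<close> makes it integrable, and the other entry
    of the minimum makes it tend to 0.\<close>
  define D where "D n y = min K0 (3 * (\<Lambda> y / real (Suc n)) + (\<Lambda> y / real (Suc n))\<^sup>2) / (1 + y\<^sup>2)" for n y
  have \<Lambda>0: "0 \<le> \<Lambda> y" for y by (simp add: \<Lambda>_def)
  have c: "continuous_on UNIV \<Lambda>"
    unfolding \<Lambda>_def by (intro continuous_intros vertical_line_continuous[OF ss_holomorphic] vertical_line_continuous[OF kk_holomorphic]) auto
  then have [measurable]: "\<Lambda> \<in> borel_measurable borel" by (rule borel_measurable_continuous_onI)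
  have iK: "integrable lborel (\<lambda>y. K0 / (1 + y\<^sup>2))" using integrable_inverse_square_norm(1)[of 1 K0] by simp
  have Dm: "D n \<in> borel_measurable lborel" for n unfolding D_def by measurable
  have Db: "norm (D n y) \<le> K0 / (1 + y\<^sup>2)" for n y
    unfolding D_def using K0_pos \<Lambda>0[of y] by (auto simp: abs_mult min_def intro!: divide_right_mono)
  have iD: "integrable lborel (D n)" for n
    by (rule Bochner_Integration.integrable_bound[OF iK Dm]) (use Db K0_pos in \<open>auto intro!: AE_I2\<close>)
  have "(\<lambda>n. \<integral>y. D n y \<partial>lborel) \<longlonglongrightarrow> (LBINT (y::real). 0)"
  proof (rule integral_dominated_convergence[OF _ Dm iK])
    show "AE y in lborel. (\<lambda>n. D n y) \<longlonglongrightarrow> 0"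
    proof (rule AE_I2)
      fix y :: real
      have l: "(\<lambda>n. \<Lambda> y / real (Suc n)) \<longlonglongrightarrow> 0" using LIMSEQ_Suc[OF lim_const_over_n[of "\<Lambda> y"]] by simp
      have "(\<lambda>n. D n y) \<longlonglongrightarrow> min K0 (3 * 0 + 0\<^sup>2) / (1 + y\<^sup>2)"
        unfolding D_def by (intro tendsto_divide tendsto_min tendsto_add tendsto_mult tendsto_power tendsto_const l) (simp add: add_nonneg_eq_0_iff)
      then show "(\<lambda>n. D n y) \<longlonglongrightarrow> 0" using K0_pos by simp
    qed
  qed (use Db in auto)
  then have "(\<lambda>n. \<integral>y. D n y \<partial>lborel) \<longlonglongrightarrow> 0" by simp
  then have "\<forall>\<^sub>F n in sequentially. (LBINT y. D n y) < e" using e by (rule order_tendstoD)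
  then obtain n where n: "(LBINT y. D n y) < e" unfolding eventually_sequentially by blast
  have "t\<^sup>2 * bromwich (EE \<sigma> \<zeta>) t \<le> e * exp t"
    if *: "0 \<le> \<sigma>" "\<sigma> \<le> 1 / real (Suc n)" "0 \<le> \<zeta>" "\<zeta> \<le> 1 / real (Suc n)" "0 < \<sigma> + \<zeta>" for \<sigma> \<zeta> t
  proof -
    have sym: "bromwich_symbol (EE2 \<sigma> \<zeta>)" by (rule EE_times_t_square(1)) (use * in auto)
    have le: "norm (EE2 \<sigma> \<zeta> (Complex 1 y)) \<le> D n y" for y
    proof -
      let ?p = "Complex 1 y"
      have L: "0 \<le> LL \<sigma> \<zeta> ?p" using * by (simp add: LL_def)
      have L2: "LL \<sigma> \<zeta> ?p \<le> \<Lambda> y / real (Suc n)"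
      proof -
        have "LL \<sigma> \<zeta> ?p \<le> 1 / real (Suc n) * norm (ss ?p) + 1 / real (Suc n) * norm (kk ?p)"
          unfolding LL_def using * by (intro add_mono mult_right_mono) auto
        then show ?thesis unfolding \<Lambda>_def by (simp add: add_divide_distrib)
      qed
      have "(3 * LL \<sigma> \<zeta> ?p + (LL \<sigma> \<zeta> ?p)\<^sup>2) * exp (- \<kappa>' * LL \<sigma> \<zeta> ?p) \<le> (3 * LL \<sigma> \<zeta> ?p + (LL \<sigma> \<zeta> ?p)\<^sup>2) * 1"
        using L kappa' by (intro mult_left_mono) auto
      also have "\<dots> \<le> 3 * (\<Lambda> y / real (Suc n)) + (\<Lambda> y / real (Suc n))\<^sup>2"
        unfolding mult_1_right using L L2 by (intro add_mono power_mono mult_left_mono) auto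
      finally have "(3 * LL \<sigma> \<zeta> ?p + (LL \<sigma> \<zeta> ?p)\<^sup>2) * exp (- \<kappa>' * LL \<sigma> \<zeta> ?p) \<le> min K0 (3 * (\<Lambda> y / real (Suc n)) + (\<Lambda> y / real (Suc n))\<^sup>2)"
        using LL_exp_bound[OF L] by simp
      then have "(3 * LL \<sigma> \<zeta> ?p + (LL \<sigma> \<zeta> ?p)\<^sup>2) * exp (- \<kappa>' * LL \<sigma> \<zeta> ?p) / (norm ?p)\<^sup>2 \<le> D n y"
        unfolding D_def norm_Complex_sq one_power2 by (rule divide_right_mono) simp
      then show ?thesis using norm_EE2[OF *(1,3), of ?p] by simp
    qed
    have "(LBINT y. norm (EE2 \<sigma> \<zeta> (Complex 1 y))) \<le> (LBINT y. D n y)"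
      using exp_symbol_integrable[OF sym, of 1 0] iD le by (intro integral_mono) auto
    then have "(LBINT y. norm (EE2 \<sigma> \<zeta> (Complex 1 y))) \<le> e" using n by simp
    then have "exp (1 * t) * (LBINT y. norm (EE2 \<sigma> \<zeta> (Complex 1 y))) / (2 * pi) \<le> exp (1 * t) * e / 1"
      using pi_gt3 e by (intro frac_le mult_left_mono) auto
    then show ?thesis
      using bromwich_abs_le_integral[OF sym, of 1 t] EE_times_t_square(2)[OF *(1,3,5)] by (simp add: mult.commute)
  qed
  then show ?thesis by (intro exI[of _ "1 / real (Suc n)"]) auto
qed

end

section \<open>The weight in the subordination parameter\<close>

text \<open>Up to normalization the inverse Gamma density with shape b - 1 and scale x^2 / 4. The
  exponent b is left general because powers of \<tau> and derivatives in x shift it.\<close>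

definition weight :: "real \<Rightarrow> real \<Rightarrow> real \<Rightarrow> real" where
  "weight b x \<tau> = \<tau> powr (- b) * exp (- (x\<^sup>2 / (4 * \<tau>)))"

lemma weight_nonneg: "0 \<le> weight b x \<tau>"
  by (simp add: weight_def)

lemma weight_measurable [measurable]: "weight b x \<in> borel_measurable borel"
  unfolding weight_def[abs_def] by measurable

lemma weight_powr: "0 < \<tau> \<Longrightarrow> \<tau> powr c * weight b x \<tau> = weight (b - c) x \<tau>"
  by (simp add: weight_def powr_add[symmetric] mult.assoc[symmetric] add.commute)

text \<open>The substitution $\tau = x^2 / (4 \sigma)$ turns the weight into a Gamma density.\<close>

lemma weight_integral:
  assumes x: "0 < x" and b: "1 < b"
  shows "int_pos (weight b x)"
    and "(LBINT \<tau>:{0<..}. weight b x \<tau>) = Gamma (b - 1) * (x / 2) powr (2 - 2 * b)"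
proof -
  define q where "q = x\<^sup>2 / 4"
  have q: "0 < q" using x by (simp add: q_def)
  have im: "(\<lambda>\<sigma>. q / \<sigma>) ` {0<..} = {0<..}"
  proof (intro equalityI subsetI)
    fix \<tau> :: real assume "\<tau> \<in> {0<..}"
    then show "\<tau> \<in> (\<lambda>\<sigma>. q / \<sigma>) ` {0<..}" using q by (intro image_eqI[of _ _ "q / \<tau>"]) auto
  qed (use q in auto)
  have inj: "inj_on (\<lambda>\<sigma>. q / \<sigma>) {0<..}" using q by (auto simp: inj_on_def field_simps)
  have der: "((\<lambda>\<sigma>. q / \<sigma>) has_field_derivative (- q / \<sigma>\<^sup>2)) (at \<sigma> within {0<..})" if "\<sigma> \<in> {0<..}" for \<sigma> :: real
    using that by (auto intro!: derivative_eq_intros simp: power2_eq_square)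
  have eq: "\<bar>- q / \<sigma>\<^sup>2\<bar> * weight b x (q / \<sigma>) = q powr (1 - b) * (\<sigma> powr ((b - 1) - 1) * exp (- \<sigma>))" if "\<sigma> \<in> {0<..}" for \<sigma>
  proof -
    have s: "0 < \<sigma>" using that by simp
    have "(q / \<sigma>) powr (- b) = q powr (- b) * \<sigma> powr b" using s q by (simp add: powr_divide powr_minus field_simps)
    moreover have "q / \<sigma>\<^sup>2 = q powr 1 * \<sigma> powr (- 2)" using s q by (simp add: powr_minus powr_numeral divide_inverse)
    moreover have "exp (- (x\<^sup>2 / (4 * (q / \<sigma>)))) = exp (- \<sigma>)" using x s by (simp add: q_def)
    moreover have "\<bar>- q / \<sigma>\<^sup>2\<bar> = q / \<sigma>\<^sup>2" using q by simp
    ultimately have "\<bar>- q / \<sigma>\<^sup>2\<bar> * weight b x (q / \<sigma>) = (q powr 1 * q powr (- b)) * (\<sigma> powr (- 2) * \<sigma> powr b) * exp (- \<sigma>)"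
      unfolding weight_def by (simp only: mult_ac)
    then show ?thesis unfolding powr_add[symmetric] by (simp add: mult.assoc)
  qed
  let ?f = "\<lambda>\<sigma>. q powr (1 - b) * (\<sigma> powr ((b - 1) - 1) * exp (- \<sigma>))"
  have b1: "0 < b - 1" using b by simp
  have si: "int_pos ?f"
    using Gamma_integral_lborel(1)[OF b1] by (rule set_integrable_mult_right)
  have "?f absolutely_integrable_on {0<..}" "integral {0<..} ?f = q powr (1 - b) * Gamma (b - 1)"
    using set_borel_integral_eq_integral[OF si] Gamma_integral_lborel(2)[OF b1] si
      integrable_completion[of "\<lambda>x. ind x *\<^sub>R ?f x" lborel]
    by (auto simp: set_integrable_def set_integral_mult_right intro!: nonnegative_absolutely_integrable_1)
  moreover have "(\<lambda>\<sigma>. \<bar>- q / \<sigma>\<^sup>2\<bar> * weight b x (q / \<sigma>)) absolutely_integrable_on {0<..} \<longleftrightarrow> ?f absolutely_integrable_on {0<..}"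
    by (rule set_integrable_cong[OF refl refl]) (rule eq)
  moreover have "integral {0<..} (\<lambda>\<sigma>. \<bar>- q / \<sigma>\<^sup>2\<bar> * weight b x (q / \<sigma>)) = integral {0<..} ?f"
    by (rule Henstock_Kurzweil_Integration.integral_cong) (rule eq)
  ultimately have "(\<lambda>\<sigma>. \<bar>- q / \<sigma>\<^sup>2\<bar> * weight b x (q / \<sigma>)) absolutely_integrable_on {0<..} \<and> integral {0<..} (\<lambda>\<sigma>. \<bar>- q / \<sigma>\<^sup>2\<bar> * weight b x (q / \<sigma>)) = q powr (1 - b) * Gamma (b - 1)"
    by (simp only: simp_thms)
  moreover have "(\<lambda>\<sigma>. \<bar>- q / \<sigma>\<^sup>2\<bar> * weight b x (q / \<sigma>)) absolutely_integrable_on {0<..} \<and> integral {0<..} (\<lambda>\<sigma>. \<bar>- q / \<sigma>\<^sup>2\<bar> * weight b x (q / \<sigma>)) = q powr (1 - b) * Gamma (b - 1)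
    \<longleftrightarrow> weight b x absolutely_integrable_on ((\<lambda>\<sigma>. q / \<sigma>) ` {0<..}) \<and> integral ((\<lambda>\<sigma>. q / \<sigma>) ` {0<..}) (weight b x) = q powr (1 - b) * Gamma (b - 1)"
    by (rule has_absolute_integral_change_of_variables_1'[OF _ der inj]) simp
  ultimately have w: "weight b x absolutely_integrable_on {0<..}" "integral {0<..} (weight b x) = q powr (1 - b) * Gamma (b - 1)"
    unfolding im by (simp_all only: simp_thms)
  show si2: "int_pos (weight b x)"
    using w(1) integrable_completion[of "\<lambda>\<tau>. ind \<tau> *\<^sub>R weight b x \<tau>" lborel]
    unfolding set_integrable_def by simp
  have "q powr (1 - b) = (x / 2) powr (2 - 2 * b)"
  proof -
    have "q = (x / 2) powr 2" using x by (simp add: q_def powr_numeral power2_eq_square)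
    then have "q powr (1 - b) = (x / 2) powr (2 * (1 - b))" using x by (simp only: powr_powr)
    then show ?thesis by (simp add: algebra_simps)
  qed
  then show "(LBINT \<tau>:{0<..}. weight b x \<tau>) = Gamma (b - 1) * (x / 2) powr (2 - 2 * b)"
    using set_borel_integral_eq_integral(2)[OF si2] w(2) by simp
qed

text \<open>For b >= 2 the weight alone is integrable. Otherwise the exponential is traded for
  \<tau>^(- c) with c = 2 - b, which raises the exponent to 2. Small b do occur, since a derivative
  of the integral in \<mu> lowers b by 1.\<close>

lemma weight_exp_integrable:
  assumes x: "0 < x" and m: "0 < m"
  shows "int_pos (\<lambda>\<tau>. weight b x \<tau> * exp (- \<tau> * m))"
proof -
  obtain C where C: "\<And>\<tau>. 0 < \<tau> \<Longrightarrow> weight b x \<tau> * exp (- \<tau> * m) \<le> C * weight (max b 2) x \<tau>" "0 \<le> C"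
  proof (cases "2 \<le> b")
    case True
    have "weight b x \<tau> * exp (- \<tau> * m) \<le> weight b x \<tau> * 1" if "0 < \<tau>" for \<tau>
      using weight_nonneg[of b x \<tau>] m that by (intro mult_left_mono) auto
    then show ?thesis using True by (intro that[of 1]) (auto simp: max_def)
  next
    case False
    define c where "c = 2 - b"
    have c: "0 < c" "max b 2 = 2" "b = 2 - c" using False by (auto simp: c_def)
    have "weight b x \<tau> * exp (- \<tau> * m) \<le> (c powr c * m powr (- c)) * weight (max b 2) x \<tau>" if t: "0 < \<tau>" for \<tau>
    proof -
      have "exp (- (\<tau> * m)) \<le> c powr c * (\<tau> * m) powr (- c)"
        by (rule exp_minus_le_powr) (use c t m in auto)
      then have e: "exp (- \<tau> * m) \<le> (c powr c * m powr (- c)) * \<tau> powr (- c)" using t m by (simp add: powr_mult mult_ac)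
      have "weight b x \<tau> * exp (- \<tau> * m) \<le> weight b x \<tau> * ((c powr c * m powr (- c)) * \<tau> powr (- c))"
        by (rule mult_left_mono[OF e weight_nonneg])
      also have "\<dots> = (c powr c * m powr (- c)) * (\<tau> powr (- c) * weight b x \<tau>)" by (simp only: mult_ac)
      also have "\<tau> powr (- c) * weight b x \<tau> = weight (max b 2) x \<tau>" using weight_powr[OF t, of "-c" b x] c by simp
      finally show ?thesis .
    qed
    then show ?thesis by (intro that[of "c powr c * m powr (- c)"]) auto
  qed
  have i: "integrable lborel (\<lambda>\<tau>. C * (ind \<tau> *\<^sub>R weight (max b 2) x \<tau>))"
    using weight_integral(1)[OF x, of "max b 2"] unfolding set_integrable_def by (intro integrable_mult_right) auto
  show ?thesis unfolding set_integrable_def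
  proof (rule Bochner_Integration.integrable_bound[OF i])
    show "AE \<tau> in lborel. norm (ind \<tau> *\<^sub>R (weight b x \<tau> * exp (- \<tau> * m))) \<le> norm (C * (ind \<tau> *\<^sub>R weight (max b 2) x \<tau>))"
      using C weight_nonneg by (intro AE_I2) (auto simp: indicator_def abs_mult)
  qed measurable
qed

lemma weight_antimono: "0 < x0 \<Longrightarrow> x0 \<le> x \<Longrightarrow> 0 < \<tau> \<Longrightarrow> weight b x \<tau> \<le> weight b x0 \<tau>"
  unfolding weight_def by (intro mult_left_mono) (auto intro!: divide_right_mono power_mono)

text \<open>A modified Bessel function: for x > 0 and Re \<mu> > 0 it is 2 (x / (2 sqrt \<mu>))^(1 -
  b) times K of order b - 1 at x sqrt \<mu>. Holomorphy, bounds and the differential equation are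
  all derived from the integral.\<close>

definition JJ :: "real \<Rightarrow> real \<Rightarrow> complex \<Rightarrow> complex" where
  "JJ b x \<mu> = (LBINT \<tau>. ind \<tau> *\<^sub>R (of_real (weight b x \<tau>) * exp (- of_real \<tau> * \<mu>)))"

lemma JJ_integrable:
  assumes "0 < x" "0 < Re \<mu>"
  shows "integrable lborel (\<lambda>\<tau>. ind \<tau> *\<^sub>R (complex_of_real (weight b x \<tau>) * exp (- of_real \<tau> * \<mu>)))"
proof (rule Bochner_Integration.integrable_bound[OF weight_exp_integrable[OF assms, of b, unfolded set_integrable_def]])
  show "AE \<tau> in lborel. norm (ind \<tau> *\<^sub>R (complex_of_real (weight b x \<tau>) * exp (- of_real \<tau> * \<mu>))) \<le> norm (indicat_real {0<..} \<tau> *\<^sub>R (weight b x \<tau> * exp (- \<tau> * Re \<mu>)))"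
    by (intro AE_I2) (auto simp: norm_mult indicator_def abs_mult)
qed measurable

lemma JJ_holomorphic:
  assumes x: "0 < x"
  shows "JJ b x holomorphic_on {\<mu>. 0 < Re \<mu>}"
proof (rule holomorphic_onI)
  fix \<mu> assume mu: "\<mu> \<in> {\<mu>. 0 < Re \<mu>}"
  define m where "m = Re \<mu> / 2"
  have m: "0 < m" "m < Re \<mu>" using mu by (auto simp: m_def)
  let ?f = "\<lambda>\<mu> \<tau>. ind \<tau> *\<^sub>R (complex_of_real (weight b x \<tau>) * exp (- of_real \<tau> * \<mu>))"
  let ?f' = "\<lambda>\<mu> \<tau>. - (ind \<tau> *\<^sub>R (complex_of_real (weight (b - 1) x \<tau>) * exp (- of_real \<tau> * \<mu>)))"
  have "((\<lambda>\<mu>. \<integral>\<tau>. ?f \<mu> \<tau> \<partial>lborel) has_field_derivative (LBINT \<tau>. ?f' \<mu> \<tau>)) (at \<mu> within {\<mu>. m < Re \<mu>})"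
  proof (rule has_field_derivative_integral[OF half_plane_convex(1), where g="\<lambda>\<tau>. ind \<tau> *\<^sub>R (weight (b - 1) x \<tau> * exp (- \<tau> * m))"])
    show "integrable lborel (\<lambda>\<tau>. ind \<tau> *\<^sub>R (weight (b - 1) x \<tau> * exp (- \<tau> * m)))"
      using weight_exp_integrable[OF x m(1)] unfolding set_integrable_def .
    show "?f' \<mu> \<in> borel_measurable lborel" by measurable
    fix \<nu> \<tau> assume nu: "\<nu> \<in> {\<mu>. m < Re \<mu>}"
    show "integrable lborel (?f \<nu>)" by (rule JJ_integrable[OF x]) (use nu m in auto)
    show "((\<lambda>\<mu>. ?f \<mu> \<tau>) has_field_derivative ?f' \<nu> \<tau>) (at \<nu> within {\<mu>. m < Re \<mu>})"
    proof (cases "0 < \<tau>")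
      case True
      have "((\<lambda>\<mu>. of_real (weight b x \<tau>) * exp (- of_real \<tau> * \<mu>)) has_field_derivative - (of_real (\<tau> powr 1 * weight b x \<tau>) * exp (- of_real \<tau> * \<nu>))) (at \<nu> within {\<mu>. m < Re \<mu>})"
        using True by (auto intro!: derivative_eq_intros)
      then show ?thesis using True unfolding weight_powr[OF True] by simp
    qed simp
    show "norm (?f' \<nu> \<tau>) \<le> ind \<tau> *\<^sub>R (weight (b - 1) x \<tau> * exp (- \<tau> * m))"
      using nu weight_nonneg[of "b - 1" x \<tau>] by (auto simp: norm_mult indicator_def intro!: mult_left_mono)
  qed (use m in auto)
  then have "(JJ b x has_field_derivative (LBINT \<tau>. ?f' \<mu> \<tau>)) (at \<mu>)"
    unfolding JJ_def[abs_def] using m at_within_open[OF _ half_plane_convex(2), of \<mu> m] by (simp only: mem_Collect_eq)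
  then show "JJ b x field_differentiable at \<mu> within {\<mu>. 0 < Re \<mu>}"
    using field_differentiable_def field_differentiable_at_within by blast
qed

text \<open>Differentiating the weight in x multiplies it by - x / (2 \<tau>), which raises b by 1.
  On (x / 2, 2 x) the weight at x / 2 dominates, since the weight decreases in x.\<close>

lemma JJ_derivative_x:
  assumes x: "0 < x" and mu: "0 < Re \<mu>"
  shows "((\<lambda>x. JJ b x \<mu>) has_vector_derivative (- of_real (x / 2) * JJ (b + 1) x \<mu>)) (at x)"
proof -
  let ?S = "{x / 2<..<2 * x}"
  let ?f = "\<lambda>x \<tau>. ind \<tau> *\<^sub>R (complex_of_real (weight b x \<tau>) * exp (- of_real \<tau> * \<mu>))"
  let ?f' = "\<lambda>x \<tau>. - of_real (x / 2) * (ind \<tau> *\<^sub>R (complex_of_real (weight (b + 1) x \<tau>) * exp (- of_real \<tau> * \<mu>)))"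
  have "((\<lambda>x. \<integral>\<tau>. ?f x \<tau> \<partial>lborel) has_vector_derivative (LBINT \<tau>. ?f' x \<tau>)) (at x within ?S)"
  proof (rule has_vector_derivative_integral[where g="\<lambda>\<tau>. x * (ind \<tau> *\<^sub>R (weight (b + 1) (x / 2) \<tau> * exp (- \<tau> * Re \<mu>)))"])
    show "integrable lborel (\<lambda>\<tau>. x * (ind \<tau> *\<^sub>R (weight (b + 1) (x / 2) \<tau> * exp (- \<tau> * Re \<mu>))))"
      using weight_exp_integrable[of "x / 2" "Re \<mu>" "b + 1"] x mu unfolding set_integrable_def by (intro integrable_mult_right) auto
    show "?f' x \<in> borel_measurable lborel" by measurable
    fix y \<tau> assume y: "y \<in> ?S"
    show "integrable lborel (?f y)" by (rule JJ_integrable) (use y x mu in auto)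
    show "((\<lambda>x. ?f x \<tau>) has_vector_derivative ?f' y \<tau>) (at y within ?S)"
    proof (cases "0 < \<tau>")
      case True
      have "((\<lambda>x. weight b x \<tau>) has_real_derivative (- (y / 2) * (\<tau> powr (- 1) * weight b y \<tau>))) (at y within ?S)"
        unfolding weight_def using True by (auto intro!: derivative_eq_intros simp: powr_minus field_simps)
      then have "((\<lambda>x. of_real (weight b x \<tau>)) has_vector_derivative (complex_of_real (- (y / 2) * weight (b + 1) y \<tau>))) (at y within ?S)"
        unfolding weight_powr[OF True] diff_minus_eq_add has_real_derivative_iff_has_vector_derivative
        using bounded_linear.has_vector_derivative[OF bounded_linear_of_real] by fastforce
      from has_vector_derivative_mult_left[OF this, of "exp (- of_real \<tau> * \<mu>)"]
      show ?thesis using True by (simp add: mult.assoc)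
    qed simp
    show "norm (?f' y \<tau>) \<le> x * (ind \<tau> *\<^sub>R (weight (b + 1) (x / 2) \<tau> * exp (- \<tau> * Re \<mu>)))"
    proof (cases "0 < \<tau>")
      case True
      have "\<bar>y / 2\<bar> * (weight (b + 1) y \<tau> * exp (- \<tau> * Re \<mu>)) \<le> x * (weight (b + 1) (x / 2) \<tau> * exp (- \<tau> * Re \<mu>))"
        using y x weight_antimono[of "x / 2" y \<tau> "b + 1"] True weight_nonneg[of "b + 1"] by (intro mult_mono mult_right_mono) auto
      then show ?thesis using True weight_nonneg[of "b + 1" y \<tau>] by (simp add: norm_mult)
    qed simp
  qed (use x in auto)
  moreover have "(LBINT \<tau>. ?f' x \<tau>) = - of_real (x / 2) * JJ (b + 1) x \<mu>"
    unfolding JJ_def by (rule integral_mult_right_zero)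
  moreover have "at x within ?S = at x" by (rule at_within_open) (use x in auto)
  ultimately show ?thesis unfolding JJ_def[abs_def] by (simp only:)
qed

lemma norm_JJ_le:
  assumes "0 < x" "0 < Re \<mu>"
  shows "norm (JJ b x \<mu>) \<le> (LBINT \<tau>:{0<..}. weight b x \<tau> * exp (- \<tau> * Re \<mu>))"
proof -
  have "norm (JJ b x \<mu>) \<le> (LBINT \<tau>. norm (ind \<tau> *\<^sub>R (complex_of_real (weight b x \<tau>) * exp (- of_real \<tau> * \<mu>))))"
    unfolding JJ_def by (rule integral_norm_bound)
  also have "\<dots> = (LBINT \<tau>:{0<..}. weight b x \<tau> * exp (- \<tau> * Re \<mu>))"
    unfolding set_lebesgue_integral_def using weight_nonneg
    by (intro Bochner_Integration.integral_cong) (auto simp: norm_mult indicator_def)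
  finally show ?thesis .
qed

text \<open>The equation satisfied by the weight, after integration by parts in \<open>\<tau>\<close>.\<close>

lemma JJ_recurrence:
  assumes x: "0 < x" and m: "0 < m"
  shows "of_real m * JJ b x (of_real m) = of_real (x\<^sup>2 / 4) * JJ (b + 2) x (of_real m) - of_real b * JJ (b + 1) x (of_real m)"
proof -
  let ?W = "\<lambda>b. LBINT \<tau>:{0<..}. weight b x \<tau> * exp (- \<tau> * m)"
  have J: "JJ b x (of_real m) = of_real (?W b)" for b
  proof -
    have "(\<lambda>\<tau>. ind \<tau> *\<^sub>R (complex_of_real (weight b x \<tau>) * exp (- of_real \<tau> * of_real m))) = (\<lambda>\<tau>. complex_of_real (ind \<tau> *\<^sub>R (weight b x \<tau> * exp (- \<tau> * m))))"
      unfolding exp_minus_mult_of_real by (simp add: scaleR_conv_of_real)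
    then show ?thesis unfolding JJ_def set_lebesgue_integral_def by (simp only: integral_complex_of_real)
  qed
  have i: "int_pos (\<lambda>\<tau>. weight b x \<tau> * exp (- \<tau> * m))" for b
    by (rule weight_exp_integrable[OF x m])
  \<comment> \<open>The derivative in \<tau> of the weight times the exponential. Its integral is 0
    because that product vanishes at 0 and at infinity.\<close>
  define g where "g \<tau> = (x\<^sup>2 / 4) * (weight (b + 2) x \<tau> * exp (- \<tau> * m)) - b * (weight (b + 1) x \<tau> * exp (- \<tau> * m)) - m * (weight b x \<tau> * exp (- \<tau> * m))" for \<tau>
  have E: "einterval 0 \<infinity> = {0<..}" by (auto simp: einterval_def zero_ereal_def)
  have gi: "int_pos g"
    unfolding g_def by (intro set_integral_diff set_integrable_mult_right i)
  have "(LBINT \<tau>=0..\<infinity>. g \<tau>) = 0 - 0"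
  proof (rule interval_integral_FTC_integrable[where F="\<lambda>\<tau>. weight b x \<tau> * exp (- \<tau> * m)"])
    fix \<tau> :: real assume "(0::ereal) < ereal \<tau>"
    then have t: "0 < \<tau>" by simp
    have w: "weight (b + 1) x \<tau> = \<tau> powr (- 1) * weight b x \<tau>" "weight (b + 2) x \<tau> = \<tau> powr (- 2) * weight b x \<tau>"
      using weight_powr[OF t, of "-1" b x] weight_powr[OF t, of "-2" b x] by simp_all
    have "((\<lambda>\<tau>. \<tau> powr (- b)) has_real_derivative (- b * (\<tau> powr (- 1) * \<tau> powr (- b)))) (at \<tau>)"
      using t by (auto intro!: derivative_eq_intros simp: powr_diff powr_minus field_simps)
    moreover have "((\<lambda>\<tau>. exp (- (x\<^sup>2 / (4 * \<tau>)))) has_real_derivative ((x\<^sup>2 / 4) * \<tau> powr (- 2) * exp (- (x\<^sup>2 / (4 * \<tau>))))) (at \<tau>)"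
      using t by (auto intro!: derivative_eq_intros simp: powr_minus powr_numeral power2_eq_square field_simps)
    ultimately have "(weight b x has_real_derivative (- b * (\<tau> powr (- 1) * \<tau> powr (- b))) * exp (- (x\<^sup>2 / (4 * \<tau>))) + ((x\<^sup>2 / 4) * \<tau> powr (- 2) * exp (- (x\<^sup>2 / (4 * \<tau>)))) * \<tau> powr (- b)) (at \<tau>)"
      unfolding weight_def[abs_def] by (rule DERIV_mult)
    then have "(weight b x has_real_derivative ((x\<^sup>2 / 4) * weight (b + 2) x \<tau> - b * weight (b + 1) x \<tau>)) (at \<tau>)"
      unfolding w by (simp add: weight_def algebra_simps)
    moreover have "((\<lambda>\<tau>. exp (- \<tau> * m)) has_real_derivative (- m * exp (- \<tau> * m))) (at \<tau>)"
      by (auto intro!: derivative_eq_intros)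
    ultimately have "((\<lambda>\<tau>. weight b x \<tau> * exp (- \<tau> * m)) has_real_derivative ((x\<^sup>2 / 4) * weight (b + 2) x \<tau> - b * weight (b + 1) x \<tau>) * exp (- \<tau> * m) + (- m * exp (- \<tau> * m)) * weight b x \<tau>) (at \<tau>)"
      by (rule DERIV_mult)
    then show "((\<lambda>\<tau>. weight b x \<tau> * exp (- \<tau> * m)) has_vector_derivative g \<tau>) (at \<tau>)"
      unfolding g_def has_real_derivative_iff_has_vector_derivative[symmetric] by (simp add: algebra_simps)
    have "isCont (weight c x) \<tau>" for c unfolding weight_def[abs_def] using t by (intro continuous_intros) auto
    then show "isCont g \<tau>" unfolding g_def[abs_def] by (intro continuous_intros)
  next
    show "set_integrable lborel (einterval 0 \<infinity>) g" using gi unfolding E .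
    have "((\<lambda>\<tau>. \<tau> powr (- b) * exp (- (x\<^sup>2 / (4 * \<tau>))) * exp (- \<tau> * m)) \<longlongrightarrow> 0) (at_right 0)"
      using x m by real_asymp
    then show "(((\<lambda>\<tau>. weight b x \<tau> * exp (- \<tau> * m)) \<circ> real_of_ereal) \<longlongrightarrow> 0) (at_right 0)"
      unfolding zero_ereal_def ereal_tendsto_simps weight_def .
    have "((\<lambda>\<tau>. \<tau> powr (- b) * exp (- (x\<^sup>2 / (4 * \<tau>))) * exp (- \<tau> * m)) \<longlongrightarrow> 0) at_top"
      using x m by real_asymp
    then show "(((\<lambda>\<tau>. weight b x \<tau> * exp (- \<tau> * m)) \<circ> real_of_ereal) \<longlongrightarrow> 0) (at_left \<infinity>)"
      unfolding ereal_tendsto_simps weight_def .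
  qed auto
  then have "(LBINT \<tau>:{0<..}. g \<tau>) = 0" by (simp add: interval_lebesgue_integral_0_infty)
  moreover have "(LBINT \<tau>:{0<..}. g \<tau>) = (x\<^sup>2 / 4) * ?W (b + 2) - b * ?W (b + 1) - m * ?W b"
    unfolding g_def by (subst set_integral_diff(2); (intro set_integral_diff set_integrable_mult_right i)?)+
      (simp only: set_integral_mult_right)
  ultimately have "m * ?W b = (x\<^sup>2 / 4) * ?W (b + 2) - b * ?W (b + 1)" by linarith
  then show ?thesis unfolding J by (simp only: of_real_mult[symmetric] of_real_diff[symmetric])
qed

section \<open>Solutions as Bromwich integrals\<close>

text \<open>The factor by which the boundary datum enters a symbol: the transform of h for the
  field, 1 for the kernel. Boundedness on half planes is what the transform of h offers.\<close>

definition transfer :: "(complex \<Rightarrow> complex) \<Rightarrow> bool" where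
  "transfer H \<longleftrightarrow> H holomorphic_on {p. 0 < Re p} \<and> symbol_real H \<and>
     (\<forall>c>0. \<exists>C>0. \<forall>p. c \<le> Re p \<longrightarrow> norm (H p) \<le> C)"

lemma transfer_one: "transfer (\<lambda>p. 1)"
  by (auto simp: transfer_def symbol_real_def intro!: exI[of _ 1])

lemma transfer_laplace: "exp_integrable h \<Longrightarrow> transfer (laplace h)"
  unfolding transfer_def
proof (intro conjI allI impI laplace_holomorphic laplace_symbol_real)
  fix c :: real assume h: "exp_integrable h" and c: "0 < c"
  have "norm (laplace h p) \<le> \<bar>rlap (\<lambda>t. \<bar>h t\<bar>) c\<bar> + 1" if "c \<le> Re p" for p
    using norm_laplace_le[OF h c that] by linarith
  then show "\<exists>C>0. \<forall>p. c \<le> Re p \<longrightarrow> norm (laplace h p) \<le> C"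
    by (intro exI[of _ "\<bar>rlap (\<lambda>t. \<bar>h t\<bar>) c\<bar> + 1"]) auto
qed

lemma bromwich_symbol_cmult:
  assumes "bromwich_symbol F"
  shows "bromwich_symbol (\<lambda>p. of_real c * F p)"
  using bromwich_symbol_mult[OF assms holomorphic_on_const[of "of_real c"]] by (simp only: mult.commute) blast

context fractional_symbols
begin

text \<open>The common symbol of the field and its derivatives, without the factor that depends on r
  alone. M collects the factors p, s and - k produced by the derivatives in t and z, b grows by 1
  with each derivative of \<open>JJ\<close> in r, and H is the datum.\<close>

definition Sy :: "(complex \<Rightarrow> complex) \<Rightarrow> (complex \<Rightarrow> complex) \<Rightarrow> real \<Rightarrow> real \<Rightarrow> real \<Rightarrow> complex \<Rightarrow> complex" where
  "Sy H M b x z p = M p * JJ b x (mm p) * EE 0 z p * H p"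

lemma Re_mm: "0 < Re p \<Longrightarrow> Re (ss p) \<le> Re (mm p)" "0 < Re p \<Longrightarrow> 0 < Re (mm p)"
  using Re_ss_pos[of p] Re_kk[of p] pos by (auto simp: mm_def add_pos_pos)

definition KJ :: "real \<Rightarrow> real" where "KJ N = (N / \<delta>) powr (N / \<delta>) * \<kappa> powr (- N / \<delta>)"

lemma KJ_pos: "0 < N \<Longrightarrow> 0 < KJ N"
  using pos kappa by (simp add: KJ_def)

text \<open>For each \<tau> the factor exp (- \<tau> Re s) is traded for \<tau>^(- N / \<delta>)
  |p|^(- N). The power of \<tau> shifts b to b + N / \<delta>, and the remaining integral is
  explicit.\<close>

lemma norm_JJ_mm:
  assumes "0 < N" "0 < x" "0 < Re p" "1 < b"
  shows "norm (JJ b x (mm p)) \<le> KJ N * Gamma (b + N / \<delta> - 1) * (x / 2) powr (2 - 2 * (b + N / \<delta>)) * norm p powr (- N)"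
proof -
  have "0 < N / \<delta>" using assms pos by simp
  then have b: "1 < b + N / \<delta>" using assms(4) by linarith
  have "norm (JJ b x (mm p)) \<le> (LBINT \<tau>:{0<..}. weight b x \<tau> * exp (- \<tau> * Re (mm p)))"
    using norm_JJ_le Re_mm assms by blast
  also have "\<dots> \<le> (LBINT \<tau>:{0<..}. (KJ N * norm p powr (- N)) * weight (b + N / \<delta>) x \<tau>)"
  proof (rule set_integral_mono)
    show "int_pos (\<lambda>\<tau>. weight b x \<tau> * exp (- \<tau> * Re (mm p)))"
      by (rule weight_exp_integrable) (use Re_mm assms in auto)
    show "int_pos (\<lambda>\<tau>. (KJ N * norm p powr (- N)) * weight (b + N / \<delta>) x \<tau>)"
      using weight_integral(1)[OF assms(2) b] by (rule set_integrable_mult_right)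
    fix \<tau> :: real assume "\<tau> \<in> {0<..}"
    then have t: "0 < \<tau>" by simp
    have "exp (- \<tau> * Re (mm p)) \<le> exp (- \<tau> * Re (ss p))" using Re_mm(1)[OF assms(3)] t by simp
    also have "\<dots> \<le> KJ N * \<tau> powr (- N / \<delta>) * norm p powr (- N)"
      unfolding KJ_def by (rule exp_ss_bound[OF assms(1) t assms(3)])
    finally have "weight b x \<tau> * exp (- \<tau> * Re (mm p)) \<le> weight b x \<tau> * (KJ N * \<tau> powr (- N / \<delta>) * norm p powr (- N))"
      by (intro mult_left_mono weight_nonneg)
    also have "\<dots> = (KJ N * norm p powr (- N)) * (\<tau> powr (- N / \<delta>) * weight b x \<tau>)" by (simp only: mult_ac)
    also have "\<tau> powr (- N / \<delta>) * weight b x \<tau> = weight (b + N / \<delta>) x \<tau>"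
      using weight_powr[OF t, of "- N / \<delta>" b x] by simp
    finally show "weight b x \<tau> * exp (- \<tau> * Re (mm p)) \<le> (KJ N * norm p powr (- N)) * weight (b + N / \<delta>) x \<tau>" .
  qed
  also have "\<dots> = (KJ N * norm p powr (- N)) * (Gamma (b + N / \<delta> - 1) * (x / 2) powr (2 - 2 * (b + N / \<delta>)))"
    unfolding set_integral_mult_right weight_integral(2)[OF assms(2) b] ..
  finally show ?thesis by (simp only: mult_ac)
qed

text \<open>Decay of order N + 2 from \<open>JJ\<close> beats the growth N of M, already at z = 0.
  The power of x involved has a nonpositive exponent, which makes the constant uniform for x >= x0,
  as derivatives in x and majorants on compact sets require.\<close>

lemma Sy_bound:
  assumes H: "transfer H" and M: "poly_growth M" and b: "1 < b" and x0: "0 < x0" and c: "0 < c"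
  shows "\<exists>C>0. \<forall>x z p. x0 \<le> x \<longrightarrow> 0 \<le> z \<longrightarrow> c \<le> Re p \<longrightarrow> norm (Sy H M b x z p) \<le> C / (norm p)\<^sup>2"
proof -
  obtain CH where CH: "0 < CH" "\<And>p. c \<le> Re p \<Longrightarrow> norm (H p) \<le> CH"
    using H c unfolding transfer_def by blast
  obtain N CM where N: "0 \<le> N" and CM: "0 \<le> CM" "\<And>p. c \<le> Re p \<Longrightarrow> norm (M p) \<le> CM * norm p powr N"
    using M c unfolding poly_growth_def by blast
  define e where "e = 2 - 2 * (b + (N + 2) / \<delta>)"
  have e: "e \<le> 0"
  proof -
    have "2 - 2 * (b + X) \<le> 0" if "0 \<le> X" for X :: real using b that by simp
    moreover have "0 \<le> (N + 2) / \<delta>" using N pos by simp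
    ultimately show ?thesis unfolding e_def by blast
  qed
  define J where "J = KJ (N + 2) * Gamma (b + (N + 2) / \<delta> - 1) * (x0 / 2) powr e"
  have "0 < b + (N + 2) / \<delta> - 1" using b divide_nonneg_pos[of "N + 2" \<delta>] N pos by linarith
  then have G0: "0 \<le> KJ (N + 2) * Gamma (b + (N + 2) / \<delta> - 1)"
    using KJ_pos[of "N + 2"] N Gamma_real_pos by (intro mult_nonneg_nonneg less_imp_le) auto
  have J0: "0 \<le> J" unfolding J_def by (rule mult_nonneg_nonneg[OF G0]) simp
  define C where "C = CM * J * CH"
  have "norm (Sy H M b x z p) \<le> (C + 1) / (norm p)\<^sup>2" if x: "x0 \<le> x" and z: "0 \<le> z" and p: "c \<le> Re p" for x z p
  proof -
    have p0: "0 < Re p" "0 < norm p" using p c half_plane_nonzero[OF c p] by auto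
    have pw: "(x / 2) powr e \<le> (x0 / 2) powr e" using x x0 e by (intro powr_mono2') auto
    have "norm (JJ b x (mm p)) \<le> KJ (N + 2) * Gamma (b + (N + 2) / \<delta> - 1) * (x / 2) powr e * norm p powr (- (N + 2))"
      unfolding e_def by (rule norm_JJ_mm) (use N x x0 p0 b in auto)
    also have "\<dots> \<le> KJ (N + 2) * Gamma (b + (N + 2) / \<delta> - 1) * (x0 / 2) powr e * norm p powr (- (N + 2))"
      by (intro mult_right_mono mult_left_mono pw G0) simp
    finally have "norm (JJ b x (mm p)) \<le> J * norm p powr (- (N + 2))" unfolding J_def .
    then have "norm (Sy H M b x z p) \<le> (CM * norm p powr N) * (J * norm p powr (- (N + 2))) * 1 * CH"
      unfolding Sy_def norm_mult using CM CH p z p0 norm_EE_le_1[of 0 z p] J0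
      by (intro mult_mono) auto
    also have "\<dots> = C * (norm p powr N * norm p powr (- (N + 2)))" unfolding C_def by (simp only: mult_ac mult_1_right)
    also have "norm p powr N * norm p powr (- (N + 2)) = norm p powr (- 2)" by (simp add: powr_add[symmetric])
    also have "\<dots> = 1 / (norm p)\<^sup>2" using p0 by (simp add: powr_minus powr_numeral divide_inverse)
    finally have "norm (Sy H M b x z p) \<le> C / (norm p)\<^sup>2" by simp
    also have "\<dots> \<le> (C + 1) / (norm p)\<^sup>2" by (intro divide_right_mono) auto
    finally show ?thesis .
  qed
  moreover have "0 \<le> C" unfolding C_def using CM CH J0 by simp
  ultimately show ?thesis by (intro exI[of _ "C + 1"]) auto
qed

lemma Sy_symbol:
  assumes H: "transfer H" and M: "poly_growth M" and b: "1 < b" and x: "0 < x" and z: "0 \<le> z"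
  shows "bromwich_symbol (Sy H M b x z)"
proof -
  have hm: "mm ` {p. 0 < Re p} \<subseteq> {\<mu>. 0 < Re \<mu>}" using Re_mm by auto
  have "(\<lambda>p. JJ b x (mm p)) holomorphic_on {p. 0 < Re p}"
    using holomorphic_on_compose_gen[OF mm_holomorphic JJ_holomorphic[OF x] hm] by (simp add: o_def)
  then have "Sy H M b x z holomorphic_on {p. 0 < Re p}"
    unfolding Sy_def[abs_def] using H M
    by (intro holomorphic_on_mult EE_holomorphic) (auto simp: transfer_def poly_growth_def)
  then show ?thesis
    unfolding bromwich_symbol_def using Sy_bound[OF H M b x] z by fastforce
qed

lemma Sy_real:
  assumes "transfer H" "symbol_real M" "0 < x"
  shows "symbol_real (Sy H M b x z)"
proof -
  have "JJ b x (mm (of_real q)) \<in> \<real>" if q: "0 < q" for q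
  proof -
    obtain m where m: "mm (of_real q) = of_real m" using symbol_real_mm q by (auto simp: symbol_real_def elim: Reals_cases)
    have "JJ b x (of_real m) = of_real (LBINT \<tau>. ind \<tau> *\<^sub>R (weight b x \<tau> * exp (- \<tau> * m)))"
      unfolding JJ_def exp_minus_mult_of_real integral_complex_of_real[symmetric]
      by (rule Bochner_Integration.integral_cong) (auto simp: scaleR_conv_of_real)
    then show ?thesis unfolding m by simp
  qed
  moreover have "EE 0 z (of_real q) \<in> \<real>" if "0 < q" for q using EE_real that by (simp add: symbol_real_def)
  ultimately show ?thesis using assms by (auto simp: symbol_real_def Sy_def transfer_def)
qed

lemma Sy_derivative_z:
  assumes H: "transfer H" and M: "poly_growth M" and b: "1 < b" and x: "0 < x" and z: "0 \<le> z"
  shows "((\<lambda>z. bromwich (Sy H M b x z) t) has_real_derivative bromwich (Sy H (\<lambda>p. - kk p * M p) b x z) t) (at z within {0..})"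
proof -
  have mk: "poly_growth (\<lambda>p. - kk p * M p)"
    using poly_growth_mult[OF poly_growth_mult[OF poly_growth_const[of "-1"] poly_growth_kk] M] by simp
  obtain C where C: "\<And>x' z p. x \<le> x' \<Longrightarrow> 0 \<le> z \<Longrightarrow> 1 \<le> Re p \<Longrightarrow> norm (Sy H (\<lambda>p. - kk p * M p) b x' z p) \<le> C / (norm p)\<^sup>2"
    using Sy_bound[OF H mk b x, of 1] by auto
  show ?thesis
  proof (rule bromwich_parameter_derivative[where F="\<lambda>z. Sy H M b x z" and F'="\<lambda>z. Sy H (\<lambda>p. - kk p * M p) b x z" and C=C])
    show "bromwich_symbol (Sy H M b x y)" if "y \<in> {0..}" for y by (rule Sy_symbol[OF H M b x]) (use that in simp)
    fix y :: real and p assume y: "y \<in> {0..}" and p: "Re p = (1::real)"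
    have "((\<lambda>y. EE 0 y p) has_vector_derivative (EE 0 y p * - kk p)) (at y within {0..})"
      unfolding EE_def by (rule has_vector_derivative_real_field) (auto intro!: derivative_eq_intros)
    from has_vector_derivative_mult_left[OF has_vector_derivative_mult_right[OF this, of "M p * JJ b x (mm p)"], of "H p"]
    show "((\<lambda>y. Sy H M b x y p) has_vector_derivative Sy H (\<lambda>p. - kk p * M p) b x y p) (at y within {0..})"
      unfolding Sy_def by (simp add: mult_ac)
    show "norm (Sy H (\<lambda>p. - kk p * M p) b x y p) \<le> C / (norm p)\<^sup>2" by (rule C) (use y p in auto)
  qed (use z Sy_symbol[OF H mk b x z] in auto)
qed

lemma Sy_derivative_x:
  assumes H: "transfer H" and M: "poly_growth M" and b: "1 < b" and x: "0 < x" and z: "0 \<le> z"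
  shows "((\<lambda>x. bromwich (Sy H M b x z) t) has_real_derivative (- (x / 2) * bromwich (Sy H M (b + 1) x z) t)) (at x)"
proof -
  let ?S = "{x / 2<..<2 * x}"
  have b1: "1 < b + 1" and x2: "0 < x / 2" using b x by auto
  obtain C where C: "0 < C" "\<And>x' z p. x / 2 \<le> x' \<Longrightarrow> 0 \<le> z \<Longrightarrow> 1 \<le> Re p \<Longrightarrow> norm (Sy H M (b + 1) x' z p) \<le> C / (norm p)\<^sup>2"
    using Sy_bound[OF H M b1 x2, of 1] by auto
  have "((\<lambda>x. bromwich (Sy H M b x z) t) has_real_derivative bromwich (\<lambda>p. of_real (- (x / 2)) * Sy H M (b + 1) x z p) t) (at x within ?S)"
  proof (rule bromwich_parameter_derivative[where F="\<lambda>x. Sy H M b x z" and F'="\<lambda>x p. of_real (- (x / 2)) * Sy H M (b + 1) x z p" and C="x * C"])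
    show "bromwich_symbol (\<lambda>p. of_real (- (x / 2)) * Sy H M (b + 1) x z p)"
      by (rule bromwich_symbol_cmult[OF Sy_symbol[OF H M b1 x z]])
    show "bromwich_symbol (Sy H M b y z)" if "y \<in> ?S" for y
      by (rule Sy_symbol[OF H M b _ z]) (use that x in auto)
    fix y :: real and p assume y: "y \<in> ?S" and p: "Re p = (1::real)"
    then have y0: "0 < y" using x by auto
    have m: "0 < Re (mm p)" using Re_mm p by simp
    have "((\<lambda>y. JJ b y (mm p)) has_vector_derivative (- of_real (y / 2) * JJ (b + 1) y (mm p))) (at y within ?S)"
      by (rule has_vector_derivative_at_within[OF JJ_derivative_x[OF y0 m]])
    from has_vector_derivative_mult_left[OF has_vector_derivative_mult_right[OF this, of "M p"], of "EE 0 z p * H p"]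
    show "((\<lambda>y. Sy H M b y z p) has_vector_derivative of_real (- (y / 2)) * Sy H M (b + 1) y z p) (at y within ?S)"
      unfolding Sy_def by (simp add: mult_ac)
    have "norm (Sy H M (b + 1) y z p) \<le> C / (norm p)\<^sup>2" by (rule C(2)) (use y z p in auto)
    then have "\<bar>y / 2\<bar> * norm (Sy H M (b + 1) y z p) \<le> x * (C / (norm p)\<^sup>2)"
      using y x by (intro mult_mono) auto
    then show "norm (of_real (- (y / 2)) * Sy H M (b + 1) y z p) \<le> x * C / (norm p)\<^sup>2"
      unfolding norm_mult norm_of_real by simp
  qed (use x in auto)
  moreover have "at x within ?S = at x" by (rule at_within_open) (use x in auto)
  ultimately show ?thesis unfolding bromwich_mult by (simp only:)
qed

text \<open>The Caputo derivative is f' convolved with t^(- \<delta>) / Gamma (1 - \<delta>), whose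
  transform is p^(\<delta> - 1). Since f starts at 0, f' has the transform p F, and the product is s
  F. Both sides are continuous, so equality of transforms gives equality for every t > 0.\<close>

lemma caputo_bromwich:
  assumes F: "bromwich_symbol F" and r: "symbol_real F" and pF: "bromwich_symbol (\<lambda>p. p * F p)" and sF: "bromwich_symbol (\<lambda>p. ss p * F p)"
    and f: "\<And>t. 0 < t \<Longrightarrow> f t = bromwich F t" and t: "0 < t"
  shows "caputo \<delta> f t = bromwich (\<lambda>p. ss p * F p) t" "caputo_differentiable \<delta> f t"
proof -
  let ?G = "bromwich (\<lambda>p. p * F p)"
  have pr: "symbol_real (\<lambda>p. p * F p)" using r by (simp add: symbol_real_def)
  have sr: "symbol_real (\<lambda>p. ss p * F p)" by (rule symbol_real_mult[OF symbol_real_ss r])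
  have m: "nat \<lceil>\<delta>\<rceil> = 1" using pos by (simp add: nat_eq_iff ceiling_eq_iff)
  have df: "(f has_real_derivative ?G s) (at s)" if s: "0 < s" for s
  proof (rule has_field_derivative_transform_within_open[OF bromwich_derivative[OF F pF], where S="{0<..}"])
    show "bromwich F x = f x" if "x \<in> {0<..}" for x using f that by simp
  qed (use s in auto)
  then have dd: "deriv f s = ?G s" if "0 < s" for s using DERIV_imp_deriv that by blast
  have e1: "1 - (1 - \<delta>) = \<delta>" "0 < 1 - \<delta>" using pos by auto
  have pw: "exp_integrable (\<lambda>t. t powr (- \<delta>))" "\<And>q. 0 < q \<Longrightarrow> rlap (\<lambda>t. t powr (- \<delta>)) q = Gamma (1 - \<delta>) * q powr (\<delta> - 1)"
    using powr_transform[OF e1(2)] by simp_all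
  have Gi: "exp_integrable ?G" by (rule bromwich_exp_integrable[OF pF])
  have cv: "(LBINT s:{0<..<t}. deriv f s / (t - s) powr \<delta>) = conv ?G (\<lambda>t. t powr (- \<delta>)) t"
  proof -
    have "(LBINT s:{0<..<t}. deriv f s / (t - s) powr \<delta>) = conv (\<lambda>t. t powr (- \<delta>)) ?G t"
      unfolding laplace_convolution_def set_lebesgue_integral_def
    proof (rule integral_discrete_difference[of "{0, t}"])
      fix s assume "s \<notin> {0, t}"
      then show "indicator {0<..<t} s *\<^sub>R (deriv f s / (t - s) powr \<delta>) = indicator {0..t} s *\<^sub>R ((t - s) powr (- \<delta>) * ?G s)"
        by (auto simp: indicator_def dd powr_minus divide_inverse)
    qed auto
    then show ?thesis by (simp add: conv_commute)
  qed
  have "conv ?G (\<lambda>t. t powr (- \<delta>)) t = Gamma (1 - \<delta>) * bromwich (\<lambda>p. ss p * F p) t"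
  proof (rule rlap_eq_imp_eq[OF conv_transform(1)[OF Gi pw(1)] exp_integrable_mult[OF bromwich_exp_integrable[OF sF]] _ _ _ t])
    fix q :: real assume q: "0 < q"
    have "complex_of_real (rlap ?G q * (Gamma (1 - \<delta>) * q powr (\<delta> - 1))) = of_real (Gamma (1 - \<delta>) * rlap (bromwich (\<lambda>p. ss p * F p)) q)"
    proof -
      have "complex_of_real (q powr (\<delta> - 1)) * of_real q = of_real (q powr \<delta>)"
        unfolding of_real_mult[symmetric] using q by (simp add: powr_diff)
      then show ?thesis
        unfolding of_real_mult rlap_bromwich[OF pF pr q] rlap_bromwich[OF sF sr q] ss_of_real[OF q]
        by (metis mult.assoc mult.commute)
    qed
    then show "rlap (conv ?G (\<lambda>t. t powr (- \<delta>))) q = rlap (\<lambda>t. Gamma (1 - \<delta>) * bromwich (\<lambda>p. ss p * F p) t) q"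
      unfolding conv_transform(2)[OF Gi pw(1) q] pw(2)[OF q] rlap_mult by (simp only: of_real_eq_iff)
  next
    show "continuous_on {0<..} (conv ?G (\<lambda>t. t powr (- \<delta>)))"
      by (rule continuous_on_subset[OF conv_continuous[OF bromwich_continuous[OF pF] bromwich_nonpos[OF pF] pw(1)]]) auto
    show "continuous_on {0<..} (\<lambda>t. Gamma (1 - \<delta>) * bromwich (\<lambda>p. ss p * F p) t)"
      by (intro continuous_intros bromwich_continuous[OF sF])
  qed
  moreover have "Gamma (1 - \<delta>) \<noteq> 0" using Gamma_real_pos[OF e1(2)] by simp
  moreover have "caputo \<delta> f t = 1 / Gamma (1 - \<delta>) * (LBINT s:{0<..<t}. deriv f s / (t - s) powr \<delta>)"
    unfolding caputo_def Let_def m using pos by simp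
  ultimately show "caputo \<delta> f t = bromwich (\<lambda>p. ss p * F p) t" unfolding cv by simp
  have "set_integrable lborel {0<..<t} (\<lambda>s. deriv f s / (t - s) powr \<delta>)"
  proof -
    have "integrable lborel (\<lambda>s. indicator {0<..<t} s * s powr (- \<delta>))" by (rule exp_integrable_integrable_Ioo[OF pw(1)])
    from lborel_integrable_real_affine[OF this, of "-1" t]
    have i: "integrable lborel (\<lambda>s. indicator {0<..<t} (t - s) * (t - s) powr (- \<delta>))" by simp
    have "compact (?G ` {0..t})" by (rule compact_continuous_image[OF bromwich_continuous[OF pF]]) simp
    then obtain B where B: "\<forall>s\<in>{0..t}. \<bar>?G s\<bar> \<le> B"
      using compact_imp_bounded[of "?G ` {0..t}"] unfolding bounded_iff by auto
    have "integrable lborel (\<lambda>s. ?G s * (indicator {0<..<t} (t - s) * (t - s) powr (- \<delta>)))"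
    proof (rule Bochner_Integration.integrable_bound[OF integrable_mult_right[OF i, of B]])
      have [measurable]: "?G \<in> borel_measurable borel" by (rule bromwich_measurable[OF pF])
      show "(\<lambda>s. ?G s * (indicator {0<..<t} (t - s) * (t - s) powr (- \<delta>))) \<in> borel_measurable lborel" by measurable
      show "AE s in lborel. norm (?G s * (indicator {0<..<t} (t - s) * (t - s) powr (- \<delta>))) \<le> norm (B * (indicator {0<..<t} (t - s) * (t - s) powr (- \<delta>)))"
      proof (rule AE_I2)
        fix s :: real
        show "norm (?G s * (indicator {0<..<t} (t - s) * (t - s) powr (- \<delta>))) \<le> norm (B * (indicator {0<..<t} (t - s) * (t - s) powr (- \<delta>)))"
          using B[rule_format, of s] by (cases "0 < s \<and> s < t") (auto simp: abs_mult indicator_def intro!: mult_right_mono)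
      qed
    qed
    moreover have "?G s * (indicator {0<..<t} (t - s) * (t - s) powr (- \<delta>)) = indicator {0<..<t} s *\<^sub>R (deriv f s / (t - s) powr \<delta>)" for s
      by (auto simp: indicator_def dd powr_minus divide_inverse)
    ultimately show ?thesis unfolding set_integrable_def by (simp only:)
  qed
  moreover have "f differentiable (at s)" if "s \<in> {0<..t}" for s
    using df[of s] that real_differentiable_def by auto
  ultimately show "caputo_differentiable \<delta> f t"
    unfolding caputo_differentiable_def Let_def m by simp
qed

text \<open>Fubini's theorem between \<tau> and the line, with \<tau> s + (z + \<alpha> \<tau>) k =
  \<tau> m + z k in the exponent. Trading the exponential in \<tau> m for \<tau>^(- 2 / \<delta>)
  |p|^(-2) gives an integrable majorant of product form.\<close>

lemma bromwich_subordination: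
  assumes H: "transfer H" and b: "1 < b" and x: "0 < x" and z: "0 \<le> z"
  shows "int_pos (\<lambda>\<tau>. weight b x \<tau> * bromwich (\<lambda>p. EE \<tau> (z + \<alpha> * \<tau>) p * H p) t)"
    "(LBINT \<tau>:{0<..}. weight b x \<tau> * bromwich (\<lambda>p. EE \<tau> (z + \<alpha> * \<tau>) p * H p) t) = bromwich (Sy H (\<lambda>p. 1) b x z) t"
proof -
  obtain CH where CH: "0 < CH" "\<And>p. 1 \<le> Re p \<Longrightarrow> norm (H p) \<le> CH"
    using H unfolding transfer_def by (metis zero_less_one)
  define P where "P y = exp (Complex 1 y * of_real t) * (EE 0 z (Complex 1 y) * H (Complex 1 y))" for y
  define g where "g \<tau> y = (ind \<tau> *\<^sub>R (of_real (weight b x \<tau>) * exp (- of_real \<tau> * mm (Complex 1 y)))) * P y" for \<tau> y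
  have EEm: "EE \<tau> (z + \<alpha> * \<tau>) p = exp (- of_real \<tau> * mm p) * EE 0 z p" for \<tau> p
    unfolding EE_def mm_def exp_add[symmetric] by (simp add: algebra_simps)
  have "0 < 2 / \<delta>" using pos by simp
  then have b2: "1 < b + 2 / \<delta>" using b by linarith
  have cP: "continuous_on UNIV P"
    unfolding P_def using H
    by (intro vertical_line_continuous[of "\<lambda>p. exp (p * of_real t) * (EE 0 z p * H p)" 0]) (auto simp: transfer_def intro!: holomorphic_intros EE_holomorphic)
  have cm: "continuous_on UNIV (\<lambda>y. mm (Complex 1 y))" by (rule vertical_line_continuous[OF mm_holomorphic]) simp
  have [measurable]: "P \<in> borel_measurable borel" "(\<lambda>y. mm (Complex 1 y)) \<in> borel_measurable borel"
    by (rule borel_measurable_continuous_onI[OF cP] borel_measurable_continuous_onI[OF cm])+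
  have nP: "norm (P y) \<le> exp t * CH" for y
  proof -
    have "norm (P y) \<le> exp t * (1 * CH)"
      unfolding P_def norm_mult using norm_EE_le_1[of 0 z "Complex 1 y"] z CH(2)[of "Complex 1 y"] CH(1)
      by (intro mult_mono) auto
    then show ?thesis by simp
  qed
  let ?D = "\<lambda>(\<tau>, y). (exp t * CH * KJ 2) * ((ind \<tau> *\<^sub>R weight (b + 2 / \<delta>) x \<tau>) * (1 / (1\<^sup>2 + y\<^sup>2)))"
  have iD: "integrable (lborel \<Otimes>\<^sub>M lborel) ?D"
  proof (rule lborel_pair.Fubini_integrable)
    show "?D \<in> borel_measurable (lborel \<Otimes>\<^sub>M lborel)" by measurable
    have w: "integrable lborel (\<lambda>\<tau>. ind \<tau> *\<^sub>R weight (b + 2 / \<delta>) x \<tau>)"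
      using weight_integral(1)[OF x b2] unfolding set_integrable_def .
    have "norm (?D (\<tau>, y)) = \<bar>exp t * CH * KJ 2\<bar> * ((ind \<tau> *\<^sub>R weight (b + 2 / \<delta>) x \<tau>) * (1 / (1\<^sup>2 + y\<^sup>2)))" for \<tau> y
      using weight_nonneg[of "b + 2 / \<delta>" x \<tau>] by (simp add: abs_mult indicator_def)
    then show "integrable lborel (\<lambda>\<tau>. \<integral>y. norm (?D (\<tau>, y)) \<partial>lborel)"
      using w by (simp only: integral_mult_right_zero) (intro integrable_mult_right integrable_mult_left)
    show "AE \<tau> in lborel. integrable lborel (\<lambda>y. ?D (\<tau>, y))"
      unfolding prod.case by (intro AE_I2 integrable_mult_right integrable_inverse_square_norm) simp
  qed
  have gb: "norm (g \<tau> y) \<le> norm (?D (\<tau>, y))" for \<tau> y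
  proof (cases "0 < \<tau>")
    case True
    let ?p = "Complex 1 y"
    have np: "norm ?p powr (- 2) = 1 / (1\<^sup>2 + y\<^sup>2)"
      using norm_Complex_sq[of 1 y] by (simp add: powr_minus powr_numeral divide_inverse)
    have "exp (- \<tau> * Re (mm ?p)) \<le> exp (- \<tau> * Re (ss ?p))" using Re_mm(1)[of ?p] True by simp
    also have "\<dots> \<le> KJ 2 * \<tau> powr (- 2 / \<delta>) * norm ?p powr (- 2)"
      using exp_ss_bound[of 2 \<tau> ?p] True unfolding KJ_def by simp
    finally have e: "exp (- \<tau> * Re (mm ?p)) \<le> KJ 2 * \<tau> powr (- 2 / \<delta>) * (1 / (1\<^sup>2 + y\<^sup>2))" unfolding np .
    have "norm (g \<tau> y) = weight b x \<tau> * exp (- \<tau> * Re (mm ?p)) * norm (P y)"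
      unfolding g_def using True weight_nonneg[of b x \<tau>] by (simp add: norm_mult)
    also have "\<dots> \<le> weight b x \<tau> * (KJ 2 * \<tau> powr (- 2 / \<delta>) * (1 / (1\<^sup>2 + y\<^sup>2))) * (exp t * CH)"
      using e nP[of y] weight_nonneg[of b x \<tau>] KJ_pos[of 2] by (intro mult_mono mult_left_mono mult_nonneg_nonneg) auto
    also have "\<dots> = (exp t * CH * KJ 2) * ((\<tau> powr (- 2 / \<delta>) * weight b x \<tau>) * (1 / (1\<^sup>2 + y\<^sup>2)))" by (simp only: mult_ac)
    also have "\<tau> powr (- 2 / \<delta>) * weight b x \<tau> = weight (b + 2 / \<delta>) x \<tau>" using weight_powr[OF True, of "- 2 / \<delta>" b x] by simp
    also have "(exp t * CH * KJ 2) * (weight (b + 2 / \<delta>) x \<tau> * (1 / (1\<^sup>2 + y\<^sup>2))) \<le> norm (?D (\<tau>, y))"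
      using True abs_ge_self[of "exp t * CH * KJ 2 * weight (b + 2 / \<delta>) x \<tau> * (1 / (1\<^sup>2 + y\<^sup>2))"] by (simp only: prod.case real_norm_def mult.assoc indicator_simps greaterThan_iff real_scaleR_def mult_1_left)
    finally show ?thesis .
  qed (simp add: g_def)
  have int: "integrable (lborel \<Otimes>\<^sub>M lborel) (\<lambda>(\<tau>, y). g \<tau> y)"
  proof (rule Bochner_Integration.integrable_bound[OF iD])
    show "(\<lambda>(\<tau>, y). g \<tau> y) \<in> borel_measurable (lborel \<Otimes>\<^sub>M lborel)" unfolding g_def by measurable
    show "AE q in lborel \<Otimes>\<^sub>M lborel. norm (case q of (\<tau>, y) \<Rightarrow> g \<tau> y) \<le> norm (?D q)"
      using gb by (intro AE_I2) (auto simp del: norm_mult split: prod.splits)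
  qed
  have inner: "ind \<tau> *\<^sub>R (weight b x \<tau> * bromwich (\<lambda>p. EE \<tau> (z + \<alpha> * \<tau>) p * H p) t) = Re (LBINT y. g \<tau> y) / (2 * pi)" for \<tau>
  proof -
    have "exp (Complex 1 y * of_real t) * (EE \<tau> (z + \<alpha> * \<tau>) (Complex 1 y) * H (Complex 1 y)) = exp (- of_real \<tau> * mm (Complex 1 y)) * P y" for y
      unfolding EEm P_def by (simp only: mult_ac)
    then have "bromwich (\<lambda>p. EE \<tau> (z + \<alpha> * \<tau>) p * H p) t = Re (LBINT y. exp (- of_real \<tau> * mm (Complex 1 y)) * P y) / (2 * pi)"
      unfolding bromwich_def by (simp only:)
    moreover have "(LBINT y. g \<tau> y) = of_real (ind \<tau> * weight b x \<tau>) * (LBINT y. exp (- of_real \<tau> * mm (Complex 1 y)) * P y)"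
      unfolding g_def scaleR_conv_of_real of_real_mult mult.assoc integral_mult_right_zero ..
    ultimately show ?thesis
      by (simp only: times_complex.sel Re_complex_of_real Im_complex_of_real mult_zero_left diff_zero real_scaleR_def times_divide_eq_right mult.assoc)
  qed
  have "integrable lborel (\<lambda>\<tau>. \<integral>y. g \<tau> y \<partial>lborel)"
    using lborel_pair.integrable_fst[OF int] .
  then have i1: "integrable lborel (\<lambda>\<tau>. Re (LBINT y. g \<tau> y) / (2 * pi))"
    by (intro Bochner_Integration.integrable_divide integrable_Re)
  then show "int_pos (\<lambda>\<tau>. weight b x \<tau> * bromwich (\<lambda>p. EE \<tau> (z + \<alpha> * \<tau>) p * H p) t)"
    unfolding set_integrable_def inner .
  have "(LBINT \<tau>. (LBINT y. g \<tau> y)) = (LBINT y. (LBINT \<tau>. g \<tau> y))"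
    using lborel_pair.Fubini_integral[OF int] by simp
  also have "\<dots> = (LBINT y. exp (Complex 1 y * of_real t) * Sy H (\<lambda>p. 1) b x z (Complex 1 y))"
    unfolding g_def integral_mult_left_zero JJ_def[symmetric] Sy_def P_def mult_1_left by (simp only: mult_ac)
  finally have "(LBINT \<tau>. (LBINT y. g \<tau> y)) = (LBINT y. exp (Complex 1 y * of_real t) * Sy H (\<lambda>p. 1) b x z (Complex 1 y))" .
  then show "(LBINT \<tau>:{0<..}. weight b x \<tau> * bromwich (\<lambda>p. EE \<tau> (z + \<alpha> * \<tau>) p * H p) t) = bromwich (Sy H (\<lambda>p. 1) b x z) t"
    unfolding set_lebesgue_integral_def inner unfolding bromwich_def
    using \<open>integrable lborel (\<lambda>\<tau>. \<integral>y. g \<tau> y \<partial>lborel)\<close> by (simp only: integral_divide_zero integral_Re)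
qed

end

section \<open>Decay of the symbol in space\<close>

context fractional_symbols
begin

text \<open>For z <= r the decay comes from \<open>JJ\<close> with N = 2: its power (r / 2)^(- 2
  \<nu> - 4 / \<delta>) meets the factor (r / 2)^(2 \<nu>). For z > r it comes from exp (- z Re k),
  again with the exponent 4 / \<delta>, while the normalized \<open>JJ\<close> is at most 1. The two
  cases combine to a bound in \<open>max r z\<close>.\<close>

lemma Sy_decay:
  assumes H: "transfer H" and nu: "0 < \<nu>" and c: "0 < c"
  shows "\<exists>K>0. \<forall>r>0. \<forall>z\<ge>0. \<forall>p. c \<le> Re p \<longrightarrow>
    (r / 2) powr (2 * \<nu>) / Gamma \<nu> * norm (Sy H (\<lambda>p. 1) (\<nu> + 1) r z p) \<le> (K * (max r z) powr (- 4 / \<delta>)) / (norm p)\<^sup>2"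
proof -
  have d0: "0 < 2 / \<delta>" using pos by simp
  obtain CH where CH: "0 < CH" "\<And>p. c \<le> Re p \<Longrightarrow> norm (H p) \<le> CH"
    using H c unfolding transfer_def by blast
  obtain K2 where K2: "0 < K2" "\<And>\<zeta> p. 0 < \<zeta> \<Longrightarrow> c \<le> Re p \<Longrightarrow> exp (- \<zeta> * Re (kk p)) \<le> K2 * \<zeta> powr (- 2 * 2 / \<delta>) * norm p powr (- 2)"
    using exp_kk_bound[of 2 c] c by auto
  define K1 where "K1 = KJ 2 * Gamma (\<nu> + 2 / \<delta>) / Gamma \<nu> * 2 powr (4 / \<delta>)"
  have G: "0 < Gamma \<nu>" "0 < Gamma (\<nu> + 2 / \<delta>)" using nu d0 by (auto intro!: Gamma_real_pos add_pos_pos)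
  have K1: "0 < K1" using G KJ_pos[of 2] by (simp add: K1_def)
  have "(r / 2) powr (2 * \<nu>) / Gamma \<nu> * norm (Sy H (\<lambda>p. 1) (\<nu> + 1) r z p) \<le> ((K1 + K2) * CH * (max r z) powr (- 4 / \<delta>)) / (norm p)\<^sup>2"
    if r: "0 < r" and z: "0 \<le> z" and p: "c \<le> Re p" for r z p
  proof -
    have p0: "0 < Re p" "0 < norm p" using p c half_plane_nonzero[OF c p] by auto
    have np: "norm p powr (- 2) = 1 / (norm p)\<^sup>2" using p0 by (simp add: powr_minus powr_numeral divide_inverse)
    let ?q = "(r / 2) powr (2 * \<nu>) / Gamma \<nu>"
    have q0: "0 \<le> ?q" using G by simp
    have "?q * norm (JJ (\<nu> + 1) r (mm p)) * norm (EE 0 z p) \<le> (K1 + K2) * (max r z) powr (- 4 / \<delta>) * norm p powr (- 2)"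
    proof (cases "z \<le> r")
      case True
      have "norm (JJ (\<nu> + 1) r (mm p)) \<le> KJ 2 * Gamma (\<nu> + 2 / \<delta>) * (r / 2) powr (- (2 * \<nu>) + - (4 / \<delta>)) * norm p powr (- 2)"
        using norm_JJ_mm[of 2 r p "\<nu> + 1"] r p0 nu by (simp add: algebra_simps)
      then have "?q * norm (JJ (\<nu> + 1) r (mm p)) \<le> ?q * (KJ 2 * Gamma (\<nu> + 2 / \<delta>) * (r / 2) powr (- (2 * \<nu>) + - (4 / \<delta>)) * norm p powr (- 2))"
        by (rule mult_left_mono[OF _ q0])
      also have "\<dots> = KJ 2 * Gamma (\<nu> + 2 / \<delta>) / Gamma \<nu> * ((r / 2) powr (2 * \<nu>) * (r / 2) powr (- (2 * \<nu>) + - (4 / \<delta>))) * norm p powr (- 2)"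
        by (simp add: mult_ac)
      also have "(r / 2) powr (2 * \<nu>) * (r / 2) powr (- (2 * \<nu>) + - (4 / \<delta>)) = 2 powr (4 / \<delta>) * r powr (- 4 / \<delta>)"
        unfolding powr_add[symmetric] using r by (simp add: powr_divide powr_minus field_simps)
      finally have "?q * norm (JJ (\<nu> + 1) r (mm p)) \<le> K1 * r powr (- 4 / \<delta>) * norm p powr (- 2)" by (simp add: K1_def mult_ac)
      then have "?q * norm (JJ (\<nu> + 1) r (mm p)) * norm (EE 0 z p) \<le> K1 * r powr (- 4 / \<delta>) * norm p powr (- 2) * 1"
        using norm_EE_le_1[of 0 z p] z p0 K1 by (intro mult_mono[of _ _ "norm (EE 0 z p)"]) auto
      also have "\<dots> \<le> (K1 + K2) * (max r z) powr (- 4 / \<delta>) * norm p powr (- 2)"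
        using True K2 K1 by (simp add: max_def mult_right_mono)
      finally show ?thesis .
    next
      case False
      then have z0: "0 < z" "max r z = z" using r by auto
      have "norm (JJ (\<nu> + 1) r (mm p)) \<le> (LBINT \<tau>:{0<..}. weight (\<nu> + 1) r \<tau> * exp (- \<tau> * Re (mm p)))"
        by (rule norm_JJ_le[OF r]) (use Re_mm p0 in auto)
      also have "\<dots> \<le> (LBINT \<tau>:{0<..}. weight (\<nu> + 1) r \<tau>)"
      proof (rule set_integral_mono)
        show "int_pos (\<lambda>\<tau>. weight (\<nu> + 1) r \<tau> * exp (- \<tau> * Re (mm p)))"
          by (rule weight_exp_integrable[OF r]) (use Re_mm p0 in auto)
        show "int_pos (weight (\<nu> + 1) r)" by (rule weight_integral[OF r]) (use nu in simp)
        show "weight (\<nu> + 1) r \<tau> * exp (- \<tau> * Re (mm p)) \<le> weight (\<nu> + 1) r \<tau>" if "\<tau> \<in> {0<..}" for \<tau>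
          using mult_left_mono[of "exp (- \<tau> * Re (mm p))" 1 "weight (\<nu> + 1) r \<tau>"] that Re_mm(2)[OF p0(1)] weight_nonneg by simp
      qed
      also have "\<dots> = Gamma \<nu> * (r / 2) powr (- (2 * \<nu>))" using weight_integral(2)[OF r, of "\<nu> + 1"] nu by simp
      finally have "?q * norm (JJ (\<nu> + 1) r (mm p)) \<le> ?q * (Gamma \<nu> * (r / 2) powr (- (2 * \<nu>)))"
        by (rule mult_left_mono[OF _ q0])
      also have "\<dots> = 1" using G r by (simp add: powr_minus)
      finally have "?q * norm (JJ (\<nu> + 1) r (mm p)) * norm (EE 0 z p) \<le> 1 * (K2 * z powr (- 4 / \<delta>) * norm p powr (- 2))"
        using K2(2)[OF z0(1) p] q0 by (intro mult_mono[of _ _ "norm (EE 0 z p)"]) (auto simp: norm_EE)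
      also have "\<dots> \<le> (K1 + K2) * (max r z) powr (- 4 / \<delta>) * norm p powr (- 2)"
        using K2 K1 z0 by (simp add: mult_right_mono)
      finally show ?thesis .
    qed
    then have "?q * norm (JJ (\<nu> + 1) r (mm p)) * norm (EE 0 z p) * norm (H p) \<le> (K1 + K2) * (max r z) powr (- 4 / \<delta>) * norm p powr (- 2) * CH"
      using CH(1) CH(2)[OF p] K1 K2 by (intro mult_mono[of _ _ "norm (H p)"]) auto
    then show ?thesis unfolding Sy_def norm_mult np by (simp add: mult_ac)
  qed
  then show ?thesis using K1 K2 CH by (intro exI[of _ "(K1 + K2) * CH"]) auto
qed

end

text \<open>\<open>bromwich F\<close> is a witness for the choice in \<open>inverse_laplace\<close>,
  so the chosen function has the right transform; uniqueness then identifies it with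
  \<open>bromwich F\<close> almost everywhere.\<close>

lemma inverse_laplace_bromwich:
  assumes F: "bromwich_symbol F" "symbol_real F" and G: "\<And>p. 0 < Re p \<Longrightarrow> G p = F p"
  shows "exp_integrable (inverse_laplace G)"
    "0 < q \<Longrightarrow> complex_of_real (rlap (inverse_laplace G) q) = F (of_real q)"
    "AE t in lborel. 0 < t \<longrightarrow> inverse_laplace G t = bromwich F t"
proof -
  have "laplace_transformable (bromwich F) \<and> (\<forall>p. 0 < Re p \<longrightarrow> laplace (bromwich F) p = G p)"
    using bromwich_exp_integrable[OF F(1)] laplace_bromwich[OF F] G by (simp add: laplace_transformable_iff)
  then have *: "laplace_transformable (inverse_laplace G) \<and> (\<forall>p. 0 < Re p \<longrightarrow> laplace (inverse_laplace G) p = G p)"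
    using someI[where P="\<lambda>f. laplace_transformable f \<and> (\<forall>p. 0 < Re p \<longrightarrow> laplace f p = G p)"] unfolding inverse_laplace_def by blast
  then show e: "exp_integrable (inverse_laplace G)" by (simp add: laplace_transformable_iff)
  have v: "complex_of_real (rlap (inverse_laplace G) q) = F (of_real q)" if "0 < q" for q
    using * G[of "of_real q"] that by (simp add: laplace_of_real[symmetric])
  then show "0 < q \<Longrightarrow> complex_of_real (rlap (inverse_laplace G) q) = F (of_real q)" .
  show "AE t in lborel. 0 < t \<longrightarrow> inverse_laplace G t = bromwich F t"
  proof (rule rlap_eq_imp_AE_eq[OF e bromwich_exp_integrable[OF F(1)]])
    fix q :: real assume "0 < q"
    from v[OF this] rlap_bromwich[OF F this] show "rlap (inverse_laplace G) q = rlap (bromwich F) q"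
      by (simp flip: of_real_eq_iff[where 'a=complex])
  qed
qed

lemma inverse_laplace_laplace:
  assumes "exp_integrable h"
  shows "exp_integrable (inverse_laplace (laplace h))" "0 < q \<Longrightarrow> rlap (inverse_laplace (laplace h)) q = rlap h q"
proof -
  have "laplace_transformable h \<and> (\<forall>p. 0 < Re p \<longrightarrow> laplace h p = laplace h p)"
    using assms by (simp add: laplace_transformable_iff)
  then have *: "laplace_transformable (inverse_laplace (laplace h)) \<and> (\<forall>p. 0 < Re p \<longrightarrow> laplace (inverse_laplace (laplace h)) p = laplace h p)"
    using someI[where P="\<lambda>f. laplace_transformable f \<and> (\<forall>p. 0 < Re p \<longrightarrow> laplace f p = laplace h p)"] unfolding inverse_laplace_def by blast
  then show "exp_integrable (inverse_laplace (laplace h))" by (simp add: laplace_transformable_iff)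
  assume "0 < q"
  with * have "laplace (inverse_laplace (laplace h)) (of_real q) = laplace h (of_real q)" by simp
  then show "rlap (inverse_laplace (laplace h)) q = rlap h q" by (simp add: laplace_of_real)
qed

section \<open>The temperature field: representation, equations and bounds\<close>

locale temperature = fractional_symbols +
  fixes \<beta> A \<nu> :: real and h :: "real \<Rightarrow> real"
  assumes beta: "2 * \<beta> = \<delta>" and A: "0 < A" and h: "exp_integrable h"
begin

abbreviation TF :: "real \<Rightarrow> real \<Rightarrow> real \<Rightarrow> real" where
  "TF \<equiv> temperature_field \<beta> a lam A \<alpha> \<nu> h"

text \<open>Since root = a k + lam / (2 a), the factor exp (lam y / (2 a^2)) with y = z + \<alpha>
  \<tau> turns the third inverse transform into that of exp (- y k). The representative chosen for
  the first factor is replaced by the continuous function \<open>bromwich (EE \<tau> 0)\<close>;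
  both convolutions are then continuous in t, and comparing transforms decides.\<close>

lemma g1_eq:
  assumes tau: "0 < \<tau>" and z: "0 \<le> z" and t: "0 < t"
  shows "exp (lam / (2 * a\<^sup>2) * (z + \<alpha> * \<tau>)) * g1 \<beta> a lam \<alpha> h t \<tau> z = bromwich (\<lambda>p. EE \<tau> (z + \<alpha> * \<tau>) p * laplace h p) t"
proof -
  define y where "y = z + \<alpha> * \<tau>"
  have y: "0 < y" using tau z pos by (simp add: y_def add_nonneg_pos)
  define e where "e = exp (lam / (2 * a\<^sup>2) * y)"
  have e0: "0 < e" by (simp add: e_def)
  define G1 where "G1 p = exp (- of_real \<tau> * p powr of_real \<delta>)" for p :: complex
  define G3 where "G3 p = exp (- of_real (y / a) * csqrt (p powr of_real \<delta> + of_real (lam\<^sup>2 / (4 * a\<^sup>2))))" for p :: complex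
  let ?f1 = "inverse_laplace G1" and ?f2 = "inverse_laplace (laplace h)" and ?f3 = "inverse_laplace G3"
  have s1: "bromwich_symbol (EE \<tau> 0)" by (rule EE_symbol1) (use tau in auto)
  have s3: "bromwich_symbol (\<lambda>p. of_real (1 / e) * EE 0 y p)" by (intro bromwich_symbol_cmult EE_symbol1) (use y in auto)
  have r3: "symbol_real (\<lambda>p. of_real (1 / e) * EE 0 y p)" using EE_real[of 0 y] by (auto simp: symbol_real_def)
  have G1: "G1 p = EE \<tau> 0 p" for p by (simp add: G1_def EE_def ss_def)
  have G3: "G3 p = of_real (1 / e) * EE 0 y p" for p
  proof -
    have "- of_real (y / a) * root p = of_real (- (lam / (2 * a\<^sup>2) * y)) + - (of_real 0 * ss p + of_real y * kk p)"
      unfolding root_kk using pos by (simp add: field_simps power2_eq_square)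
    then have "G3 p = exp (of_real (- (lam / (2 * a\<^sup>2) * y))) * EE 0 y p"
      unfolding G3_def EE_def exp_add[symmetric] root_def ss_def by simp
    moreover have "exp (- (lam / (2 * a\<^sup>2) * y)) = 1 / e" unfolding e_def by (simp only: exp_minus inverse_eq_divide)
    ultimately show ?thesis by (simp only: exp_of_real)
  qed
  note f1 = inverse_laplace_bromwich[OF s1 EE_real, of G1, OF G1]
  note f3 = inverse_laplace_bromwich[OF s3 r3, of G3, OF G3]
  note f2 = inverse_laplace_laplace[OF h]
  define X where "X = conv (bromwich (EE \<tau> 0)) ?f2"
  have inner: "conv ?f1 ?f2 = X"
    unfolding X_def by (rule ext) (rule conv_cong_AE[OF f1(1) bromwich_exp_integrable[OF s1] f2(1) f1(3)])
  have Xc: "continuous_on UNIV X" unfolding X_def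
    by (rule conv_continuous[OF bromwich_continuous[OF s1] bromwich_nonpos[OF s1] f2(1)])
  have X0: "t \<le> 0 \<Longrightarrow> X t = 0" for t unfolding X_def by (rule conv_nonpos)
  have Xi: "exp_integrable X" and Xr: "\<And>q. 0 < q \<Longrightarrow> rlap X q = rlap (bromwich (EE \<tau> 0)) q * rlap h q"
    unfolding X_def using conv_transform[OF bromwich_exp_integrable[OF s1] f2(1)] f2(2) by auto
  let ?Y = "conv X ?f3"
  have sy: "bromwich_symbol (EE \<tau> y)" by (rule EE_symbol1) (use tau y in auto)
  have sV: "bromwich_symbol (\<lambda>p. EE \<tau> y p * laplace h p)" by (rule bromwich_symbol_mult_laplace[OF sy h])
  have rV: "symbol_real (\<lambda>p. EE \<tau> y p * laplace h p)" by (rule symbol_real_mult[OF EE_real laplace_symbol_real])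
  have "e * ?Y t = bromwich (\<lambda>p. EE \<tau> y p * laplace h p) t"
  proof (rule rlap_eq_imp_eq[OF exp_integrable_mult[OF conv_transform(1)[OF Xi f3(1)]] bromwich_exp_integrable[OF sV] _ _ _ t])
    fix q :: real assume q: "0 < q"
    have EEsplit: "EE \<tau> y p = EE \<tau> 0 p * EE 0 y p" for p unfolding EE_def exp_add[symmetric] by simp
    have alg: "of_real e * (E1 * H * (of_real (1 / e) * E2)) = E1 * E2 * H" for E1 E2 H :: complex
      using e0 by (simp add: mult_ac)
    have "complex_of_real (e * (rlap (bromwich (EE \<tau> 0)) q * rlap h q * rlap ?f3 q)) = EE \<tau> y (of_real q) * laplace h (of_real q)"
      unfolding of_real_mult rlap_bromwich[OF s1 EE_real q] f3(2)[OF q] laplace_of_real EEsplit[of "of_real q"] by (rule alg)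
    also have "\<dots> = of_real (rlap (bromwich (\<lambda>p. EE \<tau> y p * laplace h p)) q)"
      by (rule rlap_bromwich[OF sV rV q, symmetric])
    finally have "complex_of_real (e * (rlap (bromwich (EE \<tau> 0)) q * rlap h q * rlap ?f3 q)) = of_real (rlap (bromwich (\<lambda>p. EE \<tau> y p * laplace h p)) q)" .
    then show "rlap (\<lambda>t. e * ?Y t) q = rlap (bromwich (\<lambda>p. EE \<tau> y p * laplace h p)) q"
      unfolding rlap_mult conv_transform(2)[OF Xi f3(1) q] Xr[OF q] by (simp only: of_real_eq_iff)
  next
    show "continuous_on {0<..} (\<lambda>t. e * ?Y t)"
      by (intro continuous_intros continuous_on_subset[OF conv_continuous[OF Xc X0 f3(1)]]) auto
    show "continuous_on {0<..} (bromwich (\<lambda>p. EE \<tau> y p * laplace h p))" by (rule bromwich_continuous[OF sV])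
  qed
  then show ?thesis
    unfolding g1_def beta inner[unfolded G1_def[abs_def]] y_def[symmetric] e_def G3_def[abs_def] .
qed

abbreviation BB :: "(complex \<Rightarrow> complex) \<Rightarrow> real \<Rightarrow> real \<Rightarrow> real \<Rightarrow> real \<Rightarrow> real" where
  "BB M b r z \<equiv> bromwich (Sy (laplace h) M b r z)"

definition cc :: "real \<Rightarrow> real" where "cc r = A * (r / 2) powr (2 * \<nu>) / Gamma \<nu>"

abbreviation one :: "complex \<Rightarrow> complex" where "one \<equiv> \<lambda>p. 1"

lemmas tH = transfer_laplace[OF h]

context
  assumes nu: "0 < \<nu>"
begin

lemma cc_pos: "0 < r \<Longrightarrow> 0 < cc r"
  using A nu by (simp add: cc_def Gamma_real_pos)

lemma nu1: "1 < \<nu> + 1" "1 < \<nu> + 1 + 1" "1 < \<nu> + 1 + 1 + 1"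
  using nu by auto

lemma TF_eq:
  assumes r: "0 < r" and z: "0 \<le> z" and t: "0 < t"
  shows "TF r z t = cc r * BB one (\<nu> + 1) r z t"
proof -
  have "(LBINT \<tau>:{0<..}. 1 / \<tau> powr (\<nu> + 1) * (r / 2) powr (2 * \<nu>) * exp (- (r\<^sup>2 / (4 * \<tau>))) *
        exp (lam / (2 * a\<^sup>2) * (z + \<alpha> * \<tau>)) * g1 \<beta> a lam \<alpha> h t \<tau> z)
     = (LBINT \<tau>:{0<..}. (r / 2) powr (2 * \<nu>) * (weight (\<nu> + 1) r \<tau> * bromwich (\<lambda>p. EE \<tau> (z + \<alpha> * \<tau>) p * laplace h p) t))"
  proof (rule set_lebesgue_integral_cong)
    show "\<forall>\<tau>. \<tau> \<in> {0<..} \<longrightarrow> 1 / \<tau> powr (\<nu> + 1) * (r / 2) powr (2 * \<nu>) * exp (- (r\<^sup>2 / (4 * \<tau>))) *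
        exp (lam / (2 * a\<^sup>2) * (z + \<alpha> * \<tau>)) * g1 \<beta> a lam \<alpha> h t \<tau> z
      = (r / 2) powr (2 * \<nu>) * (weight (\<nu> + 1) r \<tau> * bromwich (\<lambda>p. EE \<tau> (z + \<alpha> * \<tau>) p * laplace h p) t)"
    proof (intro allI impI)
      fix \<tau> :: real assume "\<tau> \<in> {0<..}"
      then have "exp (lam / (2 * a\<^sup>2) * (z + \<alpha> * \<tau>)) * g1 \<beta> a lam \<alpha> h t \<tau> z = bromwich (\<lambda>p. EE \<tau> (z + \<alpha> * \<tau>) p * laplace h p) t"
        by (intro g1_eq z t) simp
      moreover have "1 / \<tau> powr (\<nu> + 1) = \<tau> powr (- (\<nu> + 1))" by (simp only: powr_minus_divide)
      moreover have "x * P * e1 * E * G = P * (x * e1 * (E * G))" for x P e1 E G :: real by (simp only: mult_ac)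
      ultimately show "1 / \<tau> powr (\<nu> + 1) * (r / 2) powr (2 * \<nu>) * exp (- (r\<^sup>2 / (4 * \<tau>))) *
        exp (lam / (2 * a\<^sup>2) * (z + \<alpha> * \<tau>)) * g1 \<beta> a lam \<alpha> h t \<tau> z
      = (r / 2) powr (2 * \<nu>) * (weight (\<nu> + 1) r \<tau> * bromwich (\<lambda>p. EE \<tau> (z + \<alpha> * \<tau>) p * laplace h p) t)"
        unfolding weight_def by (simp only:)
    qed
  qed simp
  also have "\<dots> = (r / 2) powr (2 * \<nu>) * BB one (\<nu> + 1) r z t"
    unfolding set_integral_mult_right bromwich_subordination(2)[OF tH nu1(1) r z] ..
  finally show ?thesis unfolding temperature_field_def cc_def by simp
qed

text \<open>The multipliers of the field, of its first and second derivative in z, of its derivative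
  in t and of its Caputo derivative.\<close>

lemma poly_growths: "poly_growth one" "poly_growth (\<lambda>p. - kk p * one p)" "poly_growth (\<lambda>p. - kk p * (- kk p * one p))"
  "poly_growth (\<lambda>p. p * one p)" "poly_growth (\<lambda>p. ss p * one p)"
proof -
  have k: "poly_growth M \<Longrightarrow> poly_growth (\<lambda>p. - kk p * M p)" for M
    using poly_growth_mult[OF poly_growth_mult[OF poly_growth_const[of "-1"] poly_growth_kk], of M] by simp
  show "poly_growth one" "poly_growth (\<lambda>p. - kk p * one p)" "poly_growth (\<lambda>p. - kk p * (- kk p * one p))"
    "poly_growth (\<lambda>p. p * one p)" "poly_growth (\<lambda>p. ss p * one p)"
    by (intro k poly_growth_const poly_growth_mult poly_growth_id poly_growth_ss)+
qed

lemma one_real: "symbol_real one"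
  by (simp add: symbol_real_def)

lemma TF_caputo:
  assumes r: "0 < r" and z: "0 \<le> z" and t: "0 < t"
  shows "caputo \<delta> (TF r z) t = cc r * BB (\<lambda>p. ss p * one p) (\<nu> + 1) r z t" "caputo_differentiable \<delta> (TF r z) t"
proof -
  let ?F = "\<lambda>p. of_real (cc r) * Sy (laplace h) one (\<nu> + 1) r z p"
  have eq: "(\<lambda>p. M' p * (of_real (cc r) * Sy (laplace h) one (\<nu> + 1) r z p)) = (\<lambda>p. of_real (cc r) * Sy (laplace h) (\<lambda>p. M' p * one p) (\<nu> + 1) r z p)" for M'
    by (simp add: Sy_def mult_ac fun_eq_iff)
  have 1: "bromwich_symbol ?F" by (intro bromwich_symbol_cmult Sy_symbol tH poly_growths nu1 r z)
  have 2: "bromwich_symbol (\<lambda>p. p * ?F p)" unfolding eq by (intro bromwich_symbol_cmult Sy_symbol tH poly_growths nu1 r z)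
  have 3: "bromwich_symbol (\<lambda>p. ss p * ?F p)" unfolding eq by (intro bromwich_symbol_cmult Sy_symbol tH poly_growths nu1 r z)
  have 4: "symbol_real ?F" using Sy_real[OF tH one_real r] by (simp add: symbol_real_def)
  have 5: "TF r z t = bromwich ?F t" if "0 < t" for t unfolding TF_eq[OF r z that] bromwich_mult ..
  show "caputo \<delta> (TF r z) t = cc r * BB (\<lambda>p. ss p * one p) (\<nu> + 1) r z t"
    using caputo_bromwich(1)[OF 1 4 2 3 5 t] unfolding eq bromwich_mult .
  show "caputo_differentiable \<delta> (TF r z) t"
    by (rule caputo_bromwich(2)[OF 1 4 2 3 5 t])
qed

definition uz :: "real \<Rightarrow> real \<Rightarrow> real \<Rightarrow> real" where "uz r z t = cc r * BB (\<lambda>p. - kk p * one p) (\<nu> + 1) r z t"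
definition uzz :: "real \<Rightarrow> real \<Rightarrow> real \<Rightarrow> real" where "uzz r z t = cc r * BB (\<lambda>p. - kk p * (- kk p * one p)) (\<nu> + 1) r z t"
text \<open>The product rule for \<open>cc r\<close> times the inverse transform: the logarithmic
  derivative of \<open>cc\<close> is 2 \<nu> / r, and a derivative of \<open>JJ\<close> in r
  contributes - r / 2 and raises b by 1.\<close>

definition ur :: "real \<Rightarrow> real \<Rightarrow> real" where
  "ur r t = (2 * \<nu> / r) * (cc r * BB one (\<nu> + 1) r 0 t) - (r / 2) * (cc r * BB one (\<nu> + 1 + 1) r 0 t)"
definition urr :: "real \<Rightarrow> real \<Rightarrow> real" where
  "urr r t = (- 2 * \<nu> / r\<^sup>2) * (cc r * BB one (\<nu> + 1) r 0 t) + (2 * \<nu> / r) * ur r t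
     - (1 / 2) * (cc r * BB one (\<nu> + 1 + 1) r 0 t) - (r / 2) * ((2 * \<nu> / r) * (cc r * BB one (\<nu> + 1 + 1) r 0 t) - (r / 2) * (cc r * BB one (\<nu> + 1 + 1 + 1) r 0 t))"

lemma TF_z:
  assumes r: "0 < r" and z: "0 \<le> z" and t: "0 < t"
  shows "((\<lambda>y. TF r y t) has_real_derivative uz r z t) (at z within {0..})"
    "((\<lambda>y. uz r y t) has_real_derivative uzz r z t) (at z within {0..})"
proof -
  have "((\<lambda>y. cc r * BB one (\<nu> + 1) r y t) has_real_derivative uz r z t) (at z within {0..})"
    unfolding uz_def by (intro DERIV_cmult Sy_derivative_z tH poly_growths nu1 r z)
  then show "((\<lambda>y. TF r y t) has_real_derivative uz r z t) (at z within {0..})"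
    by (rule has_field_derivative_transform_within[OF _ zero_less_one]) (use z TF_eq[OF r _ t] in auto)
  show "((\<lambda>y. uz r y t) has_real_derivative uzz r z t) (at z within {0..})"
    unfolding uz_def uzz_def by (intro DERIV_cmult Sy_derivative_z tH poly_growths nu1 r z)
qed

lemma cc_BB_derivative:
  assumes r: "0 < r" and b: "1 < b"
  shows "((\<lambda>x. cc x * BB one b x 0 t) has_real_derivative (2 * \<nu> / r) * (cc r * BB one b r 0 t) - (r / 2) * (cc r * BB one (b + 1) r 0 t)) (at r)"
proof -
  have c: "(cc has_real_derivative (2 * \<nu> / r) * cc r) (at r)"
    unfolding cc_def using r Gamma_real_pos[OF nu] by (auto intro!: derivative_eq_intros simp: powr_diff field_simps)
  have B: "((\<lambda>x. BB one b x 0 t) has_real_derivative (- (r / 2) * BB one (b + 1) r 0 t)) (at r)"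
    by (rule Sy_derivative_x[OF tH poly_growths(1) b r]) simp
  show ?thesis using DERIV_mult[OF c B] by (simp add: algebra_simps)
qed

lemma TF_r:
  assumes r: "0 < r" and t: "0 < t"
  shows "((\<lambda>x. TF x 0 t) has_real_derivative ur r t) (at r)" "((\<lambda>x. ur x t) has_real_derivative urr r t) (at r)"
proof -
  have d: "((\<lambda>x. cc x * BB one (\<nu> + 1) x 0 t) has_real_derivative ur r t) (at r)"
    unfolding ur_def by (rule cc_BB_derivative[OF r nu1(1)])
  then show "((\<lambda>x. TF x 0 t) has_real_derivative ur r t) (at r)"
    by (rule has_field_derivative_transform_within_open[where S="{0<..}"]) (use r TF_eq[OF _ _ t] in auto)
  have d1: "((\<lambda>x. 2 * \<nu> / x) has_real_derivative (- 2 * \<nu> / r\<^sup>2)) (at r)" "((\<lambda>x. x / 2) has_real_derivative (1 / 2)) (at r)"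
    using r by (auto intro!: derivative_eq_intros simp: power2_eq_square)
  from DERIV_diff[OF DERIV_mult[OF d1(1) d] DERIV_mult[OF d1(2) cc_BB_derivative[OF r nu1(2)]]]
  show "((\<lambda>x. ur x t) has_real_derivative urr r t) (at r)"
    unfolding ur_def[abs_def] urr_def by (rule DERIV_cong) (simp add: algebra_simps)
qed

text \<open>Each derivative in z contributes a factor - k, so on the line the equation is the
  identity s = a^2 k^2 + lam k between symbols.\<close>

lemma TF_pde:
  assumes r: "0 < r" and z: "0 < z" and t: "0 < t"
  shows "caputo \<delta> (TF r z) t = a\<^sup>2 * uzz r z t - lam * uz r z t"
proof -
  let ?S = "\<lambda>M. Sy (laplace h) M (\<nu> + 1) r z"
  have sym: "bromwich_symbol (?S M)" if "poly_growth M" for M by (rule Sy_symbol[OF tH that nu1(1) r]) (use z in simp)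
  have "BB (\<lambda>p. ss p * one p) (\<nu> + 1) r z = bromwich (\<lambda>p. of_real (a\<^sup>2) * ?S (\<lambda>p. - kk p * (- kk p * one p)) p + of_real (- lam) * ?S (\<lambda>p. - kk p * one p) p)"
    by (rule bromwich_cong) (simp add: Sy_def kk_quadratic[symmetric] algebra_simps)
  then have "BB (\<lambda>p. ss p * one p) (\<nu> + 1) r z t = a\<^sup>2 * BB (\<lambda>p. - kk p * (- kk p * one p)) (\<nu> + 1) r z t + (- lam) * BB (\<lambda>p. - kk p * one p) (\<nu> + 1) r z t"
    by (simp only: bromwich_add[OF bromwich_symbol_cmult[OF sym[OF poly_growths(3)]] bromwich_symbol_cmult[OF sym[OF poly_growths(2)]]] bromwich_mult)
  then show ?thesis
    unfolding TF_caputo(1)[OF r less_imp_le[OF z] t] uzz_def uz_def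
    by (simp only: distrib_left mult.left_commute mult_minus_left diff_conv_add_uminus mult_minus_right)
qed

text \<open>\<open>JJ_recurrence\<close> is an identity for real arguments m, so the two sides are
  compared through their transforms on the positive axis rather than as symbols on the line.\<close>

lemma TF_boundary:
  assumes r: "0 < r" and t: "0 < t"
  shows "caputo \<delta> (TF r 0) t = urr r t + (1 - 2 * \<nu>) / r * ur r t + \<alpha> * uz r 0 t"
proof -
  let ?S = "\<lambda>M b. Sy (laplace h) M b r 0"
  have sym: "bromwich_symbol (?S M b)" if "poly_growth M" "1 < b" for M b by (rule Sy_symbol[OF tH that r]) simp
  have rl: "symbol_real (?S M b)" if "symbol_real M" for M b by (rule Sy_real[OF tH that r])
  let ?F1 = "\<lambda>p. of_real (- (\<nu> + 1)) * ?S one (\<nu> + 1 + 1) p" and ?F2 = "\<lambda>p. of_real (r\<^sup>2 / 4) * ?S one (\<nu> + 1 + 1 + 1) p"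
    and ?F3 = "\<lambda>p. of_real \<alpha> * ?S (\<lambda>p. - kk p * one p) (\<nu> + 1) p"
  have s1: "bromwich_symbol ?F1" "bromwich_symbol ?F2" "bromwich_symbol ?F3"
    by (intro bromwich_symbol_cmult sym poly_growths nu1)+
  have s12: "bromwich_symbol (\<lambda>p. ?F1 p + ?F2 p)" by (intro bromwich_symbol_add s1)
  have sF: "bromwich_symbol (\<lambda>p. (?F1 p + ?F2 p) + ?F3 p)" by (intro bromwich_symbol_add s12 s1)
  have rk: "symbol_real (\<lambda>p. - kk p * one p)" "symbol_real (\<lambda>p. ss p * one p)"
    using symbol_real_kk symbol_real_ss by (simp_all add: symbol_real_def)
  have rF: "symbol_real (\<lambda>p. (?F1 p + ?F2 p) + ?F3 p)"
    using rl[OF one_real, of "\<nu> + 1 + 1"] rl[OF one_real, of "\<nu> + 1 + 1 + 1"] rl[OF rk(1), of "\<nu> + 1"]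
    unfolding symbol_real_def by (auto intro!: Reals_add Reals_mult)
  have s0: "bromwich_symbol (?S (\<lambda>p. ss p * one p) (\<nu> + 1))" by (intro sym poly_growths nu1)
  have "BB (\<lambda>p. ss p * one p) (\<nu> + 1) r 0 t = bromwich (\<lambda>p. (?F1 p + ?F2 p) + ?F3 p) t"
  proof (rule rlap_eq_imp_eq[OF bromwich_exp_integrable[OF s0] bromwich_exp_integrable[OF sF] _ bromwich_continuous[OF s0] bromwich_continuous[OF sF] t])
    fix q :: real assume q: "0 < q"
    have "mm (of_real q) \<in> \<real>" using symbol_real_mm q by (simp add: symbol_real_def)
    then obtain m where m: "mm (of_real q) = of_real m" by (elim Reals_cases)
    have m0: "0 < m" using Re_mm(2)[of "of_real q"] q unfolding m by simp
    have ssm: "ss (of_real q) = of_real m - of_real \<alpha> * kk (of_real q)" using m unfolding mm_def by (simp add: eq_diff_eq)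
    have bb: "\<nu> + 1 + 2 = \<nu> + 1 + 1 + 1" by simp
    have "complex_of_real (rlap (BB (\<lambda>p. ss p * one p) (\<nu> + 1) r 0) q) = ?S (\<lambda>p. ss p * one p) (\<nu> + 1) (of_real q)"
      by (rule rlap_bromwich[OF s0 rl[OF rk(2)] q])
    also have "\<dots> = (of_real m * JJ (\<nu> + 1) r (of_real m) - of_real \<alpha> * kk (of_real q) * JJ (\<nu> + 1) r (of_real m)) * EE 0 0 (of_real q) * laplace h (of_real q)"
      unfolding Sy_def m ssm by (simp add: algebra_simps)
    also have "\<dots> = (?F1 (of_real q) + ?F2 (of_real q)) + ?F3 (of_real q)"
      unfolding JJ_recurrence[OF r m0] Sy_def m bb by (simp add: algebra_simps)
    also have "\<dots> = complex_of_real (rlap (bromwich (\<lambda>p. (?F1 p + ?F2 p) + ?F3 p)) q)"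
      by (rule rlap_bromwich[OF sF rF q, symmetric])
    finally show "rlap (BB (\<lambda>p. ss p * one p) (\<nu> + 1) r 0) q = rlap (bromwich (\<lambda>p. (?F1 p + ?F2 p) + ?F3 p)) q"
      by (simp only: of_real_eq_iff)
  qed
  also have "\<dots> = - (\<nu> + 1) * BB one (\<nu> + 1 + 1) r 0 t + (r\<^sup>2 / 4) * BB one (\<nu> + 1 + 1 + 1) r 0 t + \<alpha> * BB (\<lambda>p. - kk p * one p) (\<nu> + 1) r 0 t"
    unfolding bromwich_add[OF s12 s1(3)] bromwich_add[OF s1(1,2)] bromwich_mult ..
  finally have eq: "BB (\<lambda>p. ss p * one p) (\<nu> + 1) r 0 t = \<dots>" .
  \<comment> \<open>The terms with \<open>B0\<close> cancel because r^(2 \<nu>) solves the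
    homogeneous equation C'' + (1 - 2 \<nu>) C' / r = 0; the other coefficients are those of the
    recurrence with b = \<nu> + 1.\<close>
  have "C * (- (\<nu> + 1) * B1 + (r\<^sup>2 / 4) * B2 + \<alpha> * Bk)
    = (- 2 * \<nu> / r\<^sup>2) * (C * B0) + (2 * \<nu> / r) * ((2 * \<nu> / r) * (C * B0) - (r / 2) * (C * B1)) - (1 / 2) * (C * B1) - (r / 2) * ((2 * \<nu> / r) * (C * B1) - (r / 2) * (C * B2))
      + (1 - 2 * \<nu>) / r * ((2 * \<nu> / r) * (C * B0) - (r / 2) * (C * B1)) + \<alpha> * (C * Bk)" for C B0 B1 B2 Bk :: real
    using r by (simp add: power2_eq_square field_simps)
  then show ?thesis
    unfolding TF_caputo(1)[OF r order_refl t] eq urr_def ur_def uz_def .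
qed

text \<open>Decay in space together with arbitrarily slow exponential growth in time; both the limit
  at infinity and the majorant away from the origin are read off from this one bound.\<close>

lemma TF_bound:
  assumes c: "0 < c"
  shows "\<exists>K>0. \<forall>r>0. \<forall>z\<ge>0. \<forall>t>0. \<bar>TF r z t\<bar> \<le> K * (max r z) powr (- 4 / \<delta>) * exp (c * t)"
proof -
  obtain K where K: "0 < K" "\<And>r z p. 0 < r \<Longrightarrow> 0 \<le> z \<Longrightarrow> c \<le> Re p \<Longrightarrow>
    (r / 2) powr (2 * \<nu>) / Gamma \<nu> * norm (Sy (laplace h) one (\<nu> + 1) r z p) \<le> (K * (max r z) powr (- 4 / \<delta>)) / (norm p)\<^sup>2"
    using Sy_decay[OF tH nu c] by blast
  have "\<bar>TF r z t\<bar> \<le> (A * K / (2 * c)) * (max r z) powr (- 4 / \<delta>) * exp (c * t)" if r: "0 < r" and z: "0 \<le> z" and t: "0 < t" for r z t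
  proof -
    define q where "q = (r / 2) powr (2 * \<nu>) / Gamma \<nu>"
    have q: "0 < q" unfolding q_def using r nu by (simp add: Gamma_real_pos)
    have "\<bar>BB one (\<nu> + 1) r z t\<bar> \<le> (K * (max r z) powr (- 4 / \<delta>) / q) / (2 * c) * exp (c * t)"
    proof (rule bromwich_abs_le[OF Sy_symbol[OF tH poly_growths(1) nu1(1) r z] c])
      fix p assume "Re p = c"
      then have "q * norm (Sy (laplace h) one (\<nu> + 1) r z p) \<le> (K * (max r z) powr (- 4 / \<delta>)) / (norm p)\<^sup>2"
        unfolding q_def by (intro K(2) r z) simp
      then have "norm (Sy (laplace h) one (\<nu> + 1) r z p) \<le> (K * (max r z) powr (- 4 / \<delta>)) / (norm p)\<^sup>2 / q"
        using q by (simp only: pos_le_divide_eq mult.commute)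
      then show "norm (Sy (laplace h) one (\<nu> + 1) r z p) \<le> (K * (max r z) powr (- 4 / \<delta>) / q) / (norm p)\<^sup>2"
        by (simp only: divide_divide_eq_left mult.commute)
    qed
    then have "(A * q) * \<bar>BB one (\<nu> + 1) r z t\<bar> \<le> (A * q) * ((K * (max r z) powr (- 4 / \<delta>) / q) / (2 * c) * exp (c * t))"
      using A q by (intro mult_left_mono) auto
    also have "\<dots> = (A * K / (2 * c)) * (max r z) powr (- 4 / \<delta>) * exp (c * t)"
      using q by (simp add: field_simps)
    finally show ?thesis
      unfolding TF_eq[OF r z t] cc_def times_divide_eq_right[symmetric] q_def[symmetric] abs_mult
      using A q by simp
  qed
  then show ?thesis using A K c by (intro exI[of _ "A * K / (2 * c)"]) auto
qed

lemma TF_infinity: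
  assumes t: "0 < t"
  shows "((\<lambda>(r, z). TF r z t) \<longlongrightarrow> 0) (inf at_infinity (principal ({0<..} \<times> {0..})))"
proof -
  obtain K where K: "0 < K" "\<And>r z. 0 < r \<Longrightarrow> 0 \<le> z \<Longrightarrow> \<bar>TF r z t\<bar> \<le> K * (max r z) powr (- 4 / \<delta>) * exp (1 * t)"
    using TF_bound[of 1] t by auto
  have neg: "- 4 / \<delta> < 0" using pos by simp
  show ?thesis
  proof (rule Lim_null_comparison)
    show "\<forall>\<^sub>F x in inf at_infinity (principal ({0<..} \<times> {0..})). norm (case x of (r, z) \<Rightarrow> TF r z t) \<le> K * (norm x / 2) powr (- 4 / \<delta>) * exp t"
      unfolding eventually_inf_principal
    proof (intro always_eventually allI impI)
      fix x :: "real \<times> real" assume "x \<in> {0<..} \<times> {0..}"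
      then obtain r z where x: "x = (r, z)" and r: "0 < r" and z: "0 \<le> z" by auto
      have "norm (r, z) \<le> 2 * max r z" using norm_Pair_le[of r z] r z by (auto simp: max_def)
      moreover have "0 < norm (r, z)" using r by (simp add: zero_prod_def)
      ultimately have "(max r z) powr (- 4 / \<delta>) \<le> (norm (r, z) / 2) powr (- 4 / \<delta>)"
        using neg by (intro powr_mono2') auto
      then have "K * (max r z) powr (- 4 / \<delta>) * exp t \<le> K * (norm (r, z) / 2) powr (- 4 / \<delta>) * exp t"
        using K by (intro mult_right_mono mult_left_mono) auto
      then show "norm (case x of (r, z) \<Rightarrow> TF r z t) \<le> K * (norm x / 2) powr (- 4 / \<delta>) * exp t"
        using K(2)[OF r z] x by simp
    qed
    have "filterlim (\<lambda>x::real \<times> real. (1 / 2) * norm x) at_top at_infinity"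
      by (intro filterlim_tendsto_pos_mult_at_top[OF tendsto_const _ filterlim_norm_at_top]) simp
    then have "((\<lambda>x::real \<times> real. (norm x / 2) powr (- 4 / \<delta>)) \<longlongrightarrow> 0) at_infinity"
      using tendsto_neg_powr[OF neg] by simp
    then have "((\<lambda>x::real \<times> real. K * (norm x / 2) powr (- 4 / \<delta>) * exp t) \<longlongrightarrow> K * 0 * exp t) at_infinity"
      by (intro tendsto_intros)
    then show "((\<lambda>x::real \<times> real. K * (norm x / 2) powr (- 4 / \<delta>) * exp t) \<longlongrightarrow> 0) (inf at_infinity (principal ({0<..} \<times> {0..})))"
      by (intro tendsto_mono[OF inf_le1]) simp
  qed
qed

text \<open>The inverse transform is continuous on the whole line and 0 for t <= 0, so the initial
  value is attained.\<close>

lemma TF_zero: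
  assumes r: "0 < r" and z: "0 \<le> z"
  shows "(TF r z \<longlongrightarrow> 0) (at_right 0)"
proof -
  have s: "bromwich_symbol (Sy (laplace h) one (\<nu> + 1) r z)" by (rule Sy_symbol[OF tH poly_growths(1) nu1(1) r z])
  have "isCont (BB one (\<nu> + 1) r z) 0"
    using bromwich_continuous[OF s, of UNIV] by (simp add: continuous_on_eq_continuous_at)
  then have "(BB one (\<nu> + 1) r z \<longlongrightarrow> 0) (at_right 0)"
    unfolding isCont_def bromwich_nonpos[OF s order_refl] by (rule tendsto_mono[OF at_le, rotated]) auto
  then have "((\<lambda>t. cc r * BB one (\<nu> + 1) r z t) \<longlongrightarrow> cc r * 0) (at_right 0)" by (intro tendsto_intros)
  then have l: "((\<lambda>t. cc r * BB one (\<nu> + 1) r z t) \<longlongrightarrow> 0) (at_right 0)" by simp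
  have "\<forall>\<^sub>F t in at_right 0. cc r * BB one (\<nu> + 1) r z t = TF r z t"
    unfolding eventually_at_right_field using TF_eq[OF r z] by (intro exI[of _ 1]) auto
  with l show ?thesis by (rule Lim_transform_eventually)
qed

lemma TF_dominated:
  assumes "0 < \<rho>"
  shows "laplace_dominated {(r, z). 0 < r \<and> 0 \<le> z \<and> \<rho> \<le> r\<^sup>2 + z\<^sup>2} (\<lambda>(r, z). TF r z)"
proof (rule laplace_dominated_exp)
  fix c :: real assume c: "0 < c"
  obtain K where K0: "0 < K" "\<forall>r>0. \<forall>z\<ge>0. \<forall>t>0. \<bar>TF r z t\<bar> \<le> K * (max r z) powr (- 4 / \<delta>) * exp (c * t)"
    using TF_bound[OF c] by (elim exE conjE)
  have K: "0 < K" "\<And>r z t. 0 < r \<Longrightarrow> 0 \<le> z \<Longrightarrow> 0 < t \<Longrightarrow> \<bar>TF r z t\<bar> \<le> K * (max r z) powr (- 4 / \<delta>) * exp (c * t)"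
    using K0 by simp_all
  have neg: "- 4 / \<delta> \<le> 0" using pos by simp
  have "\<bar>TF r z t\<bar> \<le> (K * (sqrt (\<rho> / 2)) powr (- 4 / \<delta>)) * exp (c * t)" if r: "0 < r" "0 \<le> z" "\<rho> \<le> r\<^sup>2 + z\<^sup>2" "0 < t" for r z t
  proof -
    have "r\<^sup>2 \<le> (max r z)\<^sup>2" "z\<^sup>2 \<le> (max r z)\<^sup>2" using r by (auto intro!: power_mono)
    then have "\<rho> / 2 \<le> (max r z)\<^sup>2" using r(3) by linarith
    then have "sqrt (\<rho> / 2) \<le> max r z" using r by (intro real_le_lsqrt) auto
    then have "(max r z) powr (- 4 / \<delta>) \<le> (sqrt (\<rho> / 2)) powr (- 4 / \<delta>)"
      using assms neg by (intro powr_mono2') auto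
    then have "K * (max r z) powr (- 4 / \<delta>) * exp (c * t) \<le> (K * (sqrt (\<rho> / 2)) powr (- 4 / \<delta>)) * exp (c * t)"
      using K by (intro mult_right_mono mult_left_mono) auto
    then show ?thesis using K(2)[OF r(1,2,4)] by linarith
  qed
  then show "\<exists>C. \<forall>i\<in>{(r, z). 0 < r \<and> 0 \<le> z \<and> \<rho> \<le> r\<^sup>2 + z\<^sup>2}. \<forall>t>0. \<bar>(case i of (r, z) \<Rightarrow> TF r z) t\<bar> \<le> C * exp (c * t)"
    by (intro exI[of _ "K * (sqrt (\<rho> / 2)) powr (- 4 / \<delta>)"]) auto
qed

text \<open>Stronger than \<open>laplace_dominated\<close> and stable under sums and bounded
  coefficients, so that the derivatives in r can be treated term by term.\<close>

definition exp_bounded :: "'i set \<Rightarrow> ('i \<Rightarrow> real \<Rightarrow> real) \<Rightarrow> bool" where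
  "exp_bounded I F \<longleftrightarrow> (\<forall>c>0. \<exists>C\<ge>0. \<forall>i\<in>I. \<forall>t>0. \<bar>F i t\<bar> \<le> C * exp (c * t))"

lemma exp_bounded_dominated: "exp_bounded I F \<Longrightarrow> laplace_dominated I F"
  unfolding exp_bounded_def by (rule laplace_dominated_exp) blast

lemma exp_bounded_add: "exp_bounded I F \<Longrightarrow> exp_bounded I G \<Longrightarrow> exp_bounded I (\<lambda>i t. F i t + G i t)"
  unfolding exp_bounded_def
proof (intro allI impI)
  fix c :: real assume *: "\<forall>c>0. \<exists>C\<ge>0. \<forall>i\<in>I. \<forall>t>0. \<bar>F i t\<bar> \<le> C * exp (c * t)" "\<forall>c>0. \<exists>C\<ge>0. \<forall>i\<in>I. \<forall>t>0. \<bar>G i t\<bar> \<le> C * exp (c * t)" "0 < c"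
  obtain C D where C: "0 \<le> C" "\<forall>i\<in>I. \<forall>t>0. \<bar>F i t\<bar> \<le> C * exp (c * t)" and D: "0 \<le> D" "\<forall>i\<in>I. \<forall>t>0. \<bar>G i t\<bar> \<le> D * exp (c * t)"
    using *(1)[THEN spec, THEN mp, OF *(3)] *(2)[THEN spec, THEN mp, OF *(3)] by blast
  have "\<bar>F i t + G i t\<bar> \<le> (C + D) * exp (c * t)" if "i \<in> I" "0 < t" for i t
    using C(2) D(2) that abs_triangle_ineq[of "F i t" "G i t"] unfolding distrib_right by fastforce
  then show "\<exists>C\<ge>0. \<forall>i\<in>I. \<forall>t>0. \<bar>F i t + G i t\<bar> \<le> C * exp (c * t)" using C D by (intro exI[of _ "C + D"]) auto
qed

lemma exp_bounded_mult: "exp_bounded I F \<Longrightarrow> (\<And>i. i \<in> I \<Longrightarrow> \<bar>g i\<bar> \<le> D) \<Longrightarrow> exp_bounded I (\<lambda>i t. g i * F i t)"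
  unfolding exp_bounded_def
proof (intro allI impI)
  fix c :: real assume *: "\<forall>c>0. \<exists>C\<ge>0. \<forall>i\<in>I. \<forall>t>0. \<bar>F i t\<bar> \<le> C * exp (c * t)" "\<And>i. i \<in> I \<Longrightarrow> \<bar>g i\<bar> \<le> D" "0 < c"
  from *(1)[THEN spec, THEN mp, OF *(3)] obtain C where C: "0 \<le> C" "\<forall>i\<in>I. \<forall>t>0. \<bar>F i t\<bar> \<le> C * exp (c * t)" by blast
  have "\<bar>g i * F i t\<bar> \<le> (\<bar>D\<bar> * C) * exp (c * t)" if "i \<in> I" "0 < t" for i t
  proof -
    have "\<bar>g i\<bar> * \<bar>F i t\<bar> \<le> \<bar>D\<bar> * (C * exp (c * t))" using C(2) that *(2)[OF that(1)] by (intro mult_mono) auto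
    then show ?thesis by (simp add: abs_mult)
  qed
  then show "\<exists>C\<ge>0. \<forall>i\<in>I. \<forall>t>0. \<bar>g i * F i t\<bar> \<le> C * exp (c * t)" using C by (intro exI[of _ "\<bar>D\<bar> * C"]) auto
qed

lemma compact_positive:
  assumes "compact K" "K \<subseteq> {0<..}"
  obtains x0 x1 :: real where "0 < x0" "x0 \<le> x1" "\<And>x. x \<in> K \<Longrightarrow> x0 \<le> x \<and> x \<le> x1"
proof (cases "K = {}")
  case False
  obtain x0 x1 where "x0 \<in> K" "\<forall>x\<in>K. x0 \<le> x" "x1 \<in> K" "\<forall>x\<in>K. x \<le> x1"
    using compact_attains_inf[OF assms(1) False] compact_attains_sup[OF assms(1) False] by blast
  then show ?thesis using assms(2) by (intro that[of x0 x1]) auto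
qed (use that[of 1 1] in auto)

lemma exp_bounded_BB:
  assumes x0: "0 < x0" "x0 \<le> x1" and M: "poly_growth M" and b: "1 < b" and I: "\<And>i. i \<in> I \<Longrightarrow> x0 \<le> R i \<and> R i \<le> x1 \<and> 0 \<le> Z i"
  shows "exp_bounded I (\<lambda>i t. cc (R i) * BB M b (R i) (Z i) t)"
proof (rule exp_bounded_mult[where D="cc x1"])
  show "\<bar>cc (R i)\<bar> \<le> cc x1" if "i \<in> I" for i
  proof -
    have r: "0 < R i" "R i \<le> x1" using I[OF that] x0 by auto
    have "(R i / 2) powr (2 * \<nu>) \<le> (x1 / 2) powr (2 * \<nu>)" using r nu by (intro powr_mono2) auto
    then have "cc (R i) \<le> cc x1" unfolding cc_def using A nu by (intro divide_right_mono mult_left_mono) (auto simp: Gamma_real_pos less_imp_le)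
    then show ?thesis using cc_pos[OF r(1)] by simp
  qed
  show "exp_bounded I (\<lambda>i t. BB M b (R i) (Z i) t)" unfolding exp_bounded_def
  proof (intro allI impI)
    fix c :: real assume c: "0 < c"
    obtain C where C: "0 < C" "\<And>x z p. x0 \<le> x \<Longrightarrow> 0 \<le> z \<Longrightarrow> c \<le> Re p \<Longrightarrow> norm (Sy (laplace h) M b x z p) \<le> C / (norm p)\<^sup>2"
      using Sy_bound[OF tH M b x0(1) c] by blast
    have "\<bar>BB M b (R i) (Z i) t\<bar> \<le> C / (2 * c) * exp (c * t)" if "i \<in> I" for i t
      by (rule bromwich_abs_le[OF Sy_symbol[OF tH M b] c C(2)]) (use I[OF that] x0 in auto)
    then show "\<exists>C\<ge>0. \<forall>i\<in>I. \<forall>t>0. \<bar>BB M b (R i) (Z i) t\<bar> \<le> C * exp (c * t)"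
      using C c by (intro exI[of _ "C / (2 * c)"]) auto
  qed
qed

lemma uz_dominated:
  assumes "compact K" "K \<subseteq> {0<..} \<times> {0..}"
  shows "laplace_dominated K (\<lambda>(r, z). uz r z)" "laplace_dominated K (\<lambda>(r, z). uzz r z)"
proof -
  obtain x0 x1 where x: "0 < x0" "x0 \<le> x1" "\<And>x. x \<in> fst ` K \<Longrightarrow> x0 \<le> x \<and> x \<le> x1"
    by (rule compact_positive[OF compact_continuous_image[OF continuous_on_fst[OF continuous_on_id] assms(1)]]) (use assms(2) in auto)
  have I: "x0 \<le> fst i \<and> fst i \<le> x1 \<and> 0 \<le> snd i" if "i \<in> K" for i using x(3)[of "fst i"] that assms(2) by auto
  have "exp_bounded K (\<lambda>i t. cc (fst i) * BB M (\<nu> + 1) (fst i) (snd i) t)" if "poly_growth M" for M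
    by (rule exp_bounded_BB[OF x(1,2) that nu1(1) I])
  from this[OF poly_growths(2)] this[OF poly_growths(3)]
  show "laplace_dominated K (\<lambda>(r, z). uz r z)" "laplace_dominated K (\<lambda>(r, z). uzz r z)"
    by (auto simp: uz_def[abs_def] uzz_def[abs_def] case_prod_beta' intro!: exp_bounded_dominated)
qed

lemma ur_dominated:
  assumes "compact K" "K \<subseteq> {0<..}"
  shows "laplace_dominated K ur" "laplace_dominated K urr"
proof -
  obtain x0 x1 where x: "0 < x0" "x0 \<le> x1" "\<And>x. x \<in> K \<Longrightarrow> x0 \<le> x \<and> x \<le> x1"
    by (rule compact_positive[OF assms]) auto
  have B: "exp_bounded K (\<lambda>r t. cc r * BB one b r 0 t)" if "1 < b" for b
    by (rule exp_bounded_BB[OF x(1,2) poly_growths(1) that]) (use x(3) in auto)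
  have i: "\<bar>2 * \<nu> / r\<bar> \<le> 2 * \<nu> / x0" "\<bar>- 2 * \<nu> / r\<^sup>2\<bar> \<le> 2 * \<nu> / x0\<^sup>2" "\<bar>- (r / 2)\<bar> \<le> x1" if "r \<in> K" for r
    using x(1) x(3)[OF that] nu by (auto simp: abs_mult intro!: divide_left_mono power_mono mult_pos_pos)
  have 1: "exp_bounded K (\<lambda>r t. (2 * \<nu> / r) * (cc r * BB one b r 0 t) + (- (r / 2)) * (cc r * BB one (b + 1) r 0 t))" if "1 < b" for b
    by (intro exp_bounded_add exp_bounded_mult[OF B i(1)] exp_bounded_mult[OF B i(3)]) (use that in auto)
  have u: "exp_bounded K ur"
    using 1[OF nu1(1)] by (simp add: ur_def[abs_def])
  then show "laplace_dominated K ur" by (rule exp_bounded_dominated)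
  have "exp_bounded K (\<lambda>r t. ((- 2 * \<nu> / r\<^sup>2) * (cc r * BB one (\<nu> + 1) r 0 t) + (2 * \<nu> / r) * ur r t)
     + ((- 1 / 2) * (cc r * BB one (\<nu> + 1 + 1) r 0 t) + (- (r / 2)) * ((2 * \<nu> / r) * (cc r * BB one (\<nu> + 1 + 1) r 0 t) + (- (r / 2)) * (cc r * BB one (\<nu> + 1 + 1 + 1) r 0 t))))"
    by (intro exp_bounded_add exp_bounded_mult[OF B[OF nu1(1)] i(2)] exp_bounded_mult[OF u i(1)] exp_bounded_mult[OF 1[OF nu1(2)] i(3)]
        exp_bounded_mult[OF B[OF nu1(2)], where D="1 / 2"]) auto
  then have "exp_bounded K urr" by (simp add: urr_def[abs_def] algebra_simps)
  then show "laplace_dominated K urr" by (rule exp_bounded_dominated)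
qed

end

end

section \<open>Approximate identities\<close>

lemma exp_integrable_bounded:
  assumes "continuous_on UNIV f" "\<And>t. 0 < t \<Longrightarrow> \<bar>f t\<bar> \<le> B"
  shows "exp_integrable f"
proof (rule exp_integrable_exp)
  have "f \<in> borel_measurable borel" by (rule borel_measurable_continuous_onI[OF assms(1)])
  then show "(\<lambda>t. ind t * f t) \<in> borel_measurable borel" by simp
  have B: "0 \<le> B" using assms(2)[of 1] by simp
  show "\<exists>C. \<forall>t>0. \<bar>f t\<bar> \<le> C * exp (c * t)" if "0 < c" for c
  proof (intro exI[of _ B] allI impI)
    fix t :: real assume "0 < t"
    with assms(2)[OF this] mult_left_mono[of 1 "exp (c * t)" B] B that show "\<bar>f t\<bar> \<le> B * exp (c * t)" by simp
  qed
qed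

lemma rlap_mono:
  assumes "exp_integrable f" "exp_integrable g" "0 < p" "\<And>t. 0 < t \<Longrightarrow> f t \<le> g t"
  shows "rlap f p \<le> rlap g p"
  unfolding rlap_def using assms by (intro set_integral_mono exp_integrableD) auto

lemma rlap_nonneg:
  assumes "\<And>t. 0 < t \<Longrightarrow> 0 \<le> f t"
  shows "0 \<le> rlap f p"
  unfolding rlap_def set_lebesgue_integral_def using assms by (intro integral_nonneg_AE) (auto simp: indicator_def)

text \<open>Density of bounded continuous functions in the weighted L^1 space. Clipping h at level N
  costs little by dominated convergence. The cut-off h is an almost everywhere limit of continuous
  functions, and these are clipped at the same level, which gives an integrable majorant for the
  second limit.\<close>

lemma exp_integrable_approx:
  assumes h: "exp_integrable h" and p: "0 < p" and e: "0 < e"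
  shows "\<exists>f B. continuous_on UNIV f \<and> (\<forall>t. \<bar>f t\<bar> \<le> B) \<and> rlap (\<lambda>t. \<bar>h t - f t\<bar>) p < e"
proof -
  define h' where "h' t = ind t * h t" for t
  have hm[measurable]: "h' \<in> borel_measurable borel" unfolding h'_def[abs_def] by (rule exp_integrable_measurable[OF h])
  define w where "w t = ind t * exp (- p * t)" for t :: real
  have wm[measurable]: "w \<in> borel_measurable borel" by (simp add: w_def[abs_def])
  have w0: "0 \<le> w t" for t by (simp add: w_def)
  have wi: "integrable lborel (\<lambda>t. w t * h' t)"
    using exp_integrableD[OF h p] unfolding set_integrable_def by (rule back_subst[of "integrable lborel"]) (auto simp: w_def h'_def indicator_def)
  have "exp_integrable (\<lambda>t. 1)" by (rule exp_integrable_bounded[of _ 1]) auto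
  from exp_integrableD[OF this p] have w1: "integrable lborel w"
    unfolding set_integrable_def by (rule back_subst[of "integrable lborel"]) (auto simp: w_def)
  define cl where "cl n x = max (- real n) (min (real n) x)" for n and x :: real
  have clm[measurable]: "cl n \<in> borel_measurable borel" for n unfolding cl_def[abs_def] by simp
  have cll: "(\<lambda>n. cl n x) \<longlonglongrightarrow> x" for x
  proof (rule tendsto_eventually)
    obtain N :: nat where "\<bar>x\<bar> < real N" using reals_Archimedean2 by blast
    then show "\<forall>\<^sub>F n in sequentially. cl n x = x"
      unfolding eventually_sequentially cl_def by (intro exI[of _ N]) (auto simp: max_def min_def)
  qed
  have "(\<lambda>n. \<integral>t. w t * \<bar>h' t - cl n (h' t)\<bar> \<partial>lborel) \<longlonglongrightarrow> (LBINT (t::real). 0)"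
  proof (rule integral_dominated_convergence[where w="\<lambda>t. \<bar>w t * h' t\<bar>"])
    show "AE t in lborel. (\<lambda>n. w t * \<bar>h' t - cl n (h' t)\<bar>) \<longlonglongrightarrow> 0"
    proof (rule AE_I2)
      fix t
      have "(\<lambda>n. w t * \<bar>h' t - cl n (h' t)\<bar>) \<longlonglongrightarrow> w t * \<bar>h' t - h' t\<bar>" by (intro tendsto_intros cll)
      then show "(\<lambda>n. w t * \<bar>h' t - cl n (h' t)\<bar>) \<longlonglongrightarrow> 0" by simp
    qed
    have "\<bar>x - cl n x\<bar> \<le> \<bar>x\<bar>" for n x by (auto simp: cl_def max_def min_def)
    then show "AE t in lborel. norm (w t * \<bar>h' t - cl n (h' t)\<bar>) \<le> \<bar>w t * h' t\<bar>" for n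
      using w0 by (intro AE_I2) (simp add: abs_mult mult_left_mono)
    show "integrable lborel (\<lambda>t. \<bar>w t * h' t\<bar>)" using wi by (rule integrable_abs)
  qed auto
  then have "(\<lambda>n. \<integral>t. w t * \<bar>h' t - cl n (h' t)\<bar> \<partial>lborel) \<longlonglongrightarrow> 0" by simp
  from order_tendstoD(2)[OF this, of "e / 2"] e obtain N where N: "(LBINT t. w t * \<bar>h' t - cl N (h' t)\<bar>) < e / 2"
    unfolding eventually_sequentially by auto
  have "h' \<in> borel_measurable lebesgue" using hm by (intro measurable_completion) simp
  then have "h' measurable_on UNIV" by (rule lebesgue_measurable_imp_measurable_on_real) simp
  then obtain Z g where Z: "negligible Z" and g: "\<And>n. continuous_on UNIV (g n)" "\<And>x. x \<notin> Z \<Longrightarrow> (\<lambda>n. g n x) \<longlonglongrightarrow> h' x"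
    unfolding measurable_on_def by auto
  have gm[measurable]: "g n \<in> borel_measurable borel" for n by (rule borel_measurable_continuous_onI[OF g(1)])
  have clc: "continuous_on UNIV (cl N)" unfolding cl_def[abs_def] by (intro continuous_intros)
  have clb: "\<bar>cl N x\<bar> \<le> real N" for x by (auto simp: cl_def max_def min_def)
  have "AE x in lebesgue. x \<notin> Z" using Z by (simp add: AE_not_in negligible_iff_null_sets)
  then have AE: "AE x in lborel. x \<notin> Z" by (simp add: AE_completion_iff)
  have "(\<lambda>n. \<integral>t. w t * \<bar>cl N (h' t) - cl N (g n t)\<bar> \<partial>lborel) \<longlonglongrightarrow> (LBINT (t::real). 0)"
  proof (rule integral_dominated_convergence[where w="\<lambda>t. w t * (2 * real N)"])
    show "AE t in lborel. (\<lambda>n. w t * \<bar>cl N (h' t) - cl N (g n t)\<bar>) \<longlonglongrightarrow> 0" using AE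
    proof eventually_elim
      case (elim t)
      have "isCont (cl N) (h' t)" using clc by (simp add: continuous_on_eq_continuous_at)
      then have "(\<lambda>n. w t * \<bar>cl N (h' t) - cl N (g n t)\<bar>) \<longlonglongrightarrow> w t * \<bar>cl N (h' t) - cl N (h' t)\<bar>"
        by (intro tendsto_intros isCont_tendsto_compose[of _ "cl N"] g(2) elim)
      then show ?case by simp
    qed
    show "AE t in lborel. norm (w t * \<bar>cl N (h' t) - cl N (g n t)\<bar>) \<le> w t * (2 * real N)" for n
    proof (rule AE_I2)
      fix t have "\<bar>cl N (h' t) - cl N (g n t)\<bar> \<le> 2 * real N" using clb[of "h' t"] clb[of "g n t"] by linarith
      then show "norm (w t * \<bar>cl N (h' t) - cl N (g n t)\<bar>) \<le> w t * (2 * real N)" using w0 by (simp add: abs_mult mult_left_mono)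
    qed
    show "integrable lborel (\<lambda>t. w t * (2 * real N))" using w1 by (rule integrable_mult_left)
  qed auto
  then have "(\<lambda>n. \<integral>t. w t * \<bar>cl N (h' t) - cl N (g n t)\<bar> \<partial>lborel) \<longlonglongrightarrow> 0" by simp
  from order_tendstoD(2)[OF this, of "e / 2"] e obtain n where n: "(LBINT t. w t * \<bar>cl N (h' t) - cl N (g n t)\<bar>) < e / 2"
    unfolding eventually_sequentially by auto
  define f where "f t = cl N (g n t)" for t
  have fc: "continuous_on UNIV f" unfolding f_def[abs_def]
    by (rule continuous_on_compose2[OF clc g(1)]) auto
  have fm[measurable]: "f \<in> borel_measurable borel" unfolding f_def[abs_def] by simp
  have i: "integrable lborel (\<lambda>t. w t * \<bar>f1 t - f2 t\<bar>)"
    if [measurable]: "f1 \<in> borel_measurable borel" "f2 \<in> borel_measurable borel" and le: "\<And>t. \<bar>f1 t - f2 t\<bar> \<le> 2 * real N + \<bar>h' t\<bar>" for f1 f2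
  proof (rule Bochner_Integration.integrable_bound)
    show "integrable lborel (\<lambda>t. w t * (2 * real N) + \<bar>w t * h' t\<bar>)" using w1 wi by (intro Bochner_Integration.integrable_add integrable_mult_left integrable_abs)
    show "AE t in lborel. norm (w t * \<bar>f1 t - f2 t\<bar>) \<le> norm (w t * (2 * real N) + \<bar>w t * h' t\<bar>)"
    proof (rule AE_I2)
      fix t have "w t * \<bar>f1 t - f2 t\<bar> \<le> w t * (2 * real N + \<bar>h' t\<bar>)" by (rule mult_left_mono[OF le w0])
      then show "norm (w t * \<bar>f1 t - f2 t\<bar>) \<le> norm (w t * (2 * real N) + \<bar>w t * h' t\<bar>)"
        using w0[of t] by (simp add: abs_mult distrib_left)
    qed
  qed simp
  have I: "integrable lborel (\<lambda>t. w t * \<bar>h' t - cl N (h' t)\<bar>)" "integrable lborel (\<lambda>t. w t * \<bar>cl N (h' t) - f t\<bar>)" "integrable lborel (\<lambda>t. w t * \<bar>h' t - f t\<bar>)"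
  proof -
    show "integrable lborel (\<lambda>t. w t * \<bar>h' t - cl N (h' t)\<bar>)"
    proof (rule i)
      fix t show "\<bar>h' t - cl N (h' t)\<bar> \<le> 2 * real N + \<bar>h' t\<bar>" using clb[of "h' t"] by linarith
    qed simp_all
    show "integrable lborel (\<lambda>t. w t * \<bar>cl N (h' t) - f t\<bar>)"
    proof (rule i)
      fix t show "\<bar>cl N (h' t) - f t\<bar> \<le> 2 * real N + \<bar>h' t\<bar>" using clb[of "h' t"] clb[of "g n t"] unfolding f_def by linarith
    qed simp_all
    show "integrable lborel (\<lambda>t. w t * \<bar>h' t - f t\<bar>)"
    proof (rule i)
      fix t show "\<bar>h' t - f t\<bar> \<le> 2 * real N + \<bar>h' t\<bar>" using clb[of "g n t"] unfolding f_def by linarith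
    qed simp_all
  qed
  have "rlap (\<lambda>t. \<bar>h t - f t\<bar>) p = (LBINT t. w t * \<bar>h' t - f t\<bar>)"
    unfolding rlap_def set_lebesgue_integral_def by (rule Bochner_Integration.integral_cong) (auto simp: w_def h'_def indicator_def)
  also have "\<dots> \<le> (LBINT t. w t * \<bar>h' t - cl N (h' t)\<bar> + w t * \<bar>cl N (h' t) - f t\<bar>)"
  proof (rule integral_mono[OF I(3) Bochner_Integration.integrable_add[OF I(1,2)]])
    fix t
    have "w t * \<bar>h' t - f t\<bar> \<le> w t * (\<bar>h' t - cl N (h' t)\<bar> + \<bar>cl N (h' t) - f t\<bar>)" by (rule mult_left_mono[OF _ w0]) linarith
    then show "w t * \<bar>h' t - f t\<bar> \<le> w t * \<bar>h' t - cl N (h' t)\<bar> + w t * \<bar>cl N (h' t) - f t\<bar>" by (simp only: distrib_left)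
  qed
  also have "\<dots> < e" unfolding Bochner_Integration.integral_add[OF I(1,2)] using N n unfolding f_def by linarith
  finally show ?thesis using fc clb by (intro exI[of _ f] exI[of _ "real N"]) (auto simp: f_def)
qed

text \<open>Abstract form of the kernels as (r, z) tends to the origin along a sequence. Mass is
  measured by the transform: its limit 1, together with the tail bound whose factor
  \<open>E n\<close> tends to 0, forces concentration at t = 0.\<close>

locale approximate_identity =
  fixes G :: "nat \<Rightarrow> real \<Rightarrow> real" and E :: "nat \<Rightarrow> real"
  assumes G_continuous: "continuous_on UNIV (G n)" and G_nonpos: "t \<le> 0 \<Longrightarrow> G n t = 0"
    and G_integrable: "exp_integrable (G n)" and G_nonneg: "0 \<le> G n t"
    and G_tail: "0 < t \<Longrightarrow> G n t \<le> E n * exp t / t\<^sup>2" and E_tendsto: "E \<longlonglongrightarrow> 0"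
    and G_mass: "0 < p \<Longrightarrow> rlap (G n) p \<le> 1" and G_tendsto: "0 < p \<Longrightarrow> (\<lambda>n. rlap (G n) p) \<longlonglongrightarrow> 1"
begin

lemma G_measurable [measurable]: "G n \<in> borel_measurable borel"
  by (rule borel_measurable_continuous_onI[OF G_continuous])

lemma E_nonneg: "0 \<le> E n"
proof -
  have "0 \<le> E n * exp 1" using G_tail[of 1 n] G_nonneg[of n 1] by simp
  then show ?thesis by (simp add: zero_le_mult_iff)
qed

lemma G_bounded: "\<exists>B. \<forall>s>0. exp (- s) * G n s \<le> B"
proof -
  have "compact (G n ` {0..1})" by (rule compact_continuous_image[OF continuous_on_subset[OF G_continuous]]) auto
  then obtain B where B: "\<And>s. s \<in> {0..1} \<Longrightarrow> \<bar>G n s\<bar> \<le> B" using bounded_real compact_imp_bounded by (metis image_eqI)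
  have "exp (- s) * G n s \<le> \<bar>B\<bar> + E n" if s: "0 < s" for s
  proof (cases "s \<le> 1")
    case True
    then have "exp (- s) * G n s \<le> 1 * \<bar>B\<bar>" using B[of s] s G_nonneg by (intro mult_mono) auto
    then show ?thesis using E_nonneg[of n] by simp
  next
    case False
    have "exp (- s) * G n s \<le> exp (- s) * (E n * exp s / s\<^sup>2)" by (rule mult_left_mono[OF G_tail[OF s]]) simp
    also have "\<dots> = E n / s\<^sup>2" by (simp add: exp_minus)
    also have "\<dots> \<le> E n / 1" using False E_nonneg by (intro divide_left_mono) auto
    finally show ?thesis by simp
  qed
  then show ?thesis by blast
qed

text \<open>The integral is split at a small d. Up to d the factor |k s - L| is at most e and the
  mass at most 1; beyond d the tail bound gives E n / d^2 times a fixed integral; the mass defect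
  contributes |L| times its distance from 1. The weight exp (- 2 s) is shared, one half for G and
  one half for k.\<close>

lemma G_test:
  assumes k: "int_pos (\<lambda>s. exp (- s) * k s)" and L: "(k \<longlongrightarrow> L) (at_right 0)"
  shows "(\<lambda>n. LBINT s:{0<..}. exp (- 2 * s) * (G n s * k s)) \<longlonglongrightarrow> L"
proof -
  let ?I = "\<lambda>f. LBINT s:{0<..}. f s"
  have Gi: "int_pos (\<lambda>s. exp (- 2 * s) * G n s)" for n by (rule exp_integrableD[OF G_integrable]) simp
  have ee: "exp (- 2 * s) = exp (- s) * exp (- s)" for s :: real by (simp flip: exp_add)
  have e1: "int_pos (\<lambda>s::real. exp (- s))" using exp_integrableD[OF exp_integrable_bounded[of "\<lambda>t. 1" 1], of 1] by simp
  have ki: "int_pos (\<lambda>s. exp (- s) * \<bar>k s - L\<bar>)"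
  proof -
    have "int_pos (\<lambda>s. \<bar>exp (- s) * k s - L * exp (- s)\<bar>)"
      by (intro set_integrable_abs set_integral_diff k set_integrable_mult_right e1)
    then show ?thesis by (rule back_subst[of "\<lambda>f. int_pos f"]) (auto simp: fun_eq_iff abs_mult right_diff_distrib[symmetric] mult.commute[of L])
  qed
  define C where "C = ?I (\<lambda>s. exp (- s) * \<bar>k s - L\<bar>)"
  have GK: "int_pos (\<lambda>s. exp (- 2 * s) * G n s * \<bar>k s - L\<bar>)" for n
  proof -
    obtain B where B: "\<forall>s>0. exp (- s) * G n s \<le> B" using G_bounded by blast
    show ?thesis
    proof (rule set_integrable_bound)
      show "int_pos (\<lambda>s. B * (exp (- s) * \<bar>k s - L\<bar>))" by (rule set_integrable_mult_right[OF ki])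
      have [measurable]: "(\<lambda>s. ind s * (exp (- s) * \<bar>k s - L\<bar>)) \<in> borel_measurable borel"
        using ki unfolding set_integrable_def by (simp add: borel_measurable_integrable)
      have "(\<lambda>s. exp (- s) * G n s * (ind s * (exp (- s) * \<bar>k s - L\<bar>))) \<in> borel_measurable borel" by measurable
      then show "set_borel_measurable lborel {0<..} (\<lambda>s. exp (- 2 * s) * G n s * \<bar>k s - L\<bar>)"
        unfolding set_borel_measurable_def ee by (simp add: mult_ac)
      show "AE s in lborel. s \<in> {0<..} \<longrightarrow> norm (exp (- 2 * s) * G n s * \<bar>k s - L\<bar>) \<le> norm (B * (exp (- s) * \<bar>k s - L\<bar>))"
      proof (intro AE_I2 impI)
        fix s :: real assume "s \<in> {0<..}"
        with B have b: "exp (- s) * G n s \<le> B" by simp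
        have B0: "0 \<le> B" using b G_nonneg[of n s] by (meson exp_ge_zero mult_nonneg_nonneg order_trans)
        have "(exp (- s) * G n s) * (exp (- s) * \<bar>k s - L\<bar>) \<le> B * (exp (- s) * \<bar>k s - L\<bar>)" by (rule mult_right_mono[OF b]) simp
        then show "norm (exp (- 2 * s) * G n s * \<bar>k s - L\<bar>) \<le> norm (B * (exp (- s) * \<bar>k s - L\<bar>))"
          unfolding ee using B0 G_nonneg[of n s] by (simp add: abs_mult mult_ac)
      qed
    qed
  qed
  have key: "\<bar>?I (\<lambda>s. exp (- 2 * s) * (G n s * k s)) - L\<bar> \<le> e + E n * (C / d\<^sup>2) + \<bar>L\<bar> * \<bar>rlap (G n) 2 - 1\<bar>"
    if d: "0 < d" and near: "\<And>s. 0 < s \<Longrightarrow> s \<le> d \<Longrightarrow> \<bar>k s - L\<bar> \<le> e" for n d e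
  proof -
    have e0: "0 \<le> e" using near[of d] d by simp
    have GK': "int_pos (\<lambda>s. exp (- 2 * s) * G n s * (k s - L))"
    proof (rule set_integrable_bound[OF GK])
      have [measurable]: "(\<lambda>s. ind s * (exp (- s) * k s)) \<in> borel_measurable borel"
        using k unfolding set_integrable_def by (simp add: borel_measurable_integrable)
      have "(\<lambda>s. exp (- s) * G n s * (ind s * (exp (- s) * k s)) - ind s * (exp (- 2 * s) * G n s * L)) \<in> borel_measurable borel" by measurable
      then show "set_borel_measurable lborel {0<..} (\<lambda>s. exp (- 2 * s) * G n s * (k s - L))"
        unfolding set_borel_measurable_def ee by (simp add: mult_ac right_diff_distrib)
    qed (use G_nonneg in \<open>auto simp: abs_mult\<close>)
    have "?I (\<lambda>s. exp (- 2 * s) * (G n s * k s)) = ?I (\<lambda>s. exp (- 2 * s) * G n s * (k s - L) + L * (exp (- 2 * s) * G n s))"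
      by (rule set_lebesgue_integral_cong) (auto simp: algebra_simps)
    also have "\<dots> = ?I (\<lambda>s. exp (- 2 * s) * G n s * (k s - L)) + L * rlap (G n) 2"
      unfolding rlap_def set_integral_add(2)[OF GK' set_integrable_mult_right[OF Gi]] set_integral_mult_right ..
    finally have 1: "?I (\<lambda>s. exp (- 2 * s) * (G n s * k s)) - L = ?I (\<lambda>s. exp (- 2 * s) * G n s * (k s - L)) + L * (rlap (G n) 2 - 1)"
      by (simp add: algebra_simps)
    have "\<bar>?I (\<lambda>s. exp (- 2 * s) * G n s * (k s - L))\<bar> \<le> ?I (\<lambda>s. \<bar>exp (- 2 * s) * G n s * (k s - L)\<bar>)"
      using set_integral_norm_bound[OF GK'] by simp
    also have "\<dots> \<le> ?I (\<lambda>s. e * (exp (- 2 * s) * G n s) + (E n / d\<^sup>2) * (exp (- s) * \<bar>k s - L\<bar>))"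
    proof (rule set_integral_mono)
      show "int_pos (\<lambda>s. \<bar>exp (- 2 * s) * G n s * (k s - L)\<bar>)" by (rule set_integrable_abs[OF GK'])
      show "int_pos (\<lambda>s. e * (exp (- 2 * s) * G n s) + (E n / d\<^sup>2) * (exp (- s) * \<bar>k s - L\<bar>))"
        by (intro set_integral_add set_integrable_mult_right Gi ki)
      fix s :: real assume "s \<in> {0<..}"
      then have s: "0 < s" by simp
      have G0: "0 \<le> exp (- 2 * s) * G n s" using G_nonneg by simp
      have a: "\<bar>exp (- 2 * s) * G n s * (k s - L)\<bar> = exp (- 2 * s) * G n s * \<bar>k s - L\<bar>" using G_nonneg by (simp add: abs_mult)
      show "\<bar>exp (- 2 * s) * G n s * (k s - L)\<bar> \<le> e * (exp (- 2 * s) * G n s) + (E n / d\<^sup>2) * (exp (- s) * \<bar>k s - L\<bar>)"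
      proof (cases "s \<le> d")
        case True
        have "exp (- 2 * s) * G n s * \<bar>k s - L\<bar> \<le> exp (- 2 * s) * G n s * e" by (rule mult_left_mono[OF near[OF s True] G0])
        moreover have "0 \<le> (E n / d\<^sup>2) * (exp (- s) * \<bar>k s - L\<bar>)" using E_nonneg by simp
        ultimately show ?thesis unfolding a mult.commute[of e] by linarith
      next
        case False
        have "exp (- s) * G n s \<le> exp (- s) * (E n * exp s / s\<^sup>2)" by (rule mult_left_mono[OF G_tail[OF s]]) simp
        also have "\<dots> = E n / s\<^sup>2" by (simp add: exp_minus)
        also have "\<dots> \<le> E n / d\<^sup>2" using False d E_nonneg by (intro divide_left_mono power_mono mult_pos_pos) auto
        finally have "(exp (- s) * G n s) * (exp (- s) * \<bar>k s - L\<bar>) \<le> (E n / d\<^sup>2) * (exp (- s) * \<bar>k s - L\<bar>)" by (rule mult_right_mono) simp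
        moreover have "exp (- 2 * s) * G n s * \<bar>k s - L\<bar> = (exp (- s) * G n s) * (exp (- s) * \<bar>k s - L\<bar>)" unfolding ee by (simp only: mult_ac)
        moreover have "0 \<le> e * (exp (- 2 * s) * G n s)" using e0 G0 by (rule mult_nonneg_nonneg)
        ultimately show ?thesis unfolding a by linarith
      qed
    qed
    also have "\<dots> = e * rlap (G n) 2 + (E n / d\<^sup>2) * C"
      unfolding set_integral_add(2)[OF set_integrable_mult_right[OF Gi] set_integrable_mult_right[OF ki]] set_integral_mult_right rlap_def C_def ..
    also have "\<dots> \<le> e * 1 + E n * (C / d\<^sup>2)" using G_mass[of 2 n] e0 by (intro add_mono mult_left_mono) auto
    finally have 2: "\<bar>?I (\<lambda>s. exp (- 2 * s) * G n s * (k s - L))\<bar> \<le> e + E n * (C / d\<^sup>2)" by simp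
    show ?thesis unfolding 1 using 2 abs_triangle_ineq[of "?I (\<lambda>s. exp (- 2 * s) * G n s * (k s - L))" "L * (rlap (G n) 2 - 1)"]
      unfolding abs_mult by linarith
  qed
  show ?thesis
  proof (rule LIMSEQ_I)
    fix e :: real assume e: "0 < e"
    have "\<forall>\<^sub>F s in at_right 0. \<bar>k s - L\<bar> < e / 2" using tendstoD[OF L, of "e / 2"] e by (simp add: dist_real_def)
    then obtain d0 where d0: "0 < d0" "\<And>s. 0 < s \<Longrightarrow> s < d0 \<Longrightarrow> \<bar>k s - L\<bar> < e / 2" unfolding eventually_at_right_field by auto
    define d where "d = d0 / 2"
    have d: "0 < d" "\<And>s. 0 < s \<Longrightarrow> s \<le> d \<Longrightarrow> \<bar>k s - L\<bar> \<le> e / 2" using d0(1) d0(2)[THEN less_imp_le] by (auto simp: d_def)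
    have "(\<lambda>n. e / 2 + E n * (C / d\<^sup>2) + \<bar>L\<bar> * \<bar>rlap (G n) 2 - 1\<bar>) \<longlonglongrightarrow> e / 2 + 0 * (C / d\<^sup>2) + \<bar>L\<bar> * \<bar>1 - 1\<bar>"
      by (intro tendsto_intros E_tendsto G_tendsto) simp
    then have "\<forall>\<^sub>F n in sequentially. e / 2 + E n * (C / d\<^sup>2) + \<bar>L\<bar> * \<bar>rlap (G n) 2 - 1\<bar> < e"
      by (rule order_tendstoD(2)) (use e in simp)
    then obtain N where "\<And>n. N \<le> n \<Longrightarrow> e / 2 + E n * (C / d\<^sup>2) + \<bar>L\<bar> * \<bar>rlap (G n) 2 - 1\<bar> < e" unfolding eventually_sequentially by auto
    then show "\<exists>N. \<forall>n\<ge>N. norm (?I (\<lambda>s. exp (- 2 * s) * (G n s * k s)) - L) < e"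
      using key[OF d] by (intro exI[of _ N]) (fastforce intro: order.strict_trans1)
  qed
qed

text \<open>\<open>G_test\<close> is applied to the reflection of h at t. The factor exp (2 s)
  cancels the weight there, and continuity of h at t becomes the right limit of the reflected
  function at 0.\<close>

lemma convolution_tendsto:
  assumes h: "exp_integrable h" and t: "0 < t" and c: "isCont h t"
  shows "(\<lambda>n. conv (G n) h t) \<longlonglongrightarrow> h t"
proof -
  define k where "k s = indicator {0<..<t} s * (exp (2 * s) * h (t - s))" for s
  have hi: "integrable lborel (\<lambda>s. indicator {0<..<t} s * h s)" by (rule exp_integrable_integrable_Ioo[OF h])
  have hi': "integrable lborel (\<lambda>s. indicator {0<..<t} s * h (t - s))"
  proof -
    have "integrable lborel (\<lambda>s. indicator {0<..<t} (t + (- 1) * s) * h (t + (- 1) * s))"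
      by (rule lborel_integrable_real_affine[OF hi]) simp
    moreover have "indicator {0<..<t} (t + (- 1) * s) * h (t + (- 1) * s) = indicator {0<..<t} s * h (t - s)" for s
      by (auto simp: indicator_def)
    ultimately show ?thesis by (simp only:)
  qed
  have k: "int_pos (\<lambda>s. exp (- s) * k s)"
    unfolding set_integrable_def
  proof (rule Bochner_Integration.integrable_bound)
    show "integrable lborel (\<lambda>s. exp t * (indicator {0<..<t} s * h (t - s)))" using hi' by (rule integrable_mult_right)
    have [measurable]: "(\<lambda>s. indicator {0<..<t} s * h (t - s)) \<in> borel_measurable borel" using hi' by (simp add: borel_measurable_integrable)
    have "(\<lambda>s. exp s * (indicator {0<..<t} s * h (t - s))) \<in> borel_measurable borel" by measurable
    moreover have eq: "ind s *\<^sub>R (exp (- s) * k s) = exp s * (indicator {0<..<t} s * h (t - s))" for s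
    proof -
      have "exp (2 * s) = exp s * exp s" by (simp flip: exp_add)
      then show ?thesis by (auto simp: k_def indicator_def exp_minus)
    qed
    ultimately show "(\<lambda>s. ind s *\<^sub>R (exp (- s) * k s)) \<in> borel_measurable lborel" by simp
    show "AE s in lborel. norm (ind s *\<^sub>R (exp (- s) * k s)) \<le> norm (exp t * (indicator {0<..<t} s * h (t - s)))"
      unfolding eq by (intro AE_I2) (auto simp: indicator_def abs_mult intro!: mult_right_mono)
  qed
  have L: "(k \<longlongrightarrow> h t) (at_right 0)"
  proof -
    have "((\<lambda>s. exp (2 * s) * h (t - s)) \<longlongrightarrow> exp (2 * 0) * h (t - 0)) (at_right 0)"
      using c by (intro tendsto_intros isCont_tendsto_compose[of _ h]) auto
    then have l: "((\<lambda>s. exp (2 * s) * h (t - s)) \<longlongrightarrow> h t) (at_right 0)" by simp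
    have "\<forall>\<^sub>F s in at_right 0. exp (2 * s) * h (t - s) = k s"
      unfolding eventually_at_right_field by (intro exI[of _ t]) (use t in \<open>auto simp: k_def\<close>)
    with l show ?thesis by (rule Lim_transform_eventually)
  qed
  have "(LBINT s:{0<..}. exp (- 2 * s) * (G n s * k s)) = conv (G n) h t" for n
  proof -
    have "conv (G n) h t = conv h (G n) t" by (rule conv_commute)
    also have "\<dots> = (LBINT s. indicator {0..t} s *\<^sub>R (h (t - s) * G n s))" unfolding laplace_convolution_def set_lebesgue_integral_def ..
    also have "\<dots> = (LBINT s. ind s *\<^sub>R (exp (- 2 * s) * (G n s * k s)))"
    proof (rule integral_cong_AE)
      have [measurable]: "(\<lambda>s. indicator {0<..<t} s * h (t - s)) \<in> borel_measurable borel" using hi' by (simp add: borel_measurable_integrable)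
      have eq: "ind s *\<^sub>R (exp (- 2 * s) * (G n s * k s)) = G n s * (indicator {0<..<t} s * h (t - s))" for s
        by (auto simp: k_def indicator_def exp_minus)
      \<comment> \<open>\<open>conv\<close> includes the endpoint s = t, where h 0 appears; this
        concerns a single point and is discarded almost everywhere. At s = 0 the kernel
        vanishes.\<close>
      have eq2: "indicator {0..t} s *\<^sub>R (h (t - s) * G n s) = G n s * (indicator {0<..<t} s * h (t - s)) + indicator {t} s * (h 0 * G n t)" for s
        using G_nonpos[of 0 n] t by (auto simp: indicator_def)
      show "(\<lambda>s. ind s *\<^sub>R (exp (- 2 * s) * (G n s * k s))) \<in> borel_measurable lborel" unfolding eq by simp
      show "(\<lambda>s. indicator {0..t} s *\<^sub>R (h (t - s) * G n s)) \<in> borel_measurable lborel" unfolding eq2 by simp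
      show "AE s in lborel. indicator {0..t} s *\<^sub>R (h (t - s) * G n s) = ind s *\<^sub>R (exp (- 2 * s) * (G n s * k s))"
        using AE_lborel_singleton[of t]
      proof eventually_elim
        case (elim s)
        then have "indicator {t} s * (h 0 * G n t) = 0" by simp
        then show ?case unfolding eq eq2 by (simp only: add_0_right)
      qed
    qed
    finally show ?thesis unfolding set_lebesgue_integral_def ..
  qed
  with G_test[OF k L] show ?thesis by simp
qed

lemma G_mass_interval:
  assumes "0 < q" "0 < t"
  shows "(LBINT s:{0..t}. G n s) \<le> exp (q * t)"
proof -
  have "(LBINT s:{0..t}. G n s) = (LBINT s. indicator {0..t} s * G n s)" by (simp add: set_lebesgue_integral_def)
  also have "\<dots> \<le> (LBINT s. exp (q * t) * (ind s * (exp (- q * s) * G n s)))"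
  proof (rule integral_mono)
    show "integrable lborel (\<lambda>s. indicator {0..t} s * G n s)"
      using borel_integrable_atLeastAtMost'[OF continuous_on_subset[OF G_continuous], of 0 t n] by (simp add: set_integrable_def)
    show "integrable lborel (\<lambda>s. exp (q * t) * (ind s * (exp (- q * s) * G n s)))"
      using exp_integrableD[OF G_integrable assms(1), of n] by (simp add: set_integrable_def)
    fix s
    show "indicator {0..t} s * G n s \<le> exp (q * t) * (ind s * (exp (- q * s) * G n s))"
    proof (cases "0 < s \<and> s \<le> t")
      case True
      then have "1 \<le> exp (q * t) * exp (- q * s)" using assms by (simp flip: exp_add)
      from mult_right_mono[OF this G_nonneg[of n s]] True show ?thesis by (simp add: mult_ac)
    next
      case False
      then have "indicator {0..t} s * G n s = 0" using G_nonpos[of s n] by (auto simp: indicator_def)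
      then show ?thesis using G_nonneg[of n s] by (auto simp: indicator_def)
    qed
  qed
  also have "\<dots> = exp (q * t) * rlap (G n) q" by (simp add: rlap_def set_lebesgue_integral_def)
  also have "\<dots> \<le> exp (q * t) * 1" by (rule mult_left_mono[OF G_mass[OF assms(1)]]) simp
  finally show ?thesis by simp
qed

text \<open>The convolution is at most B times the mass of G on (0, t), hence at most B exp (p t /
  2), so the pointwise limit can be integrated by dominated convergence in t.\<close>

lemma convolution_mean_bounded:
  assumes f: "continuous_on UNIV f" "\<And>t. \<bar>f t\<bar> \<le> B" and p: "0 < p"
  shows "(\<lambda>n. rlap (\<lambda>t. \<bar>conv (G n) f t - f t\<bar>) p) \<longlonglongrightarrow> 0"
proof -
  have fi: "exp_integrable f" by (rule exp_integrable_bounded[OF f])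
  have B0: "0 \<le> B" using f(2)[of 0] by linarith
  have [measurable]: "f \<in> borel_measurable borel" by (rule borel_measurable_continuous_onI[OF f(1)])
  have [measurable]: "conv (G n) f \<in> borel_measurable borel" for n
    by (rule borel_measurable_continuous_onI[OF conv_continuous[OF G_continuous G_nonpos fi]])
  have bd: "\<bar>conv (G n) f t\<bar> \<le> B * exp (p / 2 * t)" if t: "0 < t" for n t
  proof -
    have i: "set_integrable lborel {0..t} (G n)" by (rule borel_integrable_atLeastAtMost'[OF continuous_on_subset[OF G_continuous]]) simp
    have c: "continuous_on {0..t} (\<lambda>s. f (t - s) * G n s)"
      by (intro continuous_intros continuous_on_subset[OF G_continuous] continuous_on_compose2[OF f(1)]) auto
    have "\<bar>conv f (G n) t\<bar> \<le> (LBINT s:{0..t}. \<bar>f (t - s) * G n s\<bar>)"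
      using set_integral_norm_bound[OF borel_integrable_atLeastAtMost'[OF c]] by (simp add: laplace_convolution_def)
    also have "\<dots> \<le> (LBINT s:{0..t}. B * G n s)"
      by (intro set_integral_mono set_integrable_abs set_integrable_mult_right i borel_integrable_atLeastAtMost' c)
        (use f(2) G_nonneg in \<open>auto simp: abs_mult intro!: mult_right_mono\<close>)
    also have "\<dots> \<le> B * exp (p / 2 * t)" unfolding set_integral_mult_right
      by (rule mult_left_mono[OF G_mass_interval B0]) (use p t in auto)
    finally show ?thesis by (simp add: conv_commute[of f])
  qed
  have "(\<lambda>n. \<integral>t. ind t * (exp (- p * t) * \<bar>conv (G n) f t - f t\<bar>) \<partial>lborel) \<longlonglongrightarrow> (LBINT (t::real). 0)"
  proof (rule integral_dominated_convergence)
    have "exp_integrable (\<lambda>t. 1)" by (rule exp_integrable_bounded[of _ 1]) auto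
    from exp_integrableD[OF this, of "p / 2"] p
    have "integrable lborel (\<lambda>t. ind t * exp (- (p / 2) * t))" by (simp add: set_integrable_def)
    then show "integrable lborel (\<lambda>t. 2 * B * (ind t * exp (- (p / 2) * t)))" by (rule integrable_mult_right)
    show "AE t in lborel. (\<lambda>n. ind t * (exp (- p * t) * \<bar>conv (G n) f t - f t\<bar>)) \<longlonglongrightarrow> 0"
    proof (rule AE_I2)
      fix t :: real
      show "(\<lambda>n. ind t * (exp (- p * t) * \<bar>conv (G n) f t - f t\<bar>)) \<longlonglongrightarrow> 0"
      proof (cases "0 < t")
        case True
        have "isCont f t" using f(1) by (simp add: continuous_on_eq_continuous_at)
        then have "(\<lambda>n. ind t * (exp (- p * t) * \<bar>conv (G n) f t - f t\<bar>)) \<longlonglongrightarrow> ind t * (exp (- p * t) * \<bar>f t - f t\<bar>)"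
          by (intro tendsto_intros convolution_tendsto[OF fi True])
        then show ?thesis by simp
      qed simp
    qed
    show "AE t in lborel. norm (ind t * (exp (- p * t) * \<bar>conv (G n) f t - f t\<bar>)) \<le> 2 * B * (ind t * exp (- (p / 2) * t))" for n
    proof (rule AE_I2)
      fix t :: real
      show "norm (ind t * (exp (- p * t) * \<bar>conv (G n) f t - f t\<bar>)) \<le> 2 * B * (ind t * exp (- (p / 2) * t))"
      proof (cases "0 < t")
        case True
        have "\<bar>f t\<bar> \<le> B * exp (p / 2 * t)" using f(2)[of t] mult_left_mono[of 1 "exp (p / 2 * t)" B] B0 True p by simp
        then have "\<bar>conv (G n) f t - f t\<bar> \<le> 2 * B * exp (p / 2 * t)" using bd[OF True, of n] by linarith
        then have "exp (- p * t) * \<bar>conv (G n) f t - f t\<bar> \<le> exp (- p * t) * (2 * B * exp (p / 2 * t))" by (rule mult_left_mono) simp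
        also have "\<dots> = 2 * B * (exp (- p * t) * exp (p / 2 * t))" by (simp only: mult_ac)
        also have "exp (- p * t) * exp (p / 2 * t) = exp (- (p / 2) * t)" by (simp flip: exp_add)
        finally show ?thesis using True by (simp add: abs_mult)
      qed simp
    qed
  qed simp_all
  then show ?thesis by (simp add: rlap_def set_lebesgue_integral_def)
qed

text \<open>Linearity is read off from the transforms, and continuity gives it at every t.\<close>

lemma convolution_diff:
  assumes h: "exp_integrable h" "exp_integrable g"
  shows "conv (G n) (\<lambda>s. h s - g s) t = conv (G n) h t - conv (G n) g t"
proof (cases "0 < t")
  case True
  have e: "exp_integrable (conv (G n) f)" "continuous_on {0<..} (conv (G n) f)" if "exp_integrable f" for f
    using conv_transform(1)[OF G_integrable that] continuous_on_subset[OF conv_continuous[OF G_continuous G_nonpos that]] by auto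
  show ?thesis
  proof (rule rlap_eq_imp_eq[OF e(1)[OF exp_integrable_diff[OF h]] exp_integrable_diff[OF e(1)[OF h(1)] e(1)[OF h(2)]] _ e(2)[OF exp_integrable_diff[OF h]] _ True])
    show "rlap (conv (G n) (\<lambda>s. h s - g s)) p = rlap (\<lambda>t. conv (G n) h t - conv (G n) g t) p" if "0 < p" for p
      unfolding rlap_diff[OF e(1)[OF h(1)] e(1)[OF h(2)] that]
        conv_transform(2)[OF G_integrable exp_integrable_diff[OF h] that] conv_transform(2)[OF G_integrable h(1) that]
        conv_transform(2)[OF G_integrable h(2) that] rlap_diff[OF h that] by (rule right_diff_distrib)
    show "continuous_on {0<..} (\<lambda>t. conv (G n) h t - conv (G n) g t)"
      by (intro continuous_intros e h)
  qed
qed (simp add: conv_nonpos)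

text \<open>As G is nonnegative, the modulus of the convolution is at most the convolution with |h|,
  and the transform of G is at most 1.\<close>

lemma convolution_contraction:
  assumes h: "exp_integrable h" and p: "0 < p"
  shows "rlap (\<lambda>t. \<bar>conv (G n) h t\<bar>) p \<le> rlap (\<lambda>t. \<bar>h t\<bar>) p"
proof -
  note ha = exp_integrable_abs[OF h]
  have "rlap (\<lambda>t. \<bar>conv (G n) h t\<bar>) p \<le> rlap (conv (G n) (\<lambda>t. \<bar>h t\<bar>)) p"
  proof (rule rlap_mono[OF exp_integrable_abs[OF conv_transform(1)[OF G_integrable h]] conv_transform(1)[OF G_integrable ha] p])
    fix t
    have "norm (conv (G n) h t) \<le> (LBINT s. norm (indicator {0..t} s *\<^sub>R (G n (t - s) * h s)))"
      unfolding laplace_convolution_def set_lebesgue_integral_def by (rule integral_norm_bound)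
    also have "\<dots> = conv (G n) (\<lambda>t. \<bar>h t\<bar>) t"
      unfolding laplace_convolution_def set_lebesgue_integral_def using G_nonneg by (simp add: abs_mult)
    finally show "\<bar>conv (G n) h t\<bar> \<le> conv (G n) (\<lambda>t. \<bar>h t\<bar>) t" by simp
  qed
  also have "\<dots> = rlap (G n) p * rlap (\<lambda>t. \<bar>h t\<bar>) p" by (rule conv_transform(2)[OF G_integrable ha p])
  also have "\<dots> \<le> 1 * rlap (\<lambda>t. \<bar>h t\<bar>) p" by (intro mult_right_mono G_mass p rlap_nonneg) simp
  finally show ?thesis by simp
qed

text \<open>Three terms of size e / 3: h is replaced by a bounded continuous f, for which the limit
  is known, and the error h - f does not grow under convolution.\<close>

lemma convolution_mean:
  assumes h: "exp_integrable h" and p: "0 < p"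
  shows "(\<lambda>n. rlap (\<lambda>t. \<bar>conv (G n) h t - h t\<bar>) p) \<longlonglongrightarrow> 0"
proof (rule LIMSEQ_I)
  fix e :: real assume e: "0 < e"
  then have "0 < e / 3" by simp
  from exp_integrable_approx[OF h p this] obtain f B where f: "continuous_on UNIV f" "\<And>t. \<bar>f t\<bar> \<le> B" "rlap (\<lambda>t. \<bar>h t - f t\<bar>) p < e / 3" by blast
  have fi: "exp_integrable f" by (rule exp_integrable_bounded[OF f(1,2)])
  note hf = exp_integrable_diff[OF h fi]
  have ci: "exp_integrable (conv (G n) g)" if "exp_integrable g" for g n by (rule conv_transform(1)[OF G_integrable that])
  from order_tendstoD(2)[OF convolution_mean_bounded[OF f(1,2) p] \<open>0 < e / 3\<close>]
  obtain N where N: "\<And>n. N \<le> n \<Longrightarrow> rlap (\<lambda>t. \<bar>conv (G n) f t - f t\<bar>) p < e / 3" unfolding eventually_sequentially by blast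
  have "norm (rlap (\<lambda>t. \<bar>conv (G n) h t - h t\<bar>) p - 0) < e" if n: "N \<le> n" for n
  proof -
    note i1 = exp_integrable_abs[OF ci[OF hf, of n]] and i2 = exp_integrable_abs[OF exp_integrable_diff[OF ci[OF fi, of n] fi]] and i3 = exp_integrable_abs[OF hf]
    have "rlap (\<lambda>t. \<bar>conv (G n) h t - h t\<bar>) p \<le> rlap (\<lambda>t. \<bar>conv (G n) (\<lambda>s. h s - f s) t\<bar> + \<bar>conv (G n) f t - f t\<bar> + \<bar>h t - f t\<bar>) p"
    proof (rule rlap_mono[OF exp_integrable_abs[OF exp_integrable_diff[OF ci[OF h] h]] exp_integrable_add[OF exp_integrable_add[OF i1 i2] i3] p])
      fix t show "\<bar>conv (G n) h t - h t\<bar> \<le> \<bar>conv (G n) (\<lambda>s. h s - f s) t\<bar> + \<bar>conv (G n) f t - f t\<bar> + \<bar>h t - f t\<bar>"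
        unfolding convolution_diff[OF h fi] by linarith
    qed
    also have "\<dots> = rlap (\<lambda>t. \<bar>conv (G n) (\<lambda>s. h s - f s) t\<bar>) p + rlap (\<lambda>t. \<bar>conv (G n) f t - f t\<bar>) p + rlap (\<lambda>t. \<bar>h t - f t\<bar>) p"
      unfolding rlap_add[OF exp_integrable_add[OF i1 i2] i3 p] rlap_add[OF i1 i2 p] ..
    also have "\<dots> < e" using convolution_contraction[OF hf p, of n] N[OF n] f(3) by linarith
    finally show ?thesis using rlap_nonneg[of "\<lambda>t. \<bar>conv (G n) h t - h t\<bar>" p] by simp
  qed
  then show "\<exists>N. \<forall>n\<ge>N. norm (rlap (\<lambda>t. \<bar>conv (G n) h t - h t\<bar>) p - 0) < e" by blast
qed

end

section \<open>The kernel as an approximate identity, and existence\<close>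

context temperature
begin

lemma mm_kk_real:
  assumes p: "0 < p"
  obtains m k where "mm (of_real p) = of_real m" "kk (of_real p) = of_real k" "0 < m" "0 < k"
    "a\<^sup>2 * k\<^sup>2 + lam * k = p powr \<delta>" "m = p powr \<delta> + \<alpha> * k"
proof -
  have "mm (of_real p) \<in> \<real>" "kk (of_real p) \<in> \<real>" using symbol_real_mm symbol_real_kk p by (simp_all add: symbol_real_def)
  then obtain m k where mk: "mm (of_real p) = of_real m" "kk (of_real p) = of_real k" by (elim Reals_cases)
  have "complex_of_real (k * (a\<^sup>2 * k + lam)) = of_real (p powr \<delta>)"
    using kk_quadratic[of "of_real p"] unfolding mk ss_of_real[OF p] by simp
  then have "k * (a\<^sup>2 * k + lam) = p powr \<delta>" by (simp only: of_real_eq_iff)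
  then have q: "a\<^sup>2 * k\<^sup>2 + lam * k = p powr \<delta>" by (simp add: algebra_simps power2_eq_square)
  have "complex_of_real m = of_real (p powr \<delta> + \<alpha> * k)" using mk unfolding mm_def ss_of_real[OF p] by simp
  then have "m = p powr \<delta> + \<alpha> * k" by (simp only: of_real_eq_iff)
  then show ?thesis using Re_mm(2)[of "of_real p"] Re_kk[of "of_real p"] p mk q by (intro that[of m k]) auto
qed

context
  assumes nu: "0 < \<nu>"
begin

abbreviation "wt \<equiv> weight (\<nu> + 1)"

text \<open>The reciprocal of the mass of \<open>wt r\<close>, so that \<open>gq r\<close> times the
  weight is a probability density in \<tau>.\<close>

definition gq :: "real \<Rightarrow> real" where "gq r = (r / 2) powr (2 * \<nu>) / Gamma \<nu>"

text \<open>The response to a Dirac impulse at t = 0 in place of h, for A = 1: the datum then has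
  transform 1.\<close>

definition GK :: "real \<Rightarrow> real \<Rightarrow> real \<Rightarrow> real" where
  "GK r z t = gq r * bromwich (Sy one one (\<nu> + 1) r z) t"

lemma gq_pos: "0 < r \<Longrightarrow> 0 < gq r"
  using nu by (simp add: gq_def Gamma_real_pos)

lemma weight_nu:
  assumes r: "0 < r"
  shows "int_pos (wt r)" "gq r * (LBINT \<tau>:{0<..}. wt r \<tau>) = 1"
proof -
  show "int_pos (wt r)" by (rule weight_integral[OF r]) (use nu in simp)
  have e: "2 - 2 * (\<nu> + 1) = - (2 * \<nu>)" "\<nu> + 1 - 1 = \<nu>" by auto
  have w: "(LBINT \<tau>:{0<..}. wt r \<tau>) = Gamma \<nu> * (r / 2) powr (- (2 * \<nu>))"
    using weight_integral(2)[OF r nu1(1)[OF nu]] unfolding e .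
  show "gq r * (LBINT \<tau>:{0<..}. wt r \<tau>) = 1"
    unfolding w gq_def using r Gamma_real_pos[OF nu] by (simp add: powr_minus)
qed

text \<open>The weight, normalized to mass 1, concentrates at 0 as \<open>r\<close> tends to 0.\<close>

lemma weight_delta:
  assumes r: "0 < r" and d: "0 < d" and e: "0 \<le> e" and M: "0 \<le> M"
    and i: "int_pos (\<lambda>\<tau>. wt r \<tau> * \<phi> \<tau>)"
    and b: "\<And>\<tau>. 0 < \<tau> \<Longrightarrow> \<bar>\<phi> \<tau>\<bar> \<le> M" "\<And>\<tau>. 0 < \<tau> \<Longrightarrow> \<tau> \<le> d \<Longrightarrow> \<bar>\<phi> \<tau>\<bar> \<le> e"
  shows "gq r * \<bar>LBINT \<tau>:{0<..}. wt r \<tau> * \<phi> \<tau>\<bar> \<le> e + M * exp (1 / (4 * d)) * r powr (2 * \<nu>)"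
proof -
  note w = weight_nu(1)[OF r] and w1 = weight_nu(1)[OF zero_less_one]
  have "\<bar>LBINT \<tau>:{0<..}. wt r \<tau> * \<phi> \<tau>\<bar> \<le> (LBINT \<tau>:{0<..}. \<bar>wt r \<tau> * \<phi> \<tau>\<bar>)"
    using set_integral_norm_bound[OF i] by simp
  also have "\<dots> \<le> (LBINT \<tau>:{0<..}. e * wt r \<tau> + M * exp (1 / (4 * d)) * wt 1 \<tau>)"
  proof (rule set_integral_mono)
    show "int_pos (\<lambda>\<tau>. \<bar>wt r \<tau> * \<phi> \<tau>\<bar>)" by (rule set_integrable_abs[OF i])
    show "int_pos (\<lambda>\<tau>. e * wt r \<tau> + M * exp (1 / (4 * d)) * wt 1 \<tau>)"
      by (intro set_integral_add set_integrable_mult_right w w1)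
    fix \<tau> :: real assume "\<tau> \<in> {0<..}"
    then have t: "0 < \<tau>" by simp
    have a: "\<bar>wt r \<tau> * \<phi> \<tau>\<bar> = wt r \<tau> * \<bar>\<phi> \<tau>\<bar>" using weight_nonneg by (simp add: abs_mult)
    show "\<bar>wt r \<tau> * \<phi> \<tau>\<bar> \<le> e * wt r \<tau> + M * exp (1 / (4 * d)) * wt 1 \<tau>"
    proof (cases "\<tau> \<le> d")
      case True
      have "wt r \<tau> * \<bar>\<phi> \<tau>\<bar> \<le> wt r \<tau> * e" by (rule mult_left_mono[OF b(2)[OF t True] weight_nonneg])
      moreover have "0 \<le> M * exp (1 / (4 * d)) * wt 1 \<tau>" using M weight_nonneg by simp
      ultimately show ?thesis unfolding a mult.commute[of e] by linarith
    next
      case False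
      \<comment> \<open>For \<tau> > d the weight at r is compared with the weight at 1, through exp
        (- r^2 / (4 \<tau>)) <= 1 <= exp (1 / (4 d)) exp (- 1 / (4 \<tau>)). Smallness then comes
        from the normalization, since gq r / gq 1 = r^(2 \<nu>).\<close>
      have "exp (1 / (4 * d)) * exp (- (1 / (4 * \<tau>))) = exp (1 / (4 * d) - 1 / (4 * \<tau>))" by (simp flip: exp_add)
      moreover have "1 / (4 * \<tau>) \<le> 1 / (4 * d)" using False d by (intro divide_left_mono) auto
      ultimately have "1 \<le> exp (1 / (4 * d)) * exp (- (1 / (4 * \<tau>)))" by simp
      moreover have "exp (- (r\<^sup>2 / (4 * \<tau>))) \<le> 1" using t by simp
      ultimately have "exp (- (r\<^sup>2 / (4 * \<tau>))) \<le> exp (1 / (4 * d)) * exp (- (1 / (4 * \<tau>)))" by linarith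
      from mult_left_mono[OF this, of "\<tau> powr (- (\<nu> + 1))"]
      have "wt r \<tau> \<le> exp (1 / (4 * d)) * wt 1 \<tau>" unfolding weight_def by (simp add: mult_ac)
      then have "wt r \<tau> * \<bar>\<phi> \<tau>\<bar> \<le> (exp (1 / (4 * d)) * wt 1 \<tau>) * M"
        using b(1)[OF t] weight_nonneg by (intro mult_mono) auto
      moreover have "0 \<le> e * wt r \<tau>" using e weight_nonneg by simp
      moreover have "(x * y) * M = M * x * y" for x y by (simp only: mult_ac)
      ultimately show ?thesis unfolding a by (metis add_increasing)
    qed
  qed
  also have "\<dots> = e * (LBINT \<tau>:{0<..}. wt r \<tau>) + M * exp (1 / (4 * d)) * (LBINT \<tau>:{0<..}. wt 1 \<tau>)"
    unfolding set_integral_add(2)[OF set_integrable_mult_right[OF w] set_integrable_mult_right[OF w1]] set_integral_mult_right ..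
  finally have "gq r * \<bar>LBINT \<tau>:{0<..}. wt r \<tau> * \<phi> \<tau>\<bar> \<le>
      gq r * (e * (LBINT \<tau>:{0<..}. wt r \<tau>) + M * exp (1 / (4 * d)) * (LBINT \<tau>:{0<..}. wt 1 \<tau>))"
    using gq_pos[OF r] by (intro mult_left_mono) auto
  also have "\<dots> = e * (gq r * (LBINT \<tau>:{0<..}. wt r \<tau>)) + M * exp (1 / (4 * d)) * ((gq r / gq 1) * (gq 1 * (LBINT \<tau>:{0<..}. wt 1 \<tau>)))"
    using gq_pos[of 1] by (simp add: distrib_left)
  also have "gq r / gq 1 = r powr (2 * \<nu>)"
    using r Gamma_real_pos[OF nu] by (simp add: gq_def powr_divide)
  finally show ?thesis unfolding weight_nu(2)[OF r] weight_nu(2)[OF zero_less_one] by simp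
qed

lemma GK_symbol: "0 < r \<Longrightarrow> 0 \<le> z \<Longrightarrow> bromwich_symbol (Sy one one (\<nu> + 1) r z)"
  by (rule Sy_symbol[OF transfer_one poly_growths(1)[OF nu] nu1(1)[OF nu]])

lemma GK_subordination:
  assumes r: "0 < r" and z: "0 \<le> z"
  shows "int_pos (\<lambda>\<tau>. wt r \<tau> * bromwich (EE \<tau> (z + \<alpha> * \<tau>)) t)"
    "GK r z t = gq r * (LBINT \<tau>:{0<..}. wt r \<tau> * bromwich (EE \<tau> (z + \<alpha> * \<tau>)) t)"
  using bromwich_subordination[OF transfer_one nu1(1)[OF nu] r z, of t] by (simp_all add: GK_def)

lemma GK_nonneg:
  assumes r: "0 < r" and z: "0 \<le> z"
  shows "0 \<le> GK r z t"
proof -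
  have "0 \<le> wt r \<tau> * bromwich (EE \<tau> (z + \<alpha> * \<tau>)) t" if "0 < \<tau>" for \<tau>
    using that z pos by (intro mult_nonneg_nonneg weight_nonneg EE_nonneg) (auto intro!: add_pos_nonneg)
  then have "0 \<le> (LBINT \<tau>:{0<..}. wt r \<tau> * bromwich (EE \<tau> (z + \<alpha> * \<tau>)) t)"
    unfolding set_lebesgue_integral_def by (intro integral_nonneg_AE AE_I2) (auto simp: indicator_def)
  then show ?thesis unfolding GK_subordination(2)[OF r z] using gq_pos[OF r] by simp
qed

text \<open>t^2 exp (- t) times the kernel is the mean over \<tau> of the same quantity for
  \<open>EE\<close>. That quantity is at most e for small \<tau> and z and at most \<open>K0\<close>
  elsewhere, and the normalized weight concentrates at \<tau> = 0.\<close>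

lemma GK_tail:
  assumes e: "0 < e"
  shows "\<exists>d>0. \<exists>C\<ge>0. \<forall>r>0. \<forall>z\<ge>0. z \<le> d \<longrightarrow> (\<forall>t>0. GK r z t * t\<^sup>2 * exp (- t) \<le> e + C * r powr (2 * \<nu>))"
proof -
  obtain d where d: "0 < d" and D: "\<And>\<sigma> \<zeta> t. 0 \<le> \<sigma> \<Longrightarrow> \<sigma> \<le> d \<Longrightarrow> 0 \<le> \<zeta> \<Longrightarrow> \<zeta> \<le> d \<Longrightarrow> 0 < \<sigma> + \<zeta> \<Longrightarrow> t\<^sup>2 * bromwich (EE \<sigma> \<zeta>) t \<le> e * exp t"
    using EE_tail_small[OF e] by blast
  \<comment> \<open>For \<tau> <= d' and z <= d / 2 both parameters, \<tau> and z + \<alpha> \<tau>,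
    are at most d.\<close>
  define d' where "d' = min d (d / (2 * \<alpha>))"
  have a: "0 < \<alpha>" using pos by simp
  have d': "0 < d'" using d a by (simp add: d'_def)
  have "GK r z t * t\<^sup>2 * exp (- t) \<le> e + K0 * exp (1 / (4 * d')) * r powr (2 * \<nu>)"
    if r: "0 < r" and z: "0 \<le> z" "z \<le> d / 2" and t: "0 < t" for r z t
  proof -
    define \<phi> where "\<phi> \<tau> = t\<^sup>2 * exp (- t) * bromwich (EE \<tau> (z + \<alpha> * \<tau>)) t" for \<tau>
    have z0: "0 \<le> z + \<alpha> * \<tau>" "0 < \<tau> + (z + \<alpha> * \<tau>)" if "0 < \<tau>" for \<tau> using that z a by (auto intro!: add_pos_nonneg)
    have ph: "0 \<le> \<phi> \<tau>" if "0 < \<tau>" for \<tau> unfolding \<phi>_def using EE_nonneg[of \<tau>] z0[OF that] that by simp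
    have mv: "x * y \<le> c" if "x \<le> c * exp t" "y = exp (- t)" for x y c
    proof -
      have "x * exp (- t) \<le> c * exp t * exp (- t)" using that by (intro mult_right_mono) auto
      then show ?thesis using that by (simp add: mult.assoc flip: exp_add)
    qed
    have eq: "\<phi> \<tau> = (t\<^sup>2 * bromwich (EE \<tau> (z + \<alpha> * \<tau>)) t) * exp (- t)" for \<tau> unfolding \<phi>_def by (simp only: mult_ac)
    have wr: "wt r \<tau> * \<phi> \<tau> = (t\<^sup>2 * exp (- t)) * (wt r \<tau> * bromwich (EE \<tau> (z + \<alpha> * \<tau>)) t)" for \<tau>
      unfolding \<phi>_def by (simp only: mult_ac)
    have "gq r * \<bar>LBINT \<tau>:{0<..}. wt r \<tau> * \<phi> \<tau>\<bar> \<le> e + K0 * exp (1 / (4 * d')) * r powr (2 * \<nu>)"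
    proof (rule weight_delta[OF r d'])
      show "int_pos (\<lambda>\<tau>. wt r \<tau> * \<phi> \<tau>)"
        unfolding wr by (rule set_integrable_mult_right[OF GK_subordination(1)[OF r z(1)]])
      show "\<bar>\<phi> \<tau>\<bar> \<le> K0" if "0 < \<tau>" for \<tau>
        using ph[OF that] mv[OF EE_tail_bound[of \<tau> "z + \<alpha> * \<tau>" t] refl] z0[OF that] that unfolding eq by simp
      show "\<bar>\<phi> \<tau>\<bar> \<le> e" if t0: "0 < \<tau>" "\<tau> \<le> d'" for \<tau>
      proof -
        have "\<tau> * (2 * \<alpha>) \<le> d" using t0 a by (simp add: d'_def pos_le_divide_eq)
        moreover have "\<tau> * (2 * \<alpha>) = 2 * (\<alpha> * \<tau>)" by simp
        ultimately have "z + \<alpha> * \<tau> \<le> d" using z by linarith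
        then show ?thesis
          using ph[OF t0(1)] mv[OF D[of \<tau> "z + \<alpha> * \<tau>" t] refl] z0[OF t0(1)] t0 unfolding eq by (simp add: d'_def)
      qed
    qed (use e K0_pos in auto)
    moreover have "gq r * (LBINT \<tau>:{0<..}. wt r \<tau> * \<phi> \<tau>) = GK r z t * t\<^sup>2 * exp (- t)"
      unfolding wr set_integral_mult_right GK_subordination(2)[OF r z(1)] by (simp only: mult_ac)
    moreover have "gq r * (LBINT \<tau>:{0<..}. wt r \<tau> * \<phi> \<tau>) \<le> gq r * \<bar>LBINT \<tau>:{0<..}. wt r \<tau> * \<phi> \<tau>\<bar>"
      using gq_pos[OF r] by (intro mult_left_mono) auto
    ultimately show ?thesis by linarith
  qed
  then show ?thesis using d K0_pos by (intro exI[of _ "d / 2"] conjI exI[of _ "K0 * exp (1 / (4 * d'))"]) auto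
qed

lemma rlap_GK:
  assumes r: "0 < r" and z: "0 \<le> z" and p: "0 < p" and mk: "mm (of_real p) = of_real m" "kk (of_real p) = of_real k"
  shows "rlap (GK r z) p = gq r * (LBINT \<tau>:{0<..}. wt r \<tau> * exp (- (\<tau> * m + z * k)))"
proof -
  have J: "JJ (\<nu> + 1) r (of_real m) = of_real (LBINT \<tau>:{0<..}. wt r \<tau> * exp (- (\<tau> * m)))"
    unfolding JJ_def set_lebesgue_integral_def integral_complex_of_real[symmetric]
    by (rule Bochner_Integration.integral_cong) (auto simp: indicator_def exp_of_real[symmetric])
  have E: "EE 0 z (of_real p) = of_real (exp (- (z * k)))" unfolding EE_def mk by (simp add: exp_of_real[symmetric])
  have "complex_of_real (rlap (bromwich (Sy one one (\<nu> + 1) r z)) p) = Sy one one (\<nu> + 1) r z (of_real p)"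
    by (rule rlap_bromwich[OF GK_symbol[OF r z] Sy_real[OF transfer_one one_real[OF nu] r] p])
  also have "\<dots> = of_real ((LBINT \<tau>:{0<..}. wt r \<tau> * exp (- (\<tau> * m))) * exp (- (z * k)))"
    unfolding Sy_def mk J E by simp
  finally have "rlap (bromwich (Sy one one (\<nu> + 1) r z)) p = (LBINT \<tau>:{0<..}. wt r \<tau> * exp (- (\<tau> * m))) * exp (- (z * k))"
    by (simp only: of_real_eq_iff)
  also have "\<dots> = (LBINT \<tau>:{0<..}. wt r \<tau> * exp (- (\<tau> * m)) * exp (- (z * k)))" by simp
  also have "\<dots> = (LBINT \<tau>:{0<..}. wt r \<tau> * exp (- (\<tau> * m + z * k)))"
    by (simp only: mult.assoc exp_add[symmetric] minus_add_distrib)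
  finally show ?thesis unfolding GK_def[abs_def] rlap_mult by (simp only:)
qed

lemma GK_exp_integrable: "0 < r \<Longrightarrow> 0 \<le> z \<Longrightarrow> exp_integrable (GK r z)"
  unfolding GK_def[abs_def] by (intro exp_integrable_mult bromwich_exp_integrable GK_symbol)

lemma weight_exp_symbol_integrable:
  assumes "0 < r" "0 \<le> z" "0 \<le> m" "0 \<le> k"
  shows "int_pos (\<lambda>\<tau>. wt r \<tau> * exp (- (\<tau> * m + z * k)))"
proof (rule set_integrable_bound[OF weight_nu(1)[OF assms(1)]])
  show "AE \<tau> in lborel. \<tau> \<in> {0<..} \<longrightarrow> norm (wt r \<tau> * exp (- (\<tau> * m + z * k))) \<le> norm (wt r \<tau>)"
  proof (intro AE_I2 impI)
    fix \<tau> :: real assume "\<tau> \<in> {0<..}"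
    then have "0 \<le> \<tau> * m + z * k" using assms by (intro add_nonneg_nonneg mult_nonneg_nonneg) auto
    then have "exp (- (\<tau> * m + z * k)) \<le> 1" by simp
    from mult_left_mono[OF this weight_nonneg] weight_nonneg show "norm (wt r \<tau> * exp (- (\<tau> * m + z * k))) \<le> norm (wt r \<tau>)"
      by (simp add: abs_mult)
  qed
qed (simp add: set_borel_measurable_def)

text \<open>The mass defect is the mean of 1 - exp (- (\<tau> m + z k)) under the normalized weight.
  This function has values between 0 and 1 and is small for small \<tau> and z.\<close>

lemma rlap_GK_bounds:
  assumes p: "0 < p"
  shows "0 < r \<Longrightarrow> 0 \<le> z \<Longrightarrow> rlap (GK r z) p \<le> 1"
    and "0 < e \<Longrightarrow> \<exists>d>0. \<exists>C\<ge>0. \<forall>r>0. \<forall>z\<ge>0. z \<le> d \<longrightarrow> 1 - rlap (GK r z) p \<le> e + C * r powr (2 * \<nu>)"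
proof -
  obtain m k where mk: "mm (of_real p) = of_real m" "kk (of_real p) = of_real k" "0 < m" "0 < k" using mm_kk_real[OF p] by blast
  have eq: "1 - rlap (GK r z) p = gq r * (LBINT \<tau>:{0<..}. wt r \<tau> * (1 - exp (- (\<tau> * m + z * k))))"
    and i: "int_pos (\<lambda>\<tau>. wt r \<tau> * (1 - exp (- (\<tau> * m + z * k))))"
    if r: "0 < r" and z: "0 \<le> z" for r z
  proof -
    have i1: "int_pos (\<lambda>\<tau>. wt r \<tau> * exp (- (\<tau> * m + z * k)))"
      by (rule weight_exp_symbol_integrable) (use r z mk in auto)
    have "1 - rlap (GK r z) p = gq r * ((LBINT \<tau>:{0<..}. wt r \<tau>) - (LBINT \<tau>:{0<..}. wt r \<tau> * exp (- (\<tau> * m + z * k))))"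
      unfolding rlap_GK[OF r z p mk(1,2)] right_diff_distrib weight_nu(2)[OF r] ..
    then show "1 - rlap (GK r z) p = gq r * (LBINT \<tau>:{0<..}. wt r \<tau> * (1 - exp (- (\<tau> * m + z * k))))"
      unfolding set_integral_diff(2)[OF weight_nu(1)[OF r] i1, symmetric] right_diff_distrib mult_1_right .
    show "int_pos (\<lambda>\<tau>. wt r \<tau> * (1 - exp (- (\<tau> * m + z * k))))"
      using set_integral_diff(1)[OF weight_nu(1)[OF r] i1] by (simp only: right_diff_distrib mult_1_right)
  qed
  have ph: "0 \<le> 1 - exp (- (\<tau> * m + z * k))" if "0 < \<tau>" "0 \<le> z" for \<tau> z
  proof -
    have "0 \<le> \<tau> * m + z * k" using that mk by (intro add_nonneg_nonneg mult_nonneg_nonneg) auto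
    then show ?thesis by simp
  qed
  show "rlap (GK r z) p \<le> 1" if r: "0 < r" and z: "0 \<le> z"
  proof -
    have "0 \<le> (LBINT \<tau>:{0<..}. wt r \<tau> * (1 - exp (- (\<tau> * m + z * k))))"
      unfolding set_lebesgue_integral_def
    proof (intro integral_nonneg_AE AE_I2)
      fix \<tau> show "0 \<le> ind \<tau> *\<^sub>R (wt r \<tau> * (1 - exp (- (\<tau> * m + z * k))))"
        using mult_nonneg_nonneg[OF weight_nonneg ph[OF _ z], of \<tau> "\<nu> + 1" r] by (cases "0 < \<tau>") auto
    qed
    then have "0 \<le> 1 - rlap (GK r z) p" unfolding eq[OF r z] using gq_pos[OF r] by simp
    then show ?thesis by simp
  qed
  show "\<exists>d>0. \<exists>C\<ge>0. \<forall>r>0. \<forall>z\<ge>0. z \<le> d \<longrightarrow> 1 - rlap (GK r z) p \<le> e + C * r powr (2 * \<nu>)" if e: "0 < e"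
  proof -
    \<comment> \<open>Chosen so that \<tau> <= d and z <= d give \<tau> m + z k <= e; then 1 - exp
      (- y) <= y applies.\<close>
    define d where "d = e / (m + k)"
    have d: "0 < d" "d * (m + k) = e" using e mk by (simp_all add: d_def)
    have "1 - rlap (GK r z) p \<le> e + 1 * exp (1 / (4 * d)) * r powr (2 * \<nu>)" if r: "0 < r" and z: "0 \<le> z" "z \<le> d" for r z
    proof -
      have "gq r * \<bar>LBINT \<tau>:{0<..}. wt r \<tau> * (1 - exp (- (\<tau> * m + z * k)))\<bar> \<le> e + 1 * exp (1 / (4 * d)) * r powr (2 * \<nu>)"
      proof (rule weight_delta[OF r d(1) less_imp_le[OF e] zero_le_one i[OF r z(1)]])
        show "\<bar>1 - exp (- (\<tau> * m + z * k))\<bar> \<le> 1" if "0 < \<tau>" for \<tau> using ph[OF that z(1)] by simp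
        show "\<bar>1 - exp (- (\<tau> * m + z * k))\<bar> \<le> e" if t: "0 < \<tau>" "\<tau> \<le> d" for \<tau>
        proof -
          have "\<tau> * m + z * k \<le> d * m + d * k" using t z mk by (intro add_mono mult_right_mono) auto
          then have "\<tau> * m + z * k \<le> e" using d(2) by (simp add: distrib_left)
          moreover have "1 - exp (- x) \<le> x" for x :: real using exp_ge_add_one_self[of "- x"] by simp
          ultimately have "1 - exp (- (\<tau> * m + z * k)) \<le> e" by (rule order_trans[rotated])
          then show ?thesis using ph[OF t(1) z(1)] by (simp only: abs_of_nonneg)
        qed
      qed
      moreover have "gq r * x \<le> gq r * \<bar>x\<bar>" for x using gq_pos[OF r] by (intro mult_left_mono) auto
      ultimately show ?thesis unfolding eq[OF r z(1)] by (rule order_trans[rotated])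
    qed
    then show ?thesis using d by (intro exI[of _ d] conjI exI[of _ "1 * exp (1 / (4 * d))"]) auto
  qed
qed

text \<open>The estimates for the tail and for the mass have the form e + C r^(2 \<nu>) with C
  depending on e; once e is fixed, r -> 0 removes the second term. The tail factor
  \<open>E n\<close> is the supremum over t of t^2 exp (- t) times the kernel.\<close>

lemma GK_approximate_identity:
  assumes R: "\<And>n. 0 < R n" "R \<longlonglongrightarrow> 0" and Z: "\<And>n. 0 \<le> Z n" "Z \<longlonglongrightarrow> (0::real)"
  shows "\<exists>E. approximate_identity (\<lambda>n. GK (R n) (Z n)) E"
proof -
  have R0: "(\<lambda>n. R n powr (2 * \<nu>)) \<longlonglongrightarrow> 0"
    using tendsto_powr2[OF R(2) tendsto_const, of "2 * \<nu>"] nu R(1) by (simp add: less_imp_le)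
  have small: "\<forall>\<^sub>F n in sequentially. F (R n) (Z n) < e"
    if small: "\<And>e. 0 < e \<Longrightarrow> \<exists>d>0. \<exists>C\<ge>0. \<forall>r>0. \<forall>z\<ge>0. z \<le> d \<longrightarrow> F r z \<le> e + C * r powr (2 * \<nu>)" and e: "0 < e" for F :: "real \<Rightarrow> real \<Rightarrow> real" and e
  proof -
    obtain d C where d: "0 < d" and F: "\<And>r z. 0 < r \<Longrightarrow> 0 \<le> z \<Longrightarrow> z \<le> d \<Longrightarrow> F r z \<le> e / 2 + C * r powr (2 * \<nu>)"
      using small[OF half_gt_zero[OF e]] by blast
    have "(\<lambda>n. e / 2 + C * R n powr (2 * \<nu>)) \<longlonglongrightarrow> e / 2 + C * 0" by (intro tendsto_intros R0)
    then have "\<forall>\<^sub>F n in sequentially. e / 2 + C * R n powr (2 * \<nu>) < e" by (rule order_tendstoD(2)) (use e in simp)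
    moreover have "\<forall>\<^sub>F n in sequentially. Z n < d" by (rule order_tendstoD(2)[OF Z(2) d])
    ultimately show ?thesis
    proof eventually_elim
      case (elim n)
      then show ?case using F[OF R(1) Z(1), of n n] by simp
    qed
  qed
  define S where "S r z = (\<lambda>t. GK r z t * t\<^sup>2 * exp (- t)) ` {0<..}" for r z
  define E where "E n = Sup (S (R n) (Z n))" for n
  have S0: "S r z \<noteq> {}" for r z by (auto simp: S_def)
  \<comment> \<open>The supremum is finite: t^2 exp (- t) times each \<open>EE\<close> kernel is at
    most \<open>K0\<close>, and so is the mean over \<tau>.\<close>
  have Sb: "bdd_above (S r z)" if "0 < r" "0 \<le> z" for r z
  proof (rule bdd_aboveI)
    fix y assume "y \<in> S r z"
    then obtain t where t: "0 < t" "y = GK r z t * t\<^sup>2 * exp (- t)" by (auto simp: S_def)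
    define \<phi> where "\<phi> \<tau> = t\<^sup>2 * bromwich (EE \<tau> (z + \<alpha> * \<tau>)) t" for \<tau>
    have wr: "wt r \<tau> * \<phi> \<tau> = t\<^sup>2 * (wt r \<tau> * bromwich (EE \<tau> (z + \<alpha> * \<tau>)) t)" for \<tau>
      unfolding \<phi>_def by (simp only: mult_ac)
    have i: "int_pos (\<lambda>\<tau>. wt r \<tau> * \<phi> \<tau>)"
      unfolding wr by (rule set_integrable_mult_right[OF GK_subordination(1)[OF that]])
    have "(LBINT \<tau>:{0<..}. wt r \<tau> * \<phi> \<tau>) \<le> (LBINT \<tau>:{0<..}. (K0 * exp t) * wt r \<tau>)"
    proof (rule set_integral_mono[OF i set_integrable_mult_right[OF weight_nu(1)[OF that(1)]]])
      fix \<tau> :: real assume "\<tau> \<in> {0<..}"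
      then have "\<phi> \<tau> \<le> K0 * exp t" unfolding \<phi>_def using that pos by (intro EE_tail_bound) (auto intro!: add_pos_nonneg)
      from mult_right_mono[OF this weight_nonneg[of "\<nu> + 1" r \<tau>]]
      show "wt r \<tau> * \<phi> \<tau> \<le> (K0 * exp t) * wt r \<tau>" by (simp only: mult.commute[of "\<phi> \<tau>"])
    qed
    then have "gq r * (t\<^sup>2 * (LBINT \<tau>:{0<..}. wt r \<tau> * bromwich (EE \<tau> (z + \<alpha> * \<tau>)) t)) \<le> gq r * ((K0 * exp t) * (LBINT \<tau>:{0<..}. wt r \<tau>))"
      unfolding wr set_integral_mult_right using gq_pos[OF that(1)] by (intro mult_left_mono) auto
    also have "\<dots> = (K0 * exp t) * (gq r * (LBINT \<tau>:{0<..}. wt r \<tau>))" by (simp only: mult_ac)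
    also have "\<dots> = K0 * exp t" unfolding weight_nu(2)[OF that(1)] by simp
    finally have "GK r z t * t\<^sup>2 \<le> K0 * exp t" unfolding GK_subordination(2)[OF that] by (simp only: mult_ac)
    then have "GK r z t * t\<^sup>2 * exp (- t) \<le> K0 * exp t * exp (- t)" by (rule mult_right_mono) simp
    then show "y \<le> K0" unfolding t by (simp add: mult.assoc flip: exp_add)
  qed
  have Su: "GK r z t * t\<^sup>2 * exp (- t) \<le> Sup (S r z)" if "0 < r" "0 \<le> z" "0 < t" for r z t
    by (rule cSup_upper[OF _ Sb[OF that(1,2)]]) (use that in \<open>auto simp: S_def\<close>)
  have E0: "0 \<le> E n" for n
  proof -
    have "0 \<le> GK (R n) (Z n) 1 * 1\<^sup>2 * exp (- 1)" using GK_nonneg[OF R(1) Z(1)] by simp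
    then show ?thesis unfolding E_def using Su[OF R(1) Z(1) zero_less_one, of n n] by linarith
  qed
  have "approximate_identity (\<lambda>n. GK (R n) (Z n)) E"
  proof
    show "continuous_on UNIV (GK (R n) (Z n))" for n
      unfolding GK_def[abs_def] by (intro continuous_intros bromwich_continuous[OF GK_symbol[OF R(1) Z(1)]])
    show "GK (R n) (Z n) t = 0" if "t \<le> 0" for n t
      unfolding GK_def bromwich_nonpos[OF GK_symbol[OF R(1) Z(1)] that] by simp
    show "exp_integrable (GK (R n) (Z n))" for n by (rule GK_exp_integrable[OF R(1) Z(1)])
    show "0 \<le> GK (R n) (Z n) t" for n t by (rule GK_nonneg[OF R(1) Z(1)])
    show "GK (R n) (Z n) t \<le> E n * exp t / t\<^sup>2" if t: "0 < t" for n t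
    proof -
      have "GK (R n) (Z n) t * t\<^sup>2 * exp (- t) * exp t \<le> E n * exp t" unfolding E_def by (intro mult_right_mono Su R Z t) simp
      then show ?thesis using t by (simp add: pos_le_divide_eq mult.assoc flip: exp_add)
    qed
    show "E \<longlonglongrightarrow> 0"
    proof (rule order_tendstoI)
      show "\<forall>\<^sub>F n in sequentially. y < E n" if "y < 0" for y using E0 that by (auto intro!: always_eventually intro: less_le_trans)
      show "\<forall>\<^sub>F n in sequentially. E n < y" if y: "0 < y" for y unfolding E_def
      proof (rule small[of "\<lambda>r z. Sup (S r z)", OF _ y])
        fix e :: real assume "0 < e"
        from GK_tail[OF this] obtain d C where dC: "0 < d" "0 \<le> C" "\<forall>r>0. \<forall>z\<ge>0. z \<le> d \<longrightarrow> (\<forall>t>0. GK r z t * t\<^sup>2 * exp (- t) \<le> e + C * r powr (2 * \<nu>))" by (elim exE conjE)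
        have "Sup (S r z) \<le> e + C * r powr (2 * \<nu>)" if "0 < r" "0 \<le> z" "z \<le> d" for r z
          by (rule cSup_least[OF S0]) (use dC(3) that in \<open>auto simp: S_def\<close>)
        then show "\<exists>d>0. \<exists>C\<ge>0. \<forall>r>0. \<forall>z\<ge>0. z \<le> d \<longrightarrow> Sup (S r z) \<le> e + C * r powr (2 * \<nu>)"
          using dC(1,2) by (intro exI[of _ d] conjI exI[of _ C]) auto
      qed
    qed
    show "rlap (GK (R n) (Z n)) p \<le> 1" if "0 < p" for n p by (rule rlap_GK_bounds(1)[OF that R(1) Z(1)])
    show "(\<lambda>n. rlap (GK (R n) (Z n)) p) \<longlonglongrightarrow> 1" if p: "0 < p" for p
    proof (rule order_tendstoI)
      show "\<forall>\<^sub>F n in sequentially. y < rlap (GK (R n) (Z n)) p" if "y < 1" for y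
        using small[of "\<lambda>r z. 1 - rlap (GK r z) p", OF rlap_GK_bounds(2)[OF p], of "1 - y"] that by simp
      show "\<forall>\<^sub>F n in sequentially. rlap (GK (R n) (Z n)) p < y" if "1 < y" for y
        using rlap_GK_bounds(1)[OF p R(1) Z(1)] that by (auto intro!: always_eventually intro: le_less_trans)
    qed
  qed
  then show ?thesis by blast
qed

lemma TF_convolution:
  assumes r: "0 < r" and z: "0 \<le> z" and t: "0 < t"
  shows "TF r z t = A * conv (GK r z) h t"
proof -
  have sB: "bromwich_symbol (Sy (laplace h) one (\<nu> + 1) r z)" by (rule Sy_symbol[OF tH poly_growths(1)[OF nu] nu1(1)[OF nu] r z])
  have sG: "bromwich_symbol (Sy one one (\<nu> + 1) r z)" by (rule GK_symbol[OF r z])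
  note ci = conv_transform[OF GK_exp_integrable[OF r z] h]
  have cG: "continuous_on UNIV (GK r z)" unfolding GK_def[abs_def] by (intro continuous_intros bromwich_continuous[OF sG])
  have zG: "GK r z t = 0" if "t \<le> 0" for t unfolding GK_def bromwich_nonpos[OF sG that] by simp
  have "(\<lambda>t. cc r * BB one (\<nu> + 1) r z t) t = (\<lambda>t. A * conv (GK r z) h t) t"
  proof (rule rlap_eq_imp_eq[OF exp_integrable_mult[OF bromwich_exp_integrable[OF sB]] exp_integrable_mult[OF ci(1)] _ _ _ t])
    fix p :: real assume p: "0 < p"
    have "complex_of_real (rlap (BB one (\<nu> + 1) r z) p) = of_real (rlap (bromwich (Sy one one (\<nu> + 1) r z)) p * rlap h p)"
      unfolding of_real_mult rlap_bromwich[OF sB Sy_real[OF tH one_real[OF nu] r] p] rlap_bromwich[OF sG Sy_real[OF transfer_one one_real[OF nu] r] p]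
      by (simp add: Sy_def laplace_of_real)
    then have "rlap (BB one (\<nu> + 1) r z) p = rlap (bromwich (Sy one one (\<nu> + 1) r z)) p * rlap h p" by (simp only: of_real_eq_iff)
    moreover have "cc r = A * gq r" by (simp add: cc_def gq_def)
    ultimately show "rlap (\<lambda>t. cc r * BB one (\<nu> + 1) r z t) p = rlap (\<lambda>t. A * conv (GK r z) h t) p"
      unfolding rlap_mult ci(2)[OF p] unfolding GK_def[abs_def] rlap_mult by (simp only: mult_ac)
  next
    show "continuous_on {0<..} (\<lambda>t. cc r * BB one (\<nu> + 1) r z t)" by (intro continuous_intros bromwich_continuous[OF sB])
    show "continuous_on {0<..} (\<lambda>t. A * conv (GK r z) h t)"
      by (intro continuous_intros continuous_on_subset[OF conv_continuous[OF cG zG h]]) auto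
  qed
  then show ?thesis unfolding TF_eq[OF nu r z t] .
qed

text \<open>The limits at the origin are tested along arbitrary sequences in the domain, and each of
  them yields an approximate identity.\<close>

lemma TF_origin:
  shows "0 < t \<Longrightarrow> isCont h t \<Longrightarrow> ((\<lambda>(r, z). TF r z t) \<longlongrightarrow> A * h t) (at (0, 0) within {0<..} \<times> {0..})"
    and "0 < p \<Longrightarrow> ((\<lambda>(r, z). LBINT t:{0<..}. exp (- p * t) * \<bar>TF r z t - A * h t\<bar>) \<longlongrightarrow> 0) (at (0, 0) within {0<..} \<times> {0..})"
proof -
  have seq: "\<exists>E. approximate_identity (\<lambda>n. GK (fst (X n)) (snd (X n))) E" "\<And>n. 0 < fst (X n)" "\<And>n. 0 \<le> snd (X n)"
    if X: "\<forall>i. X i \<in> {0<..} \<times> {0..} - {(0, 0)}" "X \<longlonglongrightarrow> (0, 0)" for X :: "nat \<Rightarrow> real \<times> real"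
  proof -
    show 1: "0 < fst (X n)" "0 \<le> snd (X n)" for n using X(1)[rule_format, of n] by auto
    show "\<exists>E. approximate_identity (\<lambda>n. GK (fst (X n)) (snd (X n))) E"
      by (rule GK_approximate_identity[OF 1(1) _ 1(2)]) (use tendsto_fst[OF X(2)] tendsto_snd[OF X(2)] in auto)
  qed
  show "((\<lambda>(r, z). TF r z t) \<longlongrightarrow> A * h t) (at (0, 0) within {0<..} \<times> {0..})" if t: "0 < t" and c: "isCont h t"
    unfolding tendsto_at_iff_sequentially
  proof (intro allI impI)
    fix X :: "nat \<Rightarrow> real \<times> real" assume "\<forall>i. X i \<in> {0<..} \<times> {0..} - {(0, 0)}" "X \<longlonglongrightarrow> (0, 0)"
    note s = seq[OF this]
    from s(1) obtain E where "approximate_identity (\<lambda>n. GK (fst (X n)) (snd (X n))) E" by blast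
    then interpret approximate_identity "\<lambda>n. GK (fst (X n)) (snd (X n))" E .
    have "(\<lambda>n. A * conv (GK (fst (X n)) (snd (X n))) h t) \<longlonglongrightarrow> A * h t"
      by (intro tendsto_intros convolution_tendsto[OF h t c])
    then show "((\<lambda>(r, z). TF r z t) \<circ> X) \<longlonglongrightarrow> A * h t"
      unfolding comp_def case_prod_beta' using TF_convolution[OF s(2,3) t] by simp
  qed
  show "((\<lambda>(r, z). LBINT t:{0<..}. exp (- p * t) * \<bar>TF r z t - A * h t\<bar>) \<longlongrightarrow> 0) (at (0, 0) within {0<..} \<times> {0..})" if p: "0 < p"
    unfolding tendsto_at_iff_sequentially
  proof (intro allI impI)
    fix X :: "nat \<Rightarrow> real \<times> real" assume "\<forall>i. X i \<in> {0<..} \<times> {0..} - {(0, 0)}" "X \<longlonglongrightarrow> (0, 0)"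
    note s = seq[OF this]
    from s(1) obtain E where "approximate_identity (\<lambda>n. GK (fst (X n)) (snd (X n))) E" by blast
    then interpret approximate_identity "\<lambda>n. GK (fst (X n)) (snd (X n))" E .
    have l: "(\<lambda>n. A * rlap (\<lambda>t. \<bar>conv (GK (fst (X n)) (snd (X n))) h t - h t\<bar>) p) \<longlonglongrightarrow> A * 0"
      by (intro tendsto_intros convolution_mean[OF h p])
    have "(LBINT t:{0<..}. exp (- p * t) * \<bar>TF (fst (X n)) (snd (X n)) t - A * h t\<bar>) = A * rlap (\<lambda>t. \<bar>conv (GK (fst (X n)) (snd (X n))) h t - h t\<bar>) p" for n
    proof -
      have "\<bar>A * x - A * y\<bar> = A * \<bar>x - y\<bar>" for x y using A by (simp add: abs_mult flip: right_diff_distrib)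
      then show ?thesis unfolding rlap_mult[symmetric] rlap_def[symmetric] using TF_convolution[OF s(2,3)] by (intro exp_integrable_cong(2)) simp
    qed
    with l show "((\<lambda>(r, z). LBINT t:{0<..}. exp (- p * t) * \<bar>TF r z t - A * h t\<bar>) \<circ> X) \<longlonglongrightarrow> 0"
      unfolding comp_def case_prod_beta' by simp
  qed
qed

theorem TF_solution: "temperature_field_solution \<beta> a lam A \<alpha> \<nu> h TF"
  unfolding temperature_field_solution_def beta
proof (rule exI[of _ "uz"], rule exI[of _ "uzz"], rule exI[of _ "ur"], rule exI[of _ "urr"], intro conjI allI impI)
  fix r z t :: real assume r: "0 < r" and z: "0 < z" and t: "0 < t"
  have "at z within {0..} = at z" by (rule at_within_open_subset[of _ "{0<..}"]) (use z in auto)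
  then show "((\<lambda>y. uz r y t) has_real_derivative uzz r z t) (at z)" using TF_z(2)[OF nu r less_imp_le[OF z] t] by simp
next
  fix K :: "(real \<times> real) set" assume K: "compact K \<and> K \<subseteq> {0<..} \<times> {0<..}"
  show "laplace_dominated K (\<lambda>(r, z). uzz r z)" by (rule uz_dominated(2)[OF nu]) (use K in fastforce)+
qed (rule TF_caputo[OF nu] TF_z(1)[OF nu] TF_r[OF nu] TF_pde[OF nu] TF_boundary[OF nu] TF_origin TF_infinity[OF nu] TF_zero[OF nu] TF_dominated[OF nu]
    uz_dominated(1)[OF nu] ur_dominated[OF nu]; (elim conjE)?; assumption)+

end

end

section \<open>Uniqueness\<close>

lemma rlap_cong_AE:
  assumes f: "exp_integrable f" and g: "exp_integrable g" and eq: "AE t in lborel. 0 < t \<longrightarrow> f t = g t"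
  shows "rlap f p = rlap g p"
proof -
  have m: "(\<lambda>t. exp (- p * t) * (ind t * F t)) \<in> borel_measurable borel" if "exp_integrable F" for F
    by (rule borel_measurable_exp_times[OF exp_integrable_measurable[OF that]])
  have "(LBINT t. exp (- p * t) * (ind t * f t)) = (LBINT t. exp (- p * t) * (ind t * g t))"
  proof (rule integral_cong_AE)
    show "AE t in lborel. exp (- p * t) * (ind t * f t) = exp (- p * t) * (ind t * g t)"
      using eq by eventually_elim (auto simp: indicator_def)
  qed (use m[OF f] m[OF g] in simp_all)
  then show ?thesis unfolding rlap_def set_lebesgue_integral_def by (simp add: mult.left_commute)
qed

text \<open>The derivative F' carries no measurability of its own; it is obtained as a limit of
  difference quotients along a sequence in S, which is the purpose of the limit point condition. The
  majorant then permits differentiation under the integral.\<close>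

lemma rlap_derivative:
  assumes S: "convex S" "x \<in> S" "x islimpt S" and p: "0 < p"
    and F: "\<And>y. y \<in> S \<Longrightarrow> exp_integrable (F y)"
    and d: "\<And>y t. y \<in> S \<Longrightarrow> 0 < t \<Longrightarrow> ((\<lambda>y. F y t) has_real_derivative F' y t) (at y within S)"
    and dom: "laplace_dominated S F'"
  shows "exp_integrable (F' x)" "((\<lambda>y. rlap (F y) p) has_real_derivative rlap (F' x) p) (at x within S)"
proof -
  obtain M where M: "exp_integrable M" "\<And>y t. y \<in> S \<Longrightarrow> 0 < t \<Longrightarrow> \<bar>F' y t\<bar> \<le> M t"
    using dom unfolding laplace_dominated_def laplace_transformable_iff by blast
  obtain X where X: "\<And>n::nat. X n \<in> S - {x}" "X \<longlonglongrightarrow> x" using S(3) unfolding islimpt_sequential by blast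
  have m: "(\<lambda>t. ind t * F' x t) \<in> borel_measurable borel"
  proof (rule borel_measurable_LIMSEQ_real)
    show "(\<lambda>t. (ind t * F (X n) t - ind t * F x t) / (X n - x)) \<in> borel_measurable borel" for n
      using exp_integrable_measurable[OF F[of "X n"]] exp_integrable_measurable[OF F[OF S(2)]] X(1)[of n] by simp
    fix t :: real
    show "(\<lambda>n. (ind t * F (X n) t - ind t * F x t) / (X n - x)) \<longlonglongrightarrow> ind t * F' x t"
    proof (cases "0 < t")
      case True
      have "((\<lambda>y. (F y t - F x t) / (y - x)) \<longlongrightarrow> F' x t) (at x within S)"
        using d[OF S(2) True] by (simp add: has_field_derivative_iff)
      then have "((\<lambda>y. (F y t - F x t) / (y - x)) \<circ> X) \<longlonglongrightarrow> F' x t"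
        unfolding tendsto_at_iff_sequentially using X by blast
      then show ?thesis using True by (simp add: comp_def)
    qed simp
  qed
  show e: "exp_integrable (F' x)" by (rule exp_integrable_bound[OF M(1) m M(2)[OF S(2)]])
  have "((\<lambda>y. \<integral>t. ind t * (exp (- p * t) * F y t) \<partial>lborel) has_vector_derivative (LBINT t. ind t * (exp (- p * t) * F' x t))) (at x within S)"
  proof (rule has_vector_derivative_integral[OF S(1,2)])
    show "integrable lborel (\<lambda>t. ind t * (exp (- p * t) * F y t))" if "y \<in> S" for y
      using exp_integrableD[OF F[OF that] p] by (simp add: set_integrable_def)
    show "((\<lambda>y. ind t * (exp (- p * t) * F y t)) has_vector_derivative ind t * (exp (- p * t) * F' y t)) (at y within S)" if "y \<in> S" for y t
    proof (cases "0 < t")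
      case True
      have "((\<lambda>y. exp (- p * t) * F y t) has_real_derivative exp (- p * t) * F' y t) (at y within S)" by (rule DERIV_cmult[OF d[OF that True]])
      then show ?thesis using True by (simp add: has_real_derivative_iff_has_vector_derivative)
    qed simp
    show "(\<lambda>t. ind t * (exp (- p * t) * F' x t)) \<in> borel_measurable lborel"
      using exp_integrableD[OF e p] unfolding set_integrable_def by (simp add: borel_measurable_integrable)
    show "integrable lborel (\<lambda>t. ind t * (exp (- p * t) * M t))"
      using exp_integrableD[OF M(1) p] by (simp add: set_integrable_def)
    show "norm (ind t * (exp (- p * t) * F' y t)) \<le> ind t * (exp (- p * t) * M t)" if "y \<in> S" for y t
      using M(2)[OF that, of t] by (auto simp: indicator_def abs_mult mult_left_mono)
  qed
  then show "((\<lambda>y. rlap (F y) p) has_real_derivative rlap (F' x) p) (at x within S)"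
    by (simp add: rlap_def set_lebesgue_integral_def has_real_derivative_iff_has_vector_derivative)
qed

lemma rlap_at_top:
  assumes p: "0 < p" and F: "\<And>y. y0 \<le> y \<Longrightarrow> exp_integrable (F y)" and dom: "laplace_dominated {y0..} F"
    and l: "\<And>t. 0 < t \<Longrightarrow> ((\<lambda>y. F y t) \<longlongrightarrow> 0) at_top"
  shows "((\<lambda>y::real. rlap (F y) p) \<longlongrightarrow> 0) at_top"
proof -
  obtain M where M: "exp_integrable M" "\<And>y t. y0 \<le> y \<Longrightarrow> 0 < t \<Longrightarrow> \<bar>F y t\<bar> \<le> M t"
    using dom unfolding laplace_dominated_def laplace_transformable_iff by auto
  \<comment> \<open>Replacing y by \<open>max y0 y\<close> makes the family dominated for all y
    without changing the limit.\<close>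
  have "((\<lambda>y. \<integral>t. ind t * (exp (- p * t) * F (max y0 y) t) \<partial>lborel) \<longlongrightarrow> (LBINT (t::real). 0)) at_top"
  proof (rule integral_dominated_convergence_at_top)
    show "(\<lambda>t. ind t * (exp (- p * t) * F (max y0 y) t)) \<in> borel_measurable lborel" for y
      using exp_integrableD[OF F[of "max y0 y"] p] unfolding set_integrable_def by (simp add: borel_measurable_integrable)
    show "integrable lborel (\<lambda>t. ind t * (exp (- p * t) * M t))"
      using exp_integrableD[OF M(1) p] by (simp add: set_integrable_def)
    show "AE t in lborel. ((\<lambda>y. ind t * (exp (- p * t) * F (max y0 y) t)) \<longlongrightarrow> 0) at_top"
    proof (rule AE_I2)
      fix t :: real
      show "((\<lambda>y. ind t * (exp (- p * t) * F (max y0 y) t)) \<longlongrightarrow> 0) at_top"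
      proof (cases "0 < t")
        case True
        have "((\<lambda>y. exp (- p * t) * F y t) \<longlongrightarrow> exp (- p * t) * 0) at_top" by (intro tendsto_intros l True)
        moreover have "\<forall>\<^sub>F y in at_top. exp (- p * t) * F y t = ind t * (exp (- p * t) * F (max y0 y) t)"
          using eventually_ge_at_top[of y0] by eventually_elim (use True in simp)
        ultimately show ?thesis using Lim_transform_eventually by fastforce
      qed simp
    qed
    show "\<forall>\<^sub>F y in at_top. AE t in lborel. norm (ind t * (exp (- p * t) * F (max y0 y) t)) \<le> ind t * (exp (- p * t) * M t)"
      using M(2)[of "max y0 _"] by (intro always_eventually allI AE_I2) (auto simp: indicator_def abs_mult mult_left_mono)
  qed simp
  then have "((\<lambda>y. rlap (F (max y0 y)) p) \<longlongrightarrow> 0) at_top" by (simp add: rlap_def set_lebesgue_integral_def)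
  moreover have "\<forall>\<^sub>F y in at_top. rlap (F (max y0 y)) p = rlap (F y) p"
    using eventually_ge_at_top[of y0] by eventually_elim simp
  ultimately show ?thesis by (rule Lim_transform_eventually)
qed

text \<open>The transform of f' need not exist, so the transforms of f and f' cannot be related
  directly. Abel's inversion is used instead: convolving the Caputo derivative with t^(\<delta> - 1)
  gives Gamma \<delta> times f, because t^(\<delta> - 1) convolved with t^(- \<delta>) is the
  constant Gamma \<delta> Gamma (1 - \<delta>). This relation involves only f and its Caputo
  derivative, both of which have transforms.\<close>

lemma rlap_caputo:
  assumes dl: "0 < \<delta>" "\<delta> < 1" and f: "\<And>t. 0 < t \<Longrightarrow> caputo_differentiable \<delta> f t" and f0: "(f \<longlongrightarrow> 0) (at_right 0)"
    and fi: "exp_integrable f" and wi: "exp_integrable (caputo \<delta> f)" and p: "0 < p"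
  shows "rlap (caputo \<delta> f) p = p powr \<delta> * rlap f p"
proof -
  define w where "w = caputo \<delta> f"
  have m: "nat \<lceil>\<delta>\<rceil> = 1" using dl by (simp add: nat_eq_iff ceiling_eq_iff)
  have diff: "(f has_real_derivative deriv f s) (at s)" if "0 < s" for s
    using f[OF that] that unfolding caputo_differentiable_def m Let_def
    by (auto simp: DERIV_deriv_iff_real_differentiable dest!: spec[of _ 0])
  have fr: "set_integrable lborel {0<..<t} (\<lambda>s. deriv f s / (t - s) powr \<delta>)" if "0 < t" for t
    using f[OF that] dl unfolding caputo_differentiable_def m Let_def by simp
  have w: "w t = 1 / Gamma (1 - \<delta>) * (LBINT s:{0<..<t}. deriv f s / (t - s) powr \<delta>)" for t
    using dl unfolding w_def caputo_def m Let_def by simp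
  have G: "0 < Gamma \<delta>" "0 < Gamma (1 - \<delta>)" using dl by (auto intro!: Gamma_real_pos)
  have e1: "1 - (1 - \<delta>) = \<delta>" "1 - \<delta> - 1 = - \<delta>" "0 < 1 - \<delta>" "- (1 - \<delta>) = \<delta> - 1" using dl by auto
  note k = powr_transform[OF e1(3), unfolded e1] and g = powr_transform[OF dl(1)] and one' = powr_transform[OF zero_less_one]
  have oi: "exp_integrable (\<lambda>t. 1)" and ol: "\<And>q. 0 < q \<Longrightarrow> rlap (\<lambda>t. 1) q = q powr (- 1)"
    using one' exp_integrable_cong[of "\<lambda>t. t powr (1 - 1)" "\<lambda>t. 1"] by simp_all
  let ?k = "\<lambda>t::real. t powr (- \<delta>)" and ?g = "\<lambda>t::real. t powr (\<delta> - 1)"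
  have AE: "AE t in lborel. 0 < t \<and> t < T \<longrightarrow> conv ?g w t = Gamma \<delta> * f t" if T: "0 < T" for T
  proof -
    \<comment> \<open>On (0, T) the modulus of f' is at most T^\<delta> times that of the integrand
      of the Caputo derivative at time T, hence integrable. Cut off at T, the derivative has a
      transform.\<close>
    define v where "v s = indicator {0<..<T} s * deriv f s" for s
    have vi: "integrable lborel v"
    proof (rule Bochner_Integration.integrable_bound)
      show "integrable lborel (\<lambda>s. T powr \<delta> * (indicator {0<..<T} s * (deriv f s / (T - s) powr \<delta>)))"
        using fr[OF T] unfolding set_integrable_def by (intro integrable_mult_right) simp
      have [measurable]: "(\<lambda>s. indicator {0<..<T} s * (deriv f s / (T - s) powr \<delta>)) \<in> borel_measurable borel"
        using fr[OF T] unfolding set_integrable_def by (simp add: borel_measurable_integrable)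
      have "(\<lambda>s. (T - s) powr \<delta> * (indicator {0<..<T} s * (deriv f s / (T - s) powr \<delta>))) \<in> borel_measurable borel" by measurable
      moreover have eq: "(T - s) powr \<delta> * (indicator {0<..<T} s * (deriv f s / (T - s) powr \<delta>)) = v s" for s
        by (auto simp: v_def indicator_def)
      ultimately show "v \<in> borel_measurable lborel" by (simp add: eq)
      have "\<bar>v s\<bar> \<le> T powr \<delta> * \<bar>indicator {0<..<T} s * (deriv f s / (T - s) powr \<delta>)\<bar>" for s
      proof (cases "0 < s \<and> s < T")
        case True
        then have "(T - s) powr \<delta> \<le> T powr \<delta>" using dl by (intro powr_mono2) auto
        then show ?thesis unfolding eq[symmetric] abs_mult by (intro mult_right_mono) auto
      qed (auto simp: v_def)
      then show "AE s in lborel. norm (v s) \<le> norm (T powr \<delta> * (indicator {0<..<T} s * (deriv f s / (T - s) powr \<delta>)))"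
        by (intro AE_I2) (simp add: abs_mult)
    qed
    have ve: "exp_integrable v" unfolding exp_integrable_def set_integrable_def
    proof (intro allI impI)
      fix q :: real assume q: "0 < q"
      have [measurable]: "v \<in> borel_measurable borel" using vi by (simp add: borel_measurable_integrable)
      show "integrable lborel (\<lambda>t. ind t *\<^sub>R (exp (- q * t) * v t))"
        by (rule Bochner_Integration.integrable_bound[OF vi]) (use q in \<open>auto simp: indicator_def abs_mult intro!: mult_left_le_one_le\<close>)
    qed
    have f1: "conv (\<lambda>t. 1) v t = f t" if t: "0 < t" "t < T" for t
    proof -
      \<comment> \<open>Extending f by 0 to t = 0 makes it continuous on the closed interval,
        because f tends to 0 there; hence integrating f' from 0 returns f.\<close>
      define F where "F s = (if s \<le> 0 then 0 else f s)" for s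
      have Fc: "continuous_on {0..t} F" unfolding continuous_on_eq_continuous_within
      proof
        fix x assume x: "x \<in> {0..t}"
        show "continuous (at x within {0..t}) F"
        proof (cases "x = 0")
          case True
          have "\<forall>\<^sub>F s in at_right 0. f s = F s" unfolding eventually_at_right_field by (intro exI[of _ 1]) (auto simp: F_def)
          then have "(F \<longlongrightarrow> F 0) (at_right 0)" using Lim_transform_eventually[OF f0] by (simp add: F_def)
          moreover have "at 0 within {0..t} = at_right 0" using t by (simp add: at_within_Icc_at_right)
          ultimately show ?thesis using True by (simp add: continuous_within)
        next
          case False
          then have "0 < x" using x by simp
          have "\<forall>\<^sub>F s in nhds x. f s = F s" using eventually_nhds_in_open[of "{0<..}" x] \<open>0 < x\<close> by (auto elim!: eventually_mono simp: F_def)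
          then have "isCont F x" using DERIV_isCont[OF diff[OF \<open>0 < x\<close>]] isCont_cong by blast
          then show ?thesis by (rule continuous_at_imp_continuous_at_within)
        qed
      qed
      have "(v has_integral F t - F 0) {0..t}"
      proof (rule fundamental_theorem_of_calculus_interior[OF less_imp_le[OF t(1)] Fc])
        fix s assume s: "s \<in> {0<..<t}"
        have "(F has_real_derivative deriv f s) (at s)"
          by (rule has_field_derivative_transform_within_open[OF diff, of _ "{0<..}"]) (use s in \<open>auto simp: F_def\<close>)
        then show "(F has_vector_derivative v s) (at s)" using s t by (simp add: v_def has_real_derivative_iff_has_vector_derivative)
      qed
      moreover have "set_integrable lborel {0..t} v" unfolding set_integrable_def by (rule integrable_mult_indicator[OF _ vi]) simp
      ultimately have "(LBINT s:{0..t}. v s) = F t - F 0" using set_borel_integral_eq_integral(2) integral_unique by metis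
      then show ?thesis using t by (simp add: laplace_convolution_def F_def)
    qed
    have kv: "conv ?k v t = Gamma (1 - \<delta>) * w t" if t: "0 \<le> t" "t < T" for t
    proof -
      have "conv ?k v t = (LBINT s:{0<..<t}. deriv f s / (t - s) powr \<delta>)"
        unfolding laplace_convolution_def set_lebesgue_integral_def
      proof (rule integral_discrete_difference[of "{0, t}"])
        fix s assume "s \<notin> {0, t}"
        then show "indicator {0..t} s *\<^sub>R ((t - s) powr (- \<delta>) * v s) = indicator {0<..<t} s *\<^sub>R (deriv f s / (t - s) powr \<delta>)"
          using t by (auto simp: indicator_def v_def powr_minus divide_inverse)
      qed auto
      then show ?thesis unfolding w using G by simp
    qed
    \<comment> \<open>Read off from transforms: p^(- \<delta>) p^(\<delta> - 1) = 1 / p is the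
      transform of the constant 1.\<close>
    have "AE t in lborel. 0 < t \<longrightarrow> conv ?g (conv ?k v) t = (Gamma \<delta> * Gamma (1 - \<delta>)) * conv (\<lambda>t. 1) v t"
    proof (rule rlap_eq_imp_AE_eq[OF conv_transform(1)[OF g(1) conv_transform(1)[OF k(1) ve]] exp_integrable_mult[OF conv_transform(1)[OF oi ve]]])
      fix q :: real assume q: "0 < q"
      have "q powr (- \<delta>) * q powr (\<delta> - 1) = q powr (- 1)" by (simp flip: powr_add)
      moreover have "a * x * (b * y * V) = a * b * ((x * y) * V)" for a b x y V :: real by (simp only: mult_ac)
      ultimately show "rlap (conv ?g (conv ?k v)) q = rlap (\<lambda>t. (Gamma \<delta> * Gamma (1 - \<delta>)) * conv (\<lambda>t. 1) v t) q"
        unfolding rlap_mult conv_transform(2)[OF g(1) conv_transform(1)[OF k(1) ve] q]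
          conv_transform(2)[OF k(1) ve q] conv_transform(2)[OF oi ve q] k(2)[OF q] g(2)[OF q] ol[OF q] by (simp only:)
    qed
    then show ?thesis
    proof eventually_elim
      case (elim t)
      show ?case
      proof
        assume t: "0 < t \<and> t < T"
        have "conv ?g (conv ?k v) t = (LBINT s:{0..t}. Gamma (1 - \<delta>) * ((t - s) powr (\<delta> - 1) * w s))"
          unfolding laplace_convolution_def[of ?g]
          by (rule set_lebesgue_integral_cong) (use t kv in auto)
        also have "\<dots> = Gamma (1 - \<delta>) * conv ?g w t" unfolding laplace_convolution_def by (rule set_integral_mult_right)
        finally have "Gamma (1 - \<delta>) * conv ?g w t = conv ?g (conv ?k v) t" by (rule sym)
        also have "\<dots> = (Gamma \<delta> * Gamma (1 - \<delta>)) * f t"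
          using elim t f1[of t] by simp
        also have "\<dots> = Gamma (1 - \<delta>) * (Gamma \<delta> * f t)" by (simp only: mult_ac)
        finally show "conv ?g w t = Gamma \<delta> * f t"
          using mult_left_cancel[OF less_imp_neq[OF G(2), symmetric]] by blast
      qed
    qed
  qed
  \<comment> \<open>Countably many T exhaust the half line, so the exceptional null sets can be
    united.\<close>
  have "AE t in lborel. \<forall>n::nat. 0 < t \<and> t < real (Suc n) \<longrightarrow> conv ?g w t = Gamma \<delta> * f t"
    unfolding AE_all_countable using AE by simp
  then have "AE t in lborel. 0 < t \<longrightarrow> conv ?g w t = Gamma \<delta> * f t"
  proof eventually_elim
    case (elim t)
    obtain n where "t < real n" using reals_Archimedean2 by blast
    then show ?case using elim[rule_format, of n] by simp
  qed
  from rlap_cong_AE[OF conv_transform(1)[OF g(1) wi[folded w_def]] exp_integrable_mult[OF fi] this, of p]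
  have "Gamma \<delta> * (p powr (- \<delta>) * rlap w p) = Gamma \<delta> * rlap f p"
    unfolding rlap_mult conv_transform(2)[OF g(1) wi[folded w_def] p] g(2)[OF p] by (simp only: mult.assoc)
  then have "p powr (- \<delta>) * rlap w p = rlap f p" using G by simp
  then have "p powr \<delta> * rlap f p = (p powr \<delta> * p powr (- \<delta>)) * rlap w p" by (simp only: mult.assoc)
  also have "p powr \<delta> * p powr (- \<delta>) = 1" using p by (simp flip: powr_add)
  finally show ?thesis unfolding w_def by simp
qed

text \<open>With a weight \<open>w\<close> that makes the derivative of \<open>w Q'\<close> nonnegative, \<open>Q\<close> cannot decrease again after it has increased.\<close>

lemma energy_zero:
  fixes Q :: "real \<Rightarrow> real"
  assumes Q: "\<And>x. 0 < x \<Longrightarrow> (Q has_real_derivative Q' x) (at x)" and w: "\<And>x. 0 < x \<Longrightarrow> 0 < w x"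
    and mono: "\<And>x y. 0 < x \<Longrightarrow> x \<le> y \<Longrightarrow> w x * Q' x \<le> w y * Q' y"
    and nn: "\<And>x. 0 < x \<Longrightarrow> 0 \<le> Q x" and inf: "(Q \<longlongrightarrow> 0) at_top"
    and zero: "\<And>x. 0 < x \<Longrightarrow> 0 < Q x \<Longrightarrow> \<exists>y>0. y < x \<and> Q y < Q x" and x: "0 < x"
  shows "Q x = 0"
proof (rule ccontr)
  assume "Q x \<noteq> 0"
  then have Qx: "0 < Q x" using nn[OF x] by simp
  then obtain y where y: "0 < y" "y < x" "Q y < Q x" using zero[OF x] by blast
  obtain z where z: "y < z" "z < x" "Q x - Q y = (x - y) * Q' z"
    using MVT2[OF y(2), of Q Q'] Q y by auto
  then have "0 < Q' z" using y by (metis diff_gt_0_iff_gt zero_less_mult_pos)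
  then have pos: "0 < Q' s" if "z \<le> s" for s
  proof -
    have s: "0 < z" "0 < s" using z y that by auto
    have "0 < w z * Q' z" using w[OF s(1)] \<open>0 < Q' z\<close> by simp
    then have "0 < w s * Q' s" using mono[OF s(1) that] by simp
    then show ?thesis using w[OF s(2)] by (simp add: zero_less_mult_iff)
  qed
  have "Q x \<le> Q s" if "x \<le> s" for s
  proof (rule DERIV_nonneg_imp_nondecreasing[OF that])
    fix t assume "x \<le> t" "t \<le> s"
    then show "\<exists>y. (Q has_real_derivative y) (at t) \<and> 0 \<le> y" using Q[of t] pos[of t] x z by (intro exI[of _ "Q' t"]) auto
  qed
  then have "\<forall>\<^sub>F s in at_top. Q x \<le> Q s" by (intro eventually_mono[OF eventually_ge_at_top[of x]])
  then have "Q x \<le> 0" by (rule tendsto_lowerbound[OF inf]) simp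
  then show False using Qx by simp
qed

lemma tendsto_zero_smaller:
  fixes Q :: "real \<Rightarrow> real"
  assumes "(Q \<longlongrightarrow> 0) (at_right 0)" "0 < x" "0 < Q x"
  shows "\<exists>y>0. y < x \<and> Q y < Q x"
proof -
  have "\<forall>\<^sub>F y in at_right 0. Q y < Q x" by (rule order_tendstoD(2)[OF assms(1,3)])
  then obtain b where b: "0 < b" "\<And>y. 0 < y \<Longrightarrow> y < b \<Longrightarrow> Q y < Q x" unfolding eventually_at_right_field by auto
  then show ?thesis using assms(2) by (intro exI[of _ "min (b / 2) (x / 2)"]) (auto simp: min_def)
qed

lemma caputo_differentiable_continuous:
  assumes dl: "0 < \<delta>" "\<delta> < 1" and f: "\<And>t. 0 < t \<Longrightarrow> caputo_differentiable \<delta> f t"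
  shows "continuous_on {0<..} f"
proof -
  have m: "nat \<lceil>\<delta>\<rceil> = 1" using dl by (simp add: nat_eq_iff ceiling_eq_iff)
  have "isCont f t" if "0 < t" for t
    using f[OF that] that unfolding caputo_differentiable_def m Let_def
    by (auto intro: differentiable_imp_continuous_within dest!: spec[of _ 0])
  then show ?thesis by (intro continuous_at_imp_continuous_on) simp
qed

lemma exp_integrable_dominated:
  assumes c: "continuous_on {0<..} f" and dom: "laplace_dominated I F" and i: "i \<in> I" "F i = f"
  shows "exp_integrable f"
proof -
  obtain M where M: "exp_integrable M" "\<And>t. 0 < t \<Longrightarrow> \<bar>f t\<bar> \<le> M t"
    using dom i unfolding laplace_dominated_def laplace_transformable_iff by blast
  have "(\<lambda>t. ind t *\<^sub>R f t) \<in> borel_measurable borel"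
    using c by (intro borel_measurable_continuous_on_indicator) auto
  then show ?thesis by (intro exp_integrable_bound[OF M(1) _ M(2)]) simp_all
qed

lemma rlap_abs_le:
  assumes f: "exp_integrable f" and p: "0 < p"
  shows "\<bar>rlap f p\<bar> \<le> rlap (\<lambda>t. \<bar>f t\<bar>) p"
  using set_integral_norm_bound[OF exp_integrableD[OF f p]] by (simp add: rlap_def abs_mult)

lemma convex_islimpt_Icc:
  fixes a b x :: real
  assumes "a < b" "x \<in> {a..b}"
  shows "x islimpt {a..b}"
proof (rule connected_imp_perfect)
  show "{a..b} \<noteq> {x}" for x
  proof
    assume "{a..b} = {x}"
    then have "a \<in> {x}" "b \<in> {x}" using assms(1) by (metis atLeastAtMost_iff less_imp_le order_refl)+
    then show False using assms(1) by simp
  qed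
qed (use assms in auto)

text \<open>r^c is the integrating factor of C'' + c C' / r, so the derivative of r^c (C^2)' is r^c
  (2 C'^2 + 2 m C^2) >= 0.\<close>

lemma radial_energy_mono:
  fixes C :: "real \<Rightarrow> real"
  assumes C: "\<And>r. 0 < r \<Longrightarrow> (C has_real_derivative C' r) (at r)" "\<And>r. 0 < r \<Longrightarrow> (C' has_real_derivative C'' r) (at r)"
    and ode: "\<And>r. 0 < r \<Longrightarrow> C'' r + c / r * C' r = m * C r" and m: "0 \<le> m" and xy: "0 < x" "x \<le> y"
  shows "x powr c * (2 * C x * C' x) \<le> y powr c * (2 * C y * C' y)"
proof (rule DERIV_nonneg_imp_nondecreasing[OF xy(2)])
  fix t assume "x \<le> t" "t \<le> y"
  then have t: "0 < t" using xy by simp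
  have p: "((\<lambda>x. x powr c) has_real_derivative c / t * t powr c) (at t)"
    using t by (auto intro!: derivative_eq_intros simp: powr_diff)
  have d: "((\<lambda>x. 2 * C x * C' x) has_real_derivative 2 * (C' t)\<^sup>2 + 2 * C t * C'' t) (at t)"
    using C[OF t] by (auto intro!: derivative_eq_intros simp: power2_eq_square)
  have "q * P * (2 * X * Y) + P * (2 * Y\<^sup>2 + 2 * X * (m * X - q * Y)) = P * (2 * Y\<^sup>2 + 2 * m * X\<^sup>2)" for P X Y q :: real
    by (simp add: algebra_simps power2_eq_square)
  moreover have "C'' t = m * C t - c / t * C' t" using ode[OF t] by linarith
  ultimately have "c / t * t powr c * (2 * C t * C' t) + t powr c * (2 * (C' t)\<^sup>2 + 2 * C t * C'' t) = t powr c * (2 * (C' t)\<^sup>2 + 2 * m * (C t)\<^sup>2)"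
    by (simp only:)
  moreover have "0 \<le> t powr c * (2 * (C' t)\<^sup>2 + 2 * m * (C t)\<^sup>2)" using m by simp
  ultimately show "\<exists>D. ((\<lambda>x. x powr c * (2 * C x * C' x)) has_real_derivative D) (at t) \<and> 0 \<le> D"
    using DERIV_mult[OF p d] by (intro exI conjI) (auto simp: mult.commute)
qed

text \<open>Here the integrating factor is exp (- c x): the derivative of exp (- c x) (D^2)' is exp
  (- c x) (2 D'^2 + 2 m D^2) >= 0.\<close>

lemma vertical_energy_mono:
  fixes D :: "real \<Rightarrow> real"
  assumes D: "\<And>r. 0 < r \<Longrightarrow> (D has_real_derivative D' r) (at r)" "\<And>r. 0 < r \<Longrightarrow> (D' has_real_derivative D'' r) (at r)"
    and ode: "\<And>r. 0 < r \<Longrightarrow> D'' r = c * D' r + m * D r" and m: "0 \<le> m" and xy: "0 < x" "x \<le> y"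
  shows "exp (- c * x) * (2 * D x * D' x) \<le> exp (- c * y) * (2 * D y * D' y)"
proof (rule DERIV_nonneg_imp_nondecreasing[OF xy(2)])
  fix t assume "x \<le> t" "t \<le> y"
  then have t: "0 < t" using xy by simp
  have p: "((\<lambda>x. exp (- c * x)) has_real_derivative - c * exp (- c * t)) (at t)"
    by (auto intro!: derivative_eq_intros)
  have d: "((\<lambda>x. 2 * D x * D' x) has_real_derivative 2 * (D' t)\<^sup>2 + 2 * D t * D'' t) (at t)"
    using D[OF t] by (auto intro!: derivative_eq_intros simp: power2_eq_square)
  have "- c * exp (- c * t) * (2 * D t * D' t) + exp (- c * t) * (2 * (D' t)\<^sup>2 + 2 * D t * D'' t) = exp (- c * t) * (2 * (D' t)\<^sup>2 + 2 * m * (D t)\<^sup>2)"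
    unfolding ode[OF t] by (simp add: algebra_simps power2_eq_square)
  moreover have "0 \<le> exp (- c * t) * (2 * (D' t)\<^sup>2 + 2 * m * (D t)\<^sup>2)" using m by simp
  ultimately show "\<exists>E. ((\<lambda>x. exp (- c * x) * (2 * D x * D' x)) has_real_derivative E) (at t) \<and> 0 \<le> E"
    using DERIV_mult[OF p d] by (intro exI conjI) (auto simp: mult.commute)
qed

context temperature
begin

text \<open>Reduces a solution to the single function \<open>rlap (u r 0) p\<close> of r for each p
  > 0: the dependence on z is explicit, and this function solves the radial equation with prescribed
  limits at 0 and at infinity. The lemma is applied to an arbitrary solution and to the formula
  alike.\<close>

lemma solution_transform:
  assumes u: "temperature_field_solution \<beta> a lam A \<alpha> \<nu> h u"
  shows "0 < r \<Longrightarrow> 0 \<le> z \<Longrightarrow> exp_integrable (u r z) \<and> continuous_on {0<..} (u r z)"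
    and "0 < p \<Longrightarrow> 0 < k \<Longrightarrow> a\<^sup>2 * k\<^sup>2 + lam * k = p powr \<delta> \<Longrightarrow> 0 < r \<Longrightarrow> 0 \<le> z \<Longrightarrow> rlap (u r z) p = rlap (u r 0) p * exp (- k * z)"
    and "0 < p \<Longrightarrow> 0 < k \<Longrightarrow> a\<^sup>2 * k\<^sup>2 + lam * k = p powr \<delta> \<Longrightarrow> \<exists>C' C''. \<forall>r>0. ((\<lambda>r. rlap (u r 0) p) has_real_derivative C' r) (at r) \<and>
      (C' has_real_derivative C'' r) (at r) \<and> C'' r + (1 - 2 * \<nu>) / r * C' r = (p powr \<delta> + \<alpha> * k) * rlap (u r 0) p"
    and "0 < p \<Longrightarrow> ((\<lambda>r. rlap (u r 0) p) \<longlongrightarrow> A * rlap h p) (at_right 0)"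
    and "0 < p \<Longrightarrow> ((\<lambda>r. rlap (u r 0) p) \<longlongrightarrow> 0) at_top"
proof -
  obtain uz uzz :: "real \<Rightarrow> real \<Rightarrow> real \<Rightarrow> real" and ur urr :: "real \<Rightarrow> real \<Rightarrow> real" where
      cd: "\<forall>r>0. \<forall>z\<ge>0. \<forall>t>0. caputo_differentiable \<delta> (u r z) t"
      and dz: "\<forall>r>0. \<forall>z\<ge>0. \<forall>t>0. ((\<lambda>y. u r y t) has_real_derivative uz r z t) (at z within {0..})"
      and dzz: "\<forall>r>0. \<forall>z>0. \<forall>t>0. ((\<lambda>y. uz r y t) has_real_derivative uzz r z t) (at z)"
      and dr: "\<forall>r>0. \<forall>t>0. ((\<lambda>x. u x 0 t) has_real_derivative ur r t) (at r)"
      and drr: "\<forall>r>0. \<forall>t>0. ((\<lambda>x. ur x t) has_real_derivative urr r t) (at r)"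
      and pde: "\<forall>r>0. \<forall>z>0. \<forall>t>0. caputo \<delta> (u r z) t = a\<^sup>2 * uzz r z t - lam * uz r z t"
      and bc: "\<forall>r>0. \<forall>t>0. caputo \<delta> (u r 0) t = urr r t + (1 - 2 * \<nu>) / r * ur r t + \<alpha> * uz r 0 t"
      and mean: "\<forall>p>0. ((\<lambda>(r, z). LBINT t:{0<..}. exp (- p * t) * \<bar>u r z t - A * h t\<bar>) \<longlongrightarrow> 0) (at (0, 0) within {0<..} \<times> {0..})"
      and inf: "\<forall>t>0. ((\<lambda>(r, z). u r z t) \<longlongrightarrow> 0) (inf at_infinity (principal ({0<..} \<times> {0..})))"
      and zero: "\<forall>r>0. \<forall>z\<ge>0. (u r z \<longlongrightarrow> 0) (at_right 0)"
      and dom: "\<forall>\<rho>>0. laplace_dominated {(r, z). 0 < r \<and> 0 \<le> z \<and> \<rho> \<le> r\<^sup>2 + z\<^sup>2} (\<lambda>(r, z). u r z)"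
      and domz: "\<forall>K. compact K \<and> K \<subseteq> {0<..} \<times> {0..} \<longrightarrow> laplace_dominated K (\<lambda>(r, z). uz r z)"
      and domzz: "\<forall>K. compact K \<and> K \<subseteq> {0<..} \<times> {0<..} \<longrightarrow> laplace_dominated K (\<lambda>(r, z). uzz r z)"
      and domr: "\<forall>K. compact K \<and> K \<subseteq> {0<..} \<longrightarrow> laplace_dominated K ur \<and> laplace_dominated K urr"
    using u unfolding temperature_field_solution_def beta by (elim exE conjE) (rule that; assumption)
  have dl: "0 < \<delta>" "\<delta> < 1" and a0: "0 < a" "0 < lam" "0 < \<alpha>" using pos by auto
  have uc: "continuous_on {0<..} (u r z)" if "0 < r" "0 \<le> z" for r z
    by (rule caputo_differentiable_continuous[OF dl]) (use cd that in blast)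
  have ui: "exp_integrable (u r z)" if r: "0 < r" "0 \<le> z" for r z
  proof (rule exp_integrable_dominated[OF uc[OF r] dom[rule_format, of "r\<^sup>2 + z\<^sup>2"]])
    show "(r, z) \<in> {(r', z'). 0 < r' \<and> 0 \<le> z' \<and> r\<^sup>2 + z\<^sup>2 \<le> r'\<^sup>2 + z'\<^sup>2}" using r by simp
  qed (use r in \<open>auto intro: add_pos_nonneg\<close>)
  then show "0 < r \<Longrightarrow> 0 \<le> z \<Longrightarrow> exp_integrable (u r z) \<and> continuous_on {0<..} (u r z)" using uc by blast
  have sub: "laplace_dominated J (\<lambda>j. F (g j))" if "laplace_dominated I F" "g ` J \<subseteq> I" for I J and F :: "'i \<Rightarrow> real \<Rightarrow> real" and g :: "'j \<Rightarrow> 'i"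
    using that unfolding laplace_dominated_def by blast
  have line: "filterlim (\<lambda>z::real. (r, z)) (inf at_infinity (principal ({0<..} \<times> {0..}))) at_top" if "0 < r" for r :: real
    unfolding filterlim_inf filterlim_principal filterlim_at_infinity_conv_norm_at_top
  proof
    show "filterlim (\<lambda>z. norm (r, z)) at_top (at_top :: real filter)"
      by (rule filterlim_at_top_mono[OF filterlim_ident]) (auto intro!: always_eventually order_trans[OF abs_ge_self] simp: norm_prod_def real_le_rsqrt)
    show "\<forall>\<^sub>F z::real in at_top. (r, z) \<in> {0<..} \<times> {0..}" using eventually_ge_at_top[of 0] by eventually_elim (use that in simp)
  qed
  have line': "filterlim (\<lambda>r. (r, 0::real)) (inf at_infinity (principal ({0<..} \<times> {0..}))) (at_top :: real filter)"
    unfolding filterlim_inf filterlim_principal filterlim_at_infinity_conv_norm_at_top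
  proof
    show "filterlim (\<lambda>r. norm (r, 0::real)) at_top (at_top :: real filter)"
      by (rule filterlim_at_top_mono[OF filterlim_ident]) (auto intro!: always_eventually order_trans[OF abs_ge_self] simp: norm_prod_def real_le_rsqrt)
    show "\<forall>\<^sub>F r::real in at_top. (r, 0) \<in> {0<..} \<times> {0::real..}" using eventually_gt_at_top[of 0] by eventually_elim simp
  qed
  show inf_r: "((\<lambda>r. rlap (u r 0) p) \<longlongrightarrow> 0) at_top" if p: "0 < p" for p
  proof (rule rlap_at_top[OF p, of 1])
    show "exp_integrable (u y 0)" if "1 \<le> y" for y using ui[of y 0] that by simp
    have "laplace_dominated {1..} (\<lambda>y. (\<lambda>(r, z). u r z) (y, 0))"
      by (rule sub[OF dom[rule_format, OF zero_less_one]]) (auto intro: one_le_power)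
    then show "laplace_dominated {1..} (\<lambda>y. u y 0)" by simp
    show "((\<lambda>y. u y 0 t) \<longlongrightarrow> 0) at_top" if "0 < t" for t
      using filterlim_compose[OF inf[rule_format, OF that] line'] by simp
  qed
  show origin: "((\<lambda>r. rlap (u r 0) p) \<longlongrightarrow> A * rlap h p) (at_right 0)" if p: "0 < p" for p
  proof -
    have "filterlim (\<lambda>r. (r, 0::real)) (at (0, 0) within {0<..} \<times> {0..}) (at_right (0::real))"
      unfolding filterlim_at
    proof
      show "\<forall>\<^sub>F r in at_right (0::real). (r, 0::real) \<in> {0<..} \<times> {0..} \<and> (r, 0::real) \<noteq> (0, 0)"
        unfolding eventually_at_right_field by (intro exI[of _ 1]) auto
      show "((\<lambda>r. (r, 0::real)) \<longlongrightarrow> (0, 0)) (at_right (0::real))" by (intro tendsto_intros)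
    qed
    from filterlim_compose[OF mean[rule_format, OF p] this]
    have l: "((\<lambda>r. rlap (\<lambda>t. \<bar>u r 0 t - A * h t\<bar>) p) \<longlongrightarrow> 0) (at_right 0)" by (simp add: rlap_def)
    \<comment> \<open>The difference of the transforms is at most the weighted L^1 distance, so the
      mean convergence at r = z = 0 supplies the limit.\<close>
    have "((\<lambda>r. rlap (u r 0) p - A * rlap h p) \<longlongrightarrow> 0) (at_right 0)"
    proof (rule Lim_null_comparison[OF _ l])
      have "norm (rlap (u r 0) p - A * rlap h p) \<le> rlap (\<lambda>t. \<bar>u r 0 t - A * h t\<bar>) p" if r: "0 < r" for r
        using rlap_abs_le[OF exp_integrable_diff[OF ui[OF r order_refl] exp_integrable_mult[OF h, of A]] p]
        unfolding rlap_diff[OF ui[OF r order_refl] exp_integrable_mult[OF h, of A] p] rlap_mult by simp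
      then show "\<forall>\<^sub>F r in at_right 0. norm (rlap (u r 0) p - A * rlap h p) \<le> rlap (\<lambda>t. \<bar>u r 0 t - A * h t\<bar>) p"
        unfolding eventually_at_right_field by (intro exI[of _ 1]) auto
    qed
    then show ?thesis by (rule LIM_zero_cancel)
  qed
  have W: "exp_integrable (uz r z)" "0 < p \<Longrightarrow> ((\<lambda>y. rlap (u r y) p) has_real_derivative rlap (uz r z) p) (at z within {0..})"
    if r: "0 < r" and z: "0 \<le> z" for r z p
  proof -
    \<comment> \<open>Majorants for \<open>uz\<close> are given on compact sets, so the derivative
      is taken within a bounded interval, which agrees with {0..} near z.\<close>
    have "laplace_dominated ({r} \<times> {0..z+1}) (\<lambda>(r, z). uz r z)" using r by (intro domz[rule_format]) (auto intro: compact_Times)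
    from sub[OF this, of "\<lambda>z. (r, z)" "{0..z+1}"] have D: "laplace_dominated {0..z+1} (uz r)" by auto
    have d: "((\<lambda>y. u r y t) has_real_derivative uz r y t) (at y within {0..z+1})" if "y \<in> {0..z+1}" "0 < t" for y t
      by (rule DERIV_subset[OF dz[rule_format, OF r _ that(2)]]) (use that in auto)
    have lim: "z islimpt {0..z+1}" by (rule convex_islimpt_Icc) (use z in auto)
    have U: "y \<in> {0..z+1} \<Longrightarrow> exp_integrable (u r y)" for y using ui[OF r] by simp
    show "exp_integrable (uz r z)" by (rule rlap_derivative(1)[OF _ _ lim zero_less_one U d D]) (use z in auto)
    assume p: "0 < p"
    have "((\<lambda>y. rlap (u r y) p) has_real_derivative rlap (uz r z) p) (at z within {0..z+1})"
      by (rule rlap_derivative(2)[OF _ _ lim p U d D]) (use z in auto)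
    moreover have "at z within {0..z+1} = at z within {0..}" by (rule at_within_nhd[of _ "{..<z+1}"]) auto
    ultimately show "((\<lambda>y. rlap (u r y) p) has_real_derivative rlap (uz r z) p) (at z within {0..})" by simp
  qed
  have V: "exp_integrable (uzz r z)" "0 < p \<Longrightarrow> ((\<lambda>y. rlap (uz r y) p) has_real_derivative rlap (uzz r z) p) (at z)"
    if r: "0 < r" and z: "0 < z" for r z p
  proof -
    \<comment> \<open>The interval stays away from z = 0, as \<open>uzz\<close> is controlled on
      compact subsets of z > 0.\<close>
    have "laplace_dominated ({r} \<times> {z/2..z+1}) (\<lambda>(r, z). uzz r z)" using r z by (intro domzz[rule_format]) (auto intro: compact_Times)
    from sub[OF this, of "\<lambda>z. (r, z)" "{z/2..z+1}"] have D: "laplace_dominated {z/2..z+1} (uzz r)" by auto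
    have d: "((\<lambda>y. uz r y t) has_real_derivative uzz r y t) (at y within {z/2..z+1})" if "y \<in> {z/2..z+1}" "0 < t" for y t
      by (rule has_field_derivative_at_within[OF dzz[rule_format, OF r _ that(2)]]) (use that z in auto)
    have lim: "z islimpt {z/2..z+1}" by (rule convex_islimpt_Icc) (use z in auto)
    have U: "y \<in> {z/2..z+1} \<Longrightarrow> exp_integrable (uz r y)" for y using W(1)[OF r] z by simp
    show "exp_integrable (uzz r z)" by (rule rlap_derivative(1)[OF _ _ lim zero_less_one U d D]) (use z in auto)
    assume p: "0 < p"
    have "((\<lambda>y. rlap (uz r y) p) has_real_derivative rlap (uzz r z) p) (at z within {z/2..z+1})"
      by (rule rlap_derivative(2)[OF _ _ lim p U d D]) (use z in auto)
    moreover have "at z within {z/2..z+1} = at z" by (rule at_within_Icc_at) (use z in auto)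
    ultimately show "((\<lambda>y. rlap (uz r y) p) has_real_derivative rlap (uzz r z) p) (at z)" by simp
  qed
  have R: "exp_integrable (ur r)" "exp_integrable (urr r)" "0 < p \<Longrightarrow> ((\<lambda>x. rlap (u x 0) p) has_real_derivative rlap (ur r) p) (at r)"
    "0 < p \<Longrightarrow> ((\<lambda>x. rlap (ur x) p) has_real_derivative rlap (urr r) p) (at r)"
    if r: "0 < r" for r p
  proof -
    have D: "laplace_dominated {x/2..x+1} ur" "laplace_dominated {x/2..x+1} urr" if "0 < x" for x
    proof -
      have "{x/2..x+1} \<subseteq> {0<..}" using that by auto
      then show "laplace_dominated {x/2..x+1} ur" "laplace_dominated {x/2..x+1} urr" using domr[rule_format, of "{x/2..x+1}"] by simp_all
    qed
    have d: "((\<lambda>y. u y 0 t) has_real_derivative ur y t) (at y within {x/2..x+1})" if "0 < x" "y \<in> {x/2..x+1}" "0 < t" for x y t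
      by (rule has_field_derivative_at_within[OF dr[rule_format, OF _ that(3)]]) (use that in auto)
    have lim: "x islimpt {x/2..x+1}" if "0 < x" for x :: real by (rule convex_islimpt_Icc) (use that in auto)
    have U: "0 < x \<Longrightarrow> y \<in> {x/2..x+1} \<Longrightarrow> exp_integrable (u y 0)" for x y using ui[of y 0] by simp
    have ri: "exp_integrable (ur x)" if "0 < x" for x by (rule rlap_derivative(1)[OF _ _ lim[OF that] zero_less_one U[OF that] d[OF that] D(1)[OF that]]) (use that in auto)
    then show "exp_integrable (ur r)" using r .
    have at: "at r within {r/2..r+1} = at r" by (rule at_within_Icc_at) (use r in auto)
    have d': "((\<lambda>y. ur y t) has_real_derivative urr y t) (at y within {r/2..r+1})" if "y \<in> {r/2..r+1}" "0 < t" for y t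
      by (rule has_field_derivative_at_within[OF drr[rule_format, OF _ that(2)]]) (use that r in auto)
    have U': "y \<in> {r/2..r+1} \<Longrightarrow> exp_integrable (ur y)" for y using ri r by simp
    show "exp_integrable (urr r)" by (rule rlap_derivative(1)[OF _ _ lim[OF r] zero_less_one U' d' D(2)[OF r]]) (use r in auto)
    show "((\<lambda>x. rlap (u x 0) p) has_real_derivative rlap (ur r) p) (at r)" if p: "0 < p"
      using rlap_derivative(2)[OF _ _ lim[OF r] p U[OF r] d[OF r] D(1)[OF r]] r at by simp
    show "((\<lambda>x. rlap (ur x) p) has_real_derivative rlap (urr r) p) (at r)" if p: "0 < p"
      using rlap_derivative(2)[OF _ _ lim[OF r] p U' d' D(2)[OF r]] r at by simp
  qed
  have cap: "p powr \<delta> * rlap (u r z) p = rlap g p"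
    if "0 < r" "0 \<le> z" "0 < p" "exp_integrable g" "\<And>t. 0 < t \<Longrightarrow> caputo \<delta> (u r z) t = g t" for r z p g
  proof -
    have "exp_integrable (caputo \<delta> (u r z))" "rlap (caputo \<delta> (u r z)) p = rlap g p"
      using exp_integrable_cong[of "caputo \<delta> (u r z)" g] that(4,5) by auto
    then show ?thesis using rlap_caputo[OF dl _ _ ui[OF that(1,2)] _ that(3)] cd zero that(1,2) by simp
  qed
  have vert: "p powr \<delta> * rlap (u r z) p = a\<^sup>2 * rlap (uzz r z) p - lam * rlap (uz r z) p" if "0 < r" "0 < z" "0 < p" for r z p
    using cap[of r z p "\<lambda>t. a\<^sup>2 * uzz r z t - lam * uz r z t"] that pde V(1)[OF that(1,2)] W(1)[of r z]
    by (simp add: exp_integrable_diff exp_integrable_mult rlap_diff rlap_mult)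
  have rad: "p powr \<delta> * rlap (u r 0) p = rlap (urr r) p + (1 - 2 * \<nu>) / r * rlap (ur r) p + \<alpha> * rlap (uz r 0) p" if r: "0 < r" and p: "0 < p" for r p
  proof -
    have i: "exp_integrable (urr r)" "exp_integrable (\<lambda>t. (1 - 2 * \<nu>) / r * ur r t)" "exp_integrable (\<lambda>t. \<alpha> * uz r 0 t)"
      by (intro R(2)[OF r] exp_integrable_mult R(1)[OF r] W(1)[OF r order_refl])+
    show ?thesis
      using cap[OF r order_refl p exp_integrable_add[OF exp_integrable_add[OF i(1,2)] i(3)]] bc r
      unfolding rlap_add[OF exp_integrable_add[OF i(1,2)] i(3) p] rlap_add[OF i(1,2) p] rlap_mult by blast
  qed
  show trace: "rlap (u r z) p = rlap (u r 0) p * exp (- k * z)"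
    if p: "0 < p" and k: "0 < k" and quad: "a\<^sup>2 * k\<^sup>2 + lam * k = p powr \<delta>" and r: "0 < r" and z: "0 \<le> z" for p k r z
  proof (cases "z = 0")
    case False
    \<comment> \<open>D is the deviation from U0 exp (- k z). It solves the same equation in z and
      tends to 0 at z = 0 and at infinity, so the energy argument with weight exp (- lam z / a^2)
      gives D = 0.\<close>
    define U0 where "U0 = rlap (u r 0) p"
    define D where "D y = rlap (u r y) p - U0 * exp (- k * y)" for y
    define D' where "D' y = rlap (uz r y) p + k * U0 * exp (- k * y)" for y
    define D'' where "D'' y = rlap (uzz r y) p - k\<^sup>2 * U0 * exp (- k * y)" for y
    have Ud: "((\<lambda>y. rlap (u r y) p) has_real_derivative rlap (uz r y) p) (at y)" if "0 < y" for y
    proof -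
      have "at y within {0..} = at y" by (rule at_within_open_subset[of _ "{0<..}"]) (use that in auto)
      then show ?thesis using W(2)[OF r less_imp_le[OF that] p] by simp
    qed
    have d: "(D has_real_derivative D' y) (at y)" "(D' has_real_derivative D'' y) (at y)" if "0 < y" for y
      unfolding D_def[abs_def] D'_def[abs_def] D''_def
      by (auto intro!: derivative_eq_intros Ud[OF that] V(2)[OF r that p] simp: power2_eq_square)
    have ode: "D'' y = (lam / a\<^sup>2) * D' y + (p powr \<delta> / a\<^sup>2) * D y" if y: "0 < y" for y
    proof -
      have "a\<^sup>2 * D'' y - lam * D' y - p powr \<delta> * D y = (p powr \<delta> - (a\<^sup>2 * k\<^sup>2 + lam * k)) * (U0 * exp (- k * y))"
        using vert[OF r y p] unfolding D_def D'_def D''_def by (simp add: algebra_simps)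
      then have "a\<^sup>2 * D'' y = lam * D' y + p powr \<delta> * D y" unfolding quad by simp
      then show ?thesis using a0 by (simp add: field_simps)
    qed
    have top: "(D \<longlongrightarrow> 0) at_top"
    proof -
      have "((\<lambda>y. rlap (u r y) p) \<longlongrightarrow> 0) at_top"
      proof (rule rlap_at_top[OF p, of 0])
        show "exp_integrable (u r y)" if "0 \<le> y" for y using ui[OF r that] .
        have "laplace_dominated {0..} (\<lambda>y. (\<lambda>(r, z). u r z) (r, y))"
          by (rule sub[OF dom[rule_format, of "r\<^sup>2"]]) (use r in auto)
        then show "laplace_dominated {0..} (\<lambda>y. u r y)" by simp
        show "((\<lambda>y. u r y t) \<longlongrightarrow> 0) at_top" if "0 < t" for t
          using filterlim_compose[OF inf[rule_format, OF that] line[OF r]] by simp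
      qed
      moreover have "((\<lambda>y. exp (- k * y)) \<longlongrightarrow> 0) at_top"
      proof (rule filterlim_compose[OF exp_at_bot])
        show "filterlim (\<lambda>y. - k * y) at_bot at_top"
          using filterlim_tendsto_neg_mult_at_bot[OF tendsto_const _ filterlim_ident, of "- k"] k by simp
      qed
      ultimately have "(D \<longlongrightarrow> 0 - U0 * 0) at_top" unfolding D_def[abs_def] by (intro tendsto_intros)
      then show ?thesis by simp
    qed
    have bot: "(D \<longlongrightarrow> 0) (at_right 0)"
    proof -
      have "continuous (at 0 within {0..}) (\<lambda>y. rlap (u r y) p)" using DERIV_continuous[OF W(2)[OF r order_refl p]] .
      then have "((\<lambda>y. rlap (u r y) p) \<longlongrightarrow> U0) (at_right 0)"
        unfolding continuous_within U0_def by (rule tendsto_mono[OF at_le, rotated]) auto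
      moreover have "((\<lambda>y. exp (- k * y)) \<longlongrightarrow> exp (- k * 0)) (at_right 0)" by (intro tendsto_intros)
      ultimately have "(D \<longlongrightarrow> U0 - U0 * exp (- k * 0)) (at_right 0)" unfolding D_def[abs_def] by (intro tendsto_intros)
      then show ?thesis by simp
    qed
    have "(D z)\<^sup>2 = 0"
    proof (rule energy_zero[where Q="\<lambda>y. (D y)\<^sup>2" and Q'="\<lambda>y. 2 * D y * D' y" and w="\<lambda>y. exp (- (lam / a\<^sup>2) * y)"])
      show "((\<lambda>y. (D y)\<^sup>2) has_real_derivative 2 * D x * D' x) (at x)" if "0 < x" for x
        using d(1)[OF that] by (auto intro!: derivative_eq_intros)
      show "exp (- (lam / a\<^sup>2) * x) * (2 * D x * D' x) \<le> exp (- (lam / a\<^sup>2) * y) * (2 * D y * D' y)" if "0 < x" "x \<le> y" for x y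
        by (rule vertical_energy_mono[OF d ode _ that]) simp_all
      show "((\<lambda>y. (D y)\<^sup>2) \<longlongrightarrow> 0) at_top" using tendsto_power[OF top, of 2] by simp
      show "\<exists>y>0. y < x \<and> (D y)\<^sup>2 < (D x)\<^sup>2" if "0 < x" "0 < (D x)\<^sup>2" for x
        using tendsto_zero_smaller[of "\<lambda>y. (D y)\<^sup>2", OF _ that] tendsto_power[OF bot, of 2] by simp
    qed (use z False in auto)
    then show ?thesis by (simp add: D_def U0_def)
  qed simp
  show "\<exists>C' C''. \<forall>r>0. ((\<lambda>r. rlap (u r 0) p) has_real_derivative C' r) (at r) \<and>
      (C' has_real_derivative C'' r) (at r) \<and> C'' r + (1 - 2 * \<nu>) / r * C' r = (p powr \<delta> + \<alpha> * k) * rlap (u r 0) p"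
    if p: "0 < p" and k: "0 < k" and quad: "a\<^sup>2 * k\<^sup>2 + lam * k = p powr \<delta>" for p k
  proof (intro exI allI impI conjI)
    fix r :: real assume r: "0 < r"
    show "((\<lambda>r. rlap (u r 0) p) has_real_derivative rlap (ur r) p) (at r)" "((\<lambda>r. rlap (ur r) p) has_real_derivative rlap (urr r) p) (at r)"
      by (rule R(3,4)[OF r p])+
    \<comment> \<open>Differentiating the explicit exponential at z = 0 and differentiating under
      the integral give the same one-sided derivative, which is unique.\<close>
    have "rlap (uz r 0) p = - k * rlap (u r 0) p"
    proof -
      have e: "((\<lambda>y. rlap (u r 0) p * exp (- k * y)) has_real_derivative - k * rlap (u r 0) p) (at 0 within {0..})"
        by (auto intro!: derivative_eq_intros)
      have "((\<lambda>y. rlap (u r y) p) has_real_derivative - k * rlap (u r 0) p) (at 0 within {0..})"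
      proof (rule has_field_derivative_transform_within[OF e zero_less_one])
        show "rlap (u r 0) p * exp (- k * y) = rlap (u r y) p" if "y \<in> {0..}" for y
          by (rule trace[OF p k quad r, symmetric]) (use that in simp)
      qed simp
      note D1 = this and D2 = W(2)[OF r order_refl p]
      have s: "{0<..} \<subseteq> {0::real..}" by auto
      show ?thesis
        by (rule tendsto_unique[OF trivial_limit_at_right_real
          DERIV_subset[OF D2 s, unfolded has_field_derivative_iff] DERIV_subset[OF D1 s, unfolded has_field_derivative_iff]])
    qed
    then show "rlap (urr r) p + (1 - 2 * \<nu>) / r * rlap (ur r) p = (p powr \<delta> + \<alpha> * k) * rlap (u r 0) p"
      using rad[OF r p] by (simp add: algebra_simps)
  qed
qed

end

text \<open>For c >= 1 a negative value of r^c (C^2)' at some r persists down to 0 by monotonicity,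
  whence (C^2)' <= - e / x for small x. Integration makes C^2 grow at least like e |ln x| as x -> 0,
  contradicting the finite limit. With c = 1 - 2 \<nu> this is the case \<nu> <= 0.\<close>

lemma radial_increasing:
  fixes C :: "real \<Rightarrow> real"
  assumes C: "\<And>r. 0 < r \<Longrightarrow> (C has_real_derivative C' r) (at r)"
    and mono: "\<And>x y. 0 < x \<Longrightarrow> x \<le> y \<Longrightarrow> x powr c * (2 * C x * C' x) \<le> y powr c * (2 * C y * C' y)"
    and c: "1 \<le> c" and L: "(C \<longlongrightarrow> L) (at_right 0)" and r: "0 < r"
  shows "0 \<le> 2 * C r * C' r"
proof (rule ccontr)
  assume "\<not> 0 \<le> 2 * C r * C' r"
  then have neg: "2 * C r * C' r < 0" by simp
  define e where "e = - (r powr c * (2 * C r * C' r))"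
  have e: "0 < e" unfolding e_def using mult_pos_neg[OF _ neg, of "r powr c"] r by simp
  \<comment> \<open>Up to b one has both x <= r, for the monotonicity, and x <= 1, for x^c <=
    x.\<close>
  define b where "b = min r 1"
  have b: "0 < b" "b \<le> r" "b \<le> 1" using r by (auto simp: b_def)
  have slope: "2 * C x * C' x + e / x \<le> 0" if x: "0 < x" "x \<le> b" for x
  proof -
    have w: "0 < x powr c" "x powr c \<le> x" using x b powr_mono'[OF c, of x] by auto
    have "x powr c * (2 * C x * C' x) \<le> - e" unfolding e_def minus_minus by (rule mono) (use x b in auto)
    then have "(2 * C x * C' x) * x powr c \<le> - e" by (simp only: mult.commute[of "x powr c"])
    then have "2 * C x * C' x \<le> - e / x powr c" by (simp only: pos_le_divide_eq[OF w(1)])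
    also have "\<dots> \<le> - (e / x)" using divide_left_mono[OF w(2), of e] e w x by simp
    finally show ?thesis by simp
  qed
  have lb: "(C b)\<^sup>2 + e * ln b \<le> (C x)\<^sup>2 + e * ln x" if x: "0 < x" "x \<le> b" for x
  proof -
    have "- ((C x)\<^sup>2 + e * ln x) \<le> - ((C b)\<^sup>2 + e * ln b)"
    proof (rule DERIV_nonneg_imp_nondecreasing[OF x(2)])
      fix t assume "x \<le> t" "t \<le> b"
      then have t: "0 < t" "t \<le> b" using x by auto
      have "((\<lambda>x. - ((C x)\<^sup>2 + e * ln x)) has_real_derivative - (2 * C t * C' t + e / t)) (at t)"
        using C[OF t(1)] t by (auto intro!: derivative_eq_intros)
      then show "\<exists>y. ((\<lambda>x. - ((C x)\<^sup>2 + e * ln x)) has_real_derivative y) (at t) \<and> 0 \<le> y"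
        using slope[OF t] by (intro exI[of _ "- (2 * C t * C' t + e / t)"] conjI) simp_all
    qed
    then show ?thesis by simp
  qed
  have "((\<lambda>x. (C x)\<^sup>2) \<longlongrightarrow> L\<^sup>2) (at_right 0)" by (intro tendsto_intros L)
  from order_tendstoD(2)[OF this, of "L\<^sup>2 + 1"] have "\<forall>\<^sub>F x in at_right 0. (C x)\<^sup>2 < L\<^sup>2 + 1" by simp
  moreover have "\<forall>\<^sub>F x in at_right 0. ln x \<le> ((C b)\<^sup>2 + e * ln b - (L\<^sup>2 + 1)) / e"
    using ln_at_0 unfolding filterlim_at_bot by blast
  moreover have "\<forall>\<^sub>F x in at_right (0::real). 0 < x \<and> x \<le> b"
    unfolding eventually_at_right_field using b by (intro exI[of _ b]) auto
  ultimately have "\<forall>\<^sub>F x::real in at_right 0. False"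
  proof eventually_elim
    case (elim x)
    from elim(2) have "e * ln x \<le> (C b)\<^sup>2 + e * ln b - (L\<^sup>2 + 1)" using e by (simp add: pos_le_divide_eq mult.commute)
    then show False using elim(1) lb[of x] elim(3) by linarith
  qed
  then show False by simp
qed

context temperature
begin

text \<open>At z = 0 the difference of the two transforms tends to 0 both as r -> 0 and as r ->
  infinity, so the energy argument with weight r^(1 - 2 \<nu>) makes it vanish; the common factor
  exp (- k z) carries this to all z.\<close>

lemma solution_unique_positive:
  assumes nu: "0 < \<nu>" and u: "temperature_field_solution \<beta> a lam A \<alpha> \<nu> h u"
    and r: "0 < r" and z: "0 \<le> z" and t: "0 < t"
  shows "u r z t = TF r z t"
proof -
  note S = solution_transform[OF u] and T = solution_transform[OF TF_solution[OF nu]]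
  note S1 = S(1)[OF r z] and T1 = T(1)[OF r z]
  show ?thesis
  proof (rule rlap_eq_imp_eq[OF conjunct1[OF S1] conjunct1[OF T1] _ conjunct2[OF S1] conjunct2[OF T1] t])
    fix p :: real assume p: "0 < p"
    obtain m k where mk: "0 < m" "0 < k" "a\<^sup>2 * k\<^sup>2 + lam * k = p powr \<delta>" "m = p powr \<delta> + \<alpha> * k"
      using mm_kk_real[OF p] by blast
    obtain C' C'' where C: "\<And>r. 0 < r \<Longrightarrow> ((\<lambda>r. rlap (u r 0) p) has_real_derivative C' r) (at r)" "\<And>r. 0 < r \<Longrightarrow> (C' has_real_derivative C'' r) (at r)"
        "\<And>r. 0 < r \<Longrightarrow> C'' r + (1 - 2 * \<nu>) / r * C' r = m * rlap (u r 0) p"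
      using S(3)[OF p mk(2,3)] unfolding mk(4)[symmetric] by blast
    obtain B' B'' where B: "\<And>r. 0 < r \<Longrightarrow> ((\<lambda>r. rlap (TF r 0) p) has_real_derivative B' r) (at r)" "\<And>r. 0 < r \<Longrightarrow> (B' has_real_derivative B'' r) (at r)"
        "\<And>r. 0 < r \<Longrightarrow> B'' r + (1 - 2 * \<nu>) / r * B' r = m * rlap (TF r 0) p"
      using T(3)[OF p mk(2,3)] unfolding mk(4)[symmetric] by blast
    define D where "D r = rlap (u r 0) p - rlap (TF r 0) p" for r
    have d: "(D has_real_derivative C' x - B' x) (at x)" "((\<lambda>r. C' r - B' r) has_real_derivative C'' x - B'' x) (at x)" if "0 < x" for x
      unfolding D_def[abs_def] using DERIV_diff[OF C(1) B(1)] DERIV_diff[OF C(2) B(2)] that by blast+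
    have ode: "(C'' x - B'' x) + (1 - 2 * \<nu>) / x * (C' x - B' x) = m * D x" if "0 < x" for x
      unfolding D_def right_diff_distrib C(3)[OF that, symmetric] B(3)[OF that, symmetric] by simp
    have bot: "(D \<longlongrightarrow> 0) (at_right 0)" unfolding D_def[abs_def] using tendsto_diff[OF S(4)[OF p] T(4)[OF p]] by simp
    have top: "(D \<longlongrightarrow> 0) at_top" unfolding D_def[abs_def] using tendsto_diff[OF S(5)[OF p] T(5)[OF p]] by simp
    have "(D r)\<^sup>2 = 0"
    proof (rule energy_zero[where Q="\<lambda>y. (D y)\<^sup>2" and Q'="\<lambda>y. 2 * D y * (C' y - B' y)" and w="\<lambda>y. y powr (1 - 2 * \<nu>)"])
      show "((\<lambda>y. (D y)\<^sup>2) has_real_derivative 2 * D x * (C' x - B' x)) (at x)" if "0 < x" for x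
        using d(1)[OF that] by (auto intro!: derivative_eq_intros)
      show "x powr (1 - 2 * \<nu>) * (2 * D x * (C' x - B' x)) \<le> y powr (1 - 2 * \<nu>) * (2 * D y * (C' y - B' y))" if "0 < x" "x \<le> y" for x y
        by (rule radial_energy_mono[OF d ode less_imp_le[OF mk(1)] that])
      show "((\<lambda>y. (D y)\<^sup>2) \<longlongrightarrow> 0) at_top" using tendsto_power[OF top, of 2] by simp
      show "\<exists>y>0. y < x \<and> (D y)\<^sup>2 < (D x)\<^sup>2" if "0 < x" "0 < (D x)\<^sup>2" for x
        using tendsto_zero_smaller[of "\<lambda>y. (D y)\<^sup>2", OF _ that] tendsto_power[OF bot, of 2] by simp
    qed (use r in auto)
    then have "rlap (u r 0) p = rlap (TF r 0) p" by (simp add: D_def)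
    then show "rlap (u r z) p = rlap (TF r z) p"
      unfolding S(2)[OF p mk(2,3) r z] T(2)[OF p mk(2,3) r z] by (rule arg_cong)
  qed
qed

text \<open>C^2 is nondecreasing by \<open>radial_increasing\<close> and tends to 0 at infinity, so
  C vanishes; its limit at r = 0 then forces the transform of h to vanish.\<close>

lemma solution_nonpositive:
  assumes nu: "\<nu> \<le> 0" and u: "temperature_field_solution \<beta> a lam A \<alpha> \<nu> h u" and p: "0 < p"
  shows "0 < r \<Longrightarrow> 0 \<le> z \<Longrightarrow> rlap (u r z) p = 0" "rlap h p = 0"
proof -
  note S = solution_transform[OF u]
  obtain m k where mk: "0 < m" "0 < k" "a\<^sup>2 * k\<^sup>2 + lam * k = p powr \<delta>" "m = p powr \<delta> + \<alpha> * k"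
    using mm_kk_real[OF p] by blast
  define C where "C r = rlap (u r 0) p" for r
  obtain C' C'' where C: "\<And>r. 0 < r \<Longrightarrow> (C has_real_derivative C' r) (at r)" "\<And>r. 0 < r \<Longrightarrow> (C' has_real_derivative C'' r) (at r)"
      "\<And>r. 0 < r \<Longrightarrow> C'' r + (1 - 2 * \<nu>) / r * C' r = m * C r"
    using S(3)[OF p mk(2,3)] unfolding mk(4)[symmetric] C_def[symmetric] by blast
  have inc: "0 \<le> 2 * C x * C' x" if "0 < x" for x
    by (rule radial_increasing[OF C(1) radial_energy_mono[OF C less_imp_le[OF mk(1)]] _ S(4)[OF p, folded C_def] that]) (use nu in simp_all)
  have C0: "C x = 0" if x: "0 < x" for x
  proof -
    have "(C x)\<^sup>2 \<le> (C y)\<^sup>2" if "x \<le> y" for y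
    proof (rule DERIV_nonneg_imp_nondecreasing[OF that])
      fix t assume "x \<le> t" "t \<le> y"
      then have t: "0 < t" using x by simp
      have "((\<lambda>x. (C x)\<^sup>2) has_real_derivative 2 * C t * C' t) (at t)" using C(1)[OF t] by (auto intro!: derivative_eq_intros)
      then show "\<exists>y. ((\<lambda>x. (C x)\<^sup>2) has_real_derivative y) (at t) \<and> 0 \<le> y" using inc[OF t] by blast
    qed
    then have "\<forall>\<^sub>F y in at_top. (C x)\<^sup>2 \<le> (C y)\<^sup>2" by (intro eventually_mono[OF eventually_ge_at_top[of x]])
    moreover have "((\<lambda>y. (C y)\<^sup>2) \<longlongrightarrow> 0) at_top" using tendsto_power[OF S(5)[OF p, folded C_def], of 2] by simp
    ultimately have "(C x)\<^sup>2 \<le> 0" by (intro tendsto_lowerbound[of "\<lambda>y. (C y)\<^sup>2" 0 at_top]) simp_all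
    then show ?thesis by simp
  qed
  then show "rlap (u r z) p = 0" if r: "0 < r" and z: "0 \<le> z" for r z
    unfolding S(2)[OF p mk(2,3) r z] C_def[symmetric] using r by simp
  have "\<forall>\<^sub>F x in at_right 0. C x = 0" unfolding eventually_at_right_field using C0 by (intro exI[of _ 1]) auto
  then have "((\<lambda>x. 0) \<longlongrightarrow> A * rlap h p) (at_right (0::real))"
    by (rule Lim_transform_eventually[OF S(4)[OF p, folded C_def]])
  then have "A * rlap h p = 0" using tendsto_unique[OF trivial_limit_at_right_real _ tendsto_const] by blast
  then show "rlap h p = 0" using A by simp
qed

lemma solution_unique_nonpositive:
  assumes nu: "\<nu> \<le> 0" and u: "temperature_field_solution \<beta> a lam A \<alpha> \<nu> h u"
    and r: "0 < r" and z: "0 \<le> z" and t: "0 < t"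
  shows "u r z t = TF r z t"
proof -
  note N = solution_nonpositive[OF nu u]
  have zi: "exp_integrable (\<lambda>t. 0)" "rlap (\<lambda>t. 0) p = 0" for p by (simp_all add: exp_integrable_def rlap_def set_integrable_def)
  note u1 = solution_transform(1)[OF u r z]
  have u0: "u r z t = (\<lambda>t. 0) t"
    by (rule rlap_eq_imp_eq[OF conjunct1[OF u1] zi(1) _ conjunct2[OF u1] continuous_on_const t]) (simp add: N(1)[OF _ r z] zi)
  \<comment> \<open>The transform of h vanishes on the positive axis, so the product symbol inverts
    to 0 and with it every \<open>g1\<close> in the formula.\<close>
  have g0: "exp (lam / (2 * a\<^sup>2) * (z + \<alpha> * \<tau>)) * g1 \<beta> a lam \<alpha> h t \<tau> z = 0" if tau: "0 < \<tau>" for \<tau>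
  proof -
    have y: "0 \<le> z + \<alpha> * \<tau>" "0 < \<tau> + (z + \<alpha> * \<tau>)" using tau z pos by (auto intro!: add_pos_nonneg add_nonneg_nonneg)
    have s: "bromwich_symbol (\<lambda>p. EE \<tau> (z + \<alpha> * \<tau>) p * laplace h p)"
      by (rule bromwich_symbol_mult_laplace[OF EE_symbol1[OF less_imp_le[OF tau] y] h])
    have "bromwich (\<lambda>p. EE \<tau> (z + \<alpha> * \<tau>) p * laplace h p) t = (\<lambda>t. 0) t"
    proof (rule rlap_eq_imp_eq[OF bromwich_exp_integrable[OF s] zi(1) _ bromwich_continuous[OF s] continuous_on_const t])
      fix p :: real assume p: "0 < p"
      have "complex_of_real (rlap (bromwich (\<lambda>p. EE \<tau> (z + \<alpha> * \<tau>) p * laplace h p)) p) = 0"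
        unfolding rlap_bromwich[OF s symbol_real_mult[OF EE_real laplace_symbol_real] p] laplace_of_real N(2)[OF p] by simp
      then show "rlap (bromwich (\<lambda>p. EE \<tau> (z + \<alpha> * \<tau>) p * laplace h p)) p = rlap (\<lambda>t. 0) p" by (simp add: zi)
    qed
    then show ?thesis unfolding g1_eq[OF tau z t] .
  qed
  have g0': "g1 \<beta> a lam \<alpha> h t \<tau> z = 0" if "0 < \<tau>" for \<tau> using g0[OF that] by simp
  have "(LBINT \<tau>:{0<..}. w \<tau> * g1 \<beta> a lam \<alpha> h t \<tau> z) = 0" for w
    unfolding set_lebesgue_integral_def
    by (rule integral_eq_zero_AE, rule AE_I2) (use g0' in \<open>simp add: indicator_def\<close>)
  \<comment> \<open>The prefactor multiplies an integral equal to 0. At the poles, where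
    \<open>Gamma \<nu>\<close> is 0, it is itself 0 by the convention on division.\<close>
  then have "TF r z t = 0" unfolding temperature_field_def by (simp only: mult_zero_right)
  then show ?thesis using u0 by simp
qed

end

text \<open>For \<nu> <= 0 a solution can exist only if the transform of h vanishes on the positive
  axis, so existence is claimed for 0 < \<nu>, whereas every solution is represented by the formula
  for all real \<nu>. Agreement is asserted on r > 0, z >= 0, t > 0, the domain on which the
  conditions constrain u.\<close>

theorem theorem3:
  fixes \<beta> a lam A \<alpha> \<nu> :: real and h :: "real \<Rightarrow> real"
  assumes "0 < \<beta>" "\<beta> < 1 / 2" "0 < a" "0 < lam" "0 < A" "0 < \<alpha>"
    and "laplace_transformable h"
  shows "(0 < \<nu> \<longrightarrow>
            temperature_field_solution \<beta> a lam A \<alpha> \<nu> h (temperature_field \<beta> a lam A \<alpha> \<nu> h)) \<and>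
         (\<forall>u. temperature_field_solution \<beta> a lam A \<alpha> \<nu> h u \<longrightarrow>
            (\<forall>r>0. \<forall>z\<ge>0. \<forall>t>0. u r z t = temperature_field \<beta> a lam A \<alpha> \<nu> h r z t))"
proof -
  interpret temperature "2 * \<beta>" a lam \<alpha> \<beta> A \<nu> h
    by unfold_locales (use assms in \<open>auto simp: laplace_transformable_iff\<close>)
  show ?thesis
    using TF_solution solution_unique_positive solution_unique_nonpositive by (meson not_le)
qed




end
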